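(* Let $G=\mathrm{SL}(2,\mathbb{R})\times\mathrm{SL}(2,\mathbb{R})$ and let $g$ be a left-invariant pseudo-Riemannian Einstein metric on $G$ that is bi-invariant under a (non-trivial) one-parameter subgroup of $G$. Then $g$ is either homothetic to the Killing form $B$ of $G$ (regarded as a left-invariant metric), or homothetic to the up to homothety unique nearly pseudo-Kähler metric on $G$, which is the left-invariant metric $\widetilde g$ given at the neutral element in the basis $F_1,\dots,F_6$ by $$\widetilde g=\frac{1}{\sqrt3}\left(\begin{array}{ccc|ccc}-2&0&0&1&0&0\\0&2&0&0&1&0\\0&0&2&0&0&1\\\hline 1&0&0&-2&0&0\\0&1&0&0&2&0\\0&0&1&0&0&2\end{array}\right).$$ Positive rescalings of $\widetilde g$ and of the Killing form $B$ are pseudo-Riemannian with index $2$.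
   Context: Basis of $\mathfrak{sl}(2,\mathbb{R})$: $E_1=\begin{pmatrix}0&-1\\1&0\end{pmatrix}$, $E_2=\begin{pmatrix}0&1\\1&0\end{pmatrix}$, $E_3=\begin{pmatrix}1&0\\0&-1\end{pmatrix}$. Basis of $\mathfrak g=\mathfrak{sl}(2,\mathbb{R})\oplus\mathfrak{sl}(2,\mathbb{R})$: $F_1=(E_1,0)$, $F_2=(E_2,0)$, $F_3=(E_3,0)$, $F_4=(0,E_1)$, $F_5=(0,E_2)$, $F_6=(0,E_3)$. Left-invariant tensor fields on $G$ are identified with their value at the neutral element. The Killing form of $G$ is $B((X,Y),(X',Y'))=4\,\mathrm{tr}(XX')+4\,\mathrm{tr}(YY')$; in the basis $F_1,\dots,F_6$ it is $8\,\mathrm{diag}(-1,1,1,-1,1,1)$. Einstein: $\mathrm{Ric}=\lambda g$ for some constant $\lambda\in\mathbb{R}$. A left-invariant metric $g$ is bi-invariant under the one-parameter subgroup generated by $0\neq A\in\mathfrak g$ if it is also invariant under right translations by this subgroup; equivalently, $\mathrm{ad}_A$ is skew with respect to $g$ at the neutral element. The index is the maximal dimension of a negative definite subspace. Two pseudo-Riemannian metrics $g,g'$ on $G$ are homothetic if there are a diffeomorphism $\varphi$ of $G$ and a constant $c\in\mathbb{R}\setminus\{0\}$ (possibly negative) with $\varphi^*g'=c\,g$. "Nearly pseudo-Kähler" is meant in the usual sense: a pseudo-Riemannian metric $g$ admitting a $g$-orthogonal almost complex structure $J$ with $(\nabla_XJ)X=0$ for all vector fields $X$, where $\nabla$ is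 the Levi-Civita connection of $g$.
   Formalization: Uniqueness up to homothety of the nearly pseudo-Kähler metric is stated only among left-invariant structures (metric and J both left-invariant); without invariance it fails, since G is diffeomorphic to T²×R⁴, which carries a flat Kähler metric. *)

theory Defs
  imports "HOL-Analysis.Analysis"
begin

section \<open>Embedded submanifolds of a Euclidean space\<close>

text \<open>
  A manifold is given as a set \<open>M\<close> of points of a Euclidean space; the definitions of this section
  are meant for embedded submanifolds \<open>M\<close>.  Tensor fields and vector fields are functions on
  the ambient space of which only the values at points of \<open>M\<close> (and at vectors tangent to \<open>M\<close>) matter.
\<close>

text \<open>For an open set \<open>U\<close>: \<open>f\<close> is \<open>k\<close> times continuously differentiable on \<open>U\<close>.\<close>

primrec Ck_on :: "nat \<Rightarrow> 'a::euclidean_space set \<Rightarrow> ('a \<Rightarrow> 'b::real_normed_vector) \<Rightarrow> bool" where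
  "Ck_on 0 U f \<longleftrightarrow> continuous_on U f"
| "Ck_on (Suc k) U f \<longleftrightarrow> (\<forall>x\<in>U. f differentiable (at x)) \<and>
     (\<forall>v. Ck_on k U (\<lambda>x. frechet_derivative f (at x) v))"

definition smooth_fun :: "'a::euclidean_space set \<Rightarrow> ('a \<Rightarrow> 'b::real_normed_vector) \<Rightarrow> bool" where
  "smooth_fun M f \<longleftrightarrow>
     (\<exists>U h. open U \<and> M \<subseteq> U \<and> (\<forall>k. Ck_on k U h) \<and> (\<forall>x\<in>M. h x = f x))"

definition tangent_space :: "'a::euclidean_space set \<Rightarrow> 'a \<Rightarrow> 'a set" where
  "tangent_space M p =
     {v. \<exists>\<gamma>. \<gamma> 0 = p \<and> (\<forall>t::real. \<gamma> t \<in> M) \<and> (\<gamma> has_vector_derivative v) (at 0)}"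

text \<open>
  The differential of \<open>f\<close> at \<open>p\<close>.  A derivative within \<open>M\<close> is determined only on vectors tangent to
  \<open>M\<close>; \<open>differential M f p v\<close> is used only for \<open>v\<close> in \<open>tangent_space M p\<close>.
\<close>

definition differential ::
    "'a::euclidean_space set \<Rightarrow> ('a \<Rightarrow> 'b::real_normed_vector) \<Rightarrow> 'a \<Rightarrow> 'a \<Rightarrow> 'b" where
  "differential M f p v = frechet_derivative f (at p within M) v"

definition vector_field :: "'a::euclidean_space set \<Rightarrow> ('a \<Rightarrow> 'a) \<Rightarrow> bool" where
  "vector_field M X \<longleftrightarrow> smooth_fun M X \<and> (\<forall>p\<in>M. X p \<in> tangent_space M p)"

definition diffeo :: "'a::euclidean_space set \<Rightarrow> ('a \<Rightarrow> 'a) \<Rightarrow> bool" where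
  "diffeo M \<phi> \<longleftrightarrow> bij_betw \<phi> M M \<and> smooth_fun M \<phi> \<and> smooth_fun M (inv_into M \<phi>)"

text \<open>
  The bracket with \<open>[X, Y] f = X (Y f) - Y (X f)\<close>, computed in the ambient coordinates.
\<close>

definition lie_bracket ::
    "'a::euclidean_space set \<Rightarrow> ('a \<Rightarrow> 'a) \<Rightarrow> ('a \<Rightarrow> 'a) \<Rightarrow> 'a \<Rightarrow> 'a" where
  "lie_bracket M X Y p = differential M Y p (X p) - differential M X p (Y p)"

section \<open>Pseudo-Riemannian metrics\<close>

type_synonym 'a metric_field = "'a \<Rightarrow> 'a \<Rightarrow> 'a \<Rightarrow> real"

definition pseudo_riemannian :: "'a::euclidean_space set \<Rightarrow> 'a metric_field \<Rightarrow> bool" where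
  "pseudo_riemannian M g \<longleftrightarrow>
     (\<forall>p\<in>M. \<forall>u\<in>tangent_space M p. \<forall>v\<in>tangent_space M p.
        g p u v = g p v u \<and>
        (\<forall>w\<in>tangent_space M p. g p (u + v) w = g p u w + g p v w) \<and>
        (\<forall>c. g p (c *\<^sub>R u) v = c * g p u v)) \<and>
     (\<forall>p\<in>M. \<forall>u\<in>tangent_space M p. (\<forall>v\<in>tangent_space M p. g p u v = 0) \<longrightarrow> u = 0) \<and>
     (\<forall>X Y. vector_field M X \<longrightarrow> vector_field M Y \<longrightarrow> smooth_fun M (\<lambda>p. g p (X p) (Y p)))"

definition metric_index :: "'a::euclidean_space set \<Rightarrow> 'a metric_field \<Rightarrow> 'a \<Rightarrow> nat" where
  "metric_index M g p =
     Max {dim W | W. subspace W \<and> W \<subseteq> tangent_space M p \<and> (\<forall>w\<in>W. w \<noteq> 0 \<longrightarrow> g p w w < 0)}"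

definition homothetic :: "'a::euclidean_space set \<Rightarrow> 'a metric_field \<Rightarrow> 'a metric_field \<Rightarrow> bool" where
  "homothetic M g g' \<longleftrightarrow>
     (\<exists>\<phi> c. diffeo M \<phi> \<and> c \<noteq> 0 \<and>
        (\<forall>p\<in>M. \<forall>u\<in>tangent_space M p. \<forall>v\<in>tangent_space M p.
           g' (\<phi> p) (differential M \<phi> p u) (differential M \<phi> p v) = c * g p u v))"

type_synonym 'a connection = "('a \<Rightarrow> 'a) \<Rightarrow> ('a \<Rightarrow> 'a) \<Rightarrow> 'a \<Rightarrow> 'a"

definition affine_connection :: "'a::euclidean_space set \<Rightarrow> 'a connection \<Rightarrow> bool" where
  "affine_connection M nabla \<longleftrightarrow>
     (\<forall>X Y. vector_field M X \<longrightarrow> vector_field M Y \<longrightarrow> vector_field M (nabla X Y)) \<and>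
     (\<forall>X X' Y Y'. vector_field M X \<longrightarrow> vector_field M X' \<longrightarrow> vector_field M Y \<longrightarrow> vector_field M Y' \<longrightarrow>
        (\<forall>p\<in>M. nabla (\<lambda>q. X q + X' q) Y p = nabla X Y p + nabla X' Y p \<and>
               nabla X (\<lambda>q. Y q + Y' q) p = nabla X Y p + nabla X Y' p)) \<and>
     (\<forall>f X Y. smooth_fun M f \<longrightarrow> vector_field M X \<longrightarrow> vector_field M Y \<longrightarrow>
        (\<forall>p\<in>M. nabla (\<lambda>q. f q *\<^sub>R X q) Y p = f p *\<^sub>R nabla X Y p \<and>
               nabla X (\<lambda>q. f q *\<^sub>R Y q) p
                 = differential M f p (X p) *\<^sub>R Y p + f p *\<^sub>R nabla X Y p))"

definition levi_civita ::
    "'a::euclidean_space set \<Rightarrow> 'a metric_field \<Rightarrow> 'a connection \<Rightarrow> bool" where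
  "levi_civita M g nabla \<longleftrightarrow>
     affine_connection M nabla \<and>
     (\<forall>X Y. vector_field M X \<longrightarrow> vector_field M Y \<longrightarrow>
        (\<forall>p\<in>M. nabla X Y p - nabla Y X p = lie_bracket M X Y p)) \<and>
     (\<forall>X Y Z. vector_field M X \<longrightarrow> vector_field M Y \<longrightarrow> vector_field M Z \<longrightarrow>
        (\<forall>p\<in>M. differential M (\<lambda>q. g q (Y q) (Z q)) p (X p)
                = g p (nabla X Y p) (Z p) + g p (Y p) (nabla X Z p)))"

definition curvature ::
    "'a::euclidean_space set \<Rightarrow> 'a connection \<Rightarrow> ('a \<Rightarrow> 'a) \<Rightarrow> ('a \<Rightarrow> 'a) \<Rightarrow> ('a \<Rightarrow> 'a) \<Rightarrow> 'a \<Rightarrow> 'a" where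
  "curvature M nabla X Y Z p =
     nabla X (nabla Y Z) p - nabla Y (nabla X Z) p - nabla (lie_bracket M X Y) Z p"

text \<open>The trace of an endomorphism \<open>f\<close> of the subspace \<open>V\<close>, in an arbitrary basis of \<open>V\<close>.\<close>

definition trace_on :: "'a::euclidean_space set \<Rightarrow> ('a \<Rightarrow> 'a) \<Rightarrow> real" where
  "trace_on V f =
     (let B = (SOME B. independent B \<and> span B = V) in \<Sum>b\<in>B. representation B (f b) b)"

text \<open>
  \<open>Ric(Y, Z) = tr (X \<mapsto> R(X, Y) Z)\<close>.  The curvature at \<open>p\<close> depends on the field \<open>X\<close> only through
  the vector \<open>X p\<close>, so a tangent vector \<open>u\<close> may be inserted by extending it to any vector field.
\<close>

definition extension_field :: "'a::euclidean_space set \<Rightarrow> 'a \<Rightarrow> 'a \<Rightarrow> ('a \<Rightarrow> 'a)" where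
  "extension_field M p u = (SOME X. vector_field M X \<and> X p = u)"

definition ricci ::
    "'a::euclidean_space set \<Rightarrow> 'a connection \<Rightarrow> ('a \<Rightarrow> 'a) \<Rightarrow> ('a \<Rightarrow> 'a) \<Rightarrow> 'a \<Rightarrow> real" where
  "ricci M nabla Y Z p =
     trace_on (tangent_space M p) (\<lambda>u. curvature M nabla (extension_field M p u) Y Z p)"

definition einstein :: "'a::euclidean_space set \<Rightarrow> 'a metric_field \<Rightarrow> bool" where
  "einstein M g \<longleftrightarrow>
     (\<exists>nabla lam. levi_civita M g nabla \<and>
        (\<forall>Y Z. vector_field M Y \<longrightarrow> vector_field M Z \<longrightarrow>
           (\<forall>p\<in>M. ricci M nabla Y Z p = lam * g p (Y p) (Z p))))"

definition almost_complex :: "'a::euclidean_space set \<Rightarrow> ('a \<Rightarrow> 'a \<Rightarrow> 'a) \<Rightarrow> bool" where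
  "almost_complex M J \<longleftrightarrow>
     (\<forall>p\<in>M. \<forall>u\<in>tangent_space M p.
        J p u \<in> tangent_space M p \<and> J p (J p u) = - u \<and>
        (\<forall>v\<in>tangent_space M p. J p (u + v) = J p u + J p v) \<and>
        (\<forall>c. J p (c *\<^sub>R u) = c *\<^sub>R J p u)) \<and>
     (\<forall>X. vector_field M X \<longrightarrow> vector_field M (\<lambda>p. J p (X p)))"

text \<open>The last conjunct is \<open>(\<nabla>\<^sub>X J) X = \<nabla>\<^sub>X (J X) - J (\<nabla>\<^sub>X X) = 0\<close>.\<close>

definition nearly_pseudo_kaehler ::
    "'a::euclidean_space set \<Rightarrow> 'a metric_field \<Rightarrow> ('a \<Rightarrow> 'a \<Rightarrow> 'a) \<Rightarrow> bool" where
  "nearly_pseudo_kaehler M g J \<longleftrightarrow>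
     pseudo_riemannian M g \<and> almost_complex M J \<and>
     (\<forall>p\<in>M. \<forall>u\<in>tangent_space M p. \<forall>v\<in>tangent_space M p. g p (J p u) (J p v) = g p u v) \<and>
     (\<exists>nabla. levi_civita M g nabla \<and>
        (\<forall>X. vector_field M X \<longrightarrow>
           (\<forall>p\<in>M. nabla X (\<lambda>q. J q (X q)) p - J p (nabla X X p) = 0)))"

section \<open>The Lie group \<open>SL(2,\<real>) \<times> SL(2,\<real>)\<close>\<close>

type_synonym mat2 = "real^2^2"
type_synonym mat2_pair = "mat2 \<times> mat2"

definition SL2xSL2 :: "mat2_pair set" where
  "SL2xSL2 = {A. det A = 1} \<times> {A. det A = 1}"

text \<open>
  Multiplication of pairs of matrices.  Translations in the group are restrictions of linear maps of
  the ambient space, so their differentials are given by the same formula.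
\<close>

fun gmult :: "mat2_pair \<Rightarrow> mat2_pair \<Rightarrow> mat2_pair" (infixl "\<odot>" 70) where
  "(a, b) \<odot> (c, d) = (a ** c, b ** d)"

definition ginv :: "mat2_pair \<Rightarrow> mat2_pair" where
  "ginv p = (matrix_inv (fst p), matrix_inv (snd p))"

definition left_invariant :: "mat2_pair metric_field \<Rightarrow> bool" where
  "left_invariant g \<longleftrightarrow>
     (\<forall>a\<in>SL2xSL2. \<forall>p\<in>SL2xSL2. \<forall>u\<in>tangent_space SL2xSL2 p. \<forall>v\<in>tangent_space SL2xSL2 p.
        g (a \<odot> p) (a \<odot> u) (a \<odot> v) = g p u v)"

definition right_invariant_under :: "mat2_pair metric_field \<Rightarrow> mat2_pair \<Rightarrow> bool" where
  "right_invariant_under g a \<longleftrightarrow>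
     (\<forall>p\<in>SL2xSL2. \<forall>u\<in>tangent_space SL2xSL2 p. \<forall>v\<in>tangent_space SL2xSL2 p.
        g (p \<odot> a) (u \<odot> a) (v \<odot> a) = g p u v)"

definition left_invariant_J :: "(mat2_pair \<Rightarrow> mat2_pair \<Rightarrow> mat2_pair) \<Rightarrow> bool" where
  "left_invariant_J J \<longleftrightarrow>
     (\<forall>a\<in>SL2xSL2. \<forall>p\<in>SL2xSL2. \<forall>u\<in>tangent_space SL2xSL2 p. J (a \<odot> p) (a \<odot> u) = a \<odot> J p u)"

text \<open>\<open>\<gamma>\<close> is the one-parameter subgroup \<open>t \<mapsto> exp (t A)\<close>.\<close>

definition one_parameter_subgroup :: "mat2_pair \<Rightarrow> (real \<Rightarrow> mat2_pair) \<Rightarrow> bool" where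
  "one_parameter_subgroup A \<gamma> \<longleftrightarrow>
     (\<forall>t. \<gamma> t \<in> SL2xSL2) \<and> (\<forall>s t. \<gamma> (s + t) = \<gamma> s \<odot> \<gamma> t) \<and>
     (\<gamma> has_vector_derivative A) (at 0)"

definition biinvariant_under_subgroup :: "mat2_pair metric_field \<Rightarrow> bool" where
  "biinvariant_under_subgroup g \<longleftrightarrow>
     (\<exists>A \<gamma>. A \<noteq> 0 \<and> one_parameter_subgroup A \<gamma> \<and> left_invariant g \<and>
        (\<forall>t. right_invariant_under g (\<gamma> t)))"

text \<open>The left-invariant tensor field with value \<open>b\<close> at the neutral element.\<close>

definition left_invariant_field ::
    "(mat2_pair \<Rightarrow> mat2_pair \<Rightarrow> real) \<Rightarrow> mat2_pair metric_field" where
  "left_invariant_field b p u v = b (ginv p \<odot> u) (ginv p \<odot> v)"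

definition E1 :: mat2 where "E1 = vector [vector [0, -1], vector [1, 0]]"
definition E2 :: mat2 where "E2 = vector [vector [0, 1], vector [1, 0]]"
definition E3 :: mat2 where "E3 = vector [vector [1, 0], vector [0, -1]]"

definition F :: "mat2_pair^6" where
  "F = vector [(E1, 0), (E2, 0), (E3, 0), (0, E1), (0, E2), (0, E3)]"

text \<open>The bilinear form on the Lie algebra with Gram matrix \<open>Q\<close> in the basis \<open>F\<close>.\<close>

definition gram_form :: "real^6^6 \<Rightarrow> mat2_pair \<Rightarrow> mat2_pair \<Rightarrow> real" where
  "gram_form Q X Y =
     (\<Sum>i\<in>UNIV. \<Sum>j\<in>UNIV. Q $ i $ j *
        representation (range (($) F)) X (F $ i) * representation (range (($) F)) Y (F $ j))"

text \<open>On \<open>sl(2,\<real>)\<close>, \<open>tr (ad X \<circ> ad Y) = 4 tr (X Y)\<close>.\<close>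

definition killing_form :: "mat2_pair \<Rightarrow> mat2_pair \<Rightarrow> real" where
  "killing_form X Y = 4 * trace (fst X ** fst Y) + 4 * trace (snd X ** snd Y)"

definition killing_metric :: "mat2_pair metric_field" where
  "killing_metric = left_invariant_field killing_form"

definition nk_metric :: "mat2_pair metric_field" where
  "nk_metric = left_invariant_field (gram_form ((1 / sqrt 3) *\<^sub>R vector
     [vector [-2, 0, 0,   1, 0, 0],
      vector [ 0, 2, 0,   0, 1, 0],
      vector [ 0, 0, 2,   0, 0, 1],
      vector [ 1, 0, 0,  -2, 0, 0],
      vector [ 0, 1, 0,   0, 2, 0],
      vector [ 0, 0, 1,   0, 0, 2]]))"

end

(*
  Left-invariant tensors are computed at the neutral element.  In frames m1 E_i m1^-1 / 2,
  m2 E_i m2^-1 / 2 of the two factors the bracket is D (x \<times> y) with D = diag(1,-1,-1), and a metric is a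
  symmetric block matrix [[P, K], [K^T, S]].  Its Ricci form is an explicit expression in the blocks
  of the metric and of its inverse.  The invariance generator can be brought to companion form
  in each factor, which reduces the metric to a few scalars; the Einstein equations then force
  P = p D, S = r D and either K = 0 or K = x O with O in SO(D) and (p, r) one of (-2x, -2x), (-x, -2x),
  (-2x, -x).  As SO(D) is the adjoint group of GL(2), O is absorbed into the frame.  The first case is the
  nearly Kaehler metric up to conjugation, and the last two are pulled back from the Killing metric by
  (a, b) \<mapsto> (a b^-1, b) and (a, b) \<mapsto> (a, b a^-1).  A left-invariant nearly Kaehler structure has a totally
  skew tensor (nabla J), determined by the bracket and the Kaehler form; comparison with the Nijenhuis
  tensor gives the same normal form.
*)
theory Submission
  imports Defs
begin

section \<open>Smooth functions\<close>

text \<open>The companion vector of a nonzero component \<open>B\<close> of the generator is (1 +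
  det B, 1 - det B, 0). Elliptic, hyperbolic and nilpotent components thus form one family with
  third coordinate zero, told apart only by the number \<open>eps\<close> = 4 det B. Nearly all of
  the algebra is polynomial in \<open>eps\<close>; a split at \<open>eps = 0\<close> remains only
  where the result has to be divided by it. Components with different determinants let the first of
  them preserve the metric alone; equal determinants of nonzero components give the same vector
  \<open>e\<close> in both factors. So there are two cases, a generator in one factor and a diagonal
  one.

  A second obstacle is that connections are abstract operators on functions of the ambient space and
  that tangent vectors are extended by an arbitrary choice. Uniqueness of the Levi-Civita connection
  turns it into a bilinear product on the Lie algebra, and tensoriality of the curvature is proved
  before any Ricci form is computed. Conversely a nearly Kaehler structure asks for a connection, so
  one is constructed for the model metric.\<close>

lemma frechet_derivative_cong_open:
  assumes "open U" "x \<in> U" "\<And>y. y \<in> U \<Longrightarrow> f y = g y"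
  shows "frechet_derivative f (at x) = frechet_derivative g (at x)"
proof -
  have "(f has_derivative f') (at x) \<longleftrightarrow> (g has_derivative f') (at x)" for f'
    using assms by (metis has_derivative_transform_within_open)
  then show ?thesis by (simp add: frechet_derivative_def)
qed

text \<open>\<open>frechet_derivative\<close> is a choice operator. This congruence lets later
  proofs replace it on \<open>U\<close> by an explicit formula, which is how the closure properties
  below are obtained.\<close>

lemma Ck_on_cong:
  fixes f g :: "'a::euclidean_space \<Rightarrow> 'b::real_normed_vector"
  assumes "open U" "\<And>x. x \<in> U \<Longrightarrow> f x = g x" "Ck_on k U f"
  shows "Ck_on k U g"
  using assms(2,3)
proof (induction k arbitrary: f g)
  case 0
  then show ?case by (simp cong: continuous_on_cong)
next
  case (Suc k)
  have "g differentiable (at x)" if "x \<in> U" for x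
    using Suc.prems that assms(1) unfolding differentiable_def Ck_on.simps
    by (metis has_derivative_transform_within_open)
  moreover have "Ck_on k U (\<lambda>x. frechet_derivative g (at x) v)" for v
  proof (rule Suc.IH)
    show "Ck_on k U (\<lambda>x. frechet_derivative f (at x) v)" using Suc.prems by simp
  qed (use Suc.prems assms(1) frechet_derivative_cong_open[of U _ f g] in metis)
  ultimately show ?case by simp
qed

lemma Ck_on_subset: "Ck_on k U f \<Longrightarrow> V \<subseteq> U \<Longrightarrow> Ck_on k V f"
  by (induction k arbitrary: f) (auto intro: continuous_on_subset)

lemma Ck_on_SucD:
  fixes f :: "'a::euclidean_space \<Rightarrow> 'b::real_normed_vector"
  shows "Ck_on (Suc k) U f \<Longrightarrow> Ck_on k U f"
proof (induction k arbitrary: f)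
  case 0
  then show ?case
    by (auto simp: continuous_on_eq_continuous_within
        intro!: continuous_at_imp_continuous_within[OF differentiable_imp_continuous_within])
next
  case (Suc k)
  then show ?case by (metis Ck_on.simps(2))
qed

lemma Ck_on_has_derivative:
  "Ck_on (Suc k) U f \<Longrightarrow> x \<in> U \<Longrightarrow> (f has_derivative frechet_derivative f (at x)) (at x)"
  by (rule iffD1[OF frechet_derivative_works]) simp

lemma Ck_on_const: "Ck_on k U (\<lambda>x. c)"
  by (induction k arbitrary: c) (auto simp: frechet_derivative_const)

lemma Ck_on_linear:
  fixes f :: "'a::euclidean_space \<Rightarrow> 'b::real_normed_vector" and L :: "'b \<Rightarrow> 'c::real_normed_vector"
  assumes "open U" "bounded_linear L" "Ck_on k U f"
  shows "Ck_on k U (\<lambda>x. L (f x))"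
  using assms(3)
proof (induction k arbitrary: f)
  case 0
  then show ?case
    using bounded_linear.continuous_on[OF assms(2)] by auto
next
  case (Suc k)
  have D: "((\<lambda>x. L (f x)) has_derivative (\<lambda>v. L (frechet_derivative f (at x) v))) (at x)"
    if "x \<in> U" for x
    using Suc.prems that
    by (intro bounded_linear.has_derivative[OF assms(2)] Ck_on_has_derivative)
  have "Ck_on k U (\<lambda>x. frechet_derivative (\<lambda>x. L (f x)) (at x) v)" for v
  proof (rule Ck_on_cong[OF assms(1)])
    show "Ck_on k U (\<lambda>x. L (frechet_derivative f (at x) v))"
      using Suc by simp
  qed (simp add: frechet_derivative_at[OF D, symmetric])
  then show ?case using D by (auto simp: differentiable_def)
qed

lemma Ck_on_id: "Ck_on k U (\<lambda>x. x)"
proof (cases k)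
  case (Suc n)
  show ?thesis unfolding Suc Ck_on.simps
    by (auto simp: Ck_on_const frechet_derivative_ident)
qed (auto simp: continuous_on_id)

lemma Ck_on_add:
  fixes f g :: "'a::euclidean_space \<Rightarrow> 'b::real_normed_vector"
  assumes "open U" "Ck_on k U f" "Ck_on k U g"
  shows "Ck_on k U (\<lambda>x. f x + g x)"
  using assms(2,3)
proof (induction k arbitrary: f g)
  case 0
  then show ?case by (auto intro: continuous_on_add)
next
  case (Suc k)
  have D: "((\<lambda>x. f x + g x) has_derivative
      (\<lambda>v. frechet_derivative f (at x) v + frechet_derivative g (at x) v)) (at x)"
    if "x \<in> U" for x
    using Suc.prems that by (intro has_derivative_add Ck_on_has_derivative)
  have "Ck_on k U (\<lambda>x. frechet_derivative (\<lambda>x. f x + g x) (at x) v)" for v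
  proof (rule Ck_on_cong[OF assms(1)])
    show "Ck_on k U (\<lambda>x. frechet_derivative f (at x) v + frechet_derivative g (at x) v)"
      using Suc by simp
  qed (simp add: frechet_derivative_at[OF D, symmetric])
  then show ?case using D by (auto simp: differentiable_def)
qed

lemma Ck_on_bilinear:
  fixes f :: "'a::euclidean_space \<Rightarrow> 'b::real_normed_vector"
    and g :: "'a \<Rightarrow> 'c::real_normed_vector"
    and pr :: "'b \<Rightarrow> 'c \<Rightarrow> 'd::real_normed_vector"
  assumes "open U" "bounded_bilinear pr" "Ck_on k U f" "Ck_on k U g"
  shows "Ck_on k U (\<lambda>x. pr (f x) (g x))"
  using assms(3,4)
proof (induction k arbitrary: f g)
  case 0
  then show ?case by (auto intro: bounded_bilinear.continuous_on[OF assms(2)])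
next
  case (Suc k)
  have D: "((\<lambda>x. pr (f x) (g x)) has_derivative
      (\<lambda>v. pr (f x) (frechet_derivative g (at x) v) + pr (frechet_derivative f (at x) v) (g x))) (at x)"
    if "x \<in> U" for x
    using Suc.prems that
    by (intro bounded_bilinear.FDERIV[OF assms(2)] Ck_on_has_derivative)
  have "Ck_on k U (\<lambda>x. frechet_derivative (\<lambda>x. pr (f x) (g x)) (at x) v)" for v
  proof (rule Ck_on_cong[OF assms(1)])
    \<comment> \<open>The Leibniz terms contain the undifferentiated \<open>f\<close> and
      \<open>g\<close>; \<open>Ck_on_SucD\<close> lowers their order to match the induction
      hypothesis.\<close>
    show "Ck_on k U (\<lambda>x. pr (f x) (frechet_derivative g (at x) v) +
        pr (frechet_derivative f (at x) v) (g x))"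
      using Suc.prems by (intro Ck_on_add[OF assms(1)] Suc.IH) (auto intro: Ck_on_SucD)
  qed (simp add: frechet_derivative_at[OF D, symmetric])
  then show ?case using D by (auto simp: differentiable_def)
qed

lemma smooth_funE:
  assumes "smooth_fun M f"
  obtains U h where "open U" "M \<subseteq> U" "\<And>k. Ck_on k U h" "\<And>x. x \<in> M \<Longrightarrow> h x = f x"
  using assms unfolding smooth_fun_def by blast

lemma smooth_fun_cong:
  assumes "smooth_fun M f" "\<And>x. x \<in> M \<Longrightarrow> f x = g x"
  shows "smooth_fun M g"
  using assms unfolding smooth_fun_def by metis

lemma smooth_fun_const: "smooth_fun M (\<lambda>x. c)"
  unfolding smooth_fun_def by (rule exI[of _ UNIV]) (auto intro: exI[of _ "\<lambda>x. c"] Ck_on_const)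

lemma smooth_fun_id: "smooth_fun M (\<lambda>x. x)"
  unfolding smooth_fun_def by (rule exI[of _ UNIV]) (auto intro: exI[of _ "\<lambda>x. x"] Ck_on_id)

lemma smooth_fun_linear:
  assumes "bounded_linear L" "smooth_fun M f"
  shows "smooth_fun M (\<lambda>x. L (f x))"
proof -
  obtain U h where "open U" "M \<subseteq> U" "\<And>k. Ck_on k U h" "\<And>x. x \<in> M \<Longrightarrow> h x = f x"
    using smooth_funE[OF assms(2)] by metis
  then show ?thesis unfolding smooth_fun_def
    by (intro exI[of _ U] exI[of _ "\<lambda>x. L (h x)"]) (auto intro: Ck_on_linear[OF _ assms(1)])
qed

lemma smooth_fun_bilinear:
  assumes "bounded_bilinear pr" "smooth_fun M f" "smooth_fun M g"
  shows "smooth_fun M (\<lambda>x. pr (f x) (g x))"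
proof -
  obtain U h where 1: "open U" "M \<subseteq> U" "\<And>k. Ck_on k U h" "\<And>x. x \<in> M \<Longrightarrow> h x = f x"
    using smooth_funE[OF assms(2)] by metis
  obtain V h' where 2: "open V" "M \<subseteq> V" "\<And>k. Ck_on k V h'" "\<And>x. x \<in> M \<Longrightarrow> h' x = g x"
    using smooth_funE[OF assms(3)] by metis
  show ?thesis unfolding smooth_fun_def
    using 1 2 by (intro exI[of _ "U \<inter> V"] exI[of _ "\<lambda>x. pr (h x) (h' x)"])
      (auto intro!: Ck_on_bilinear[OF _ assms(1)] intro: Ck_on_subset[OF 1(3)] Ck_on_subset[OF 2(3)])
qed

lemma smooth_fun_add:
  assumes "smooth_fun M f" "smooth_fun M g"
  shows "smooth_fun M (\<lambda>x. f x + g x)"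
proof -
  obtain U h where 1: "open U" "M \<subseteq> U" "\<And>k. Ck_on k U h" "\<And>x. x \<in> M \<Longrightarrow> h x = f x"
    using smooth_funE[OF assms(1)] by metis
  obtain V h' where 2: "open V" "M \<subseteq> V" "\<And>k. Ck_on k V h'" "\<And>x. x \<in> M \<Longrightarrow> h' x = g x"
    using smooth_funE[OF assms(2)] by metis
  show ?thesis unfolding smooth_fun_def
    using 1 2 by (intro exI[of _ "U \<inter> V"] exI[of _ "\<lambda>x. h x + h' x"])
      (auto intro!: Ck_on_add intro: Ck_on_subset[OF 1(3)] Ck_on_subset[OF 2(3)])
qed

lemma smooth_fun_sum:
  assumes "\<And>i. i \<in> I \<Longrightarrow> smooth_fun M (f i)"
  shows "smooth_fun M (\<lambda>x. \<Sum>i\<in>I. f i x)"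
  using assms by (induction I rule: infinite_finite_induct) (auto intro: smooth_fun_const smooth_fun_add)

lemma smooth_fun_minus: "smooth_fun M f \<Longrightarrow> smooth_fun M (\<lambda>x. - f x)"
  by (rule smooth_fun_linear[OF bounded_linear_minus[OF bounded_linear_ident]])

lemma has_derivative_within_cong:
  assumes "(f has_derivative f') (at p within M)" "p \<in> M" "\<And>x. x \<in> M \<Longrightarrow> f x = g x"
  shows "(g has_derivative f') (at p within M)"
  using has_derivative_transform[of p M g f f'] assms by auto

lemma smooth_fun_has_derivative:
  assumes "smooth_fun M f" "p \<in> M"
  shows "\<exists>f'. (f has_derivative f') (at p within M)"
proof -
  obtain U h where 1: "open U" "M \<subseteq> U" "\<And>k. Ck_on k U h" "\<And>x. x \<in> M \<Longrightarrow> h x = f x"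
    using smooth_funE[OF assms(1)] by metis
  have "h differentiable (at p)" using 1(2) 1(3)[of 1] assms(2) by auto
  then have "(h has_derivative frechet_derivative h (at p)) (at p within M)"
    by (rule has_derivative_at_withinI[OF iffD1[OF frechet_derivative_works]])
  from has_derivative_within_cong[OF this assms(2) 1(4)] show ?thesis by blast
qed

text \<open>Within \<open>M\<close> derivatives are not unique on the whole ambient space. Along a
  curve realising \<open>v\<close> both candidates compute the derivative at 0 of the composed
  function, so they agree on tangent vectors.\<close>

lemma has_derivative_tangent_unique:
  fixes f :: "'a::euclidean_space \<Rightarrow> 'b::real_normed_vector"
  assumes "(f has_derivative f') (at p within M)" "(f has_derivative f'') (at p within M)"
    and "v \<in> tangent_space M p"
  shows "f' v = f'' v"
proof -
  obtain \<gamma> where g: "\<gamma> 0 = p" "\<And>t::real. \<gamma> t \<in> M" "(\<gamma> has_vector_derivative v) (at 0)"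
    using assms(3) unfolding tangent_space_def by auto
  have *: "((\<lambda>t. f (\<gamma> t)) has_vector_derivative F v) (at 0)"
    if "(f has_derivative F) (at p within M)" for F
  proof -
    have "(f has_derivative F) (at (\<gamma> 0) within range \<gamma>)"
      using that g by (auto intro: has_derivative_subset)
    with g(3) have "((\<lambda>t. f (\<gamma> t)) has_derivative (\<lambda>t. F (t *\<^sub>R v))) (at 0)"
      unfolding has_vector_derivative_def by (rule has_derivative_in_compose)
    moreover have "F (t *\<^sub>R v) = t *\<^sub>R F v" for t
      using that has_derivative_linear linear_scale by blast
    ultimately show ?thesis by (simp add: has_vector_derivative_def)
  qed
  show ?thesis using *[OF assms(1)] *[OF assms(2)] vector_derivative_unique_at by blast
qed

text \<open>The working rule for \<open>differential\<close>: on tangent vectors any derivative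
  found by calculus may replace the chosen one.\<close>

lemma differential_eq:
  fixes f :: "'a::euclidean_space \<Rightarrow> 'b::real_normed_vector"
  assumes "(f has_derivative f') (at p within M)" "v \<in> tangent_space M p"
  shows "differential M f p v = f' v"
proof -
  have "(f has_derivative frechet_derivative f (at p within M)) (at p within M)"
    using assms(1) frechet_derivative_works differentiable_def by blast
  then show ?thesis unfolding differential_def
    using has_derivative_tangent_unique assms by blast
qed

text \<open>\<open>Ck_on\<close> differentiates in fixed directions, so \<open>X p\<close> is
  expanded in the standard basis; this gives smooth coefficients times smooth directional
  derivatives of the ambient extension \<open>h\<close>.\<close>

lemma smooth_fun_differential:
  assumes f: "smooth_fun M f" and X: "vector_field M X"
  shows "smooth_fun M (\<lambda>p. differential M f p (X p))"
proof -
  obtain U h where 1: "open U" "M \<subseteq> U" "\<And>k. Ck_on k U h" "\<And>x. x \<in> M \<Longrightarrow> h x = f x"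
    using smooth_funE[OF f] by metis
  have h: "(h has_derivative frechet_derivative h (at p)) (at p)" if "p \<in> M" for p
    using 1(2) 1(3)[of 1] that frechet_derivative_works by auto
  have eq: "differential M f p (X p) = (\<Sum>i\<in>Basis. (X p \<bullet> i) *\<^sub>R frechet_derivative h (at p) i)"
    if "p \<in> M" for p
  proof -
    have "(f has_derivative frechet_derivative h (at p)) (at p within M)"
      by (rule has_derivative_within_cong[OF has_derivative_at_withinI[OF h[OF that]] that 1(4)])
    then have "differential M f p (X p) = frechet_derivative h (at p) (X p)"
      by (rule differential_eq) (use X that in \<open>simp add: vector_field_def\<close>)
    also have "\<dots> = frechet_derivative h (at p) (\<Sum>i\<in>Basis. (X p \<bullet> i) *\<^sub>R i)"
      by (simp add: euclidean_representation)
    also have "\<dots> = (\<Sum>i\<in>Basis. (X p \<bullet> i) *\<^sub>R frechet_derivative h (at p) i)"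
      using has_derivative_linear[OF h[OF that]] by (simp add: linear_sum linear_scale)
    finally show ?thesis .
  qed
  have "smooth_fun M (\<lambda>p. frechet_derivative h (at p) i)" for i
    unfolding smooth_fun_def
  proof (intro exI conjI)
    show "\<forall>k. Ck_on k U (\<lambda>p. frechet_derivative h (at p) i)"
      using 1(3) Ck_on.simps(2) by blast
  qed (use 1 in auto)
  moreover have "smooth_fun M (\<lambda>p. X p \<bullet> i)" for i
    using X unfolding vector_field_def
    by (intro smooth_fun_linear[OF bounded_linear_inner_left]) auto
  ultimately have "smooth_fun M (\<lambda>p. \<Sum>i\<in>Basis. (X p \<bullet> i) *\<^sub>R frechet_derivative h (at p) i)"
    by (intro smooth_fun_sum smooth_fun_bilinear[OF bounded_bilinear_scaleR])
  then show ?thesis using smooth_fun_cong eq by (metis (no_types, lifting))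
qed

section \<open>The group and its tangent spaces\<close>

text \<open>The adjugate of a 2 by 2 matrix. It is linear and inverts matrices of determinant 1, so
  group inversion is the restriction of a linear map.\<close>

definition adj2 :: "mat2 \<Rightarrow> mat2" where
  "adj2 A = trace A *\<^sub>R mat 1 - A"

lemmas mat2_simps = vec_eq_iff forall_2 sum_2 matrix_matrix_mult_def det_2 trace_def mat_def adj2_def

lemma mat2_mult_adj2: "A ** adj2 A = det A *\<^sub>R mat 1" "adj2 A ** A = det A *\<^sub>R mat 1"
  by (simp_all add: mat2_simps algebra_simps)

lemma adj2_mult: "adj2 (A ** B) = adj2 B ** adj2 A"
  by (simp add: mat2_simps algebra_simps)

lemma det_adj2 [simp]: "det (adj2 A) = det A"
  by (simp add: mat2_simps algebra_simps)

lemma adj2_adj2 [simp]: "adj2 (adj2 A) = A"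
  by (simp add: mat2_simps algebra_simps)

lemma adj2_traceless: "trace A = 0 \<Longrightarrow> adj2 A = - A"
  by (simp add: adj2_def)

lemma linear_adj2: "linear adj2"
  by (rule linearI) (simp_all add: mat2_simps algebra_simps)

lemma matrix_inv_SL: "det (A::mat2) = 1 \<Longrightarrow> matrix_inv A = adj2 A"
proof -
  assume A: "det A = 1"
  then have "invertible A" by (simp add: invertible_det_nz)
  then have "matrix_inv A ** A = mat 1"
    unfolding invertible_def matrix_inv_def by (rule someI2_ex) auto
  then have "matrix_inv A ** (A ** adj2 A) = adj2 A"
    by (simp add: matrix_mul_assoc)
  then show ?thesis using A by (simp add: mat2_mult_adj2)
qed

lemma gmult_eq: "p \<odot> q = (fst p ** fst q, snd p ** snd q)"
  by (cases p; cases q) simp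

definition gone :: mat2_pair where "gone = (mat 1, mat 1)"

definition gadj :: "mat2_pair \<Rightarrow> mat2_pair" where "gadj p = (adj2 (fst p), adj2 (snd p))"

definition sl_pair :: "mat2_pair set" where
  "sl_pair = {u. trace (fst u) = 0 \<and> trace (snd u) = 0}"

lemma bounded_bilinear_gmult: "bounded_bilinear (\<odot>)"
  unfolding bilinear_conv_bounded_bilinear[symmetric] bilinear_def
  by (auto intro!: linearI simp: gmult_eq matrix_matrix_mult_def vec_eq_iff algebra_simps
      sum.distrib scaleR_sum_right sum_distrib_left)

lemmas gmult_add_left = bounded_bilinear.add_left[OF bounded_bilinear_gmult]
lemmas gmult_add_right = bounded_bilinear.add_right[OF bounded_bilinear_gmult]
lemmas gmult_diff_right = bounded_bilinear.diff_right[OF bounded_bilinear_gmult]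
lemmas gmult_scaleR_left = bounded_bilinear.scaleR_left[OF bounded_bilinear_gmult]
lemmas gmult_scaleR_right = bounded_bilinear.scaleR_right[OF bounded_bilinear_gmult]
lemmas gmult_zero = bounded_bilinear.zero_left[OF bounded_bilinear_gmult]
  bounded_bilinear.zero_right[OF bounded_bilinear_gmult]
lemmas gmult_minus_left = bounded_bilinear.minus_left[OF bounded_bilinear_gmult]
lemmas gmult_minus_right = bounded_bilinear.minus_right[OF bounded_bilinear_gmult]
lemmas bounded_linear_gmult_left = bounded_bilinear.bounded_linear_left[OF bounded_bilinear_gmult]
lemmas bounded_linear_gmult_right = bounded_bilinear.bounded_linear_right[OF bounded_bilinear_gmult]

lemma gmult_assoc: "(p \<odot> q) \<odot> r = p \<odot> (q \<odot> r)"
  by (simp add: gmult_eq matrix_mul_assoc)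

lemma gone_gmult [simp]: "gone \<odot> p = p" "p \<odot> gone = p"
  by (simp_all add: gmult_eq gone_def)

lemma SL_iff: "p \<in> SL2xSL2 \<longleftrightarrow> det (fst p) = 1 \<and> det (snd p) = 1"
  by (cases p) (auto simp: SL2xSL2_def)

lemma gone_SL [simp]: "gone \<in> SL2xSL2"
  by (simp add: SL_iff gone_def)

lemma gmult_SL: "p \<in> SL2xSL2 \<Longrightarrow> q \<in> SL2xSL2 \<Longrightarrow> p \<odot> q \<in> SL2xSL2"
  by (simp add: SL_iff gmult_eq det_mul)

lemma gadj_SL: "p \<in> SL2xSL2 \<Longrightarrow> gadj p \<in> SL2xSL2"
  by (simp add: SL_iff gadj_def)

lemma gadj_gmult [simp]: "p \<in> SL2xSL2 \<Longrightarrow> gadj p \<odot> p = gone" "p \<in> SL2xSL2 \<Longrightarrow> p \<odot> gadj p = gone"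
  by (simp_all add: SL_iff gadj_def gmult_eq mat2_mult_adj2 gone_def)

lemma gadj_cancel [simp]:
  "p \<in> SL2xSL2 \<Longrightarrow> gadj p \<odot> (p \<odot> u) = u" "p \<in> SL2xSL2 \<Longrightarrow> p \<odot> (gadj p \<odot> u) = u"
  by (simp_all add: gmult_assoc[symmetric])

lemma ginv_eq_gadj: "p \<in> SL2xSL2 \<Longrightarrow> ginv p = gadj p"
  by (simp add: ginv_def gadj_def SL_iff matrix_inv_SL)

lemma gadj_mult: "gadj (p \<odot> q) = gadj q \<odot> gadj p"
  by (simp add: gadj_def gmult_eq adj2_mult)

lemma gadj_gone [simp]: "gadj gone = gone"
  by (simp add: gadj_def gone_def mat2_simps)

lemma bounded_linear_gadj: "bounded_linear gadj"
  unfolding linear_conv_bounded_linear[symmetric]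
  using linear_adj2 by (auto intro!: linearI simp: gadj_def linear_add linear_scale)

lemma subspace_sl_pair: "subspace sl_pair"
  by (auto simp: subspace_def sl_pair_def trace_def sum_2 algebra_simps distrib_left[symmetric])

definition mat2_of :: "real \<Rightarrow> real \<Rightarrow> real \<Rightarrow> real \<Rightarrow> mat2" where
  "mat2_of a b c d = vector [vector [a, b], vector [c, d]]"

lemma mat2_of_nth [simp]:
  "mat2_of a b c d $ 1 $ 1 = a" "mat2_of a b c d $ 1 $ 2 = b"
  "mat2_of a b c d $ 2 $ 1 = c" "mat2_of a b c d $ 2 $ 2 = d"
  by (simp_all add: mat2_of_def)

text \<open>The curve is the product of the unipotent matrices with entry \<open>t * a\<close> above
  and \<open>t * b\<close> below the diagonal and of diag(exp(t c), exp(-t c)). Determinant 1 is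
  then evident and no matrix exponential occurs.\<close>

lemma SL2_curve:
  fixes X :: mat2
  assumes "trace X = 0"
  obtains \<gamma> :: "real \<Rightarrow> mat2"
  where "\<gamma> 0 = mat 1" "\<And>t. det (\<gamma> t) = 1" "(\<gamma> has_vector_derivative X) (at 0)"
proof -
  define a b c where "a = X $ 1 $ 2" and "b = X $ 2 $ 1" and "c = X $ 1 $ 1"
  define \<gamma> where "\<gamma> t = ((1 + t * a * (t * b)) * exp (t * c)) *\<^sub>R mat2_of 1 0 0 0
     + (t * a * exp (- (t * c))) *\<^sub>R mat2_of 0 1 0 0
     + (t * b * exp (t * c)) *\<^sub>R mat2_of 0 0 1 0 + exp (- (t * c)) *\<^sub>R mat2_of 0 0 0 1" for t
  have X: "X = c *\<^sub>R mat2_of 1 0 0 0 + a *\<^sub>R mat2_of 0 1 0 0 + b *\<^sub>R mat2_of 0 0 1 0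
      + (- c) *\<^sub>R mat2_of 0 0 0 1"
    using assms by (simp add: mat2_simps a_def b_def c_def)
  have "det (\<gamma> t) = 1" for t
    by (simp add: \<gamma>_def det_2 algebra_simps exp_minus)
  moreover have "\<gamma> 0 = mat 1"
    by (simp add: \<gamma>_def mat2_simps)
  moreover have "(\<gamma> has_vector_derivative X) (at 0)"
    unfolding \<gamma>_def X
    by (intro has_vector_derivative_add has_vector_derivative_scaleR[where g = "\<lambda>t. mat2_of _ _ _ _", 
        OF _ has_vector_derivative_const, simplified])
      (auto intro!: derivative_eq_intros)
  ultimately show ?thesis using that by blast
qed

text \<open>Forward: the derivative of \<open>det\<close> along a curve is the trace of the adjugate
  times the velocity, and \<open>det\<close> is constant. Backward: left translates of the curves
  from \<open>SL2_curve\<close>.\<close>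

lemma tangent_space_SL:
  assumes "p \<in> SL2xSL2"
  shows "tangent_space SL2xSL2 p = (\<odot>) p ` sl_pair"
proof (intro equalityI subsetI)
  fix v assume "v \<in> tangent_space SL2xSL2 p"
  then obtain \<gamma> where g: "\<gamma> 0 = p" "\<And>t::real. \<gamma> t \<in> SL2xSL2" "(\<gamma> has_vector_derivative v) (at 0)"
    unfolding tangent_space_def by auto
  \<comment> \<open>\<open>L\<close> stands for \<open>fst\<close> or \<open>snd\<close>, so one
    computation serves both factors.\<close>
  have tr: "trace (adj2 (L p) ** L v) = 0"
    if L: "bounded_linear (L :: mat2_pair \<Rightarrow> mat2)" and d: "\<And>q. q \<in> SL2xSL2 \<Longrightarrow> det (L q) = 1" for L
  proof -
    have e: "((\<lambda>t. L (\<gamma> t) $ i $ j) has_real_derivative (L v $ i $ j)) (at 0)" for i j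
    proof -
      have "bounded_linear (\<lambda>q. L q $ i $ j)"
        by (intro bounded_linear_compose[OF bounded_linear_vec_nth] L)
      from bounded_linear.has_vector_derivative[OF this g(3)]
      show ?thesis by (simp add: has_real_derivative_iff_has_vector_derivative)
    qed
    have "((\<lambda>t. L (\<gamma> t) $ 1 $ 1 * L (\<gamma> t) $ 2 $ 2 - L (\<gamma> t) $ 1 $ 2 * L (\<gamma> t) $ 2 $ 1)
       has_real_derivative trace (adj2 (L p) ** L v)) (at 0)"
      by (rule derivative_eq_intros e refl | simp add: mat2_simps algebra_simps g(1))+
    moreover have "(\<lambda>t. L (\<gamma> t) $ 1 $ 1 * L (\<gamma> t) $ 2 $ 2 - L (\<gamma> t) $ 1 $ 2 * L (\<gamma> t) $ 2 $ 1) = (\<lambda>t. 1)"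
      using d[OF g(2)] by (simp add: det_2)
    ultimately show ?thesis using DERIV_unique[OF _ DERIV_const] by simp
  qed
  have "gadj p \<odot> v \<in> sl_pair"
    using tr[OF bounded_linear_fst] tr[OF bounded_linear_snd]
    by (simp add: sl_pair_def gmult_eq gadj_def SL_iff)
  then show "v \<in> (\<odot>) p ` sl_pair"
    using assms by (intro image_eqI[of _ _ "gadj p \<odot> v"]) auto
next
  fix v assume "v \<in> (\<odot>) p ` sl_pair"
  then obtain u where u: "u \<in> sl_pair" "v = p \<odot> u" by auto
  obtain \<gamma>1 where 1: "\<gamma>1 0 = mat 1" "\<And>t::real. det (\<gamma>1 t) = 1" "(\<gamma>1 has_vector_derivative fst u) (at 0)"
    using SL2_curve[of "fst u"] u(1) by (auto simp: sl_pair_def)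
  obtain \<gamma>2 where 2: "\<gamma>2 0 = mat 1" "\<And>t::real. det (\<gamma>2 t) = 1" "(\<gamma>2 has_vector_derivative snd u) (at 0)"
    using SL2_curve[of "snd u"] u(1) by (auto simp: sl_pair_def)
  have "((\<lambda>t. p \<odot> (\<gamma>1 t, \<gamma>2 t)) has_vector_derivative p \<odot> (fst u, snd u)) (at 0)"
    by (intro bounded_linear.has_vector_derivative[OF bounded_linear_gmult_right]
        has_vector_derivative_Pair 1 2)
  moreover have "p \<odot> (\<gamma>1 t, \<gamma>2 t) \<in> SL2xSL2" for t
    using assms 1(2) 2(2) by (intro gmult_SL) (auto simp: SL_iff)
  moreover have "p \<odot> (\<gamma>1 0, \<gamma>2 0) = p"
    using gone_gmult(2)[of p] by (simp add: 1 2 gone_def)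
  ultimately show "v \<in> tangent_space SL2xSL2 p"
    unfolding tangent_space_def u(2) by (auto intro!: exI[of _ "\<lambda>t. p \<odot> (\<gamma>1 t, \<gamma>2 t)"])
qed

lemma tangent_space_gone: "tangent_space SL2xSL2 gone = sl_pair"
  by (simp add: tangent_space_SL)

lemma gmult_tangent: "p \<in> SL2xSL2 \<Longrightarrow> u \<in> sl_pair \<Longrightarrow> p \<odot> u \<in> tangent_space SL2xSL2 p"
  by (simp add: tangent_space_SL)

lemma gadj_tangent: "p \<in> SL2xSL2 \<Longrightarrow> v \<in> tangent_space SL2xSL2 p \<Longrightarrow> gadj p \<odot> v \<in> sl_pair"
  by (auto simp: tangent_space_SL)

section \<open>Levi-Civita connections of left-invariant metrics\<close>

abbreviation "lvec u \<equiv> (\<lambda>p. p \<odot> (u :: mat2_pair))"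

definition brk :: "mat2_pair \<Rightarrow> mat2_pair \<Rightarrow> mat2_pair" where
  "brk u v = u \<odot> v - v \<odot> u"

lemma trace_commute_diff: "trace (A ** B - B ** (A::real^'n^'n)) = 0"
  using trace_mul_sym[of A B] by (simp add: trace_sub)

lemma brk_sl [simp]: "brk u v \<in> sl_pair"
  by (simp add: brk_def gmult_eq sl_pair_def trace_commute_diff)

lemma brk_linear:
  "brk (u + u') v = brk u v + brk u' v" "brk u (v + v') = brk u v + brk u v'"
  "brk (c *\<^sub>R u) v = c *\<^sub>R brk u v" "brk u (c *\<^sub>R v) = c *\<^sub>R brk u v"
  by (simp_all add: brk_def gmult_add_left gmult_add_right gmult_scaleR_left gmult_scaleR_right
      algebra_simps)

lemmas sl_closed [simp, intro] =
  subspace_add[OF subspace_sl_pair] subspace_scale[OF subspace_sl_pair]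
  subspace_diff[OF subspace_sl_pair] subspace_neg[OF subspace_sl_pair]
  subspace_0[OF subspace_sl_pair] subspace_sum[OF subspace_sl_pair]

text \<open>A linear retraction of the ambient space onto \<open>sl_pair\<close>. Composing with it
  turns maps that are linear only on the Lie algebra into linear maps of the ambient space, to which
  the calculus lemmas apply.\<close>

definition sl_proj :: "mat2_pair \<Rightarrow> mat2_pair" where
  "sl_proj u = (fst u - (trace (fst u) / 2) *\<^sub>R mat 1, snd u - (trace (snd u) / 2) *\<^sub>R mat 1)"

lemma linear_sl_proj: "linear sl_proj"
  by (rule linearI)
    (auto simp: sl_proj_def trace_def sum_2 algebra_simps add_divide_distrib)

lemma sl_proj_in [simp]: "sl_proj u \<in> sl_pair"
  by (simp add: sl_proj_def sl_pair_def trace_def sum_2 mat_def)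

lemma sl_proj_id [simp]: "u \<in> sl_pair \<Longrightarrow> sl_proj u = u"
  by (simp add: sl_proj_def sl_pair_def prod_eq_iff)

text \<open>The eight projected basis vectors span the six-dimensional algebra without being
  independent. What matters is that the coefficients \<open>u \<bullet> i\<close> are linear in
  \<open>u\<close>, hence smooth along a smooth field.\<close>

lemma sl_expand:
  assumes "u \<in> sl_pair"
  shows "u = (\<Sum>i\<in>Basis. (u \<bullet> i) *\<^sub>R sl_proj i)"
proof -
  have "u = sl_proj (\<Sum>i\<in>Basis. (u \<bullet> i) *\<^sub>R i)"
    using assms by (simp add: euclidean_representation)
  then show ?thesis
    by (simp add: linear_sum[OF linear_sl_proj] linear_scale[OF linear_sl_proj])
qed

lemma vector_field_left:
  assumes "smooth_fun SL2xSL2 \<xi>" "\<And>p. p \<in> SL2xSL2 \<Longrightarrow> \<xi> p \<in> sl_pair"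
  shows "vector_field SL2xSL2 (\<lambda>p. p \<odot> \<xi> p)"
  unfolding vector_field_def
  using assms by (auto intro!: smooth_fun_bilinear[OF bounded_bilinear_gmult] smooth_fun_id gmult_tangent)

lemma vector_field_lvec: "u \<in> sl_pair \<Longrightarrow> vector_field SL2xSL2 (lvec u)"
  by (rule vector_field_left) (auto intro: smooth_fun_const)

lemma vector_field_coeff:
  assumes "vector_field SL2xSL2 X"
  shows "smooth_fun SL2xSL2 (\<lambda>p. gadj p \<odot> X p)" "p \<in> SL2xSL2 \<Longrightarrow> gadj p \<odot> X p \<in> sl_pair"
  using assms unfolding vector_field_def
  by (auto intro!: smooth_fun_bilinear[OF bounded_bilinear_gmult] gadj_tangent
      smooth_fun_linear[OF bounded_linear_gadj] smooth_fun_id)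

lemma subspace_tangent: "p \<in> SL2xSL2 \<Longrightarrow> subspace (tangent_space SL2xSL2 p)"
  unfolding tangent_space_SL
  by (intro linear_subspace_image subspace_sl_pair bounded_linear.linear bounded_linear_gmult_right)

lemma vector_field_add:
  "vector_field SL2xSL2 X \<Longrightarrow> vector_field SL2xSL2 Y \<Longrightarrow> vector_field SL2xSL2 (\<lambda>p. X p + Y p)"
  unfolding vector_field_def
  by (auto intro!: smooth_fun_add subspace_add[OF subspace_tangent])

lemma vector_field_scale:
  "smooth_fun SL2xSL2 f \<Longrightarrow> vector_field SL2xSL2 X \<Longrightarrow> vector_field SL2xSL2 (\<lambda>p. f p *\<^sub>R X p)"
  unfolding vector_field_def
  by (auto intro!: smooth_fun_bilinear[OF bounded_bilinear_scaleR] subspace_scale[OF subspace_tangent])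

lemma vector_field_sum:
  assumes "finite I" "\<And>i. i \<in> I \<Longrightarrow> vector_field SL2xSL2 (X i)"
  shows "vector_field SL2xSL2 (\<lambda>p. \<Sum>i\<in>I. X i p)"
  using assms
proof (induction I)
  case empty
  show ?case using vector_field_lvec[of 0] by (simp add: gmult_zero)
qed (auto intro: vector_field_add)

lemma differential_const: "v \<in> tangent_space M p \<Longrightarrow> differential M (\<lambda>q. c) p v = 0"
  by (rule differential_eq[OF has_derivative_const])

lemma differential_lvec:
  "v \<in> tangent_space M p \<Longrightarrow> differential M (lvec u) p v = v \<odot> u"
  by (rule differential_eq[OF bounded_linear_imp_has_derivative[OF bounded_linear_gmult_left]])

text \<open>\<open>sl_proj\<close> composed with \<open>\<xi>'\<close> is also a derivative of
  \<open>\<xi>\<close>, and two derivatives agree on tangent vectors.\<close>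

lemma has_derivative_sl:
  assumes d: "(\<xi> has_derivative \<xi>') (at p within SL2xSL2)" and p: "p \<in> SL2xSL2"
    and v: "v \<in> tangent_space SL2xSL2 p" and sl: "\<And>q. q \<in> SL2xSL2 \<Longrightarrow> \<xi> q \<in> sl_pair"
  shows "\<xi>' v \<in> sl_pair"
proof -
  have "((\<lambda>q. sl_proj (\<xi> q)) has_derivative (\<lambda>v. sl_proj (\<xi>' v))) (at p within SL2xSL2)"
    by (rule bounded_linear.has_derivative[OF iffD1[OF linear_conv_bounded_linear linear_sl_proj] d])
  then have "(\<xi> has_derivative (\<lambda>v. sl_proj (\<xi>' v))) (at p within SL2xSL2)"
    by (rule has_derivative_within_cong[OF _ p]) (simp add: sl)
  from has_derivative_tangent_unique[OF d this v] show ?thesis by (metis sl_proj_in)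
qed

definition is_metric_form :: "(mat2_pair \<Rightarrow> mat2_pair \<Rightarrow> real) \<Rightarrow> bool" where
  "is_metric_form b \<longleftrightarrow>
     (\<forall>u\<in>sl_pair. \<forall>v\<in>sl_pair. b u v = b v u) \<and>
     (\<forall>u\<in>sl_pair. \<forall>v\<in>sl_pair. \<forall>w\<in>sl_pair. b (u + v) w = b u w + b v w) \<and>
     (\<forall>u\<in>sl_pair. \<forall>v\<in>sl_pair. \<forall>c. b (c *\<^sub>R u) v = c * b u v) \<and>
     (\<forall>u\<in>sl_pair. (\<forall>v\<in>sl_pair. b u v = 0) \<longrightarrow> u = 0)"

text \<open>Torsion-freeness and metric compatibility for the product that a connection induces on
  left-invariant fields. No derivative of the metric appears, since the metric is constant on such
  fields.\<close>

definition is_lc_form ::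
    "(mat2_pair \<Rightarrow> mat2_pair \<Rightarrow> real) \<Rightarrow> (mat2_pair \<Rightarrow> mat2_pair \<Rightarrow> mat2_pair) \<Rightarrow> bool" where
  "is_lc_form b G \<longleftrightarrow>
     (\<forall>u\<in>sl_pair. \<forall>v\<in>sl_pair. G u v \<in> sl_pair \<and> G u v - G v u = brk u v) \<and>
     (\<forall>u\<in>sl_pair. \<forall>v\<in>sl_pair. \<forall>w\<in>sl_pair. b (G u v) w + b v (G u w) = 0)"

lemma is_metric_formD:
  assumes "is_metric_form b" "u \<in> sl_pair" "v \<in> sl_pair" "w \<in> sl_pair"
  shows "b u v = b v u" "b (u + v) w = b u w + b v w" "b (c *\<^sub>R u) v = c * b u v"
    "b w (u + v) = b w u + b w v" "b (u - v) w = b u w - b v w" "b w (u - v) = b w u - b w v"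
proof -
  have sym: "b x y = b y x" if "x \<in> sl_pair" "y \<in> sl_pair" for x y
    using assms(1) that unfolding is_metric_form_def by simp
  have "\<forall>u\<in>sl_pair. \<forall>v\<in>sl_pair. \<forall>w\<in>sl_pair. b (u + v) w = b u w + b v w"
    using assms(1) unfolding is_metric_form_def by (elim conjE)
  then have add: "b (x + y) z = b x z + b y z" if "x \<in> sl_pair" "y \<in> sl_pair" "z \<in> sl_pair" for x y z
    using that by blast
  have diff: "b (x - y) z = b x z - b y z" if "x \<in> sl_pair" "y \<in> sl_pair" "z \<in> sl_pair" for x y z
    using add[of "x - y" y z] that by simp
  show "b u v = b v u" "b (u + v) w = b u w + b v w" "b (u - v) w = b u w - b v w"
    using assms sym add diff by auto
  show "b w (u + v) = b w u + b w v" "b w (u - v) = b w u - b w v"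
    using sym[of w] add[of u v w] diff[of u v w] assms by simp_all
  have "\<forall>u\<in>sl_pair. \<forall>v\<in>sl_pair. \<forall>c. b (c *\<^sub>R u) v = c * b u v"
    using assms(1) unfolding is_metric_form_def by (elim conjE)
  then show "b (c *\<^sub>R u) v = c * b u v"
    using assms by blast
qed

text \<open>The difference of two solutions, paired with the metric, is symmetric in its first two
  arguments and skew in the last two; alternating these two rules six times leads back to its own
  negative.\<close>

lemma is_lc_form_unique:
  assumes m: "is_metric_form b" and G: "is_lc_form b G" and H: "is_lc_form b H"
    and u: "u \<in> sl_pair" and v: "v \<in> sl_pair"
  shows "G u v = H u v"
proof -
  define T where "T u v w = b (G u v - H u v) w" for u v w
  note D = is_metric_formD[OF m]
  have sl: "G u v \<in> sl_pair" "H u v \<in> sl_pair" if "u \<in> sl_pair" "v \<in> sl_pair" for u v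
    using G H that unfolding is_lc_form_def by auto
  have 1: "T u v w = T v u w" if "u \<in> sl_pair" "v \<in> sl_pair" for u v w
  proof -
    have "G u v - G v u = H u v - H v u" using G H that unfolding is_lc_form_def by auto
    then have "G u v - H u v = G v u - H v u" by (simp add: algebra_simps)
    then show ?thesis unfolding T_def by simp
  qed
  have 2: "T u v w = - T u w v" if "u \<in> sl_pair" "v \<in> sl_pair" "w \<in> sl_pair" for u v w
  proof -
    have "b (G u v) w + b v (G u w) = 0" "b (H u v) w + b v (H u w) = 0"
      using G H that unfolding is_lc_form_def by auto
    moreover have "b v (G u w) = b (G u w) v" "b v (H u w) = b (H u w) v"
      using D(1)[of v "G u w"] D(1)[of v "H u w"] sl that by auto
    moreover have "T u v w = b (G u v) w - b (H u v) w" "T u w v = b (G u w) v - b (H u w) v"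
      unfolding T_def using D(5) sl that by auto
    ultimately show ?thesis by linarith
  qed
  have "T u v w = 0" if w: "w \<in> sl_pair" for w
    using 1[of u v w] 2[of v u w] 1[of v w u] 2[of w v u] 1[of w u v] 2[of u w v] u v w by linarith
  then have "G u v - H u v = 0"
    using m sl[OF u v] unfolding is_metric_form_def T_def by (metis sl_closed(3))
  then show ?thesis by simp
qed

section \<open>Connection and curvature of a left-invariant metric at the neutral element\<close>

locale left_invariant_lc =
  fixes g :: "mat2_pair metric_field" and nabla :: "mat2_pair connection"
  assumes pr: "pseudo_riemannian SL2xSL2 g" and li: "left_invariant g"
    and lc: "levi_civita SL2xSL2 g nabla"
begin

lemma nabla_vf: "vector_field SL2xSL2 X \<Longrightarrow> vector_field SL2xSL2 Y \<Longrightarrow> vector_field SL2xSL2 (nabla X Y)"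
  and nabla_add1: "vector_field SL2xSL2 X \<Longrightarrow> vector_field SL2xSL2 X' \<Longrightarrow> vector_field SL2xSL2 Y \<Longrightarrow>
    p \<in> SL2xSL2 \<Longrightarrow> nabla (\<lambda>q. X q + X' q) Y p = nabla X Y p + nabla X' Y p"
  and nabla_add2: "vector_field SL2xSL2 X \<Longrightarrow> vector_field SL2xSL2 Y \<Longrightarrow> vector_field SL2xSL2 Y' \<Longrightarrow>
    p \<in> SL2xSL2 \<Longrightarrow> nabla X (\<lambda>q. Y q + Y' q) p = nabla X Y p + nabla X Y' p"
  and nabla_scale1: "smooth_fun SL2xSL2 f \<Longrightarrow> vector_field SL2xSL2 X \<Longrightarrow> vector_field SL2xSL2 Y \<Longrightarrow>
    p \<in> SL2xSL2 \<Longrightarrow> nabla (\<lambda>q. f q *\<^sub>R X q) Y p = f p *\<^sub>R nabla X Y p"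
  and nabla_scale2: "smooth_fun SL2xSL2 f \<Longrightarrow> vector_field SL2xSL2 X \<Longrightarrow> vector_field SL2xSL2 Y \<Longrightarrow>
    p \<in> SL2xSL2 \<Longrightarrow> nabla X (\<lambda>q. f q *\<^sub>R Y q) p =
      differential SL2xSL2 f p (X p) *\<^sub>R Y p + f p *\<^sub>R nabla X Y p"
  using lc unfolding levi_civita_def affine_connection_def by simp_all

lemma nabla_zero:
  assumes "vector_field SL2xSL2 X" "vector_field SL2xSL2 Z" "p \<in> SL2xSL2"
    and 0: "\<And>q. q \<in> SL2xSL2 \<Longrightarrow> Z q = 0"
  shows "nabla Z X p = 0" "nabla X Z p = 0"
proof -
  \<comment> \<open>Multiplying by this indicator of the complement leaves \<open>Z\<close>
    unchanged as a function, although the factor agrees with 0 on the group and is smooth there.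
    Function-linearity and the Leibniz rule then give 0.\<close>
  define f :: "mat2_pair \<Rightarrow> real" where "f q = (if q \<in> SL2xSL2 then 0 else 1)" for q
  have f: "smooth_fun SL2xSL2 f"
    by (rule smooth_fun_cong[OF smooth_fun_const[of _ 0]]) (simp add: f_def)
  have Z: "Z = (\<lambda>q. f q *\<^sub>R Z q)"
    using 0 by (auto simp: f_def)
  have "f p = 0" using assms by (simp add: f_def)
  then show "nabla Z X p = 0" "nabla X Z p = 0"
    using nabla_scale1[OF f assms(2,1,3)] nabla_scale2[OF f assms(1,2,3)] 0[OF assms(3)] Z by simp_all
qed

text \<open>The axioms of a connection do not state that \<open>nabla\<close> ignores values off the
  group; additivity and \<open>nabla_zero\<close> supply this.\<close>

lemma nabla_cong:
  assumes "vector_field SL2xSL2 X" "vector_field SL2xSL2 X'" "vector_field SL2xSL2 Y"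
    "vector_field SL2xSL2 Y'" "p \<in> SL2xSL2"
    and "\<And>q. q \<in> SL2xSL2 \<Longrightarrow> X q = X' q" "\<And>q. q \<in> SL2xSL2 \<Longrightarrow> Y q = Y' q"
  shows "nabla X Y p = nabla X' Y' p"
proof -
  have d: "vector_field SL2xSL2 (\<lambda>q. A q - B q)"
    if "vector_field SL2xSL2 A" "vector_field SL2xSL2 B" for A B
    using vector_field_add[OF that(1) vector_field_scale[OF smooth_fun_const that(2)], of "-1"]
    by simp
  have "nabla X Y p = nabla (\<lambda>q. X' q + (X q - X' q)) Y p" by simp
  also have "\<dots> = nabla X' Y p + nabla (\<lambda>q. X q - X' q) Y p"
    by (intro nabla_add1 d assms)
  also have "nabla (\<lambda>q. X q - X' q) Y p = 0"
    using assms(6) by (intro nabla_zero d assms) simp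
  finally have 1: "nabla X Y p = nabla X' Y p" by simp
  have "nabla X' Y p = nabla X' (\<lambda>q. Y' q + (Y q - Y' q)) p" by simp
  also have "\<dots> = nabla X' Y' p + nabla X' (\<lambda>q. Y q - Y' q) p"
    by (intro nabla_add2 d assms)
  also have "nabla X' (\<lambda>q. Y q - Y' q) p = 0"
    using assms(7) by (intro nabla_zero d assms) simp
  finally show ?thesis using 1 by simp
qed

lemma nabla_sum1:
  assumes "finite I" "\<And>i. i \<in> I \<Longrightarrow> vector_field SL2xSL2 (X i)" "vector_field SL2xSL2 Y" "p \<in> SL2xSL2"
  shows "nabla (\<lambda>q. \<Sum>i\<in>I. X i q) Y p = (\<Sum>i\<in>I. nabla (X i) Y p)"
  using assms
proof (induction I)
  case empty
  show ?case using nabla_zero(1)[OF empty(2) vector_field_lvec[of 0] empty(3)] by (simp add: gmult_zero)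
qed (auto simp: nabla_add1 vector_field_sum)

lemma nabla_sum2:
  assumes "finite I" "\<And>i. i \<in> I \<Longrightarrow> vector_field SL2xSL2 (Y i)" "vector_field SL2xSL2 X" "p \<in> SL2xSL2"
  shows "nabla X (\<lambda>q. \<Sum>i\<in>I. Y i q) p = (\<Sum>i\<in>I. nabla X (Y i) p)"
  using assms
proof (induction I)
  case empty
  show ?case using nabla_zero(2)[OF empty(2) vector_field_lvec[of 0] empty(3)] by (simp add: gmult_zero)
qed (auto simp: nabla_add2 vector_field_sum)

lemma metric_left:
  "p \<in> SL2xSL2 \<Longrightarrow> u \<in> sl_pair \<Longrightarrow> v \<in> sl_pair \<Longrightarrow> g p (p \<odot> u) (p \<odot> v) = g gone u v"
  using li unfolding left_invariant_def
  by (metis gone_SL gone_gmult(2) tangent_space_gone)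

lemma metric_form: "is_metric_form (g gone)"
  using pr gone_SL unfolding pseudo_riemannian_def is_metric_form_def tangent_space_gone[symmetric]
  by blast

definition Gam :: "mat2_pair \<Rightarrow> mat2_pair \<Rightarrow> mat2_pair" where
  "Gam u v = nabla (lvec u) (lvec v) gone"

lemma lc_form_at:
  assumes p: "p \<in> SL2xSL2"
  shows "is_lc_form (g gone) (\<lambda>u v. gadj p \<odot> nabla (lvec u) (lvec v) p)"
  unfolding is_lc_form_def
proof (intro conjI ballI)
  note vf = vector_field_lvec
  fix u v assume u: "u \<in> sl_pair" and v: "v \<in> sl_pair"
  show sl: "gadj p \<odot> nabla (lvec u) (lvec v) p \<in> sl_pair"
    using nabla_vf[OF vf[OF u] vf[OF v]] p by (simp add: vector_field_coeff)
  have "nabla (lvec u) (lvec v) p - nabla (lvec v) (lvec u) p = lie_bracket SL2xSL2 (lvec u) (lvec v) p"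
    using lc p vf[OF u] vf[OF v] unfolding levi_civita_def by blast
  also have "\<dots> = p \<odot> brk u v"
    using p u v by (simp add: lie_bracket_def differential_lvec gmult_tangent brk_def gmult_diff_right gmult_assoc)
  finally show "gadj p \<odot> nabla (lvec u) (lvec v) p - gadj p \<odot> nabla (lvec v) (lvec u) p = brk u v"
    using p by (simp add: gmult_diff_right[symmetric])
  fix w assume w: "w \<in> sl_pair"
  have c: "((\<lambda>q. g q (q \<odot> v) (q \<odot> w)) has_derivative (\<lambda>_. 0)) (at p within SL2xSL2)"
    by (rule has_derivative_within_cong[OF has_derivative_const p]) (simp add: metric_left v w)
  have "differential SL2xSL2 (\<lambda>q. g q (q \<odot> v) (q \<odot> w)) p (p \<odot> u)
      = g p (nabla (lvec u) (lvec v) p) (p \<odot> w) + g p (p \<odot> v) (nabla (lvec u) (lvec w) p)"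
    using lc p vf[OF u] vf[OF v] vf[OF w] unfolding levi_civita_def by blast
  then have "0 = g p (p \<odot> (gadj p \<odot> nabla (lvec u) (lvec v) p)) (p \<odot> w)
     + g p (p \<odot> v) (p \<odot> (gadj p \<odot> nabla (lvec u) (lvec w) p))"
    using differential_eq[OF c gmult_tangent[OF p u]] p by simp
  also have "\<dots> = g gone (gadj p \<odot> nabla (lvec u) (lvec v) p) w
      + g gone v (gadj p \<odot> nabla (lvec u) (lvec w) p)"
    using metric_left[OF p] nabla_vf[OF vf[OF u] vf[OF v]] nabla_vf[OF vf[OF u] vf[OF w]] p v w
    by (simp add: vector_field_coeff del: gadj_cancel)
  finally show "g gone (gadj p \<odot> nabla (lvec u) (lvec v) p) w
      + g gone v (gadj p \<odot> nabla (lvec u) (lvec w) p) = 0" by simp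
qed

lemma lc_form: "is_lc_form (g gone) Gam"
  using lc_form_at[OF gone_SL] by (simp add: Gam_def[abs_def])

lemma Gam_sl: "u \<in> sl_pair \<Longrightarrow> v \<in> sl_pair \<Longrightarrow> Gam u v \<in> sl_pair"
  using lc_form unfolding is_lc_form_def by blast

text \<open>The products read off at \<open>p\<close> and at \<open>gone\<close> satisfy the same
  two conditions, so uniqueness makes the connection left-invariant.\<close>

lemma nabla_lvec:
  assumes p: "p \<in> SL2xSL2" and "u \<in> sl_pair" "v \<in> sl_pair"
  shows "nabla (lvec u) (lvec v) p = p \<odot> Gam u v"
  using is_lc_form_unique[OF metric_form lc_form_at[OF p] lc_form assms(2,3)] p
  by (metis gadj_cancel(2))

lemma Gam_linear:
  assumes "u \<in> sl_pair" "v \<in> sl_pair" "w \<in> sl_pair"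
  shows "Gam (u + v) w = Gam u w + Gam v w" "Gam w (u + v) = Gam w u + Gam w v"
    "Gam (c *\<^sub>R u) v = c *\<^sub>R Gam u v" "Gam u (c *\<^sub>R v) = c *\<^sub>R Gam u v"
proof -
  note vf = vector_field_lvec
  show "Gam (u + v) w = Gam u w + Gam v w" "Gam w (u + v) = Gam w u + Gam w v"
    using nabla_add1[OF vf vf vf gone_SL, of u v w] nabla_add2[OF vf vf vf gone_SL, of w u v] assms
    by (simp_all add: Gam_def gmult_add_right)
  show "Gam (c *\<^sub>R u) v = c *\<^sub>R Gam u v"
    using nabla_scale1[OF smooth_fun_const vf vf gone_SL, of u v c] assms
    by (simp add: Gam_def gmult_scaleR_right)
  show "Gam u (c *\<^sub>R v) = c *\<^sub>R Gam u v"
    using nabla_scale2[OF smooth_fun_const vf vf gone_SL, of u v c] assms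
    by (simp add: Gam_def gmult_scaleR_right differential_const tangent_space_gone)
qed

lemma Gam_sum:
  assumes "w \<in> sl_pair" "\<And>i. i \<in> I \<Longrightarrow> e i \<in> sl_pair"
  shows "Gam (\<Sum>i\<in>I. c i *\<^sub>R e i) w = (\<Sum>i\<in>I. c i *\<^sub>R Gam (e i) w)"
    "Gam w (\<Sum>i\<in>I. c i *\<^sub>R e i) = (\<Sum>i\<in>I. c i *\<^sub>R Gam w (e i))"
proof -
  have z: "Gam 0 w = 0" "Gam w 0 = 0"
    using Gam_linear(3)[of 0 w _ 0] Gam_linear(4)[of w 0 _ 0] assms(1) by auto
  show "Gam (\<Sum>i\<in>I. c i *\<^sub>R e i) w = (\<Sum>i\<in>I. c i *\<^sub>R Gam (e i) w)"
    "Gam w (\<Sum>i\<in>I. c i *\<^sub>R e i) = (\<Sum>i\<in>I. c i *\<^sub>R Gam w (e i))"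
    using assms(2)
    by (induction I rule: infinite_finite_induct) (use assms(1) z in \<open>auto simp: Gam_linear\<close>)
qed

lemma linear_Gam_proj: "w \<in> sl_pair \<Longrightarrow> linear (\<lambda>u. Gam (sl_proj u) w)"
  by (rule linearI) (auto simp: linear_add[OF linear_sl_proj] linear_scale[OF linear_sl_proj] Gam_linear)

text \<open>In its first argument the connection is function-linear and sees only the value of
  \<open>\<xi>\<close> at \<open>p\<close>; the next lemma, for the second argument, adds the
  derivative of \<open>\<xi>\<close>.\<close>

lemma nabla_left1:
  assumes \<xi>: "smooth_fun SL2xSL2 \<xi>" "\<And>q. q \<in> SL2xSL2 \<Longrightarrow> \<xi> q \<in> sl_pair"
    and z: "z \<in> sl_pair" and p: "p \<in> SL2xSL2"
  shows "nabla (\<lambda>q. q \<odot> \<xi> q) (lvec z) p = p \<odot> Gam (\<xi> p) z"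
proof -
  have s: "smooth_fun SL2xSL2 (\<lambda>q. \<xi> q \<bullet> i)" for i
    by (rule smooth_fun_linear[OF bounded_linear_inner_left \<xi>(1)])
  have "nabla (\<lambda>q. q \<odot> \<xi> q) (lvec z) p =
      nabla (\<lambda>q. \<Sum>i\<in>Basis. (\<xi> q \<bullet> i) *\<^sub>R (q \<odot> sl_proj i)) (lvec z) p"
  proof (rule nabla_cong)
    show "q \<odot> \<xi> q = (\<Sum>i\<in>Basis. (\<xi> q \<bullet> i) *\<^sub>R (q \<odot> sl_proj i))" if "q \<in> SL2xSL2" for q
      by (subst sl_expand[OF \<xi>(2)[OF that]])
        (simp add: bounded_bilinear.sum_right[OF bounded_bilinear_gmult] gmult_scaleR_right)
  qed (use \<xi> z p in \<open>auto intro!: vector_field_left vector_field_sum vector_field_scale vector_field_lvec s\<close>)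
  also have "\<dots> = (\<Sum>i\<in>Basis. nabla (\<lambda>q. (\<xi> q \<bullet> i) *\<^sub>R (q \<odot> sl_proj i)) (lvec z) p)"
    by (rule nabla_sum1) (use z p in \<open>auto intro!: vector_field_scale vector_field_lvec s\<close>)
  also have "\<dots> = (\<Sum>i\<in>Basis. (\<xi> p \<bullet> i) *\<^sub>R (p \<odot> Gam (sl_proj i) z))"
    by (intro sum.cong refl) (simp add: nabla_scale1 s vector_field_lvec z p nabla_lvec)
  also have "\<dots> = p \<odot> Gam (\<Sum>i\<in>Basis. (\<xi> p \<bullet> i) *\<^sub>R sl_proj i) z"
    by (simp add: Gam_sum z bounded_bilinear.sum_right[OF bounded_bilinear_gmult] gmult_scaleR_right)
  finally show ?thesis
    using sl_expand[OF \<xi>(2)[OF p]] by simp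
qed

lemma nabla_left2:
  assumes \<xi>: "smooth_fun SL2xSL2 \<xi>" "\<And>q. q \<in> SL2xSL2 \<Longrightarrow> \<xi> q \<in> sl_pair"
    and y: "y \<in> sl_pair" and p: "p \<in> SL2xSL2"
    and d: "(\<xi> has_derivative \<xi>') (at p within SL2xSL2)"
  shows "nabla (lvec y) (\<lambda>q. q \<odot> \<xi> q) p = p \<odot> (\<xi>' (p \<odot> y) + Gam y (\<xi> p))"
proof -
  have s: "smooth_fun SL2xSL2 (\<lambda>q. \<xi> q \<bullet> i)" for i
    by (rule smooth_fun_linear[OF bounded_linear_inner_left \<xi>(1)])
  have df: "differential SL2xSL2 (\<lambda>q. \<xi> q \<bullet> i) p (p \<odot> y) = \<xi>' (p \<odot> y) \<bullet> i" for i
    by (rule differential_eq[OF bounded_linear.has_derivative[OF bounded_linear_inner_left d]])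
      (simp add: gmult_tangent p y)
  have "nabla (lvec y) (\<lambda>q. q \<odot> \<xi> q) p =
      nabla (lvec y) (\<lambda>q. \<Sum>i\<in>Basis. (\<xi> q \<bullet> i) *\<^sub>R (q \<odot> sl_proj i)) p"
  proof (rule nabla_cong)
    show "q \<odot> \<xi> q = (\<Sum>i\<in>Basis. (\<xi> q \<bullet> i) *\<^sub>R (q \<odot> sl_proj i))" if "q \<in> SL2xSL2" for q
      by (subst sl_expand[OF \<xi>(2)[OF that]])
        (simp add: bounded_bilinear.sum_right[OF bounded_bilinear_gmult] gmult_scaleR_right)
  qed (use \<xi> y p in \<open>auto intro!: vector_field_left vector_field_sum vector_field_scale vector_field_lvec s\<close>)
  also have "\<dots> = (\<Sum>i\<in>Basis. nabla (lvec y) (\<lambda>q. (\<xi> q \<bullet> i) *\<^sub>R (q \<odot> sl_proj i)) p)"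
    by (rule nabla_sum2) (use y p in \<open>auto intro!: vector_field_scale vector_field_lvec s\<close>)
  also have "\<dots> = (\<Sum>i\<in>Basis. (\<xi>' (p \<odot> y) \<bullet> i) *\<^sub>R (p \<odot> sl_proj i) + (\<xi> p \<bullet> i) *\<^sub>R (p \<odot> Gam y (sl_proj i)))"
    by (intro sum.cong refl) (simp add: nabla_scale2 s vector_field_lvec y p nabla_lvec df)
  also have "\<dots> = p \<odot> ((\<Sum>i\<in>Basis. (\<xi>' (p \<odot> y) \<bullet> i) *\<^sub>R sl_proj i)
      + Gam y (\<Sum>i\<in>Basis. (\<xi> p \<bullet> i) *\<^sub>R sl_proj i))"
    by (simp add: Gam_sum y bounded_bilinear.sum_right[OF bounded_bilinear_gmult] gmult_scaleR_right
        gmult_add_right sum.distrib)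
  also have "\<dots> = p \<odot> (\<xi>' (p \<odot> y) + Gam y (\<xi> p))"
    using sl_expand[OF \<xi>(2)[OF p]] sl_expand[OF has_derivative_sl[OF d p gmult_tangent[OF p y] \<xi>(2)]]
    by simp
  finally show ?thesis .
qed

definition Rie :: "mat2_pair \<Rightarrow> mat2_pair \<Rightarrow> mat2_pair \<Rightarrow> mat2_pair" where
  "Rie u y z = Gam u (Gam y z) - Gam y (Gam u z) - Gam (brk u y) z"

text \<open>\<open>ricci\<close> inserts an arbitrary extension of a tangent vector, so the
  coefficient \<open>\<xi>\<close> of \<open>X\<close> may vary. Its derivative enters through
  \<open>nabla (lvec y) (nabla X (lvec z))\<close> and through the bracket of \<open>X\<close> with
  \<open>lvec y\<close>, and the two contributions cancel.\<close>

lemma curvature_gone: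
  assumes X: "vector_field SL2xSL2 X" and y: "y \<in> sl_pair" and z: "z \<in> sl_pair"
  shows "curvature SL2xSL2 nabla X (lvec y) (lvec z) gone = Rie (X gone) y z"
proof -
  define \<xi> where "\<xi> q = gadj q \<odot> X q" for q
  have \<xi>: "smooth_fun SL2xSL2 \<xi>" "\<And>q. q \<in> SL2xSL2 \<Longrightarrow> \<xi> q \<in> sl_pair"
    unfolding \<xi>_def using vector_field_coeff[OF X] by auto
  have X\<xi>: "X q = q \<odot> \<xi> q" if "q \<in> SL2xSL2" for q
    using that by (simp add: \<xi>_def)
  have g0: "X gone = \<xi> gone" by (simp add: \<xi>_def)
  obtain \<xi>' where d: "(\<xi> has_derivative \<xi>') (at gone within SL2xSL2)"
    using smooth_fun_has_derivative[OF \<xi>(1) gone_SL] by blast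
  have dy: "\<xi>' y \<in> sl_pair"
    using has_derivative_sl[OF d gone_SL _ \<xi>(2)] y by (simp add: tangent_space_gone)
  have vf: "vector_field SL2xSL2 (\<lambda>q. q \<odot> \<xi> q)" by (rule vector_field_left[OF \<xi>])
  have nX: "nabla X Y p = nabla (\<lambda>q. q \<odot> \<xi> q) Y p" if "vector_field SL2xSL2 Y" "p \<in> SL2xSL2" for Y p
    by (rule nabla_cong[OF X vf that(1) that(1) that(2)]) (auto simp: X\<xi>)
  have 1: "nabla X (nabla (lvec y) (lvec z)) gone = Gam (\<xi> gone) (Gam y z)"
  proof -
    have "nabla X (nabla (lvec y) (lvec z)) gone = nabla (\<lambda>q. q \<odot> \<xi> q) (lvec (Gam y z)) gone"
      by (rule nabla_cong[OF X vf]) (auto simp: y z nabla_lvec Gam_sl X\<xi> intro!: nabla_vf vector_field_lvec)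
    then show ?thesis using nabla_left1[OF \<xi> Gam_sl[OF y z] gone_SL] by simp
  qed
  \<comment> \<open>\<open>sl_proj\<close> makes the map linear on all pairs of matrices, so that
    the chain rule applies to it.\<close>
  have lin: "bounded_linear (\<lambda>u. Gam (sl_proj u) z)"
    using linear_Gam_proj[OF z] linear_conv_bounded_linear by blast
  have sz: "smooth_fun SL2xSL2 (\<lambda>q. Gam (sl_proj (\<xi> q)) z)"
    by (rule smooth_fun_linear[OF lin \<xi>(1)])
  have 2: "nabla (lvec y) (nabla X (lvec z)) gone = Gam (\<xi>' y) z + Gam y (Gam (\<xi> gone) z)"
  proof -
    have "nabla (lvec y) (nabla X (lvec z)) gone = nabla (lvec y) (\<lambda>q. q \<odot> Gam (sl_proj (\<xi> q)) z) gone"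
      by (rule nabla_cong) (use y z X \<xi> sz in \<open>auto simp: nX nabla_left1 Gam_sl vector_field_lvec
          intro!: nabla_vf vector_field_left smooth_fun_const\<close>)
    also have "\<dots> = gone \<odot> (Gam (sl_proj (\<xi>' (gone \<odot> y))) z + Gam y (Gam (sl_proj (\<xi> gone)) z))"
      by (rule nabla_left2[OF sz _ y gone_SL bounded_linear.has_derivative[OF lin d]]) (simp add: Gam_sl z)
    finally show ?thesis using dy \<xi>(2) by simp
  qed
  have lb: "lie_bracket SL2xSL2 X (lvec y) q = q \<odot> (brk (\<xi> q) y - differential SL2xSL2 \<xi> q (q \<odot> y))"
    if q: "q \<in> SL2xSL2" for q
  proof -
    obtain \<delta> where \<delta>: "(\<xi> has_derivative \<delta>) (at q within SL2xSL2)"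
      using smooth_fun_has_derivative[OF \<xi>(1) q] by blast
    have "((\<lambda>p. p \<odot> \<xi> p) has_derivative (\<lambda>v. q \<odot> \<delta> v + v \<odot> \<xi> q)) (at q within SL2xSL2)"
      by (rule bounded_bilinear.FDERIV[OF bounded_bilinear_gmult has_derivative_ident \<delta>])
    then have "(X has_derivative (\<lambda>v. q \<odot> \<delta> v + v \<odot> \<xi> q)) (at q within SL2xSL2)"
      by (rule has_derivative_within_cong[OF _ q]) (simp add: X\<xi>)
    then show ?thesis
      using q y \<xi>(2)[OF q] \<delta>
      by (simp add: lie_bracket_def differential_eq gmult_tangent differential_lvec X\<xi> brk_def
          gmult_diff_right gmult_assoc)
  qed
  have sd: "smooth_fun SL2xSL2 (\<lambda>q. brk (\<xi> q) y - differential SL2xSL2 \<xi> q (q \<odot> y))"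
    unfolding brk_def diff_conv_add_uminus
    by (intro smooth_fun_add smooth_fun_minus smooth_fun_bilinear[OF bounded_bilinear_gmult]
        smooth_fun_const \<xi> smooth_fun_differential vector_field_lvec y)
  have sds: "brk (\<xi> q) y - differential SL2xSL2 \<xi> q (q \<odot> y) \<in> sl_pair" if q: "q \<in> SL2xSL2" for q
  proof -
    obtain \<delta> where \<delta>: "(\<xi> has_derivative \<delta>) (at q within SL2xSL2)"
      using smooth_fun_has_derivative[OF \<xi>(1) q] by blast
    then show ?thesis
      using has_derivative_sl[OF \<delta> q gmult_tangent[OF q y] \<xi>(2)] q y
      by (simp add: differential_eq gmult_tangent)
  qed
  have vlb: "vector_field SL2xSL2 (\<lambda>q. q \<odot> (brk (\<xi> q) y - differential SL2xSL2 \<xi> q (q \<odot> y)))"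
    by (rule vector_field_left[OF sd sds])
  have "vector_field SL2xSL2 (lie_bracket SL2xSL2 X (lvec y))"
    using vlb lb unfolding vector_field_def
    by (metis (no_types, lifting) smooth_fun_cong)
  then have "nabla (lie_bracket SL2xSL2 X (lvec y)) (lvec z) gone =
      nabla (\<lambda>q. q \<odot> (brk (\<xi> q) y - differential SL2xSL2 \<xi> q (q \<odot> y))) (lvec z) gone"
    by (rule nabla_cong[OF _ vlb]) (auto simp: lb z vector_field_lvec)
  also have "\<dots> = Gam (brk (\<xi> gone) y - \<xi>' y) z"
    using nabla_left1[OF sd sds z gone_SL] differential_eq[OF d] y by (simp add: tangent_space_gone)
  also have "\<dots> = Gam (brk (\<xi> gone) y) z - Gam (\<xi>' y) z"
    using linear_diff[OF linear_Gam_proj[OF z], of "brk (\<xi> gone) y" "\<xi>' y"] dy by simp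
  finally show ?thesis
    unfolding curvature_def Rie_def g0 by (simp add: 1 2)
qed

lemma ricci_gone:
  assumes y: "y \<in> sl_pair" and z: "z \<in> sl_pair"
  shows "ricci SL2xSL2 nabla (lvec y) (lvec z) gone = trace_on sl_pair (\<lambda>u. Rie u y z)"
proof -
  have *: "curvature SL2xSL2 nabla (extension_field SL2xSL2 gone u) (lvec y) (lvec z) gone = Rie u y z"
    if "u \<in> sl_pair" for u
  proof -
    have "vector_field SL2xSL2 (lvec u) \<and> lvec u gone = u"
      using that by (simp add: vector_field_lvec)
    then have "vector_field SL2xSL2 (extension_field SL2xSL2 gone u) \<and> extension_field SL2xSL2 gone u gone = u"
      
      unfolding extension_field_def
      using someI[of "\<lambda>X. vector_field SL2xSL2 X \<and> X gone = u" "lvec u"] by blast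
    then show ?thesis using curvature_gone[OF _ y z] by metis
  qed
  obtain B0 where "independent B0" "span B0 = sl_pair"
    using basis_exists[of sl_pair] span_subspace subspace_sl_pair by metis
  define B where "B = (SOME B. independent B \<and> span B = sl_pair)"
  have "span B = sl_pair" "independent B"
    unfolding B_def by (rule someI2[of _ B0]; use \<open>independent B0\<close> \<open>span B0 = sl_pair\<close> in simp)+
  then have "b \<in> sl_pair" if "b \<in> B" for b
    using that span_superset by blast
  then show ?thesis
    unfolding ricci_def trace_on_def tangent_space_gone Let_def B_def[symmetric]
    by (intro sum.cong refl) (simp add: *)
qed

end

section \<open>The Ricci form of a left-invariant metric\<close>

type_synonym vec3 = "real^3"
type_synonym mat3 = "real^3^3"

unbundle cross3_syntax

text \<open>In the basis \<open>E\<^sub>i / 2\<close> the bracket of \<open>sl(2,\<real>)\<close> is \<open>D (x \<times> y)\<close> and its Killing form is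
  \<open>-2 D\<close>, where \<open>D = diag(1, -1, -1)\<close>.\<close>

definition dd :: "vec3 \<Rightarrow> vec3" where "dd x = vector [x$1, - x$2, - x$3]"

definition Dm :: mat3 where "Dm = vector [vector [1, 0, 0], vector [0, -1, 0], vector [0, 0, -1]]"

definition br3 :: "vec3 \<Rightarrow> vec3 \<Rightarrow> vec3" where "br3 x y = dd (x \<times> y)"

definition brV :: "vec3 \<times> vec3 \<Rightarrow> vec3 \<times> vec3 \<Rightarrow> vec3 \<times> vec3" where
  "brV X Y = (br3 (fst X) (fst Y), br3 (snd X) (snd Y))"

text \<open>The cofactor matrix, characterised by \<open>cross_cof\<close>; as a polynomial in the
  entries it is available for singular matrices too.\<close>

definition cofm :: "mat3 \<Rightarrow> mat3" where
  "cofm A = vector [vector [A$2$2 * A$3$3 - A$2$3 * A$3$2, A$2$3 * A$3$1 - A$2$1 * A$3$3, A$2$1 * A$3$2 - A$2$2 * A$3$1],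
     vector [A$3$2 * A$1$3 - A$3$3 * A$1$2, A$3$3 * A$1$1 - A$3$1 * A$1$3, A$3$1 * A$1$2 - A$3$2 * A$1$1],
     vector [A$1$2 * A$2$3 - A$1$3 * A$2$2, A$1$3 * A$2$1 - A$1$1 * A$2$3, A$1$1 * A$2$2 - A$1$2 * A$2$1]]"

text \<open>The polarisation of \<open>2 cof\<close>.\<close>

definition dia :: "mat3 \<Rightarrow> mat3 \<Rightarrow> mat3" where
  "dia A B = vector [vector [A$2$2 * B$3$3 + B$2$2 * A$3$3 - A$2$3 * B$3$2 - B$2$3 * A$3$2, A$2$3 * B$3$1 + B$2$3 * A$3$1 - A$2$1 * B$3$3 - B$2$1 * A$3$3, A$2$1 * B$3$2 + B$2$1 * A$3$2 - A$2$2 * B$3$1 - B$2$2 * A$3$1],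
     vector [A$3$2 * B$1$3 + B$3$2 * A$1$3 - A$3$3 * B$1$2 - B$3$3 * A$1$2, A$3$3 * B$1$1 + B$3$3 * A$1$1 - A$3$1 * B$1$3 - B$3$1 * A$1$3, A$3$1 * B$1$2 + B$3$1 * A$1$2 - A$3$2 * B$1$1 - B$3$2 * A$1$1],
     vector [A$1$2 * B$2$3 + B$1$2 * A$2$3 - A$1$3 * B$2$2 - B$1$3 * A$2$2, A$1$3 * B$2$1 + B$1$3 * A$2$1 - A$1$1 * B$2$3 - B$1$1 * A$2$3, A$1$1 * B$2$2 + B$1$1 * A$2$2 - A$1$2 * B$2$1 - B$1$2 * A$2$1]]"

text \<open>Conjugation by the involution \<open>Dm\<close>, which absorbs the \<open>dd\<close> of
  the bracket when products of brackets are rewritten with cross products.\<close>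

definition cD :: "mat3 \<Rightarrow> mat3" where "cD A = Dm ** A ** Dm"

lemmas v3 = vec_eq_iff forall_3 sum_3 inner_vec_def matrix_vector_mult_def matrix_matrix_mult_def
  transpose_def dd_def br3_def cross3_def Dm_def

section \<open>Traces and the Ricci contraction\<close>

definition tr :: "('a::euclidean_space \<Rightarrow> 'a) \<Rightarrow> real" where
  "tr f = (\<Sum>i\<in>Basis. f i \<bullet> i)"

lemma tr_add: "tr (\<lambda>x. f x + g x) = tr f + tr g"
  by (simp add: tr_def inner_add_left sum.distrib)

lemma tr_diff: "tr (\<lambda>x. f x - g x) = tr f - tr g"
  by (simp add: tr_def inner_diff_left sum_subtractf)

lemma tr_scale: "tr (\<lambda>x. c *\<^sub>R f x) = c * tr f"
  by (simp add: tr_def sum_distrib_left)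

lemma tr_compose:
  assumes "linear f" "linear g"
  shows "tr (\<lambda>x. f (g x)) = (\<Sum>i\<in>Basis. \<Sum>j\<in>Basis. (g i \<bullet> j) * (f j \<bullet> i))"
proof -
  have "f (g i) = (\<Sum>j\<in>Basis. (g i \<bullet> j) *\<^sub>R f j)" for i
    using linear_sum[OF assms(1), of "\<lambda>j. (g i \<bullet> j) *\<^sub>R j" Basis] linear_scale[OF assms(1)]
    by (simp add: euclidean_representation)
  then show ?thesis by (simp add: tr_def inner_sum_left)
qed

lemma tr_commute:
  assumes "linear f" "linear g"
  shows "tr (\<lambda>x. f (g x)) = tr (\<lambda>x. g (f x))"
  unfolding tr_compose[OF assms] tr_compose[OF assms(2,1)]
  by (subst sum.swap) (simp add: mult.commute)

text \<open>\<open>g\<close> is the adjoint of \<open>f\<close> for the form \<open>B\<close>: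
  conjugation by \<open>B\<close> turns \<open>f\<close> into the transpose of \<open>g\<close>, and
  both operations preserve the trace.\<close>

lemma tr_adjoint:
  fixes f g B H :: "'a::euclidean_space \<Rightarrow> 'a"
  assumes "linear f" "linear g" "linear B" "linear H" and HB: "\<And>x. H (B x) = x" "\<And>x. B (H x) = x"
    and sym: "\<And>x y. B x \<bullet> y = x \<bullet> B y" and adj: "\<And>x y. B (f x) \<bullet> y = B x \<bullet> g y"
  shows "tr f = tr g"
proof -
  have "tr f = tr (\<lambda>x. H (B (f x)))" by (simp add: HB)
  also have "\<dots> = tr (\<lambda>x. B (f (H x)))"
    using assms tr_commute[of H "\<lambda>x. B (f x)"] linear_compose[of f B] by (simp add: o_def)
  also have "\<dots> = tr g"
    unfolding tr_def
  proof (rule sum.cong[OF refl])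
    fix i show "B (f (H i)) \<bullet> i = g i \<bullet> i"
      using adj[of "H i" i] HB(2) by (metis inner_commute)
  qed
  finally show ?thesis .
qed

text \<open>With \<open>\<gamma>\<^sub>y x = G x y\<close> the contraction of the curvature is \<open>- tr (\<gamma>\<^sub>y \<gamma>\<^sub>z)\<close>, because
  \<open>tr \<gamma>\<^sub>w = 0\<close> for unimodular brackets; and \<open>2 \<gamma>\<^sub>y\<close> is minus the sum of the self-adjoint operator
  \<open>ad\<^sub>y + A\<^sub>y\<close> and the skew operator \<open>S\<^sub>y\<close>.\<close>

lemma ricci_trace:
  fixes G br A S :: "'a::euclidean_space \<Rightarrow> 'a \<Rightarrow> 'a" and B H :: "'a \<Rightarrow> 'a"
  assumes G: "bilinear G" and br: "bilinear br" and A: "bilinear A" and S: "bilinear S"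
    and B: "linear B" and H: "linear H" and HB: "\<And>x. H (B x) = x" "\<And>x. B (H x) = x"
    and sym: "\<And>x y. B x \<bullet> y = x \<bullet> B y"
    and anti: "\<And>x y. br x y = - br y x" and uni: "\<And>w. tr (br w) = 0"
    and tor: "\<And>x y. G x y - G y x = br x y"
    and met: "\<And>x y z. B (G x y) \<bullet> z + B y \<bullet> G x z = 0"
    and Adef: "\<And>z x w. B (A z x) \<bullet> w = B x \<bullet> br z w"
    and Sdef: "\<And>y x w. B (S y x) \<bullet> w = B y \<bullet> br x w"
  shows "tr (\<lambda>x. G x (G y z) - G y (G x z) - G (br x y) z) =
    - (1/2) * tr (\<lambda>x. br y (br z x)) - (1/2) * tr (\<lambda>x. br y (A z x)) - (1/4) * tr (\<lambda>x. S y (S z x))"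
proof -
  have l: "linear (f x)" "linear (\<lambda>x. f x y)" if "bilinear f" for f :: "'a \<Rightarrow> 'a \<Rightarrow> 'a" and x y
    using that by (auto simp: bilinear_def)
  note lin = l[OF G] l[OF br] l[OF A] l[OF S]
  have lc: "linear (\<lambda>x. f (g x))" if "linear f" "linear g" for f g :: "'a \<Rightarrow> 'a"
    using linear_compose[OF that(2,1)] by (simp add: o_def)
  have Binj: "x = y" if "\<And>w. B x \<bullet> w = B y \<bullet> w" for x y
    using that HB(1) by (metis vector_eq_rdot)
  have Bs: "B x \<bullet> y = B y \<bullet> x" for x y using sym inner_commute by metis
  \<comment> \<open>The Koszul formula; \<open>A\<close> and \<open>S\<close> carry the two terms in
    which the last argument stands inside a bracket.\<close>
  have kos: "2 *\<^sub>R G x y = - (br y x + A y x + S y x)" for x y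
  proof (rule Binj)
    fix w
    have "B (G a b) \<bullet> c + B (G a c) \<bullet> b = 0" for a b c using met Bs by metis
    note m = this[of x y w] this[of y x w] this[of w x y]
    have t: "B (G a b) \<bullet> c = B (G b a) \<bullet> c + B (br a b) \<bullet> c" for a b c
      using tor[of a b] linear_add[OF B] by (metis add.commute diff_add_cancel inner_add_left)
    have s: "B x \<bullet> br y w = B (br y w) \<bullet> x" "B y \<bullet> br x w = B (br x w) \<bullet> y" by (rule Bs)+
    have "2 * (B (G x y) \<bullet> w) = - (B (br y x) \<bullet> w + B x \<bullet> br y w + B y \<bullet> br x w)"
      using m t[of y w x] t[of x w y] t[of x y w] anti[of x y] unfolding s by (simp add: linear_neg[OF B])
    then show "B (2 *\<^sub>R G x y) \<bullet> w = B (- (br y x + A y x + S y x)) \<bullet> w"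
      by (simp add: linear_scale[OF B] linear_neg[OF B] linear_add[OF B] linear_diff[OF B]
          inner_add_left inner_diff_left Adef Sdef)
  qed
  have adA: "B (br z x) \<bullet> w = B x \<bullet> A z w" "B (A z x) \<bullet> w = B x \<bullet> br z w" for z x w
    using Adef Bs by metis+
  have skew: "B (S y x) \<bullet> w = B x \<bullet> (- S y w)" for y x w
    using Sdef anti Bs by (metis inner_minus_right)
  note adj = tr_adjoint[OF _ _ B H HB sym]
  have trS: "tr (S w) = 0" for w
  proof -
    have "tr (S w) = tr (\<lambda>x. - S w x)"
      by (rule adj) (auto simp: skew lin intro: linear_compose_neg)
    then show ?thesis using tr_scale[of "-1" "S w"] by simp
  qed
  have trA: "tr (A w) = 0" for w
    using adj[OF lin(5) lin(3), of w w] adA uni by simp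
  have g0: "tr (\<lambda>x. G x w) = 0" for w
  proof -
    have "2 * tr (\<lambda>x. G x w) = tr (\<lambda>x. 2 *\<^sub>R G x w)" by (simp only: tr_scale)
    also have "\<dots> = tr (\<lambda>x. (-1) *\<^sub>R (br w x + A w x + S w x))" by (simp add: kos)
    also have "\<dots> = 0" unfolding tr_scale tr_add using trS trA uni by simp
    finally show ?thesis by simp
  qed
  have R: "G x (G y z) - G y (G x z) - G (br x y) z = G x (G y z) - (G y (G x z) + G (br x y) z)" for x
    by simp
  \<comment> \<open>By cyclicity \<open>G y (G x z)\<close> has the same trace as
    \<open>G (G y x) z\<close>, which is one half of \<open>G (br x y) z\<close>; only the trace of
    \<open>G (G x y) z\<close> survives.\<close>
  have "tr (\<lambda>x. G y (G x z)) + tr (\<lambda>x. G (br x y) z) = tr (\<lambda>x. G (G x y) z)"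
  proof -
    have "tr (\<lambda>x. G y (G x z)) = tr (\<lambda>x. G (G y x) z)"
      by (rule tr_commute) (rule lin)+
    moreover have "G (br x y) z = G (G x y) z - G (G y x) z" for x
      unfolding tor[symmetric] using linear_diff[OF lin(2)] by metis
    ultimately show ?thesis by (simp add: tr_diff)
  qed
  then have "tr (\<lambda>x. G x (G y z) - G y (G x z) - G (br x y) z) = - tr (\<lambda>x. G (G x y) z)"
    by (simp add: R tr_diff tr_add g0)
  also have "\<dots> = - (1/4) * tr (\<lambda>x. (br z (br y x) + br z (A y x) + A z (br y x) + A z (A y x))
      + ((br z (S y x) + A z (S y x)) + (S z (br y x) + S z (A y x))) + S z (S y x))"
  proof -
    have "4 *\<^sub>R G (G x y) z = (br z (br y x) + br z (A y x) + A z (br y x) + A z (A y x))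
      + ((br z (S y x) + A z (S y x)) + (S z (br y x) + S z (A y x))) + S z (S y x)" for x
    proof -
      have "4 *\<^sub>R G (G x y) z = 2 *\<^sub>R G (2 *\<^sub>R G x y) z"
        by (simp add: linear_scale[OF lin(2)])
      also have "\<dots> = br z w + A z w + S z w" if w: "w = br y x + A y x + S y x" for w
        unfolding kos unfolding w[symmetric]
        by (simp add: linear_neg[OF lin(3)] linear_neg[OF lin(5)] linear_neg[OF lin(7)])
      finally show ?thesis by (simp add: linear_add[OF lin(3)] linear_add[OF lin(5)] linear_add[OF lin(7)])
    qed
    then have "tr (\<lambda>x. 4 *\<^sub>R G (G x y) z) = tr (\<lambda>x. (br z (br y x) + br z (A y x) + A z (br y x) + A z (A y x))
      + ((br z (S y x) + A z (S y x)) + (S z (br y x) + S z (A y x))) + S z (S y x))" by simp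
    then show ?thesis unfolding tr_scale by linarith
  qed
  also have "tr (\<lambda>x. (br z (br y x) + br z (A y x) + A z (br y x) + A z (A y x))
      + ((br z (S y x) + A z (S y x)) + (S z (br y x) + S z (A y x))) + S z (S y x)) =
      2 * tr (\<lambda>x. br y (br z x)) + 2 * tr (\<lambda>x. br y (A z x)) + tr (\<lambda>x. S y (S z x))"
  proof -
    have 1: "tr (\<lambda>x. br z (br y x)) = tr (\<lambda>x. br y (br z x))" "tr (\<lambda>x. S z (S y x)) = tr (\<lambda>x. S y (S z x))"
      "tr (\<lambda>x. A z (br y x)) = tr (\<lambda>x. br y (A z x))"
      by (rule tr_commute; rule lin)+
    have 2: "tr (\<lambda>x. br z (A y x)) = tr (\<lambda>x. br y (A z x))"
      by (rule adj[OF lc[OF lin(3) lin(5)] lc[OF lin(3) lin(5)]]) (simp add: adA)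
    have 3: "tr (\<lambda>x. A z (A y x)) = tr (\<lambda>x. br y (br z x))"
      by (rule adj[OF lc[OF lin(5) lin(5)] lc[OF lin(3) lin(3)]]) (simp add: adA)
    \<comment> \<open>\<open>br a + A a\<close> is self-adjoint and \<open>S c\<close> is skew, so
      the trace of their product equals its own negative.\<close>
    have 4: "tr (\<lambda>x. br a (S c x)) + tr (\<lambda>x. A a (S c x)) = 0" for a c
    proof -
      have "tr (\<lambda>x. br a (S c x) + A a (S c x)) = tr (\<lambda>x. (-1) *\<^sub>R (S c (br a x) + S c (A a x)))"
      proof (rule adj)
        show "linear (\<lambda>x. br a (S c x) + A a (S c x))"
          by (rule linear_compose_add[OF lc[OF lin(3) lin(7)] lc[OF lin(5) lin(7)]])
        show "linear (\<lambda>x. (-1) *\<^sub>R (S c (br a x) + S c (A a x)))"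
          by (rule linear_compose_scale_right[OF
              linear_compose_add[OF lc[OF lin(7) lin(3)] lc[OF lin(7) lin(5)]]])
        show "B (br a (S c x) + A a (S c x)) \<bullet> w = B x \<bullet> ((-1) *\<^sub>R (S c (br a w) + S c (A a w)))" for x w
          by (simp add: linear_add[OF B] inner_add_left adA skew inner_diff_right)
      qed
      then show ?thesis unfolding tr_scale tr_add
        using tr_commute[OF lin(7) lin(3), of c a] tr_commute[OF lin(7) lin(5), of c a] by simp
    qed
    have 5: "tr (\<lambda>x. S z (br y x)) + tr (\<lambda>x. S z (A y x)) = 0"
      using 4[of y z] tr_commute[OF lin(7) lin(3), of z y] tr_commute[OF lin(7) lin(5), of z y] by simp
    show ?thesis
      unfolding tr_add using 1 2 3 4[of z y] 5 by simp
  qed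
  finally show ?thesis by (simp add: field_simps)
qed

section \<open>The Ricci form in 3 by 3 blocks\<close>

definition bop :: "mat3 \<Rightarrow> mat3 \<Rightarrow> mat3 \<Rightarrow> vec3 \<times> vec3 \<Rightarrow> vec3 \<times> vec3" where
  "bop P K S v = (P *v fst v + K *v snd v, transpose K *v fst v + S *v snd v)"

lemma linear_bop: "linear (bop P K S)"
  by (rule linearI) (simp_all add: bop_def matrix_vector_right_distrib matrix_vector_mult_scaleR algebra_simps)

lemma bop_sym:
  assumes "transpose P = P" "transpose S = S"
  shows "bop P K S v \<bullet> w = v \<bullet> bop P K S w"
proof -
  have P: "P $ i $ j = P $ j $ i" "S $ i $ j = S $ j $ i" for i j
    using assms by (simp_all add: transpose_def vec_eq_iff)
  show ?thesis
    by (simp add: bop_def inner_prod_def v3 P[of 2 1] P[of 3 1] P[of 3 2] algebra_simps)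
qed

lemma linear_dd: "linear dd"
  by (rule linearI) (simp_all add: v3)

lemma dd_dd [simp]: "dd (dd x) = x"
  by (simp add: v3)

lemma dd_inner: "dd x \<bullet> y = x \<bullet> dd y"
  by (simp add: v3)

lemma Dm_mult: "Dm *v x = dd x"
  by (simp add: v3)

lemma bilinear_br3: "bilinear br3"
  unfolding bilinear_def by (auto intro!: linearI simp: v3 algebra_simps)

lemma bilinear_brV: "bilinear brV"
  unfolding bilinear_def by (auto intro!: linearI simp: brV_def prod_eq_iff v3 algebra_simps)

lemma brV_anti: "brV x y = - brV y x"
  by (simp add: brV_def prod_eq_iff v3)

lemma brV_self [simp]: "brV x x = 0"
  by (simp add: brV_def prod_eq_iff v3)

lemma tr_vec3: "tr f = f (axis 1 1) $ 1 + f (axis 2 1) $ 2 + f (axis 3 1) $ (3::3)"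
  for f :: "vec3 \<Rightarrow> vec3"
proof -
  have B: "(Basis :: vec3 set) = (\<lambda>i. axis i 1) ` UNIV"
    by (auto simp: Basis_vec_def)
  have "inj (\<lambda>i. axis i (1::real) :: vec3)"
    by (auto simp: inj_on_def axis_eq_axis)
  then show ?thesis
    unfolding tr_def B by (simp add: sum.reindex sum_3 inner_axis)
qed

lemma tr_pair: "tr f = tr (\<lambda>x. fst (f (x, 0))) + tr (\<lambda>u. snd (f (0, u)))"
  for f :: "vec3 \<times> vec3 \<Rightarrow> vec3 \<times> vec3"
proof -
  have 1: "inj_on (\<lambda>x::vec3. (x, 0::vec3)) Basis" "inj_on (\<lambda>u::vec3. (0::vec3, u)) Basis"
    by (auto simp: inj_on_def)
  have "(\<lambda>x::vec3. (x, 0::vec3)) ` Basis \<inter> (\<lambda>u::vec3. (0::vec3, u)) ` Basis = {}"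
    using nonzero_Basis by auto
  then show ?thesis
    unfolding tr_def Basis_prod_def
    by (simp add: sum.union_disjoint sum.reindex[OF 1(1)] sum.reindex[OF 1(2)] inner_prod_def)
qed

lemma axis3 [simp]:
  "axis i (1::real) $ j = (if i = j then 1 else 0)"
  by (simp add: axis_def)

lemma tr_br_br: "tr (\<lambda>x. br3 y (br3 z x)) = -2 * (y \<bullet> dd z)"
  unfolding tr_vec3 by (simp add: v3 algebra_simps)

lemma tr_br_adj: "tr (\<lambda>x. br3 y (M *v (dd (N *v x) \<times> z))) = y \<bullet> (dia M (cD (transpose N)) *v z)"
  unfolding tr_vec3 by (simp add: v3 dia_def cD_def algebra_simps)

lemma tr_cross_cross: "tr (\<lambda>x. M *v (a \<times> (transpose M *v (c \<times> x)))) = -2 * (c \<bullet> (cofm M *v a))"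
  unfolding tr_vec3 by (simp add: v3 cofm_def algebra_simps)

lemma transpose_cofm: "transpose (cofm M) = cofm (transpose M)"
  by (simp add: v3 cofm_def)

text \<open>The three traces of \<open>ricci_trace\<close> in blocks: the Killing form gives
  \<open>dd\<close>, a bracket composed with an adjoint gives polarised cofactors, and a product of
  skew operators gives cofactors. \<open>X\<close>, \<open>Y\<close>, \<open>Z\<close> are the
  blocks of the inverse metric.\<close>

definition ric_blocks :: "mat3 \<Rightarrow> mat3 \<Rightarrow> mat3 \<Rightarrow> mat3 \<Rightarrow> mat3 \<Rightarrow> mat3 \<Rightarrow> vec3 \<times> vec3 \<Rightarrow> vec3 \<times> vec3 \<Rightarrow> real" where
  "ric_blocks P K S X Y Z y z =
    (let y1 = dd (fst (bop P K S y)); y2 = dd (snd (bop P K S y));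
         z1 = dd (fst (bop P K S z)); z2 = dd (snd (bop P K S z)) in
     fst y \<bullet> dd (fst z) + snd y \<bullet> dd (snd z)
     - (1/2) * (fst y \<bullet> (dia X (cD P) *v fst z) + fst y \<bullet> (dia Y (cD K) *v snd z)
        + snd y \<bullet> (dia (transpose Y) (cD (transpose K)) *v fst z) + snd y \<bullet> (dia Z (cD S) *v snd z))
     + (1/2) * (y1 \<bullet> (cofm X *v z1) + z1 \<bullet> (cofm Y *v y2) + y1 \<bullet> (cofm Y *v z2) + y2 \<bullet> (cofm Z *v z2)))"

lemma cross_inner: "a \<bullet> dd (x \<times> w) = (dd a \<times> x) \<bullet> w" "a \<bullet> dd (z \<times> w) = (dd a \<times> z) \<bullet> w"
  by (simp_all add: v3 algebra_simps)

lemma ricci_blocks: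
  assumes sy: "transpose P = P" "transpose S = S" "transpose X = X" "transpose Z = Z"
    and HB: "\<And>v. bop X Y Z (bop P K S v) = v" "\<And>v. bop P K S (bop X Y Z v) = v"
    and G: "bilinear G"
    and tor: "\<And>x y. G x y - G y x = brV x y"
    and met: "\<And>x y z. bop P K S (G x y) \<bullet> z + bop P K S y \<bullet> G x z = 0"
  shows "tr (\<lambda>x. G x (G y z) - G y (G x z) - G (brV x y) z) = ric_blocks P K S X Y Z y z"
proof -
  define B where "B = bop P K S"
  \<comment> \<open>\<open>A z\<close> is the adjoint of \<open>brV z\<close>, and
    \<open>T y\<close> below is the skew operator called \<open>S\<close> in
    \<open>ricci_trace\<close>, a letter taken here by a block. Both become explicit through the
    inverse metric.\<close>
  define A where "A z x = bop X Y Z (dd (fst (B x)) \<times> fst z, dd (snd (B x)) \<times> snd z)" for z x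
  define T where "T y x = bop X Y Z (dd (fst (B y)) \<times> fst x, dd (snd (B y)) \<times> snd x)" for y x
  have linB: "linear B" unfolding B_def by (rule linear_bop)
  have bi: "bilinear (\<lambda>z x. bop X Y Z (dd (fst (f x)) \<times> fst (g z), dd (snd (f x)) \<times> snd (g z)))"
    if "linear f" "linear g" for f g
    unfolding bilinear_def
    by (auto intro!: linearI simp: linear_add[OF that(1)] linear_scale[OF that(1)] linear_add[OF that(2)]
        linear_scale[OF that(2)] linear_add[OF linear_dd] linear_scale[OF linear_dd] linear_add[OF linear_bop, symmetric]
        linear_scale[OF linear_bop, symmetric] cross_add_left cross_add_right cross_mult_left cross_mult_right)
  have A: "bilinear A" using bi[OF linB linear_id] by (simp add: A_def[abs_def])
  have T: "bilinear T" using bi[OF linB linear_id] unfolding bilinear_def T_def by simp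
  have HB': "bop X Y Z (B v) = v" "B (bop X Y Z v) = v" for v
    using HB by (auto simp: B_def)
  have uni: "tr (brV w) = 0" for w
    unfolding tr_pair tr_vec3 by (simp add: brV_def v3)
  have "tr (\<lambda>x. G x (G y z) - G y (G x z) - G (brV x y) z) =
    - (1/2) * tr (\<lambda>x. brV y (brV z x)) - (1/2) * tr (\<lambda>x. brV y (A z x)) - (1/4) * tr (\<lambda>x. T y (T z x))"
  proof (rule ricci_trace[OF G bilinear_brV A T linB linear_bop HB'])
    show "B (A z x) \<bullet> w = B x \<bullet> brV z w" for z x w
      unfolding A_def HB' by (simp add: inner_prod_def brV_def br3_def cross_inner)
    show "B (T y x) \<bullet> w = B y \<bullet> brV x w" for x y w
      unfolding T_def HB' by (simp add: inner_prod_def brV_def br3_def cross_inner)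
    show "B x \<bullet> y = x \<bullet> B y" for x y
      unfolding B_def by (rule bop_sym[OF sy(1,2)])
    show "brV x y = - brV y x" for x y by (rule brV_anti)
  qed (use uni tor met in \<open>auto simp: B_def\<close>)
  also have "tr (\<lambda>x. brV y (brV z x)) = -2 * (fst y \<bullet> dd (fst z) + snd y \<bullet> dd (snd z))"
    unfolding tr_pair by (simp add: brV_def tr_br_br)
  also have "tr (\<lambda>x. brV y (A z x)) = fst y \<bullet> (dia X (cD P) *v fst z) + fst y \<bullet> (dia Y (cD K) *v snd z)
        + snd y \<bullet> (dia (transpose Y) (cD (transpose K)) *v fst z) + snd y \<bullet> (dia Z (cD S) *v snd z)"
  proof -
    have "br3 a (b + c) = br3 a b + br3 a c" for a b c
      using bilinear_br3 bilinear_radd by blast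
    then show ?thesis
      unfolding tr_pair
      by (simp add: brV_def A_def B_def bop_def tr_add tr_br_adj sy del: transpose_matrix_vector)
  qed
  also have "tr (\<lambda>x. T y (T z x)) = -2 * (dd (fst (B z)) \<bullet> (cofm X *v dd (fst (B y)))
      + dd (fst (B z)) \<bullet> (cofm Y *v dd (snd (B y)))
      + dd (snd (B z)) \<bullet> (cofm (transpose Y) *v dd (fst (B y))) + dd (snd (B z)) \<bullet> (cofm Z *v dd (snd (B y))))"
  proof -
    have 1: "tr (\<lambda>x. X *v (a \<times> (X *v (c \<times> x)))) = -2 * (c \<bullet> (cofm X *v a))"
      "tr (\<lambda>x. Z *v (a \<times> (Z *v (c \<times> x)))) = -2 * (c \<bullet> (cofm Z *v a))" for a c
      using tr_cross_cross[of X a c] tr_cross_cross[of Z a c] by (simp_all add: sy)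
    have 2: "tr (\<lambda>x. transpose Y *v (a \<times> (Y *v (c \<times> x)))) = -2 * (c \<bullet> (cofm (transpose Y) *v a))" for a c
      using tr_cross_cross[of "transpose Y" a c] by simp
    show ?thesis
      unfolding tr_pair
      by (simp add: T_def bop_def tr_add 1 2 tr_cross_cross del: transpose_matrix_vector)
  qed
  finally have R: "tr (\<lambda>x. G x (G y z) - G y (G x z) - G (brV x y) z) =
    - (1/2) * (-2 * (fst y \<bullet> dd (fst z) + snd y \<bullet> dd (snd z)))
    - (1/2) * (fst y \<bullet> (dia X (cD P) *v fst z) + fst y \<bullet> (dia Y (cD K) *v snd z)
        + snd y \<bullet> (dia (transpose Y) (cD (transpose K)) *v fst z) + snd y \<bullet> (dia Z (cD S) *v snd z))
    - (1/4) * (-2 * (dd (fst (B z)) \<bullet> (cofm X *v dd (fst (B y)))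
      + dd (fst (B z)) \<bullet> (cofm Y *v dd (snd (B y)))
      + dd (snd (B z)) \<bullet> (cofm (transpose Y) *v dd (fst (B y))) + dd (snd (B z)) \<bullet> (cofm Z *v dd (snd (B y)))))" .
  show ?thesis
  proof -
    have c: "a \<bullet> (cofm M *v b) = b \<bullet> (cofm (transpose M) *v a)" for a b M
      by (simp add: v3 cofm_def algebra_simps)
    have X: "a \<bullet> (cofm X *v b) = b \<bullet> (cofm X *v a)" and Z: "a \<bullet> (cofm Z *v b) = b \<bullet> (cofm Z *v a)"
      and Y: "a \<bullet> (cofm (transpose Y) *v b) = b \<bullet> (cofm Y *v a)" for a b
      using c[of a X b] c[of a Z b] c[of a "transpose Y" b] by (simp_all add: sy)
    show ?thesis
      unfolding R ric_blocks_def Let_def B_def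
      unfolding X[of "dd (fst (bop P K S z))" "dd (fst (bop P K S y))"]
        Z[of "dd (snd (bop P K S z))" "dd (snd (bop P K S y))"] Y
      by (simp add: field_simps)
  qed
qed

section \<open>Einstein metrics invariant under a subgroup of one factor\<close>

declare transpose_matrix_vector [simp del]

definition outer :: "vec3 \<Rightarrow> vec3 \<Rightarrow> mat3" where "outer a b = (\<chi> i j. a $ i * b $ j)"

lemma outer_mult: "outer a b *v x = (b \<bullet> x) *\<^sub>R a"
  by (simp add: outer_def v3 algebra_simps)

lemma transpose_outer: "transpose (outer a b) = outer b a"
  by (simp add: outer_def transpose_def vec_eq_iff mult.commute)

definition minors2 :: "mat3 \<Rightarrow> real" where
  "minors2 M = M$1$1 * M$2$2 - M$1$2 * M$2$1 + M$1$1 * M$3$3 - M$1$3 * M$3$1 + M$2$2 * M$3$3 - M$2$3 * M$3$2"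

lemma cayley_hamilton3:
  "M ** M ** M = trace M *\<^sub>R (M ** M) - minors2 M *\<^sub>R M + det M *\<^sub>R (mat 1 :: mat3)"
  by (simp add: vec_eq_iff forall_3 sum_3 matrix_matrix_mult_def trace_def det_3 minors2_def mat_def algebra_simps)

lemma trace_square: "trace (M ** M) = (trace M)\<^sup>2 - 2 * minors2 (M::mat3)"
  by (simp add: sum_3 matrix_matrix_mult_def trace_def minors2_def algebra_simps power2_eq_square)

lemma transpose_sym_nth: "transpose P = P \<Longrightarrow> P $ i $ j = (P $ j $ i :: real)"
  by (simp add: transpose_def vec_eq_iff)

lemma matrix_add_rdistrib3: "(A + B) ** C = A ** C + B ** (C :: mat3)"
  by (simp add: v3 algebra_simps)

lemma mult_scaleR_matrix: "(c *\<^sub>R A) ** B = c *\<^sub>R (A ** B)" "A ** (c *\<^sub>R B) = c *\<^sub>R (A ** B)"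
  for A B :: mat3
  by (simp_all add: v3 algebra_simps)

text \<open>Cayley-Hamilton and the quadratic relation together make a multiple of \<open>M\<close>
  scalar. If that multiple is 0, the trace of \<open>M ** M\<close> forces \<open>c = 0\<close> and
  then \<open>det M = 0\<close>; this is where the coefficient \<open>trace M / 2\<close> matters.
  The criterion ends both the three-dimensional Einstein case and the nearly Kaehler case.\<close>

lemma quadratic_scalar:
  fixes M :: mat3
  assumes q: "M ** M = (trace M / 2) *\<^sub>R M + c *\<^sub>R mat 1" and d: "det M \<noteq> 0"
  shows "\<exists>m. M = m *\<^sub>R mat 1"
proof -
  define t e2 where "t = trace M" and "e2 = minors2 M"
  have 1: "M ** M ** M = (t / 2) *\<^sub>R (M ** M) + c *\<^sub>R M"
    by (subst q) (simp add: matrix_add_rdistrib3 mult_scaleR_matrix t_def)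
  have b: "(c - t\<^sup>2 / 4 + e2) *\<^sub>R M = (t * c / 2 + det M) *\<^sub>R mat 1"
  proof -
    have "(c - t\<^sup>2 / 4 + e2) * M $ i $ j = (t * c / 2 + det M) * (mat 1 :: mat3) $ i $ j" for i j
    proof -
      have "t * (M ** M) $ i $ j - e2 * M $ i $ j + det M * (mat 1 :: mat3) $ i $ j =
          t / 2 * (M ** M) $ i $ j + c * M $ i $ j"
        using arg_cong[OF 1[unfolded cayley_hamilton3], of "\<lambda>A. A $ i $ j"] by (simp add: t_def e2_def)
      moreover have "(M ** M) $ i $ j = t / 2 * M $ i $ j + c * (mat 1 :: mat3) $ i $ j"
        using arg_cong[OF q, of "\<lambda>A. A $ i $ j"] by (simp add: t_def)
      ultimately show ?thesis by (simp add: field_simps power2_eq_square)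
    qed
    then show ?thesis by (simp add: vec_eq_iff)
  qed
  show ?thesis
  proof (cases "c - t\<^sup>2 / 4 + e2 = 0")
    case False
    then have "M = ((t * c / 2 + det M) / (c - t\<^sup>2 / 4 + e2)) *\<^sub>R mat 1"
      using arg_cong[OF b, of "\<lambda>x. (1 / (c - t\<^sup>2 / 4 + e2)) *\<^sub>R x"] by simp
    then show ?thesis ..
  next
    case True
    have "trace (M ** M) = t\<^sup>2 / 2 + 3 * c"
      unfolding q t_def by (simp add: trace_def sum_3 mat_def field_simps power2_eq_square)
    then have "c = 0" using True trace_square[of M] by (simp add: t_def e2_def)
    moreover have "t * c / 2 + det M = 0"
      using arg_cong[OF b, of "\<lambda>A. A $ 1 $ 1"] True by (simp add: mat_def)
    ultimately show ?thesis using d by simp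
  qed
qed

definition ein :: "real \<Rightarrow> mat3 \<Rightarrow> mat3 \<Rightarrow> mat3 \<Rightarrow> mat3 \<Rightarrow> mat3 \<Rightarrow> mat3 \<Rightarrow> bool" where
  "ein lam P K S X Y Z \<longleftrightarrow>
     transpose P = P \<and> transpose S = S \<and> transpose X = X \<and> transpose Z = Z \<and>
     (\<forall>v. bop X Y Z (bop P K S v) = v) \<and> (\<forall>v. bop P K S (bop X Y Z v) = v) \<and>
     (\<forall>y z. ric_blocks P K S X Y Z y z = lam * (bop P K S y \<bullet> z))"

lemma bop_swap: "bop S (transpose K) P v = prod.swap (bop P K S (prod.swap v))"
  by (simp add: bop_def add.commute)

text \<open>Interchanging the two factors of the group is a symmetry of the problem; it transfers
  results on the first factor, or on the block \<open>P\<close>, to the second.\<close>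

lemma ein_swap:
  assumes "ein lam P K S X Y Z"
  shows "ein lam S (transpose K) P Z (transpose Y) X"
proof -
  have c: "a \<bullet> (cofm (transpose M) *v b) = b \<bullet> (cofm M *v a)" for a b M
    by (simp add: v3 cofm_def algebra_simps)
  have "ric_blocks S (transpose K) P Z (transpose Y) X y z = ric_blocks P K S X Y Z (prod.swap y) (prod.swap z)"
    for y z
    unfolding ric_blocks_def Let_def bop_swap[of S K P]
    by (simp add: c algebra_simps)
  moreover have "prod.swap a \<bullet> b = a \<bullet> prod.swap b" for a b :: "vec3 \<times> vec3"
    by (simp add: inner_prod_def)
  ultimately show ?thesis
    using assms unfolding ein_def bop_swap[of S K P] bop_swap[of Z Y X] by simp
qed

lemma ein_inverse:
  assumes "ein lam P K S X Y Z"
  shows "P *v (X *v a) + K *v (transpose Y *v a) = a" "transpose K *v (X *v a) + S *v (transpose Y *v a) = 0"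
    "P *v (Y *v u) + K *v (Z *v u) = 0" "transpose K *v (Y *v u) + S *v (Z *v u) = u"
proof -
  have "bop P K S (bop X Y Z (a, 0)) = (a, 0)" "bop P K S (bop X Y Z (0, u)) = (0, u)"
    using assms unfolding ein_def by auto
  then show "P *v (X *v a) + K *v (transpose Y *v a) = a" "transpose K *v (X *v a) + S *v (transpose Y *v a) = 0"
    "P *v (Y *v u) + K *v (Z *v u) = 0" "transpose K *v (Y *v u) + S *v (Z *v u) = u"
    by (simp_all add: bop_def)
qed

lemma ein_blocks:
  assumes "ein lam P K S X Y Z"
  shows "y \<bullet> dd z - (1/2) * (y \<bullet> (dia X (cD P) *v z)) + (1/2) * (dd (P *v y) \<bullet> (cofm X *v dd (P *v z))
      + dd (P *v z) \<bullet> (cofm Y *v dd (transpose K *v y)) + dd (P *v y) \<bullet> (cofm Y *v dd (transpose K *v z))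
      + dd (transpose K *v y) \<bullet> (cofm Z *v dd (transpose K *v z))) = lam * ((P *v y) \<bullet> z)"
    "- (1/2) * (y \<bullet> (dia Y (cD K) *v z)) + (1/2) * (dd (P *v y) \<bullet> (cofm X *v dd (K *v z))
      + dd (K *v z) \<bullet> (cofm Y *v dd (transpose K *v y)) + dd (P *v y) \<bullet> (cofm Y *v dd (S *v z))
      + dd (transpose K *v y) \<bullet> (cofm Z *v dd (S *v z))) = lam * (y \<bullet> (K *v z))"
    "y \<bullet> dd z - (1/2) * (y \<bullet> (dia Z (cD S) *v z)) + (1/2) * (dd (K *v y) \<bullet> (cofm X *v dd (K *v z))
      + dd (K *v z) \<bullet> (cofm Y *v dd (S *v y)) + dd (K *v y) \<bullet> (cofm Y *v dd (S *v z))
      + dd (S *v y) \<bullet> (cofm Z *v dd (S *v z))) = lam * ((S *v y) \<bullet> z)"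
proof -
  have R: "ric_blocks P K S X Y Z y z = lam * (bop P K S y \<bullet> z)" for y z
    using assms unfolding ein_def by blast
  have d0: "dd 0 = 0" by (simp add: v3)
  have t: "(transpose K *v y) \<bullet> z = y \<bullet> (K *v z)" for y z
    by (simp add: v3 algebra_simps)
  show "y \<bullet> dd z - (1/2) * (y \<bullet> (dia X (cD P) *v z)) + (1/2) * (dd (P *v y) \<bullet> (cofm X *v dd (P *v z))
      + dd (P *v z) \<bullet> (cofm Y *v dd (transpose K *v y)) + dd (P *v y) \<bullet> (cofm Y *v dd (transpose K *v z))
      + dd (transpose K *v y) \<bullet> (cofm Z *v dd (transpose K *v z))) = lam * ((P *v y) \<bullet> z)"
    using R[of "(y, 0)" "(z, 0)"] by (simp add: ric_blocks_def Let_def bop_def d0)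
  show "- (1/2) * (y \<bullet> (dia Y (cD K) *v z)) + (1/2) * (dd (P *v y) \<bullet> (cofm X *v dd (K *v z))
      + dd (K *v z) \<bullet> (cofm Y *v dd (transpose K *v y)) + dd (P *v y) \<bullet> (cofm Y *v dd (S *v z))
      + dd (transpose K *v y) \<bullet> (cofm Z *v dd (S *v z))) = lam * (y \<bullet> (K *v z))"
    using R[of "(y, 0)" "(0, z)"] by (simp add: ric_blocks_def Let_def bop_def d0 t)
  show "y \<bullet> dd z - (1/2) * (y \<bullet> (dia Z (cD S) *v z)) + (1/2) * (dd (K *v y) \<bullet> (cofm X *v dd (K *v z))
      + dd (K *v z) \<bullet> (cofm Y *v dd (S *v y)) + dd (K *v y) \<bullet> (cofm Y *v dd (S *v z))
      + dd (S *v y) \<bullet> (cofm Z *v dd (S *v z))) = lam * ((S *v y) \<bullet> z)"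
    using R[of "(0, y)" "(0, z)"] by (simp add: ric_blocks_def Let_def bop_def d0)
qed

text \<open>The invariant symmetric forms are spanned by the Killing form, here \<open>Dm\<close>,
  and the square of the linear form dual to \<open>e\<close>. With \<open>e $ 3 = 0\<close> five
  evaluations suffice, whatever the sign of \<open>e \<bullet> dd e\<close>.\<close>

lemma invariant_form3:
  assumes P: "transpose P = P" and e: "e \<noteq> 0" "e $ 3 = 0" and inv: "\<And>x. x \<bullet> (P *v br3 e x) = 0"
  shows "\<exists>p s. P = p *\<^sub>R Dm + s *\<^sub>R outer (dd e) (dd e)"
proof -
  define e1 e2 where "e1 = e $ 1" and "e2 = e $ 2"
  have sy: "P$2$1 = P$1$2" "P$3$1 = P$1$3" "P$3$2 = P$2$3"
    by (rule transpose_sym_nth[OF P])+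
  have "e2 * P$1$3 = 0" "e1 * P$2$3 = 0" "e2 * P$1$3 + e2 * P$2$3 = e1 * P$1$3 + e1 * P$2$3"
     "e1 * P$1$2 + (e2 * P$1$1 + (e1 * P$2$3 + (e2 * P$3$3 + 2 * (e2 * P$1$3)))) = 0"
     "e1 * P$2$2 + (e2 * P$1$2 + e2 * P$1$3) = e1 * P$3$3"
    using inv[of "vector [1, 0, 0]"] inv[of "vector [0, 1, 0]"]
      inv[of "vector [1, 1, 0]"] inv[of "vector [1, 0, 1]"] inv[of "vector [0, 1, 1]"] e(2)
    by (simp_all add: v3 sy e1_def e2_def algebra_simps del: mult_eq_0_iff)
  then have eq: "P$1$3 * e2 = 0" "P$2$3 * e1 = 0" "P$1$3 * e1 = P$2$3 * e2"
     "P$1$2 * e1 = - (P$1$1 + P$3$3) * e2" "P$1$2 * e2 = (P$3$3 - P$2$2) * e1"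
    by algebra+
  have ne: "e1 \<noteq> 0 \<or> e2 \<noteq> 0"
    using e by (auto simp: e1_def e2_def vec_eq_iff forall_3)
  have z: "P$1$3 = 0" "P$2$3 = 0" using eq ne by auto
  \<comment> \<open>\<open>s\<close> is read off from a diagonal entry that carries the square of a
    nonzero coordinate of \<open>e\<close>.\<close>
  have "\<exists>s. P$1$1 = - P$3$3 + s * e1 * e1 \<and> P$1$2 = - (s * e1 * e2) \<and> P$2$2 = P$3$3 + s * e2 * e2"
  proof (cases "e1 = 0")
    case True
    then show ?thesis using eq ne by (intro exI[of _ "(P$2$2 - P$3$3) / (e2 * e2)"]) auto
  next
    case False
    define s where "s = (P$1$1 + P$3$3) / (e1 * e1)"
    have s: "s * e1 * e1 = P$1$1 + P$3$3" using False by (simp add: s_def)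
    have "e1 * (P$1$2 + s * e1 * e2) = 0" "e1 * e1 * (P$2$2 - (P$3$3 + s * e2 * e2)) = 0"
      using eq(4,5) s by algebra+
    then have "P$1$2 = - (s * e1 * e2)" "P$2$2 = P$3$3 + s * e2 * e2"
      using False by simp_all
    then show ?thesis using s by (intro exI[of _ s]) simp
  qed
  then obtain s where "P$1$1 = - P$3$3 + s * e1 * e1" "P$1$2 = - (s * e1 * e2)" "P$2$2 = P$3$3 + s * e2 * e2"
    by blast
  then have "P = (- P$3$3) *\<^sub>R Dm + s *\<^sub>R outer (dd e) (dd e)"
    using z e(2) by (simp add: vec_eq_iff forall_3 Dm_def outer_def dd_def sy e1_def e2_def)
  then show ?thesis by blast
qed

text \<open>The brackets \<open>br3 e x\<close> fill the plane orthogonal to \<open>dd e\<close>, so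
  every column of \<open>K\<close> is a multiple of \<open>dd e\<close>; \<open>w\<close> collects
  the factors.\<close>

lemma orthogonal_to_bracket:
  assumes e: "e \<noteq> 0" "e $ 3 = 0" and K: "\<And>x u. br3 e x \<bullet> (K *v u) = 0"
  shows "\<exists>w. K = outer (dd e) w"
proof -
  have ne: "(e$1)\<^sup>2 + (e$2)\<^sup>2 \<noteq> 0"
    using e by (auto simp: vec_eq_iff forall_3 sum_power2_eq_zero_iff)
  define w where "w = (\<chi> j. (e$1 * K$1$j - e$2 * K$2$j) / ((e$1)\<^sup>2 + (e$2)\<^sup>2))"
  have "K $ 1 $ j = e$1 * w$j \<and> K $ 2 $ j = - e$2 * w$j \<and> K $ 3 $ j = 0" for j
  proof -
    have Kj: "K *v axis j 1 = (\<chi> i. K $ i $ j)"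
      by (simp add: matrix_vector_mult_basis column_def)
    have "e$2 * K$1$j + e$1 * K$2$j = 0" "e$1 * K$3$j = 0" "e$2 * K$3$j = 0"
      using K[of "vector [0, 0, 1]" "axis j 1"] K[of "vector [0, 1, 0]" "axis j 1"]
        K[of "vector [1, 0, 0]" "axis j 1"] e(2)
      unfolding Kj by (simp_all add: br3_def dd_def cross3_def inner_vec_def sum_3)
    moreover have "K $ 1 $ j * ((e$1)\<^sup>2 + (e$2)\<^sup>2) = e$1 * (e$1 * K$1$j - e$2 * K$2$j)"
      "K $ 2 $ j * ((e$1)\<^sup>2 + (e$2)\<^sup>2) = - e$2 * (e$1 * K$1$j - e$2 * K$2$j)"
      using calculation(1) by algebra+
    ultimately show ?thesis using ne by (auto simp: w_def field_simps)
  qed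
  then have "K = outer (dd e) w"
    using e(2) by (simp add: vec_eq_iff forall_3 outer_def dd_def)
  then show ?thesis ..
qed

text \<open>Cofactors stay in a pencil of the same kind, with \<open>e\<close> replaced by
  \<open>dd e\<close>. This and the next identity turn the Ricci terms of an invariant metric into
  scalar equations.\<close>

lemma cofm_invariant:
  "cofm (p *\<^sub>R Dm + s *\<^sub>R outer e e) = (p\<^sup>2 + p * s * (e \<bullet> dd e)) *\<^sub>R Dm - (p * s) *\<^sub>R outer (dd e) (dd e)"
  by (simp add: v3 cofm_def outer_def algebra_simps power2_eq_square)

lemma dia_invariant:
  "dia (p *\<^sub>R Dm + s *\<^sub>R outer e e) (cD (q *\<^sub>R Dm + t *\<^sub>R outer (dd e) (dd e))) =
    (2 * p * q + (p * t + q * s) * (e \<bullet> dd e)) *\<^sub>R Dm - (p * t + q * s) *\<^sub>R outer (dd e) (dd e)"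
  by (simp add: v3 dia_def cD_def outer_def algebra_simps)

lemma cofm_outer [simp]: "cofm (outer a b) = 0"
  by (simp add: v3 cofm_def outer_def)

lemma dia_outer: "dia (outer e y) (cD (outer (dd e) w)) = 0"
  by (simp add: v3 dia_def cD_def outer_def)

lemma cofm_inverse: "transpose Z = Z \<Longrightarrow> Z *v (cofm Z *v v) = det Z *\<^sub>R v"
proof -
  assume Z: "transpose Z = Z"
  have "Z$2$1 = Z$1$2" "Z$3$1 = Z$1$3" "Z$3$2 = Z$2$3"
    by (rule transpose_sym_nth[OF Z])+
  then show ?thesis by (simp add: v3 cofm_def det_3 algebra_simps)
qed

lemma Dm_Dm [simp]: "Dm ** Dm = mat 1" "Dm ** (Dm ** A) = A"
  by (simp_all add: v3 mat_def)

lemma matrix_mult_zero3: "A ** (0 :: mat3) = 0"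
  by (simp add: v3)

lemma det_0_kernel:
  fixes Z :: mat3
  assumes "det Z = 0"
  obtains m where "m \<noteq> 0" "Z *v m = 0"
proof -
  have "\<not> invertible Z" using assms invertible_det_nz by blast
  then have "\<nexists>B. B ** Z = mat 1"
    by (simp add: invertible_left_inverse)
  then show ?thesis using that matrix_left_invertible_ker by blast
qed

text \<open>For the endomorphism \<open>M\<close> comparing the metric with \<open>Dm\<close>, the
  Einstein equation is a cubic with constant term \<open>det M\<close>. Cayley-Hamilton removes that
  term, a factor \<open>M\<close> cancels, and \<open>quadratic_scalar\<close> applies.\<close>

lemma einstein_three_dim:
  fixes S Z :: mat3
  assumes sy: "transpose S = S" "transpose Z = Z" and SZ: "\<And>u. S *v (Z *v u) = u"
    and E: "\<And>y z. y \<bullet> dd z - (1/2) * (y \<bullet> (dia Z (cD S) *v z))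
        + (1/2) * (dd (S *v y) \<bullet> (cofm Z *v dd (S *v z))) = lam * ((S *v y) \<bullet> z)"
  shows "\<exists>m. S = m *\<^sub>R Dm \<and> m \<noteq> 0 \<and> 2 * lam * m = 1"
proof -
  define t where "t = det S"
  define M where "M = Dm ** S"
  have S: "S = Dm ** M" by (simp add: M_def)
  have ss: "S$2$1 = S$1$2" "S$3$1 = S$1$3" "S$3$2 = S$2$3"
    by (rule transpose_sym_nth[OF sy(1)])+
  have "S ** Z = mat 1"
    using SZ by (simp add: matrix_eq matrix_vector_mul_assoc[symmetric])
  then have "t * det Z = 1"
    unfolding t_def by (metis det_I det_mul)
  then have t: "t \<noteq> 0" by auto
  have dM: "det M = t"
    by (simp add: t_def M_def det_mul) (simp add: Dm_def det_3)
  have ZS: "Z ** S = mat 1"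
    using \<open>S ** Z = mat 1\<close> matrix_left_right_inverse by metis
  have "Z *v (S *v v) = v" for v
    using ZS by (simp add: matrix_vector_mul_assoc)
  then have "cofm S *v v = t *\<^sub>R (Z *v v)" for v
    using cofm_inverse[OF sy(1), of v] by (metis t_def matrix_vector_mult_scaleR)
  \<comment> \<open>In dimension three the inverse and its cofactors are multiples of
    \<open>cofm S\<close> and \<open>S\<close>, which frees the equation of
    \<open>Z\<close>.\<close>
  then have Z: "t *\<^sub>R Z = cofm S"
    by (simp add: matrix_eq scaleR_matrix_vector_assoc)
  have cZ: "t *\<^sub>R cofm Z = S"
  proof -
    have "cofm (t *\<^sub>R Z) = t\<^sup>2 *\<^sub>R cofm Z"
      by (simp add: v3 cofm_def algebra_simps power2_eq_square)
    moreover have "cofm (cofm S) = t *\<^sub>R S"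
      by (simp add: v3 cofm_def det_3 t_def algebra_simps)
    ultimately have "t *\<^sub>R (t *\<^sub>R cofm Z) = t *\<^sub>R S"
      using Z by (simp add: power2_eq_square)
    then show ?thesis using t by (metis scaleR_left_imp_eq)
  qed
  have dia: "t *\<^sub>R dia Z A = dia (cofm S) A" for A
    unfolding Z[symmetric] by (simp add: v3 dia_def algebra_simps)
  have "t *\<^sub>R Dm - (1/2) *\<^sub>R dia (cofm S) (cD S) + (1/2) *\<^sub>R (S ** Dm ** S ** Dm ** S) = (lam * t) *\<^sub>R S"
    (is "?L = ?R")
  proof -
    have "y \<bullet> (?L *v z) = y \<bullet> (?R *v z)" for y z
    proof -
      have "dd (S *v y) \<bullet> (S *v dd (S *v z)) = y \<bullet> ((S ** Dm ** S ** Dm ** S) *v z)"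
        unfolding matrix_vector_mul_assoc[symmetric] Dm_mult
        by (metis dd_inner dot_lmul_matrix sy(1) transpose_matrix_vector)
      moreover have "(S *v y) \<bullet> z = y \<bullet> (S *v z)"
        by (metis dot_lmul_matrix sy(1) transpose_matrix_vector)
      moreover have "t * (y \<bullet> dd z - (1/2) * (y \<bullet> (dia Z (cD S) *v z))
        + (1/2) * (dd (S *v y) \<bullet> (cofm Z *v dd (S *v z)))) = t * (lam * ((S *v y) \<bullet> z))"
        using E by simp
      then have "t * (y \<bullet> dd z) - (1/2) * (y \<bullet> ((t *\<^sub>R dia Z (cD S)) *v z))
        + (1/2) * (dd (S *v y) \<bullet> ((t *\<^sub>R cofm Z) *v dd (S *v z))) = t * (lam * ((S *v y) \<bullet> z))"
        by (simp add: scaleR_matrix_vector_assoc[symmetric] algebra_simps)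
      ultimately show ?thesis
        unfolding cZ dia
        by (simp add: matrix_vector_mult_add_rdistrib matrix_vector_mult_diff_rdistrib inner_add_right
            inner_diff_right scaleR_matrix_vector_assoc[symmetric] Dm_mult)
    qed
    then show ?thesis
      using vector_eq_ldot by (simp only: matrix_eq) blast
  qed
  then have "Dm ** ?L = Dm ** ?R" by simp
  moreover have "Dm ** dia (cofm S) (cD S) = trace (M ** M) *\<^sub>R M - M ** M ** M"
    by (simp add: v3 dia_def cofm_def cD_def trace_def M_def ss algebra_simps)
  moreover have "Dm ** (S ** Dm ** S ** Dm ** S) = M ** M ** M"
    by (simp add: M_def matrix_mul_assoc)
  moreover have "Dm ** (a *\<^sub>R Dm - b *\<^sub>R A + b *\<^sub>R B) = a *\<^sub>R mat 1 - b *\<^sub>R (Dm ** A) + b *\<^sub>R (Dm ** B)" for a b A B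
    by (simp add: v3 mat_def algebra_simps)
  ultimately have M3': "t *\<^sub>R mat 1 - (1/2) *\<^sub>R (trace (M ** M) *\<^sub>R M - M ** M ** M)
      + (1/2) *\<^sub>R (M ** M ** M) = (lam * t) *\<^sub>R M"
    by (simp only: mult_scaleR_matrix M_def[symmetric])
  have M3: "t *\<^sub>R mat 1 - (trace (M ** M) / 2) *\<^sub>R M + M ** M ** M = (lam * t) *\<^sub>R M"
  proof -
    have "t * (mat 1 :: mat3) $ i $ j - trace (M ** M) / 2 * M $ i $ j + (M ** M ** M) $ i $ j = lam * t * M $ i $ j" for i j
      using arg_cong[OF M3', of "\<lambda>A. A $ i $ j"] by (simp add: field_simps)
    then show ?thesis by (simp add: vec_eq_iff)
  qed
  \<comment> \<open>Cayley-Hamilton rewrites the constant term \<open>t\<close> as a polynomial in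
    \<open>M\<close> divisible by \<open>M\<close>.\<close>
  have "M ** (2 *\<^sub>R (M ** M) - trace M *\<^sub>R M + (minors2 M - trace (M ** M) / 2 - lam * t) *\<^sub>R mat 1) = 0"
  proof -
    have "t * (mat 1 :: mat3) $ i $ j - trace (M ** M) / 2 * M $ i $ j + (M ** M ** M) $ i $ j = lam * t * M $ i $ j" for i j
      using arg_cong[OF M3, of "\<lambda>A. A $ i $ j"] by simp
    moreover have "(M ** M ** M) $ i $ j = trace M * (M ** M) $ i $ j - minors2 M * M $ i $ j + t * (mat 1 :: mat3) $ i $ j" for i j
      using arg_cong[OF cayley_hamilton3[of M], of "\<lambda>A. A $ i $ j"] by (simp add: dM)
    ultimately have "2 * (M ** M ** M) $ i $ j - trace M * (M ** M) $ i $ j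
        + (minors2 M - trace (M ** M) / 2 - lam * t) * M $ i $ j = 0" for i j
      by (smt (verit) left_diff_distrib)
    moreover have "M ** (a *\<^sub>R (M ** M) - b *\<^sub>R M + c *\<^sub>R mat 1) = a *\<^sub>R (M ** M ** M) - b *\<^sub>R (M ** M) + c *\<^sub>R M" for a b c
      by (simp add: v3 mat_def algebra_simps)
    ultimately show ?thesis by (simp add: vec_eq_iff)
  qed
  moreover obtain N where "N ** M = mat 1"
    using dM t invertible_det_nz[of M] unfolding invertible_def by auto
  then have "N ** (M ** A) = A" for A by (simp add: matrix_mul_assoc)
  ultimately have N: "2 *\<^sub>R (M ** M) - trace M *\<^sub>R M + (minors2 M - trace (M ** M) / 2 - lam * t) *\<^sub>R mat 1 = 0"
    using matrix_mult_zero3[of N] by metis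
  have "M ** M = (trace M / 2) *\<^sub>R M + (- (minors2 M - trace (M ** M) / 2 - lam * t) / 2) *\<^sub>R mat 1"
  proof -
    have "(M ** M) $ i $ j = trace M / 2 * M $ i $ j
      + - (minors2 M - trace (M ** M) / 2 - lam * t) / 2 * (mat 1 :: mat3) $ i $ j" for i j
      using arg_cong[OF N, of "\<lambda>A. A $ i $ j"] by (simp add: field_simps)
    then show ?thesis by (simp add: vec_eq_iff)
  qed
  then obtain m where m: "M = m *\<^sub>R mat 1"
    using quadratic_scalar dM t by metis
  have tm: "t = m ^ 3"
    unfolding dM[symmetric] m by (simp add: det_3 mat_def power3_eq_cube)
  then have m0: "m \<noteq> 0" using t by auto
  have "t - trace (M ** M) / 2 * m + m * m * m = lam * t * m"
    using arg_cong[OF M3, of "\<lambda>A. A $ 1 $ 1"]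
    by (simp add: m v3 mat_def)
  moreover have "trace (M ** M) = 3 * (m * m)"
    by (simp add: m trace_def v3 mat_def)
  ultimately have "m ^ 3 * (2 * lam * m) = m ^ 3 * 1"
    unfolding tm by algebra
  then have "2 * lam * m = 1" using m0 by simp
  moreover have "S = m *\<^sub>R Dm" by (simp add: S m mult_scaleR_matrix)
  ultimately show ?thesis using m0 by blast
qed

text \<open>Invariance leaves two scalars and a vector in the blocks that touch the first factor,
  for the metric and for its inverse. Testing the Einstein equation on the axis \<open>k\<close>
  orthogonal to \<open>e\<close> and on \<open>dd e\<close> yields \<open>s = 0\<close>,
  nondegeneracy then yields \<open>w = 0\<close>, and \<open>S\<close> becomes a three-dimensional
  Einstein metric with the same constant.\<close>

lemma einstein_invariant_first_factor:
  assumes E: "ein lam P K S X Y Z" and e: "e \<noteq> 0" "e $ 3 = 0"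
    and inv: "\<And>v w. bop P K S (brV (e, 0) v) \<bullet> w + bop P K S v \<bullet> brV (e, 0) w = 0"
  shows "\<exists>p. p \<noteq> 0 \<and> P = p *\<^sub>R Dm \<and> K = 0 \<and> S = p *\<^sub>R Dm"
proof -
  have sy: "transpose P = P" "transpose S = S" "transpose X = X" "transpose Z = Z"
    and HB: "\<And>v. bop X Y Z (bop P K S v) = v" "\<And>v. bop P K S (bop X Y Z v) = v"
    using E unfolding ein_def by auto
  have b0: "br3 0 x = 0" "br3 x 0 = 0" for x by (simp_all add: v3)
  have adj: "(A *v x) \<bullet> y = x \<bullet> (transpose A *v y)" for A :: mat3 and x y
    by (simp add: v3 algebra_simps)
  note symP = adj[of P, unfolded sy] and symS = adj[of S, unfolded sy] and symZ = adj[of Z, unfolded sy]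
    and symX = adj[of X, unfolded sy]
  \<comment> \<open>The inverse metric is invariant as well, so the same normal forms apply to
    \<open>X\<close> and \<open>Y\<close> after conjugation by \<open>Dm\<close>.\<close>
  have Hinv: "brV (e, 0) (bop X Y Z v) \<bullet> w + v \<bullet> brV (e, 0) (bop X Y Z w) = 0" for v w
    using inv[of "bop X Y Z v" "bop X Y Z w"] bop_sym[OF sy(1,2)] HB by (metis inner_commute)
  obtain p s where P: "P = p *\<^sub>R Dm + s *\<^sub>R outer (dd e) (dd e)"
  proof -
    have "x \<bullet> (P *v br3 e x) = 0" for x
      using inv[of "(x, 0)" "(x, 0)"] symP[of "br3 e x" x]
      by (simp add: bop_def brV_def b0 inner_commute symP)
    then show ?thesis using invariant_form3[OF sy(1) e] that by blast
  qed
  have "br3 e x \<bullet> (K *v u) = 0" for x u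
    using inv[of "(x, 0)" "(0, u)"] adj[of "transpose K" "br3 e x" u] by (simp add: bop_def brV_def b0)
  then obtain w where K: "K = outer (dd e) w" using orthogonal_to_bracket[OF e] by blast
  obtain p' s' where X: "X = p' *\<^sub>R Dm + s' *\<^sub>R outer e e"
  proof -
    have "x \<bullet> (cD X *v br3 e x) = 0" for x
    proof -
      have "br3 e (X *v dd x) \<bullet> dd x = 0"
        using Hinv[of "(dd x, 0)" "(dd x, 0)"] by (simp add: bop_def brV_def b0 inner_commute)
      moreover have "br3 e v \<bullet> dd x = - (v \<bullet> dd (br3 e x))" for v
        by (simp add: v3 algebra_simps)
      ultimately have "(X *v dd x) \<bullet> dd (br3 e x) = 0" by simp
      then show ?thesis
        unfolding cD_def matrix_vector_mul_assoc[symmetric] Dm_mult symX by (simp add: dd_inner)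
    qed
    moreover have "transpose (cD X) = cD X"
      using transpose_sym_nth[OF sy(3)] by (simp add: v3 cD_def algebra_simps)
    ultimately obtain p' s' where "cD X = p' *\<^sub>R Dm + s' *\<^sub>R outer (dd e) (dd e)"
      using invariant_form3[OF _ e] by blast
    then have "cD (cD X) = p' *\<^sub>R Dm + s' *\<^sub>R outer e e"
      by (simp add: v3 cD_def outer_def)
    moreover have "cD (cD X) = X" by (simp add: cD_def v3)
    ultimately show ?thesis using that by simp
  qed
  obtain y where Y: "Y = outer e y"
  proof -
    have "br3 e x \<bullet> (cD Y *v u) = 0" for x u
    proof -
      have "dd x \<bullet> br3 e (Y *v dd u) = 0"
        using Hinv[of "(dd x, 0)" "(0, dd u)"] by (simp add: bop_def brV_def b0)
      moreover have "br3 e x \<bullet> dd v = - (dd x \<bullet> br3 e v)" for v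
        by (simp add: v3 algebra_simps)
      ultimately show ?thesis
        unfolding cD_def matrix_vector_mul_assoc[symmetric] Dm_mult by simp
    qed
    then obtain w where "cD Y = outer (dd e) w"
      using orthogonal_to_bracket[OF e] by blast
    then have "cD (cD Y) = outer e (dd w)"
      by (simp add: v3 cD_def outer_def)
    moreover have "cD (cD Y) = Y" by (simp add: cD_def v3)
    ultimately show ?thesis using that by simp
  qed
  define eps where "eps = e \<bullet> dd e"
  define a where "a = p + s * eps"
  define n where "n = dd (cofm Z *v dd w)"
  define W where "W = w \<bullet> n"
  \<comment> \<open>Both \<open>e\<close> and \<open>dd e\<close> are orthogonal to the third axis,
    so on it only the coefficients of \<open>Dm\<close> are visible.\<close>
  define k :: vec3 where "k = vector [0, 0, 1]"
  have Pv: "P *v v = p *\<^sub>R dd v + (s * (dd e \<bullet> v)) *\<^sub>R dd e" for v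
    unfolding P by (simp add: matrix_vector_mult_add_rdistrib scaleR_matrix_vector_assoc[symmetric] Dm_mult outer_mult)
  have Kv: "K *v u = (w \<bullet> u) *\<^sub>R dd e" "transpose K *v v = (dd e \<bullet> v) *\<^sub>R w" for u v
    unfolding K transpose_outer by (simp_all add: outer_mult)
  have Xv: "X *v v = p' *\<^sub>R dd v + (s' * (e \<bullet> v)) *\<^sub>R e" for v
    unfolding X by (simp add: matrix_vector_mult_add_rdistrib scaleR_matrix_vector_assoc[symmetric] Dm_mult outer_mult)
  have Yv: "Y *v u = (y \<bullet> u) *\<^sub>R e" "transpose Y *v v = (e \<bullet> v) *\<^sub>R y" for u v
    unfolding Y transpose_outer by (simp_all add: outer_mult)
  have dd: "dd (c *\<^sub>R x) = c *\<^sub>R dd x" "dd (x + z) = dd x + dd z" "dd (- x) = - dd x" "dd 0 = 0" for c x z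
    using linear_dd by (simp_all add: linear_scale linear_add linear_neg linear_0)
  have ek: "dd e \<bullet> k = 0" "e \<bullet> k = 0" "k \<noteq> 0" "k \<bullet> dd k = -1" "dd k = - k" "k \<bullet> k = 1"
    using e(2) by (simp_all add: v3 k_def)
  have ee: "e \<bullet> e \<noteq> 0" "dd e \<bullet> dd e = e \<bullet> e" "dd e \<noteq> 0" "dd e \<bullet> e = eps"
    using e(1) dd_dd[of e] by (auto simp: dd_inner eps_def inner_commute simp del: dd_dd)
      (auto simp: v3)
  note inv' = ein_inverse[OF E, unfolded Kv Yv]
  have pp: "p * p' = 1"
  proof -
    have "(p * p') *\<^sub>R k = 1 *\<^sub>R k"
      using inv'(1)[of k] ek by (simp add: Pv Xv dd)
    then show ?thesis using ek(3) by (simp only: scaleR_cancel_right) simp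
  qed
  have r11: "p * s' + s * p' + s * s' * eps + w \<bullet> y = 0"
  proof -
    have "(p * p') *\<^sub>R e + ((e \<bullet> e) * (p * s' + s * p' + s * s' * eps + w \<bullet> y)) *\<^sub>R dd e = e"
      using inv'(1)[of e] by (simp add: Pv Xv dd inner_add_right ee algebra_simps)
    then show ?thesis using ee pp by simp
  qed
  have r21: "(p' + s' * eps) *\<^sub>R w + S *v y = 0"
  proof -
    have "(e \<bullet> e) *\<^sub>R ((p' + s' * eps) *\<^sub>R w + S *v y) = 0"
      using inv'(2)[of e]
      by (simp add: Xv inner_add_right ee matrix_vector_mult_scaleR algebra_simps)
    then show ?thesis using ee by simp
  qed
  have r12: "a *\<^sub>R y + Z *v w = 0"
  proof -
    have "((a *\<^sub>R y + Z *v w) \<bullet> u) *\<^sub>R dd e = 0" for u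
      using inv'(3)[of u]
      by (simp add: Pv ee a_def inner_add_left symZ matrix_vector_mult_scaleR algebra_simps)
    then have "(a *\<^sub>R y + Z *v w) \<bullet> u = 0" for u using ee by simp
    then show ?thesis by (metis inner_eq_zero_iff)
  qed
  have r22: "((y \<bullet> u) * eps) *\<^sub>R w + S *v (Z *v u) = u" for u
    using inv'(4)[of u] by (simp add: ee)
  have cofX: "cofm X *v v = (p'\<^sup>2 + p' * s' * eps) *\<^sub>R dd v - (p' * s' * (dd e \<bullet> v)) *\<^sub>R dd e" for v
    unfolding X cofm_invariant eps_def
    by (simp add: matrix_vector_mult_diff_rdistrib scaleR_matrix_vector_assoc[symmetric] Dm_mult outer_mult)
  have diaX: "dia X (cD P) *v v = (2 * p' * p + (p' * s + p * s') * eps) *\<^sub>R dd v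
      - ((p' * s + p * s') * (dd e \<bullet> v)) *\<^sub>R dd e" for v
    unfolding X P dia_invariant eps_def
    by (simp add: matrix_vector_mult_diff_rdistrib scaleR_matrix_vector_assoc[symmetric] Dm_mult outer_mult)
  have cofY: "cofm Y = 0" "dia Y (cD K) = 0" unfolding Y K by (simp_all add: dia_outer)
  have WZ: "dd w \<bullet> (cofm Z *v dd w) = W" by (simp add: W_def n_def dd_inner)
  have alpha: "2 * lam * p = 1 - p' * s * eps"
    using ein_blocks(1)[OF E, of k k] pp
    apply (simp add: diaX cofX cofY Pv Kv dd ek inner_diff_right inner_add_right field_simps power2_eq_square)
    by algebra
  have beta: "3 * s * p' + s\<^sup>2 * eps * p'\<^sup>2 + W = 2 * lam * s"
  proof -
    define N where "N = e \<bullet> e"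
    have "eps - ((2 * p' * p + (p' * s + p * s') * eps) * eps - (p' * s + p * s') * N * N) / 2 +
      ((p'\<^sup>2 + p' * s' * eps) * (p * (p * eps + s * N * N) + s * N * (p * N + s * N * eps)) -
       p' * s' * (p * N + s * N * eps) * (p * N + s * N * eps) + N * (N * W)) / 2 =
      lam * (p * eps + s * N * N)"
      using ein_blocks(1)[OF E, of "dd e" "dd e"]
      by (simp add: diaX cofX cofY Pv Kv dd ee inner_diff_right inner_diff_left inner_add_right inner_add_left WZ
         matrix_vector_mult_scaleR N_def[symmetric] eps_def[symmetric])
    then have "N\<^sup>2 * (3 * s * p' + s\<^sup>2 * eps * p'\<^sup>2 + W - 2 * lam * s) = 0"
      using pp alpha by algebra
    then have "(e \<bullet> e)\<^sup>2 * (3 * s * p' + s\<^sup>2 * eps * p'\<^sup>2 + W - 2 * lam * s) = 0"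
      by (simp add: N_def)
    then show ?thesis using ee by simp
  qed
  have cross: "(p'\<^sup>2 * a - 2 * lam) *\<^sub>R w + S *v n = 0"
  proof -
    have "dd w \<bullet> (cofm Z *v dd v) = n \<bullet> v" for v
      using adj[of "cofm Z" "dd w" "dd v"] by (simp add: transpose_cofm sy n_def dd_inner)
    then have "(w \<bullet> u) * ((p'\<^sup>2 + p' * s' * eps) * (p * (e \<bullet> e) + s * (e \<bullet> e) * eps) -
        p' * s' * eps * (p * (e \<bullet> e) + s * (e \<bullet> e) * eps)) + (e \<bullet> e) * (n \<bullet> (S *v u)) =
        lam * ((w \<bullet> u) * (e \<bullet> e)) * 2" for u
      using ein_blocks(2)[OF E, of "dd e" u]
      by (simp add: cofX cofY Pv Kv dd ee inner_diff_right inner_diff_left inner_add_right inner_add_left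
         matrix_vector_mult_scaleR eps_def[symmetric])
    then have "(e \<bullet> e) * ((p'\<^sup>2 * a - 2 * lam) * (w \<bullet> u) + n \<bullet> (S *v u)) = 0" for u
      by (simp add: a_def algebra_simps)
    then have "(e \<bullet> e) * (((p'\<^sup>2 * a - 2 * lam) *\<^sub>R w + S *v n) \<bullet> u) = 0" for u
      by (simp add: inner_add_left symS)
    then have "((p'\<^sup>2 * a - 2 * lam) *\<^sub>R w + S *v n) \<bullet> u = 0" for u
      using ee by simp
    then show ?thesis by (metis inner_eq_zero_iff)
  qed
  \<comment> \<open>Pairing \<open>cross\<close> with \<open>y\<close> and inserting the inverse
    relation \<open>r21\<close> gives a second equation for \<open>W\<close>; \<open>alpha\<close>,
    \<open>beta\<close> and \<open>r11\<close> then eliminate everything except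
    \<open>s\<close>.\<close>
  have "s = 0"
  proof -
    have "y \<bullet> ((p'\<^sup>2 * a - 2 * lam) *\<^sub>R w + S *v n) = 0" unfolding cross by simp
    then have 1: "(p'\<^sup>2 * a - 2 * lam) * (w \<bullet> y) + (S *v y) \<bullet> n = 0"
      by (simp add: inner_add_right symS inner_commute[of y w])
    have "S *v y = - ((p' + s' * eps) *\<^sub>R w)" using r21 by (simp add: eq_neg_iff_add_eq_0 add.commute)
    then have "(p'\<^sup>2 * a - 2 * lam) * (w \<bullet> y) = (p' + s' * eps) * W"
      using 1 by (simp add: W_def)
    then show ?thesis using alpha beta r11 pp unfolding a_def by algebra
  qed
  \<comment> \<open>If \<open>w\<close> were nonzero, \<open>n\<close> would be orthogonal to all
    vectors and \<open>Z\<close> singular, with every kernel vector a multiple of \<open>w\<close>.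
    Then \<open>r12\<close> gives \<open>y = 0\<close>, which contradicts \<open>r22\<close> on the
    kernel.\<close>
  have "w = 0"
  proof (rule ccontr)
    assume w: "w \<noteq> 0"
    have W: "W = 0" using beta \<open>s = 0\<close> by simp
    have "p'\<^sup>2 * a - 2 * lam = 0" using alpha pp \<open>s = 0\<close> unfolding a_def by algebra
    then have "S *v n = 0" using cross by simp
    have "n \<bullet> u = 0" for u
    proof -
      have "n \<bullet> u = n \<bullet> (((y \<bullet> u) * eps) *\<^sub>R w + S *v (Z *v u))" unfolding r22 ..
      also have "\<dots> = 0"
        using W \<open>S *v n = 0\<close> symS[of n "Z *v u"] by (simp add: inner_add_right W_def inner_commute[of n w])
      finally show ?thesis .
    qed
    then have "n = 0" by (metis inner_eq_zero_iff)
    then have "cofm Z *v dd w = 0" unfolding n_def by (metis dd_dd linear_0 linear_dd)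
    then have "det Z *\<^sub>R dd w = 0" using cofm_inverse[OF sy(4), of "dd w"] by simp
    moreover have "dd w \<noteq> 0" using w by (metis dd_dd linear_0 linear_dd)
    ultimately have "det Z = 0" by simp
    then obtain m where m: "m \<noteq> 0" "Z *v m = 0"
      using det_0_kernel by metis
    have "m = ((y \<bullet> m) * eps) *\<^sub>R w" using r22[of m] m by simp
    then have "((y \<bullet> m) * eps) *\<^sub>R (Z *v w) = 0" "(y \<bullet> m) * eps \<noteq> 0"
      using m by (metis matrix_vector_mult_scaleR, force)
    then have "Z *v w = 0" by simp
    then have "y = 0" using r12 \<open>s = 0\<close> pp unfolding a_def by auto
    then show False using \<open>(y \<bullet> m) * eps \<noteq> 0\<close> by simp
  qed
  have K0: "K = 0" by (simp add: K \<open>w = 0\<close> outer_def vec_eq_iff)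
  have Kt: "K *v u = 0" "transpose K *v u = 0" for u by (simp_all add: Kv \<open>w = 0\<close>)
  have "\<exists>m. S = m *\<^sub>R Dm \<and> m \<noteq> 0 \<and> 2 * lam * m = 1"
  proof (rule einstein_three_dim[OF sy(2,4)])
    show "S *v (Z *v u) = u" for u using r22[of u] \<open>w = 0\<close> by simp
    show "y \<bullet> dd z - (1/2) * (y \<bullet> (dia Z (cD S) *v z))
        + (1/2) * (dd (S *v y) \<bullet> (cofm Z *v dd (S *v z))) = lam * ((S *v y) \<bullet> z)" for y z
      using ein_blocks(3)[OF E, of y z] by (simp add: Kt cofY linear_0[OF linear_dd])
  qed
  then obtain m where m: "S = m *\<^sub>R Dm" "2 * lam * m = 1" by blast
  \<comment> \<open>The common Einstein constant forces the same scale on both factors.\<close>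
  have "2 * lam * p = 1" using alpha \<open>s = 0\<close> by simp
  then have "m = p" using m(2) by (metis mult_cancel_left mult_zero_left zero_neq_one)
  then show ?thesis using m K0 P \<open>s = 0\<close> pp by (intro exI[of _ p]) auto
qed

section \<open>Einstein metrics invariant under a diagonal subgroup\<close>

definition crossm :: "vec3 \<Rightarrow> mat3" where
  "crossm e = vector [vector [0, - e$3, e$2], vector [e$3, 0, - e$1], vector [- e$2, e$1, 0]]"

text \<open>The symmetric part is covered by \<open>invariant_form3\<close>. A skew part is a cross
  product with some vector, and invariance makes that vector proportional to
  \<open>e\<close>.\<close>

lemma intertwiner_form:
  assumes e: "e \<noteq> 0" "e $ 3 = 0" and inv: "\<And>a u. br3 e a \<bullet> (K *v u) + a \<bullet> (K *v br3 e u) = 0"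
  shows "\<exists>x y z. K = x *\<^sub>R Dm + y *\<^sub>R crossm e + z *\<^sub>R outer (dd e) (dd e)"
proof -
  define e1 e2 where "e1 = e $ 1" and "e2 = e $ 2"
  have ne: "e1 \<noteq> 0 \<or> e2 \<noteq> 0"
    using e by (auto simp: e1_def e2_def vec_eq_iff forall_3)
  define Q where "Q = (1/2) *\<^sub>R (K + transpose K)"
  have "transpose Q = Q" by (simp add: Q_def transpose_def vec_eq_iff)
  moreover have "u \<bullet> (Q *v br3 e u) = 0" for u
  proof -
    have "2 * (u \<bullet> (Q *v v)) = v \<bullet> (K *v u) + u \<bullet> (K *v v)" for v
      by (simp add: v3 Q_def algebra_simps)
    then show ?thesis using inv[of u u] by (metis mult_eq_0_iff zero_neq_numeral)
  qed
  ultimately obtain x z where Q: "Q = x *\<^sub>R Dm + z *\<^sub>R outer (dd e) (dd e)"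
    using invariant_form3 e by blast
  define a b c d f g where K: "a = K$1$2" "b = K$2$1" "c = K$1$3" "d = K$3$1" "f = K$2$3" "g = K$3$2"
  have "e2 * c + e2 * d = 0" "- (e1 * f) = e1 * g" "e2 * g = e1 * c" "e2 * f = e1 * d"
    "e1 * a + (e2 * K$1$1 + e2 * K$3$3) = 0" "e1 * b + (e2 * K$1$1 + e2 * K$3$3) = 0"
    "e1 * K$2$2 + e2 * b = e1 * K$3$3" "e1 * K$2$2 + e2 * a = e1 * K$3$3"
    using inv[of "axis 1 1" "axis 1 1"] inv[of "axis 2 1" "axis 2 1"] inv[of "axis 1 1" "axis 2 1"]
      inv[of "axis 2 1" "axis 1 1"] inv[of "axis 1 1" "axis 3 1"] inv[of "axis 3 1" "axis 1 1"]
      inv[of "axis 2 1" "axis 3 1"] inv[of "axis 3 1" "axis 2 1"] e(2)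
    by (simp_all add: v3 K e1_def e2_def algebra_simps del: mult_eq_0_iff)
  then have eq: "e1 * (a - b) = 0" "e2 * (a - b) = 0" "e2 * (c + d) = 0" "e1 * (f + g) = 0"
    "e2 * g = e1 * c" "e2 * f = e1 * d"
    by algebra+
  have "a = b" using eq(1,2) ne by auto
  have "\<exists>y. c = y * e2 \<and> d = - (y * e2) \<and> g = y * e1 \<and> f = - (y * e1)"
  proof (cases "e1 = 0")
    case True
    then show ?thesis using eq ne by (intro exI[of _ "c / e2"]) auto
  next
    case False
    then have "f = - g" using eq(4) by auto
    moreover have "c = g / e1 * e2" "d = f / e1 * e2" using eq(5,6) False by (simp_all add: field_simps)
    ultimately show ?thesis using False by (intro exI[of _ "g / e1"]) auto
  qed
  then obtain y where y: "c = y * e2" "d = - (y * e2)" "g = y * e1" "f = - (y * e1)" by blast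
  have "K = Q + y *\<^sub>R crossm e"
    using y \<open>a = b\<close> e(2) by (simp add: vec_eq_iff forall_3 Q_def crossm_def transpose_def K e1_def e2_def)
  then show ?thesis unfolding Q by (intro exI[of _ x] exI[of _ y] exI[of _ z]) simp
qed

text \<open>The suffix \<open>E\<close> marks blocks of the metric, \<open>H\<close> blocks of its
  inverse: forms on the algebra are built from the covector \<open>dd e\<close>, forms on the dual
  from \<open>e\<close> itself.\<close>

definition symE :: "real \<Rightarrow> real \<Rightarrow> vec3 \<Rightarrow> mat3" where
  "symE p s e = p *\<^sub>R Dm + s *\<^sub>R outer (dd e) (dd e)"
definition symH :: "real \<Rightarrow> real \<Rightarrow> vec3 \<Rightarrow> mat3" where
  "symH p s e = p *\<^sub>R Dm + s *\<^sub>R outer e e"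
definition mixE :: "real \<Rightarrow> real \<Rightarrow> real \<Rightarrow> vec3 \<Rightarrow> mat3" where
  "mixE x y z e = x *\<^sub>R Dm + y *\<^sub>R crossm e + z *\<^sub>R outer (dd e) (dd e)"
definition mixH :: "real \<Rightarrow> real \<Rightarrow> real \<Rightarrow> vec3 \<Rightarrow> mat3" where
  "mixH x y z e = x *\<^sub>R Dm + y *\<^sub>R cD (crossm e) + z *\<^sub>R outer e e"

lemmas blk = symE_def symH_def mixE_def mixH_def v3 outer_def crossm_def cofm_def dia_def cD_def

text \<open>This and \<open>ric12\<close> are twice the Ricci blocks, so that no halves
  appear.\<close>

definition ric11 :: "mat3 \<Rightarrow> mat3 \<Rightarrow> mat3 \<Rightarrow> mat3 \<Rightarrow> mat3 \<Rightarrow> vec3 \<Rightarrow> vec3 \<Rightarrow> real" where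
  "ric11 P K X Y Z y z = 2 * (y \<bullet> dd z) - y \<bullet> (dia X (cD P) *v z) + dd (P *v y) \<bullet> (cofm X *v dd (P *v z))
      + dd (P *v z) \<bullet> (cofm Y *v dd (transpose K *v y)) + dd (P *v y) \<bullet> (cofm Y *v dd (transpose K *v z))
      + dd (transpose K *v y) \<bullet> (cofm Z *v dd (transpose K *v z))"

definition ric12 :: "mat3 \<Rightarrow> mat3 \<Rightarrow> mat3 \<Rightarrow> mat3 \<Rightarrow> mat3 \<Rightarrow> mat3 \<Rightarrow> vec3 \<Rightarrow> vec3 \<Rightarrow> real" where
  "ric12 P K S X Y Z y z = - (y \<bullet> (dia Y (cD K) *v z)) + dd (P *v y) \<bullet> (cofm X *v dd (K *v z))
      + dd (K *v z) \<bullet> (cofm Y *v dd (transpose K *v y)) + dd (P *v y) \<bullet> (cofm Y *v dd (S *v z))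
      + dd (transpose K *v y) \<bullet> (cofm Z *v dd (S *v z))"

lemma ein_ric:
  assumes "ein lam P K S X Y Z"
  shows "ric11 P K X Y Z y z = 2 * lam * ((P *v y) \<bullet> z)" "ric12 P K S X Y Z y z = 2 * lam * (y \<bullet> (K *v z))"
  using ein_blocks(1,2)[OF assms, of y z] by (simp_all add: ric11_def ric12_def field_simps)

text \<open>The prefixes \<open>pl\<close>, \<open>g\<close>, \<open>th\<close> stand for the
  coefficients of \<open>Dm\<close>, of the square of \<open>dd e\<close> and of
  \<open>crossm e\<close> in twice the Ricci blocks; 11 is the first diagonal and 12 the mixed
  block. The arguments from \<open>ip\<close> to \<open>iz\<close> are the coefficients of the
  inverse metric. The lemmas on \<open>ric11\<close> and \<open>ric12\<close> below verify these
  values on test vectors.\<close>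

definition pl11 :: "real \<Rightarrow> real \<Rightarrow> real \<Rightarrow> real \<Rightarrow> real \<Rightarrow> real \<Rightarrow> real \<Rightarrow> real \<Rightarrow> real \<Rightarrow> real \<Rightarrow> real \<Rightarrow> real \<Rightarrow> real \<Rightarrow> real" where
  "pl11 eps p s x y z ip is' ir it' ix iy iz = 2 - (p * (ip + eps * is') + (p + eps * s) * ip)
  + (p * p * ip * (ip + eps * is') + 2 * p * (ix + eps * iz) * (x * ix + eps * y * iy)
     + (x * x + eps * y * y) * ir * (ir + eps * it'))"

definition g11 :: "real \<Rightarrow> real \<Rightarrow> real \<Rightarrow> real \<Rightarrow> real \<Rightarrow> real \<Rightarrow> real \<Rightarrow> real \<Rightarrow> real \<Rightarrow> real \<Rightarrow> real \<Rightarrow> real \<Rightarrow> real \<Rightarrow> real" where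
  "g11 eps p s x y z ip is' ir it' ix iy iz = 2 * eps * eps * iy * iy * s * z + eps * ip * ip * s * s - eps * ir * it' * y * y + eps * ir * ir * z * z + 2 * eps * ix * ix * s * z - 2 * eps * iy * iz * p * y + 2 * eps * iy * iy * p * z + 2 * eps * iy * iy * s * x - ip * is' * p * p + 2 * ip * ip * p * s - ir * it' * x * x + 2 * ir * ir * x * z - ir * ir * y * y - 2 * ix * iy * p * y - 2 * ix * iz * p * x + 2 * ix * ix * p * z + 2 * ix * ix * s * x + 2 * iy * iy * p * x + ip * s + is' * p"

definition pl12 :: "real \<Rightarrow> real \<Rightarrow> real \<Rightarrow> real \<Rightarrow> real \<Rightarrow> real \<Rightarrow> real \<Rightarrow> real \<Rightarrow> real \<Rightarrow> real \<Rightarrow> real \<Rightarrow> real \<Rightarrow> real \<Rightarrow> real" where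
  "pl12 eps p r x y z ip is' ir it' ix iy iz = - eps * eps * ix * iz * y * y + 2 * eps * eps * iy * iz * x * y + eps * ip * is' * p * x + eps * ir * it' * r * x + 2 * eps * ix * iy * x * y + eps * ix * iz * p * r + eps * ix * iz * x * x - eps * ix * ix * y * y + ip * ip * p * x + ir * ir * r * x + ix * ix * p * r + ix * ix * x * x - eps * ix * z - eps * iz * x - 2 * ix * x"

definition g12 :: "real \<Rightarrow> real \<Rightarrow> real \<Rightarrow> real \<Rightarrow> real \<Rightarrow> real \<Rightarrow> real \<Rightarrow> real \<Rightarrow> real \<Rightarrow> real \<Rightarrow> real \<Rightarrow> real \<Rightarrow> real \<Rightarrow> real \<Rightarrow> real \<Rightarrow> real" where
  "g12 eps p s r t x y z ip is' ir it' ix iy iz = eps * eps * iy * iy * s * t + eps * eps * iy * iy * z * z + eps * ip * ip * s * z + eps * ir * ir * t * z + eps * ix * iz * y * y + eps * ix * ix * s * t + eps * ix * ix * z * z - 2 * eps * iy * iz * x * y + eps * iy * iy * p * t + eps * iy * iy * r * s + 2 * eps * iy * iy * x * z - ip * is' * p * x + ip * ip * p * z + ip * ip * s * x - ir * it' * r * x + ir * ir * r * z + ir * ir * t * x - 2 * ix * iy * x * y - ix * iz * p * r - ix * iz * x * x + ix * ix * p * t + ix * ix * r * s + 2 * ix * ix * x * z + ix * ix * y * y + iy * iy * p * r + iy * iy * x * x + ix * z - 2 * iy * y + iz * x"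

lemma blocks_ric_plane:
  fixes e1 e2 :: real
  defines "e \<equiv> vector [e1, e2, 0] :: vec3" and "eps \<equiv> e1 * e1 - e2 * e2"
  shows "ric11 (symE p s e) (mixE x y z e) (symH ip is' e) (mixH ix iy iz e) (symH ir it' e) (vector [0, 0, 1]) (vector [0, 0, 1])
    = - pl11 eps p s x y z ip is' ir it' ix iy iz"
    and "ric12 (symE p s e) (mixE x y z e) (symE r t e) (symH ip is' e) (mixH ix iy iz e) (symH ir it' e)
      (vector [0, 0, 1]) (vector [0, 0, 1]) = - pl12 eps p r x y z ip is' ir it' ix iy iz"
  unfolding ric11_def pl11_def ric12_def pl12_def eps_def e_def
  by (simp_all add: blk algebra_simps)

lemma blocks_ric11:
  fixes e1 e2 :: real
  defines "e \<equiv> vector [e1, e2, 0] :: vec3" and "eps \<equiv> e1 * e1 - e2 * e2"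
  shows "ric11 (symE p s e) (mixE x y z e) (symH ip is' e) (mixH ix iy iz e) (symH ir it' e) (dd e) (dd e)
    = eps * pl11 eps p s x y z ip is' ir it' ix iy iz + (e1 * e1 + e2 * e2) * (e1 * e1 + e2 * e2) * g11 eps p s x y z ip is' ir it' ix iy iz"
  unfolding ric11_def pl11_def g11_def eps_def e_def
  by (simp add: blk algebra_simps)

lemma blocks_ric12:
  fixes e1 e2 :: real
  defines "e \<equiv> vector [e1, e2, 0] :: vec3" and "eps \<equiv> e1 * e1 - e2 * e2"
  shows "ric12 (symE p s e) (mixE x y z e) (symE r t e) (symH ip is' e) (mixH ix iy iz e) (symH ir it' e) (dd e) (dd e)
    = eps * pl12 eps p r x y z ip is' ir it' ix iy iz
      + (e1 * e1 + e2 * e2) * (e1 * e1 + e2 * e2) * g12 eps p s r t x y z ip is' ir it' ix iy iz"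
  unfolding ric12_def pl12_def g12_def eps_def e_def
  by (simp add: blk algebra_simps)

definition th12 :: "real \<Rightarrow> real \<Rightarrow> real \<Rightarrow> real \<Rightarrow> real \<Rightarrow> real \<Rightarrow> real \<Rightarrow> real \<Rightarrow> real \<Rightarrow> real \<Rightarrow> real \<Rightarrow> real \<Rightarrow> real \<Rightarrow> real" where
  "th12 eps p r x y z ip is' ir it' ix iy iz = eps * eps * iy * iz * y * y + eps * ip * is' * p * y + eps * ir * it' * r * y + eps * ix * iy * y * y + 2 * eps * ix * iz * x * y + eps * iy * iz * p * r - eps * iy * iz * x * x + ip * ip * p * y + ir * ir * r * y + ix * iy * p * r - ix * iy * x * x + 2 * ix * ix * x * y - eps * iy * z - eps * iz * y - ix * y - iy * x"

text \<open>Between the third axis and (-e2, e1, 0) both symmetric basis forms vanish, which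
  isolates the coefficient of \<open>crossm e\<close>.\<close>

lemma blocks_ric12_rotation:
  fixes e1 e2 :: real
  defines "e \<equiv> vector [e1, e2, 0] :: vec3" and "eps \<equiv> e1 * e1 - e2 * e2"
  shows "ric12 (symE p s e) (mixE x y z e) (symE r t e) (symH ip is' e) (mixH ix iy iz e) (symH ir it' e)
      (vector [0, 0, 1]) (vector [- e2, e1, 0]) = (e1 * e1 + e2 * e2) * th12 eps p r x y z ip is' ir it' ix iy iz"
  unfolding ric12_def th12_def eps_def e_def
  by (simp add: blk algebra_simps)

text \<open>The operators a + b ad(e) + c e (dd e)^T form a commutative algebra with the product of
  \<open>opT_compose\<close>. Metric blocks are \<open>dd\<close> after such an operator, inverse
  blocks such an operator after \<open>dd\<close>, so inverting the metric becomes arithmetic with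
  triples.\<close>

definition opT :: "vec3 \<Rightarrow> real \<Rightarrow> real \<Rightarrow> real \<Rightarrow> vec3 \<Rightarrow> vec3" where
  "opT e a b c v = a *\<^sub>R v + b *\<^sub>R br3 e v + (c * (dd e \<bullet> v)) *\<^sub>R e"

lemma linear_opT: "linear (opT e a b c)"
  by (rule linearI) (simp_all add: opT_def v3 algebra_simps)

lemma opT_compose:
  "opT e a b c (opT e a' b' c' v) =
    opT e (a * a' - (e \<bullet> dd e) * b * b') (a * b' + b * a') (a * c' + c * a' + b * b' + (e \<bullet> dd e) * c * c') v"
  by (simp add: opT_def v3 algebra_simps)

lemma opT_add: "opT e a b c v + opT e a' b' c' v = opT e (a + a') (b + b') (c + c') v"
  by (simp add: opT_def algebra_simps)

lemma opT_trivial [simp]: "opT e 1 0 0 v = v" "opT e 0 0 0 v = 0"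
  by (simp_all add: opT_def)

lemma blk_opT:
  "symE p s e *v v = dd (opT e p 0 s v)" "mixE x y z e *v v = dd (opT e x y z v)"
  "transpose (mixE x y z e) *v v = dd (opT e x (- y) z v)"
  "symH p s e *v v = opT e p 0 s (dd v)" "mixH x y z e *v v = opT e x y z (dd v)"
  "transpose (mixH x y z e) *v v = opT e x (- y) z (dd v)"
  by (simp_all add: opT_def blk algebra_simps)

lemma dd_add: "dd (x + y) = dd x + dd y"
  by (simp add: v3)

text \<open>The relations \<open>rel\<close> say that the candidate is a right inverse in the
  algebra of the \<open>opT\<close>; as the metric is invertible, it is the inverse.\<close>

lemma diagonal_inverse:
  assumes HB: "\<And>v. bop X Y Z (bop (symE p s e) (mixE x y z e) (symE r t e) v) = v"
    "\<And>v. bop (symE p s e) (mixE x y z e) (symE r t e) (bop X Y Z v) = v"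
    and eps: "eps = e \<bullet> dd e"
    and rel: "p * ip + x * ix + eps * y * iy = 1" "x * iy = y * ix"
      "p * is' + s * ip + eps * s * is' + x * iz + z * ix - y * iy + eps * z * iz = 0"
      "p * ix + x * ir = 0" "p * iy + y * ir = 0"
      "p * iz + s * ix + eps * s * iz + x * it' + z * ir + eps * z * it' = 0"
      "x * ip + r * ix = 0" "y * ip + r * iy = 0"
      "x * is' + z * ip + eps * z * is' + r * iz + t * ix + eps * t * iz = 0"
      "x * ix + eps * y * iy + r * ir = 1"
      "x * iz + z * ix - y * iy + eps * z * iz + r * it' + t * ir + eps * t * it' = 0"
  shows "X = symH ip is' e" "Y = mixH ix iy iz e" "Z = symH ir it' e"
proof -
  let ?H = "bop (symH ip is' e) (mixH ix iy iz e) (symH ir it' e)"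
  have "bop (symE p s e) (mixE x y z e) (symE r t e) (?H v) = v" for v
  proof -
    note l = linear_add[OF linear_opT]
    have c: "opT e a b c u + opT e a' b' c' u = u" if "a + a' = 1" "b + b' = 0" "c + c' = 0" for a b c a' b' c' u
      using that by (simp add: opT_add)
    have c0: "opT e a b c u + opT e a' b' c' u = 0" if "a + a' = 0" "b + b' = 0" "c + c' = 0" for a b c a' b' c' u
      using that by (simp add: opT_add)
    have 1: "opT e p 0 s (opT e ip 0 is' u) + opT e x y z (opT e ix (- iy) iz u) = u" for u
      unfolding opT_compose eps[symmetric] using rel by (intro c) (simp_all add: algebra_simps)
    have 2: "opT e p 0 s (opT e ix iy iz u) + opT e x y z (opT e ir 0 it' u) = 0" for u
      unfolding opT_compose eps[symmetric] using rel by (intro c0) (simp_all add: algebra_simps)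
    have 3: "opT e x (- y) z (opT e ip 0 is' u) + opT e r 0 t (opT e ix (- iy) iz u) = 0" for u
      unfolding opT_compose eps[symmetric] using rel by (intro c0) (simp_all add: algebra_simps)
    have 4: "opT e x (- y) z (opT e ix iy iz u) + opT e r 0 t (opT e ir 0 it' u) = u" for u
      unfolding opT_compose eps[symmetric] using rel by (intro c) (simp_all add: algebra_simps)
    have ac: "(a + b) + (c + d) = (a + c) + (b + d)" for a b c d :: vec3
      by simp
    obtain v1 v2 where v: "v = (v1, v2)" by (cases v)
    have "opT e p 0 s (opT e ip 0 is' (dd v1) + opT e ix iy iz (dd v2)) +
        opT e x y z (opT e ix (- iy) iz (dd v1) + opT e ir 0 it' (dd v2)) = dd v1"
      unfolding l by (subst ac) (simp add: 1 2)
    moreover have "opT e x (- y) z (opT e ip 0 is' (dd v1) + opT e ix iy iz (dd v2)) +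
        opT e r 0 t (opT e ix (- iy) iz (dd v1) + opT e ir 0 it' (dd v2)) = dd v2"
      unfolding l by (subst ac) (simp add: 3 4)
    ultimately show ?thesis
      by (simp add: bop_def blk_opT v dd_add[symmetric])
  qed
  then have eq: "bop X Y Z v = ?H v" for v
    using HB(1)[of "?H v"] by simp
  have "X *v a = symH ip is' e *v a" "Y *v a = mixH ix iy iz e *v a" "Z *v a = symH ir it' e *v a" for a
    using eq[of "(a, 0)"] eq[of "(0, a)"] by (simp_all add: bop_def)
  then show "X = symH ip is' e" "Y = mixH ix iy iz e" "Z = symH ir it' e"
    by (simp_all add: matrix_eq)
qed

text \<open>On the line of \<open>e\<close> the metric is a 2 by 2 matrix with entries
  \<open>p + eps * s\<close>, \<open>x + eps * z\<close>, \<open>r + eps * t\<close>; on the plane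
  of the third axis and its bracket with \<open>e\<close> it is one over the algebra generated by
  ad(e). If a determinant vanishes, adjugate columns lie in the kernel, so they are 0 and the matrix
  itself degenerates.\<close>

lemma diagonal_nondegenerate:
  assumes HB: "\<And>v. bop X Y Z (bop (symE p s e) (mixE x y z e) (symE r t e) v) = v"
    and e: "e \<noteq> 0" "e $ 3 = 0" and eps: "eps = e \<bullet> dd e"
  shows "p * r - (x * x + eps * y * y) \<noteq> 0"
    "(p + eps * s) * (r + eps * t) - (x + eps * z) * (x + eps * z) \<noteq> 0"
proof -
  let ?B = "bop (symE p s e) (mixE x y z e) (symE r t e)"
  have inj: "v = 0" if "?B v = 0" for v
    using HB[of v] that linear_0[OF linear_bop] by simp
  have ee: "dd e \<bullet> e = eps" by (simp add: eps dd_inner)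
  have d0: "dd 0 = 0" by (simp add: v3)
  have be: "br3 e e = 0" by (simp add: v3)
  have o: "opT e a b c (d *\<^sub>R e) = (d * (a + c * eps)) *\<^sub>R e" for a b c d
    by (simp add: opT_def linear_scale[of "br3 e"] bilinear_br3[unfolded bilinear_def] be ee algebra_simps)
  have oe: "opT e a b c e = (a + c * eps) *\<^sub>R e" for a b c
    using o[where d = 1] by simp
  show "(p + eps * s) * (r + eps * t) - (x + eps * z) * (x + eps * z) \<noteq> 0"
  proof
    assume 0: "(p + eps * s) * (r + eps * t) - (x + eps * z) * (x + eps * z) = 0"
    have 1: "((r + eps * t) *\<^sub>R e, (- (x + eps * z)) *\<^sub>R e) = 0"
      by (rule inj) (use 0 in \<open>simp add: bop_def blk_opT o dd_add[symmetric] d0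
        scaleR_add_left[symmetric] prod_eq_iff del: scaleR_minus_left; simp add: algebra_simps d0\<close>)
    have 2: "((- (x + eps * z)) *\<^sub>R e, (p + eps * s) *\<^sub>R e) = 0"
      by (rule inj) (use 0 in \<open>simp add: bop_def blk_opT o dd_add[symmetric] d0
        scaleR_add_left[symmetric] prod_eq_iff del: scaleR_minus_left; simp add: algebra_simps d0\<close>)
    have "- (x + eps * z) = 0" "p + eps * s = 0"
      using 1 2 e(1) by (auto simp only: prod_eq_iff fst_conv snd_conv fst_zero snd_zero scaleR_eq_0_iff)
    then have "x + z * eps = 0" "p + s * eps = 0" by (simp_all add: mult.commute)
    then have "(1 *\<^sub>R e, 0 *\<^sub>R e) = 0"
      by (rule_tac inj) (simp add: bop_def blk_opT oe d0 prod_eq_iff)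
    then show False using e by (simp add: prod_eq_iff)
  qed
  define k :: vec3 where "k = vector [0, 0, 1]"
  define h where "h = br3 e k"
  have k: "dd e \<bullet> k = 0" "dd e \<bullet> h = 0" "br3 e h = (- eps) *\<^sub>R k"
    using e(2) by (simp_all add: k_def h_def v3 eps algebra_simps)
  have hk: "h $ 3 = 0" "k $ 3 = 1" "h \<noteq> 0"
    using e by (auto simp: k_def h_def v3)
  have q: "opT e a b c (f *\<^sub>R k + g *\<^sub>R h) = (a * f - eps * b * g) *\<^sub>R k + (a * g + b * f) *\<^sub>R h" for a b c f g
    using bilinear_br3 k h_def
    by (simp add: opT_def inner_add_right bilinear_radd bilinear_rmul algebra_simps)
  have z: "f = 0 \<and> g = 0" if "f *\<^sub>R k + g *\<^sub>R h = 0" for f g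
  proof -
    have "f = 0" using arg_cong[OF that, of "\<lambda>v. v $ 3"] hk by simp
    then show ?thesis using that hk by simp
  qed
  show "p * r - (x * x + eps * y * y) \<noteq> 0"
  proof
    assume 0: "p * r - (x * x + eps * y * y) = 0"
    have "(r *\<^sub>R k + 0 *\<^sub>R h, (- x) *\<^sub>R k + y *\<^sub>R h) = 0"
    proof (rule inj)
      have "p * r - eps * 0 * 0 + (x * (- x) - eps * y * y) = 0" using 0 by simp
      then show "?B (r *\<^sub>R k + 0 *\<^sub>R h, (- x) *\<^sub>R k + y *\<^sub>R h) = 0"
        unfolding bop_def blk_opT fst_conv snd_conv q
        by (simp add: dd_add[symmetric] d0 prod_eq_iff algebra_simps)
    qed
    then have 1: "r = 0" "x = 0" "y = 0"
      using z[of r 0] z[of "- x" y] by (simp_all add: prod_eq_iff)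
    have "(0 *\<^sub>R k + 0 *\<^sub>R h, 1 *\<^sub>R k + 0 *\<^sub>R h) = 0"
      by (rule inj) (use 1 in \<open>simp add: bop_def blk_opT prod_eq_iff d0 opT_def k\<close>)
    then show False using z[of 1 0] by (simp add: prod_eq_iff)
  qed
qed

text \<open>\<open>a\<close>, \<open>c\<close>, \<open>k\<close> describe the metric on the line of
  \<open>e\<close>; \<open>Dl\<close> and \<open>D0\<close> are the determinants on the plane and on
  the line. \<open>mix\<close> is the divided difference (D0 - Dl) / eps written without division,
  so the inverse coefficients \<open>is'\<close>, \<open>it'\<close>, \<open>iz\<close> make sense
  for \<open>eps = 0\<close> too.\<close>

locale diagonal_scalars =
  fixes eps p s r t x y z m n a c k Dl D0 iD i0 mix ip is' ir it' ix iy iz :: real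
  assumes m: "m = x * x + eps * y * y" and n: "n = 2 * x * z + eps * z * z - y * y"
    and a: "a = p + eps * s" and c: "c = r + eps * t" and k: "k = x + eps * z"
    and Dl: "Dl = p * r - m" and D0: "D0 = a * c - k * k"
    and iD: "Dl * iD = 1" and i0: "D0 * i0 = 1"
    and mix: "mix = p * t + r * s + eps * s * t - n"
    and ip: "ip = r * iD" and ir: "ir = p * iD" and ix: "ix = - (x * iD)" and iy: "iy = - (y * iD)"
    and is': "is' = (t * Dl - r * mix) * iD * i0" and it': "it' = (s * Dl - p * mix) * iD * i0"
    and iz: "iz = (x * mix - z * Dl) * iD * i0"
begin

lemma D0_eq: "D0 = Dl + eps * mix"
  unfolding D0 Dl mix a c k m n by algebra

lemma cartan_inverse: "ip + eps * is' = c * i0" "ir + eps * it' = a * i0" "ix + eps * iz = - (k * i0)"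
  using D0_eq iD i0 c a k unfolding ip ir ix is' it' iz by algebra+

lemma relations:
  "p * ip + x * ix + eps * y * iy = 1" "x * iy = y * ix"
  "p * ix + x * ir = 0" "p * iy + y * ir = 0" "x * ip + r * ix = 0" "y * ip + r * iy = 0"
  "x * ix + eps * y * iy + r * ir = 1"
proof -
  have "(p * r - m) * iD = 1" using iD Dl by simp
  then show "p * ip + x * ix + eps * y * iy = 1" "x * ix + eps * y * iy + r * ir = 1"
    unfolding ip ix iy ir m by algebra+
qed (simp_all add: ip ix iy ir)

lemma relations_mixed:
  "p * is' + s * ip + eps * s * is' + x * iz + z * ix - y * iy + eps * z * iz = 0"
  "p * iz + s * ix + eps * s * iz + x * it' + z * ir + eps * z * it' = 0"
  "x * is' + z * ip + eps * z * is' + r * iz + t * ix + eps * t * iz = 0"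
  "x * iz + z * ix - y * iy + eps * z * iz + r * it' + t * ir + eps * t * it' = 0"
proof -
  have "a * (t * Dl - r * mix) + s * r * D0 + k * (x * mix - z * Dl) - z * x * D0 + y * y * D0 = 0"
    unfolding D0_eq mix Dl m n a k by algebra
  then show "p * is' + s * ip + eps * s * is' + x * iz + z * ix - y * iy + eps * z * iz = 0"
    using i0 unfolding ip ix iy is' iz a k by algebra
  have "a * (x * mix - z * Dl) - s * x * D0 + k * (s * Dl - p * mix) + z * p * D0 = 0"
    unfolding D0_eq mix Dl m n a k by algebra
  then show "p * iz + s * ix + eps * s * iz + x * it' + z * ir + eps * z * it' = 0"
    using i0 unfolding ir ix it' iz a k by algebra
  have "k * (t * Dl - r * mix) + z * r * D0 + c * (x * mix - z * Dl) - t * x * D0 = 0"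
    unfolding D0_eq mix Dl m n c k by algebra
  then show "x * is' + z * ip + eps * z * is' + r * iz + t * ix + eps * t * iz = 0"
    using i0 unfolding ip ix is' iz c k by algebra
  have "k * (x * mix - z * Dl) - z * x * D0 + y * y * D0 + c * (s * Dl - p * mix) + t * p * D0 = 0"
    unfolding D0_eq mix Dl m n c k by algebra
  then show "x * iz + z * ix - y * iy + eps * z * iz + r * it' + t * ir + eps * t * it' = 0"
    using i0 unfolding ir ix iy it' iz c k by algebra
qed

lemma my_eq: "x * ix + eps * y * iy = - (m * iD)" "ix * ix + eps * iy * iy = m * iD * iD"
  by (simp_all add: ix iy m algebra_simps)

lemma eq11_plane:
  assumes "pl11 eps p s x y z ip is' ir it' ix iy iz = L * p"
  shows "2 * Dl * D0 - a * r * D0 + p * m * (a + c + 2 * k) = L * p * Dl * D0"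
proof -
  have "2 - (p * (c * i0) + a * (r * iD)) + (p * p * (r * iD) * (c * i0) + 2 * p * (- (k * i0)) * (- (m * iD))
     + m * (p * iD) * (a * i0)) = L * p"
    using assms cartan_inverse my_eq unfolding pl11_def ip[symmetric] ir[symmetric]
    by (simp add: a m[unfolded mult.assoc] mult.assoc)
  then show ?thesis using iD i0 Dl by algebra
qed

text \<open>In the mixed block the coefficients of \<open>Dm\<close> and \<open>crossm e\<close> are
  \<open>x\<close> and \<open>y\<close> times one common factor \<open>Ph\<close>, so the two
  equations amount to \<open>L = Ph\<close>.\<close>

lemma eq12_plane:
  assumes "pl12 eps p r x y z ip is' ir it' ix iy iz = L * x" "th12 eps p r x y z ip is' ir it' ix iy iz = L * y"
    and "x \<noteq> 0 \<or> y \<noteq> 0"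
  shows "p * r * (a + c + 2 * k) + k * D0 = L * Dl * D0"
proof -
  define A' C' k' where "A' = ip + eps * is'" and "C' = ir + eps * it'" and "k' = ix + eps * iz"
  define Ph where "Ph = k * iD + k * i0 + (p * r * iD * (c * i0) + p * r * iD * (k * i0) + m * iD * (k * i0) + r * p * iD * (a * i0))"
  have h: "A' = c * i0" "C' = a * i0" "k' = - (k * i0)"
    by (simp_all add: A'_def C'_def k'_def cartan_inverse)
  have w: "x * iy - y * ix = 0" by (simp add: ix iy)
  have "pl12 eps p r x y z ip is' ir it' ix iy iz = - (k * ix + x * k')
      + (p * ip * A' * x + p * k' * ix * r + x * (x * ix + eps * y * iy) * k' + x * ir * C' * r)
      + eps * k' * y * (x * iy - y * ix)"
    unfolding pl12_def A'_def C'_def k'_def k by (simp add: algebra_simps)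
  also have "\<dots> = x * Ph"
    unfolding w my_eq h unfolding Ph_def ip ir ix by (simp add: algebra_simps)
  finally have 1: "pl12 eps p r x y z ip is' ir it' ix iy iz = x * Ph" .
  have "th12 eps p r x y z ip is' ir it' ix iy iz = - (k * iy + y * k')
      + (p * ip * A' * y + p * k' * iy * r + y * (x * ix + eps * y * iy) * k' + y * ir * C' * r)
      - k' * x * (x * iy - y * ix)"
    unfolding th12_def A'_def C'_def k'_def k by (simp add: algebra_simps)
  also have "\<dots> = y * Ph"
    unfolding w my_eq h unfolding Ph_def ip ir iy by (simp add: algebra_simps)
  finally have 2: "th12 eps p r x y z ip is' ir it' ix iy iz = y * Ph" .
  have L: "L = Ph" using 1 2 assms by auto
  have "L * Dl * D0 = k * D0 * (Dl * iD) + k * Dl * (D0 * i0) + (p * r * (c + k + a) + m * k) * (Dl * iD) * (D0 * i0)"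
    unfolding L Ph_def by (simp add: algebra_simps)
  also have "\<dots> = p * r * (a + c + 2 * k) + k * D0"
    unfolding iD i0 by (simp add: Dl algebra_simps)
  finally show ?thesis by simp
qed

text \<open>\<open>pl11 + eps * g11\<close> is, up to scale, the Ricci form on the line of
  \<open>e\<close>. There the coefficients combine to \<open>a\<close> and \<open>k\<close>, and the
  sum is much shorter than either summand.\<close>

lemma eq11_cartan:
  assumes "pl11 eps p s x y z ip is' ir it' ix iy iz = L * p" "g11 eps p s x y z ip is' ir it' ix iy iz = L * s"
  shows "a * a * r * r + 2 * a * k * m + k * k * p * p - 2 * m * Dl = L * a * Dl * Dl"
proof -
  have "pl11 eps p s x y z ip is' ir it' ix iy iz + eps * g11 eps p s x y z ip is' ir it' ix iy iz
      = 2 - 2 * p * ip + (a * a * ip * ip + 2 * a * k * (ix * ix + eps * iy * iy) + k * k * ir * ir)"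
    unfolding pl11_def g11_def a k by (simp add: algebra_simps)
  then have "2 - 2 * p * (r * iD) + (a * a * (r * iD) * (r * iD) + 2 * a * k * (m * iD * iD) + k * k * (p * iD) * (p * iD)) = L * a"
    unfolding assms my_eq a by (simp add: ip ir algebra_simps)
  then show ?thesis using iD Dl by algebra
qed

lemma eq12_cartan:
  assumes "pl12 eps p r x y z ip is' ir it' ix iy iz = L * x" "g12 eps p s r t x y z ip is' ir it' ix iy iz = L * z"
  shows "2 * m * Dl + a * k * r * r + (a * c + k * k) * m + k * c * p * p = L * k * Dl * Dl"
proof -
  have "pl12 eps p r x y z ip is' ir it' ix iy iz + eps * g12 eps p s r t x y z ip is' ir it' ix iy iz
      = - 2 * (x * ix + eps * y * iy) + (a * k * ip * ip + (a * c + k * k) * (ix * ix + eps * iy * iy) + k * c * ir * ir)"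
    unfolding pl12_def g12_def a k c by (simp add: algebra_simps)
  then have "2 * (m * iD) + (a * k * (r * iD) * (r * iD) + (a * c + k * k) * (m * iD * iD) + k * c * (p * iD) * (p * iD)) = L * k"
    unfolding assms my_eq k by (simp add: ip ir algebra_simps)
  then show ?thesis using iD by algebra
qed

text \<open>On the mixed block, swapping the factors is transposition, which only changes the sign
  of \<open>y\<close>.\<close>

lemma swapped: "diagonal_scalars eps r t p s x (- y) z m n c a k Dl D0 iD i0 mix ir it' ip is' ix (- iy) iz"
  by unfold_locales
    (use m n a c k Dl D0 iD i0 mix ip ir ix iy is' it' iz in \<open>simp_all add: algebra_simps\<close>)

end

section \<open>Solving the polynomial system\<close>

lemma diag_solve_r:
  fixes p r m a c k D W :: real
  assumes D: "D = p * r - m" "D \<noteq> 0" and D0: "a * c - k * k \<noteq> 0"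
    and i: "2 * D = a * r + p * k + p * W" and ii: "2 * D = c * p + r * k + r * W"
    and iii: "W * (a * c - k * k) = D * (a + c + 2 * k)"
    and C11: "a * a * r * r + 2 * a * k * m + k * k * p * p - 2 * m * D = a * (p * r * W + k * D)"
    and C22: "c * c * p * p + 2 * c * k * m + k * k * r * r - 2 * m * D = c * (p * r * W + k * D)"
    and C12: "2 * m * D + a * k * r * r + (a * c + k * k) * m + k * c * p * p = k * (p * r * W + k * D)"
  shows "r \<noteq> 0"
proof
  assume r: "r = 0"
  have m: "m = - D" using D r by simp
  \<comment> \<open>With \<open>r = 0\<close> the system is triangular: \<open>k\<close>,
    \<open>W\<close> and \<open>a\<close> are expressed by \<open>c\<close> and \<open>p\<close>,
    and the last two equations contradict each other.\<close>
  have cp: "c * p = 2 * D" and pk: "p * (k + W) = 2 * D" using i ii r by (simp_all add: algebra_simps)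
  have p: "p \<noteq> 0" "c \<noteq> 0" using cp D by auto
  have "D * (2 * D - c * k) * 3 = 0" using C22 m cp r by algebra
  then have "2 * D = c * k" using D by simp
  then have "c * (p - k) = 0" using cp by algebra
  then have k: "k = p" using p by simp
  have "p * (k + W - c) = 0" using cp pk by (simp add: algebra_simps)
  then have W: "W = c - p" using k p by simp
  have "p * c * (a + p) = 0" using C12 m cp r k W D by algebra
  then have a: "a = - p" using p by simp
  have "p * (c + p) \<noteq> 0" using D0 a k by (simp add: algebra_simps)
  moreover have "p * (c + p) * (3 * c - 2 * p) = 0"
    using iii a k W cp by algebra
  ultimately have "3 * c = 2 * p" by simp
  then have "p ^ 4 = 0" using C11 m a k W cp r by algebra
  then show False using p by simp
qed

text \<open>The case \<open>p = r\<close> scaled to \<open>p = 1\<close>: \<open>q\<close> and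
  \<open>d\<close> are half the sum and half the difference of \<open>a\<close> and
  \<open>k\<close>. Elimination leaves a polynomial in \<open>d\<close> whose only admissible real
  root is 3/4.\<close>

lemma diag_solve_equal:
  fixes d q w :: real
  assumes q: "q = w * (d - 1/2)" and nz: "q \<noteq> 0" "d \<noteq> 0"
    and F1: "w * (6 * d^2 - 6 * d + 2) - 2 * d + (q - d) * (1 - 3 * d * q - 3 * d^2) = 0"
    and F2: "3 * d + w * (2 * d^2 - 5 * d + 3/2) - d * (3 * q^2 - 2 * q * d + 3 * d^2) = 0"
  shows "d = 3/4" "q = 1/4" "w = 1"
proof -
  have d2: "d \<noteq> 1/2" using q nz by auto
  have "2 * d * (2 * q * d + (d - 1/2) * (3 * d^2 - 3 - q * d)) = 0"
    using F1 F2 q by algebra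
  then have G: "2 * q * d + (d - 1/2) * (3 * d^2 - 3 - q * d) = 0" using nz by simp
  have "q * (6 * d^2 - 5 * d + 3/2) - 3 * d * (d - 1/2) * (q^2 + 1 - d^2) = 0"
    using F1 q by algebra
  then have "(d - 1/2) * (d^2 - 1) * (4 * d - 3) * (2 * d - 1) * (2 * d^2 + 1) = 0"
    using G by algebra
  moreover have "2 * d^2 + 1 \<noteq> 0" using zero_le_power2[of d] by linarith
  moreover have "d^2 - 1 \<noteq> 0"
  proof
    assume 1: "d^2 - 1 = 0"
    then have "q * d * (5/2 - d) = 0" using G by algebra
    then have "d = 5/2" using nz by simp
    then have "(5/2 :: real)^2 - 1 = 0" using 1 by (simp only:)
    then show False by (simp add: power2_eq_square)
  qed
  ultimately show d: "d = 3/4" using d2 by auto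
  show "q = 1/4" using G unfolding d by (simp add: power2_eq_square field_simps)
  then show "w = 1" using q unfolding d by simp
qed

text \<open>\<open>W\<close> abbreviates D (a + c + 2k) / (a c - k k), and the Einstein constant has
  been eliminated. The equations are homogeneous and symmetric under exchanging \<open>p\<close>,
  \<open>a\<close> with \<open>r\<close>, \<open>c\<close>. \<open>p = r\<close> leads to the nearly
  Kaehler metric, distinct \<open>p\<close>, \<open>r\<close> to the Killing metric pulled back by a
  twist.\<close>

lemma diag_solve:
  fixes p r m a c k D W :: real
  assumes D: "D = p * r - m" "D \<noteq> 0" and D0: "a * c - k * k \<noteq> 0"
    and i: "2 * D = a * r + p * k + p * W" and ii: "2 * D = c * p + r * k + r * W"
    and iii: "W * (a * c - k * k) = D * (a + c + 2 * k)"
    and C11: "a * a * r * r + 2 * a * k * m + k * k * p * p - 2 * m * D = a * (p * r * W + k * D)"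
    and C22: "c * c * p * p + 2 * c * k * m + k * k * r * r - 2 * m * D = c * (p * r * W + k * D)"
    and C12: "2 * m * D + a * k * r * r + (a * c + k * k) * m + k * c * p * p = k * (p * r * W + k * D)"
  shows "a = p \<and> c = r \<and> k * k = m \<and> m \<noteq> 0"
proof -
  have r0: "r \<noteq> 0" by (rule diag_solve_r[OF assms])
  have p0: "p \<noteq> 0"
    by (rule diag_solve_r[of D r p m c a k W]) (use assms in \<open>simp_all add: algebra_simps\<close>)
  define n where "n = p * r"
  have n0: "n \<noteq> 0" using r0 p0 by (simp add: n_def)
  have A1: "r * (6 * D^2 - 2 * n * D) - 6 * D * (n * W + k * D) + p * (2 * n * W^2 + n * k * W + 3 * k * D * (k + W)) = 0"
    using C11 i D(1) n_def by algebra
  have A2: "p * (6 * D^2 - 2 * n * D) - 6 * D * (n * W + k * D) + r * (2 * n * W^2 + n * k * W + 3 * k * D * (k + W)) = 0"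
    using C22 ii D(1) n_def by algebra
  show ?thesis
  proof (cases "p = r")
    case True
    have ac: "a = c" using i ii True p0 by simp
    have "(a + k) * (W * (a - k) - 2 * D) = 0" using iii ac by algebra
    moreover have "a + k \<noteq> 0" using D0 ac by algebra
    ultimately have ak: "W * (a - k) = 2 * D" by simp
    then have W0: "W \<noteq> 0" using D by auto
    define d w where "d = D / (W * p)" and "w = W / p"
    have Dd: "D = p^2 * w * d" and Ww: "W = p * w" using W0 p0 by (simp_all add: d_def w_def power2_eq_square)
    define q where "q = w * (d - 1/2)"
    have "p * (a + k) = p * (2 * p * q)" using i True Dd Ww by (simp add: q_def algebra_simps power2_eq_square)
    then have 1: "a + k = 2 * p * q" using p0 by simp
    have "W * (a - k) = W * (2 * p * d)" using ak Dd Ww by (simp add: algebra_simps power2_eq_square)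
    then have 2: "a - k = 2 * p * d" using W0 by simp
    have a: "a = p * (q + d)" and k: "k = p * (q - d)" using 1 2 by (simp_all add: algebra_simps)
    have "a * a - k * k = 4 * p^2 * (q * d)" unfolding a k by algebra
    then have nz: "q \<noteq> 0" "d \<noteq> 0" using D0 ac by auto
    have w0: "w \<noteq> 0" using W0 Ww by auto
    have "p^4 * w * (w * (6 * d^2 - 6 * d + 2) - 2 * d + (q - d) * (1 - 3 * d * q - 3 * d^2)) = 0"
      using C11 D(1) True Dd Ww a k q_def by algebra
    then have F1: "w * (6 * d^2 - 6 * d + 2) - 2 * d + (q - d) * (1 - 3 * d * q - 3 * d^2) = 0"
      using p0 w0 by simp
    have "p^4 * w * (3 * d + w * (2 * d^2 - 5 * d + 3/2) - d * (3 * q^2 - 2 * q * d + 3 * d^2)) = 0"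
      using C12 D(1) True Dd Ww a k ac q_def by algebra
    then have F2: "3 * d + w * (2 * d^2 - 5 * d + 3/2) - d * (3 * q^2 - 2 * q * d + 3 * d^2) = 0"
      using p0 w0 by simp
    note sol = diag_solve_equal[OF q_def nz F1 F2]
    have "a = p" "k = - p / 2" "m = p * p / 4"
      using a k D(1) True Dd unfolding sol by (simp_all add: power2_eq_square)
    moreover from this have "m \<noteq> 0" using p0 by auto
    ultimately show ?thesis using ac True by simp
  next
    case False
    \<comment> \<open>\<open>A1\<close> and \<open>A2\<close> are exchanged by \<open>p\<close> and
      \<open>r\<close>, so their difference is divisible by \<open>r - p\<close>. From here on
      \<open>p\<close> and \<open>r\<close> enter through their sum and \<open>n\<close>.\<close>
    have "(r - p) * ((6 * D^2 - 2 * n * D) - (2 * n * W^2 + n * k * W + 3 * k * D * (k + W))) = 0"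
      using A1 A2 by algebra
    then have A: "6 * D^2 - 2 * n * D = 2 * n * W^2 + n * k * W + 3 * k * D * (k + W)"
      using False by simp
    have "D * ((p + r) * (3 * D - n) - 3 * (n * W + k * D)) = 0" using A1 A by algebra
    then have B: "(p + r) * (3 * D - n) = 3 * (n * W + k * D)" using D by simp
    have E: "2 * n^2 * D + 2 * n * D^2 - 2 * n * D * (p + r) * W + n^2 * W^2 - 4 * D^3 + 2 * D^2 * (p + r) * (k + W)
        - n * D * (k + W)^2 - 2 * n * k^2 * D - k * n^2 * W = 0"
      using C12 i ii D(1) n_def by algebra
    have D0n: "n * (a * c - k * k) = 4 * D^2 - 2 * D * (p + r) * (k + W) + n * (k + W)^2 - n * k^2"
      using i ii n_def by algebra
    have T: "3 * D - n \<noteq> 0"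
    proof
      assume t: "3 * D - n = 0"
      then have nD: "n = 3 * D" by simp
      have "D * (3 * W + k) = 0" using B t nD by algebra
      then have kW: "k = - 3 * W" using D by simp
      have "D * W^2 = 0" using A nD kW by algebra
      then have "W = 0" using D by simp
      then have "D^3 = 0" using E nD kW by algebra
      then show False using D by simp
    qed
    \<comment> \<open>This product lies in the ideal of \<open>A\<close>, \<open>B\<close>,
      \<open>E\<close>; all factors but the last are excluded.\<close>
    have "n * (n - 3 * D) * (n - D) * (2 * k + W) * (3 * D * k + D * W + n * W) = 0"
      using A B E by algebra
    moreover have "n - D \<noteq> 0"
    proof
      assume "n - D = 0"
      then have nD: "n = D" by simp
      have "D * (4 * D - (2 * W^2 + 4 * k * W + 3 * k^2)) = 0" using A nD by algebra
      then have 1: "4 * D = 2 * W^2 + 4 * k * W + 3 * k^2" using D by simp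
      have "D * (2 * (p + r) - 3 * (W + k)) = 0" using B nD by algebra
      then have 2: "2 * (p + r) = 3 * (W + k)" using D by simp
      have "D * (a * c - k * k) = 0" using D0n nD 1 2 by algebra
      then show False using D D0 by simp
    qed
    moreover have "2 * k + W \<noteq> 0"
    proof
      assume "2 * k + W = 0"
      then have W: "W = - 2 * k" by simp
      have "(3 * D - n) * ((p + r) * k + 2 * D) = 0" using A B W by algebra
      then have "(p + r) * k + 2 * D = 0" using T by simp
      then have "n * (a * c - k * k) = 0" using D0n W by algebra
      then show False using n0 D0 by simp
    qed
    moreover have "n - 3 * D \<noteq> 0" using T by simp
    ultimately have "3 * D * k + D * W + n * W = 0" using n0 by simp
    then have nW: "n * W = - D * (3 * k + W)" by algebra
    have W0: "W \<noteq> 0"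
    proof
      assume "W = 0"
      then have "k = 0" using nW D by simp
      then have "D * (3 * D - n) = 0" using A \<open>W = 0\<close> by algebra
      then show False using D T by simp
    qed
    \<comment> \<open>By homogeneity one ratio remains; \<open>n\<close> and \<open>k\<close> are
      now expressed by \<open>h\<close>, \<open>W\<close> and \<open>D\<close>.\<close>
    define h where "h = k / W"
    have k: "k = h * W" using W0 by (simp add: h_def)
    have "W * (n + D * (1 + 3 * h)) = 0" using nW k by algebra
    then have n: "n = - D * (1 + 3 * h)" using W0 by simp
    have h4: "4 + 3 * h \<noteq> 0"
    proof
      assume "4 + 3 * h = 0"
      then have "3 * D - n = 0" using n by algebra
      then show False using T by simp
    qed
    have h13: "1 + 3 * h \<noteq> 0" using n n0 by auto
    have "2 * D * (W^2 * (1 + 2 * h) + (3 * h + 4) * D) = 0" using A n k by algebra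
    then have "W^2 * (1 + 2 * h) + (3 * h + 4) * D = 0" using D(2) by simp
    then have W2: "W^2 * (1 + 2 * h) = - (3 * h + 4) * D" by algebra
    have "D * (4 + 3 * h) * ((p + r) * W - 3 * D) = 0" using B n k W2 by algebra
    then have PW: "(p + r) * W = 3 * D" using D h4 by simp
    have "n * (W * (a * c - k * k)) = D * (n * (a + c + 2 * k))" using iii by algebra
    moreover have "n * (a + c) = 2 * D * (p + r) - (k + W) * ((p + r)^2 - 2 * n)"
      using i ii n_def by algebra
    ultimately have "W * (4 * D^2 - 2 * D * (p + r) * (k + W) + n * (k + W)^2 - n * k^2)
        = D * (2 * D * (p + r) - (k + W) * ((p + r)^2 - 2 * n) + 2 * n * k)"
      using D0n by algebra
    then have "D^2 * (1 + 3 * h) * (W^2 * (3 * h + 2) - D * (6 * h + 5)) = 0"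
      using PW W2 n k by algebra
    then have W3: "W^2 * (3 * h + 2) = D * (6 * h + 5)" using D h13 by simp
    have "D * ((h + 1) * (21 * h + 13)) = 0" using W2 W3 by algebra
    then consider "h = -1" | "21 * h = -13" using D by auto
    then show ?thesis
    proof cases
      case 1
      have DW: "D = W^2" and n: "n = 2 * D" using W2 n 1 by simp_all
      have k: "k = - W" using k 1 by simp
      have "r * (a - p) = 0" "p * (c - r) = 0" using i ii k n n_def by algebra+
      then have "a = p" "c = r" using r0 p0 by simp_all
      moreover have "m = D" using D n n_def by simp
      ultimately show ?thesis using k DW W0 by (simp add: power2_eq_square)
    next
      case 2
      \<comment> \<open>For this second root \<open>p\<close> and \<open>r\<close> would have the
        negative discriminant (p - r)^2.\<close>
      have "W^2 = 9 * D" "7 * n = 6 * D" using W2 n 2 by algebra+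
      then have "D > 0" using W0 D zero_less_power2[of W] by linarith
      have "D * ((p + r)^2 - D) = 0" using PW \<open>W^2 = 9 * D\<close> by algebra
      then have "(p + r)^2 = D" using D by simp
      moreover have "(p - r)^2 = (p + r)^2 - 4 * n" unfolding n_def by algebra
      ultimately have "7 * (p - r)^2 = - 17 * D" using \<open>7 * n = 6 * D\<close> by linarith
      then show ?thesis using \<open>D > 0\<close> zero_le_power2[of "p - r"] by linarith
    qed
  qed
qed

context diagonal_scalars
begin

text \<open>\<open>diag_solve\<close> gives \<open>a = p\<close>, \<open>c = r\<close> and
  \<open>k * k = m\<close>. The differences are \<open>eps * s\<close>, \<open>eps * t\<close> and
  \<open>eps * n\<close>, so division by \<open>eps\<close> finishes.\<close>

lemma solve_nonnull:
  assumes eps: "eps \<noteq> 0" and xy: "x \<noteq> 0 \<or> y \<noteq> 0"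
    and E: "pl11 eps p s x y z ip is' ir it' ix iy iz = L * p" "g11 eps p s x y z ip is' ir it' ix iy iz = L * s"
      "pl11 eps r t x (- y) z ir it' ip is' ix (- iy) iz = L * r" "g11 eps r t x (- y) z ir it' ip is' ix (- iy) iz = L * t"
      "pl12 eps p r x y z ip is' ir it' ix iy iz = L * x" "th12 eps p r x y z ip is' ir it' ix iy iz = L * y"
      "g12 eps p s r t x y z ip is' ir it' ix iy iz = L * z"
  shows "s = 0 \<and> t = 0 \<and> n = 0 \<and> m \<noteq> 0"
proof -
  have Dl0: "Dl \<noteq> 0" and D00: "D0 \<noteq> 0" using iD i0 by auto
  define W where "W = Dl * (a + c + 2 * k) / D0"
  have W: "W * D0 = Dl * (a + c + 2 * k)" using D00 by (simp add: W_def)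
  note p11 = eq11_plane[OF E(1)] and p22 = diagonal_scalars.eq11_plane[OF swapped E(3)]
    and p12 = eq12_plane[OF E(5,6) xy]
  have "D0 * (2 * Dl - (a * r + p * k + p * W)) = 0" using p11 p12 W Dl by algebra
  then have i: "2 * Dl = a * r + p * k + p * W" using D00 by simp
  have "D0 * (2 * Dl - (c * p + r * k + r * W)) = 0" using p22 p12 W Dl by algebra
  then have ii: "2 * Dl = c * p + r * k + r * W" using D00 by simp
  have "D0 * (L * Dl * Dl - (p * r * W + k * Dl)) = 0" using p12 W by algebra
  then have L: "L * Dl * Dl = p * r * W + k * Dl" using D00 by simp
  have "a = p \<and> c = r \<and> k * k = m \<and> m \<noteq> 0"
  proof (rule diag_solve[OF Dl Dl0 _ i ii])
    show "a * c - k * k \<noteq> 0" using D0 D00 by simp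
    show "W * (a * c - k * k) = Dl * (a + c + 2 * k)" using W D0 by simp
    show "a * a * r * r + 2 * a * k * m + k * k * p * p - 2 * m * Dl = a * (p * r * W + k * Dl)"
      using eq11_cartan[OF E(1,2)] L by algebra
    show "c * c * p * p + 2 * c * k * m + k * k * r * r - 2 * m * Dl = c * (p * r * W + k * Dl)"
      using diagonal_scalars.eq11_cartan[OF swapped E(3,4)] L by algebra
    show "2 * m * Dl + a * k * r * r + (a * c + k * k) * m + k * c * p * p = k * (p * r * W + k * Dl)"
      using eq12_cartan[OF E(5,7)] L by algebra
  qed
  moreover have "eps * n = k * k - m" unfolding n k m by algebra
  ultimately show ?thesis using eps a c by auto
qed

text \<open>For \<open>eps = 0\<close> the line equations coincide with the plane equations. These
  fix \<open>p\<close> and \<open>r\<close> as multiples of \<open>x\<close>, after which the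
  \<open>g\<close> equations are linear in \<open>s\<close>, \<open>t\<close> and
  \<open>n\<close>.\<close>

lemma solve_null:
  assumes eps: "eps = 0" and xy: "x \<noteq> 0 \<or> y \<noteq> 0"
    and E: "pl11 eps p s x y z ip is' ir it' ix iy iz = L * p" "g11 eps p s x y z ip is' ir it' ix iy iz = L * s"
      "pl11 eps r t x (- y) z ir it' ip is' ix (- iy) iz = L * r" "g11 eps r t x (- y) z ir it' ip is' ix (- iy) iz = L * t"
      "pl12 eps p r x y z ip is' ir it' ix iy iz = L * x" "th12 eps p r x y z ip is' ir it' ix iy iz = L * y"
      "g12 eps p s r t x y z ip is' ir it' ix iy iz = L * z"
  shows "s = 0 \<and> t = 0 \<and> n = 0 \<and> m \<noteq> 0"
proof -
  have Dl0: "Dl \<noteq> 0" using iD by auto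
  have sp: "a = p" "c = r" "k = x" "m = x * x" "n = 2 * x * z - y * y" "D0 = Dl" "Dl = p * r - x * x"
    using a c k m n Dl D0 eps by simp_all
  have p11: "Dl * (2 * Dl * Dl - p * r * Dl + p * (x * x) * (p + r + 2 * x)) = Dl * (L * p * Dl * Dl)"
    using eq11_plane[OF E(1)] unfolding sp(1-4,6) by algebra
  have p22: "2 * Dl * Dl - r * p * Dl + r * (x * x) * (p + r + 2 * x) = L * r * Dl * Dl"
    using diagonal_scalars.eq11_plane[OF swapped E(3)] unfolding sp(1-4,6) by algebra
  have p12: "p * r * (p + r + 2 * x) + x * Dl = L * Dl * Dl"
    using eq12_plane[OF E(5,6) xy] unfolding sp(1-4,6) .
  have p11: "2 * Dl * Dl - p * r * Dl + p * (x * x) * (p + r + 2 * x) = L * p * Dl * Dl"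
    using p11 Dl0 by simp
  have x0: "x \<noteq> 0"
  proof
    assume x: "x = 0"
    have pr: "p \<noteq> 0" "r \<noteq> 0" using Dl0 sp(7) x by auto
    have "(p * r) * (p * r) * (L * p - 1) = 0" using p11 sp(7) x by algebra
    then have 1: "L * p = 1" using pr by simp
    have "(p * r) * (p * r) * (L * r - 1) = 0" using p22 sp(7) x by algebra
    then have 2: "L * r = 1" using pr by simp
    have "p * r * (p + r - L * p * r) = 0" using p12 sp(7) x by algebra
    then have "p + r = L * p * r" using pr by simp
    then show False using 1 2 pr by (metis add_cancel_right_right mult.commute mult_1 mult_cancel_right)
  qed
  have "Dl * ((p + x) * (p + 2 * x)) = 0" using p11 p12 sp(7) by algebra
  moreover have "Dl * ((r + x) * (r + 2 * x)) = 0" using p22 p12 sp(7) by algebra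
  ultimately have "p = - x \<or> p = - 2 * x" "r = - x \<or> r = - 2 * x" using Dl0 by auto
  \<comment> \<open>The fourth combination \<open>p = r = - x\<close> would give
    \<open>Dl = 0\<close>.\<close>
  then have cs: "(p = - 2 * x \<and> r = - 2 * x) \<or> (p = - x \<and> r = - 2 * x) \<or> (p = - 2 * x \<and> r = - x)"
    using Dl0 sp(7) by auto
  have i0': "i0 = iD" using i0 iD sp(6) Dl0 by (metis mult_left_cancel)
  define u where "u = 1 / x"
  have u: "x * u = 1" using x0 by (simp add: u_def)
  from cs consider "p = - 2 * x" "r = - 2 * x" | "p = - x" "r = - 2 * x" | "p = - 2 * x" "r = - x" by blast
  then show ?thesis
  proof cases
    case 1
    have Dl': "Dl = 3 * (x * x)" using sp(7) 1 by simp
    have iD': "3 * iD = u * u" using iD Dl' u by algebra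
    have L: "L = (- 5/9) * u"
    proof -
      have "Dl * Dl * (L - (- 5/9) * u) = 0" using p12 1 Dl' u by algebra
      then show ?thesis using Dl0 by simp
    qed
    have mx: "mix = x * ((-2) * t + (-2) * s) - (2 * x * z - y * y)"
      using mix sp(5) eps 1 by (simp add: algebra_simps)
    have v: "3 * ip = (-2) * u" "3 * ir = (-2) * u" "3 * ix = - u" "3 * iy = - (y * u * u)"
      using iD' u unfolding ip ir ix iy 1 by algebra+
    have v': "9 * is' = 3 * t * u * u - (-2) * mix * u * u * u"
      "9 * it' = 3 * s * u * u - (-2) * mix * u * u * u"
      "9 * iz = mix * u * u * u - 3 * z * u * u"
      using iD' u unfolding is' it' iz i0' Dl' 1 by algebra+
    \<comment> \<open>A linear system in \<open>x * s\<close>, \<open>x * t\<close> and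
      \<open>n\<close> with only the trivial solution; its numbers come from inserting
      \<open>v\<close> and \<open>v'\<close> into the \<open>g\<close> equations.\<close>
    have g: "x * (47 * s + 2 * t) = 8 * n" "x * (2 * s + 47 * t) = 8 * n" "5 * (x * (s + t)) = 11 * n"
      using E(2,4,7) u v v' unfolding g11_def g12_def mx L sp(5) 1 eps by algebra+
    then have "x * s = 0" "x * t = 0" "n = 0" by algebra+
    then have "s = 0" "t = 0" "n = 0" using x0 by auto
    then show ?thesis using sp(4) x0 by simp
  next
    case 2
    have Dl': "Dl = 1 * (x * x)" using sp(7) 2 by simp
    have iD': "1 * iD = u * u" using iD Dl' u by algebra
    have L: "L = (-1) * u"
    proof -
      have "Dl * Dl * (L - (-1) * u) = 0" using p12 2 Dl' u by algebra
      then show ?thesis using Dl0 by simp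
    qed
    have mx: "mix = x * ((-1) * t + (-2) * s) - (2 * x * z - y * y)"
      using mix sp(5) eps 2 by (simp add: algebra_simps)
    have v: "1 * ip = (-2) * u" "1 * ir = (-1) * u" "1 * ix = - u" "1 * iy = - (y * u * u)"
      using iD' u unfolding ip ir ix iy 2 by algebra+
    have v': "1 * is' = 1 * t * u * u - (-2) * mix * u * u * u"
      "1 * it' = 1 * s * u * u - (-1) * mix * u * u * u"
      "1 * iz = mix * u * u * u - 1 * z * u * u"
      using iD' u unfolding is' it' iz i0' Dl' 2 by algebra+
    have g: "s = 0" "x * (s + t) = n" "n = 2 * x * s"
      using E(2,4,7) u v v' unfolding g11_def g12_def mx L sp(5) 2 eps by algebra+
    then have "s = 0" "t = 0" "n = 0" using x0 by auto
    then show ?thesis using sp(4) x0 by simp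
  next
    case 3
    have Dl': "Dl = 1 * (x * x)" using sp(7) 3 by simp
    have iD': "1 * iD = u * u" using iD Dl' u by algebra
    have L: "L = (-1) * u"
    proof -
      have "Dl * Dl * (L - (-1) * u) = 0" using p12 3 Dl' u by algebra
      then show ?thesis using Dl0 by simp
    qed
    have mx: "mix = x * ((-2) * t + (-1) * s) - (2 * x * z - y * y)"
      using mix sp(5) eps 3 by (simp add: algebra_simps)
    have v: "1 * ip = (-1) * u" "1 * ir = (-2) * u" "1 * ix = - u" "1 * iy = - (y * u * u)"
      using iD' u unfolding ip ir ix iy 3 by algebra+
    have v': "1 * is' = 1 * t * u * u - (-1) * mix * u * u * u"
      "1 * it' = 1 * s * u * u - (-2) * mix * u * u * u"
      "1 * iz = mix * u * u * u - 1 * z * u * u"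
      using iD' u unfolding is' it' iz i0' Dl' 3 by algebra+
    have g: "t = 0" "x * (s + t) = n" "n = 2 * x * t"
      using E(2,4,7) u v v' unfolding g11_def g12_def mx L sp(5) 3 eps by algebra+
    then have "s = 0" "t = 0" "n = 0" using x0 by auto
    then show ?thesis using sp(4) x0 by simp
  qed
qed

end

lemma transpose_mix: "transpose (mixE x y z e) = mixE x (- y) z e" "transpose (mixH x y z e) = mixH x (- y) z e"
  by (simp_all add: matrix_eq blk_opT)

lemma blk_values:
  fixes e1 e2 :: real
  defines "e \<equiv> vector [e1, e2, 0] :: vec3"
  shows "(symE p s e *v vector [0, 0, 1]) \<bullet> vector [0, 0, 1] = - p"
    "(symE p s e *v dd e) \<bullet> dd e = (e1 * e1 - e2 * e2) * p + (e1 * e1 + e2 * e2) * (e1 * e1 + e2 * e2) * s"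
    "vector [0, 0, 1] \<bullet> (mixE x y z e *v vector [0, 0, 1]) = - x"
    "dd e \<bullet> (mixE x y z e *v dd e) = (e1 * e1 - e2 * e2) * x + (e1 * e1 + e2 * e2) * (e1 * e1 + e2 * e2) * z"
    "vector [0, 0, 1] \<bullet> (mixE x y z e *v vector [- e2, e1, 0]) = (e1 * e1 + e2 * e2) * y"
  unfolding e_def by (simp_all add: blk algebra_simps)

lemma br3_dd_e: "dd e \<bullet> br3 e v = 0"
  by (simp add: v3 algebra_simps)

text \<open>If \<open>K\<close> has neither a \<open>Dm\<close> nor a \<open>crossm e\<close> part,
  the first component of the generator preserves the metric alone and the one-factor result applies.
  Otherwise seven scalar equations are read off and solved.\<close>

lemma einstein_invariant_diagonal:
  assumes E: "ein lam P K S X Y Z" and e: "e \<noteq> 0" "e $ 3 = 0"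
    and inv: "\<And>v w. bop P K S (brV (e, e) v) \<bullet> w + bop P K S v \<bullet> brV (e, e) w = 0"
  shows "(\<exists>p. p \<noteq> 0 \<and> P = p *\<^sub>R Dm \<and> K = 0 \<and> S = p *\<^sub>R Dm) \<or>
    (\<exists>p r m. m \<noteq> 0 \<and> P = p *\<^sub>R Dm \<and> S = r *\<^sub>R Dm \<and> K ** Dm ** transpose K = m *\<^sub>R Dm)"
proof -
  have sy: "transpose P = P" "transpose S = S"
    and HB: "\<And>v. bop X Y Z (bop P K S v) = v" "\<And>v. bop P K S (bop X Y Z v) = v"
    using E unfolding ein_def by auto
  have b0: "br3 x 0 = 0" for x by (simp_all add: v3)
  have adj: "(A *v x) \<bullet> y = x \<bullet> (transpose A *v y)" for A :: mat3 and x y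
    by (simp add: v3 algebra_simps)
  define e1 e2 where "e1 = e $ 1" and "e2 = e $ 2"
  have ev: "e = vector [e1, e2, 0]" using e(2) by (simp add: vec_eq_iff forall_3 e1_def e2_def)
  define N where "N = e1 * e1 + e2 * e2"
  have N: "N \<noteq> 0" using e(1) by (auto simp: N_def ev vec_eq_iff forall_3 sum_squares_eq_zero_iff)
  define eps where "eps = e1 * e1 - e2 * e2"
  have eps: "eps = e \<bullet> dd e" by (simp add: eps_def ev v3)
  have "x \<bullet> (P *v br3 e x) = 0" for x
    using inv[of "(x, 0)" "(x, 0)"] adj[of P "br3 e x" x] adj[of P x "br3 e x"]
    by (simp add: bop_def brV_def b0 inner_commute sy)
  then obtain p s where P: "P = symE p s e"
    using invariant_form3[OF sy(1) e] unfolding symE_def by blast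
  have "x \<bullet> (S *v br3 e x) = 0" for x
    using inv[of "(0, x)" "(0, x)"] adj[of S "br3 e x" x] adj[of S x "br3 e x"]
    by (simp add: bop_def brV_def b0 inner_commute sy)
  then obtain r t where S: "S = symE r t e"
    using invariant_form3[OF sy(2) e] unfolding symE_def by blast
  have "br3 e a \<bullet> (K *v u) + a \<bullet> (K *v br3 e u) = 0" for a u
    using inv[of "(a, 0)" "(0, u)"] adj[of "transpose K" "br3 e a" u] adj[of "transpose K" a "br3 e u"]
    by (simp add: bop_def brV_def b0)
  then obtain x y z where K: "K = mixE x y z e"
    using intertwiner_form[OF e] unfolding mixE_def by blast
  show ?thesis
  proof (cases "x = 0 \<and> y = 0")
    case True
    have "bop P K S (brV (e, 0) v) \<bullet> w + bop P K S v \<bullet> brV (e, 0) w = 0" for v w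
    proof -
      have z: "opT e 0 b c (br3 e u) = b *\<^sub>R br3 e (br3 e u)" "opT e a b c 0 = 0" for a b c u
        by (simp_all add: opT_def br3_dd_e b0)
      have "br3 0 u = 0" "dd 0 = 0" for u by (simp_all add: v3)
      moreover have "dd (opT e p 0 s (br3 e u)) \<bullet> u' + dd (opT e p 0 s u) \<bullet> br3 e u' = 0" for u u'
        by (simp add: opT_def v3 algebra_simps)
      moreover have "dd (opT e 0 0 z u) \<bullet> br3 e u' = 0" for u u'
        by (simp add: opT_def v3 algebra_simps)
      ultimately show ?thesis
        using True by (simp add: bop_def brV_def inner_prod_def P K S blk_opT z inner_add_left)
    qed
    then show ?thesis using einstein_invariant_first_factor[OF E e] by blast
  next
    case False
    then have xy: "x \<noteq> 0 \<or> y \<noteq> 0" by simp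
    define m n a c k where "m = x * x + eps * y * y" and "n = 2 * x * z + eps * z * z - y * y"
      and "a = p + eps * s" and "c = r + eps * t" and "k = x + eps * z"
    define Dl D0 where "Dl = p * r - m" and "D0 = a * c - k * k"
    define iD i0 mix where "iD = 1 / Dl" and "i0 = 1 / D0" and "mix = p * t + r * s + eps * s * t - n"
    define ip ir ix iy where "ip = r * iD" and "ir = p * iD" and "ix = - (x * iD)" and "iy = - (y * iD)"
    define is' it' iz where "is' = (t * Dl - r * mix) * iD * i0" and "it' = (s * Dl - p * mix) * iD * i0"
      and "iz = (x * mix - z * Dl) * iD * i0"
    have nz: "Dl \<noteq> 0" "D0 \<noteq> 0"
      using diagonal_nondegenerate[OF HB(1)[unfolded P K S] e eps]
      by (simp_all add: Dl_def D0_def m_def a_def c_def k_def)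
    interpret dg: diagonal_scalars eps p s r t x y z m n a c k Dl D0 iD i0 mix ip is' ir it' ix iy iz
      by unfold_locales
        (use nz in \<open>simp_all add: m_def n_def a_def c_def k_def Dl_def D0_def iD_def i0_def mix_def
          ip_def ir_def ix_def iy_def is'_def it'_def iz_def\<close>)
    have XYZ: "X = symH ip is' e" "Y = mixH ix iy iz e" "Z = symH ir it' e"
      by (rule diagonal_inverse[OF HB[unfolded P K S] eps dg.relations(1,2) dg.relations_mixed(1) dg.relations(3,4)
          dg.relations_mixed(2) dg.relations(5,6) dg.relations_mixed(3) dg.relations(7) dg.relations_mixed(4)])+
    note R = ein_ric[OF E, unfolded P K S XYZ]
    note R' = ein_ric[OF ein_swap[OF E], unfolded P K S XYZ transpose_mix]
    have c: "g = l" if "eps * q + N * N * g = L * (eps * p' + N * N * s')" "q = L * p'" "l = L * s'"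
      for g q L p' s' l :: real
    proof -
      have "N * N * (g - l) = 0" using that by algebra
      then show ?thesis using N by simp
    qed
    note fold = ev[symmetric] eps_def[symmetric] N_def[symmetric]
    note v = blk_values[where ?e1.0 = e1 and ?e2.0 = e2, unfolded fold]
    have E1: "pl11 eps p s x y z ip is' ir it' ix iy iz = 2 * lam * p"
      using R(1)[of "vector [0, 0, 1]" "vector [0, 0, 1]"]
        blocks_ric_plane(1)[of p s e1 e2 x y z ip is' ix iy iz ir it', unfolded fold] v(1)[of p s] by simp
    have E2: "g11 eps p s x y z ip is' ir it' ix iy iz = 2 * lam * s"
      by (rule c[OF _ E1 refl])
        (use R(1)[of "dd e" "dd e"] blocks_ric11[of p s e1 e2 x y z ip is' ix iy iz ir it', unfolded fold] v(2)[of p s] in simp)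
    have E3: "pl11 eps r t x (- y) z ir it' ip is' ix (- iy) iz = 2 * lam * r"
      using R'(1)[of "vector [0, 0, 1]" "vector [0, 0, 1]"]
        blocks_ric_plane(1)[of r t e1 e2 x "- y" z ir it' ix "- iy" iz ip is', unfolded fold] v(1)[of r t] by simp
    have E4: "g11 eps r t x (- y) z ir it' ip is' ix (- iy) iz = 2 * lam * t"
      by (rule c[OF _ E3 refl])
        (use R'(1)[of "dd e" "dd e"] blocks_ric11[of r t e1 e2 x "- y" z ir it' ix "- iy" iz ip is', unfolded fold] v(2)[of r t] in simp)
    have E5: "pl12 eps p r x y z ip is' ir it' ix iy iz = 2 * lam * x"
      using R(2)[of "vector [0, 0, 1]" "vector [0, 0, 1]"]
        blocks_ric_plane(2)[of p s e1 e2 x y z r t ip is' ix iy iz ir it', unfolded fold] v(3)[of x y z] by simp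
    have E6: "th12 eps p r x y z ip is' ir it' ix iy iz = 2 * lam * y"
      using R(2)[of "vector [0, 0, 1]" "vector [- e2, e1, 0]"]
        blocks_ric12_rotation[of p s e1 e2 x y z r t ip is' ix iy iz ir it', unfolded fold] v(5)[of x y z] N by simp
    have E7: "g12 eps p s r t x y z ip is' ir it' ix iy iz = 2 * lam * z"
      by (rule c[OF _ E5 refl])
        (use R(2)[of "dd e" "dd e"] blocks_ric12[of p s e1 e2 x y z r t ip is' ix iy iz ir it', unfolded fold] v(4)[of x y z] in simp)
    have "s = 0 \<and> t = 0 \<and> n = 0 \<and> m \<noteq> 0"
      using dg.solve_nonnull[OF _ xy E1 E2 E3 E4 E5 E6 E7] dg.solve_null[OF _ xy E1 E2 E3 E4 E5 E6 E7] by blast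
    moreover from this have "K ** Dm ** transpose K = m *\<^sub>R Dm"
    proof -
      have "(K ** Dm ** transpose K) *v v = (m *\<^sub>R Dm) *v v" if "n = 0" for v
      proof -
        \<comment> \<open>The product with the operator in which \<open>y\<close> is negated is the
          norm \<open>m\<close> plus \<open>n\<close> times the rank-one term, so
          \<open>n = 0\<close> makes \<open>K\<close> conformal for \<open>Dm\<close>.\<close>
        have "opT e x y z (opT e x (- y) z v) = opT e m 0 n v"
          unfolding opT_compose eps[symmetric] by (simp add: m_def n_def algebra_simps)
        then show ?thesis
          unfolding K matrix_vector_mul_assoc[symmetric] blk_opT Dm_mult
          using that by (simp add: scaleR_matrix_vector_assoc[symmetric] Dm_mult opT_def linear_scale[OF linear_dd])
      qed
      then show ?thesis using \<open>s = 0 \<and> t = 0 \<and> n = 0 \<and> m \<noteq> 0\<close> by (simp add: matrix_eq)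
    qed
    ultimately show ?thesis
      using P S unfolding symE_def by (intro disjI2 exI[of _ p] exI[of _ r] exI[of _ m]) simp
  qed
qed

text \<open>A metric whose blocks are multiples of \<open>Dm\<close> is invariant under every
  diagonal generator, so \<open>e\<close> may be chosen at will. The null vector (1, 1, 0) has
  \<open>eps = 0\<close>, and the earlier polynomials shrink to \<open>p\<close>, \<open>r\<close>
  and \<open>x\<close>.\<close>

lemma einstein_tensor_form:
  assumes E: "ein lam (p *\<^sub>R Dm) (x *\<^sub>R Dm) (r *\<^sub>R Dm) X Y Z" and x: "x \<noteq> 0"
  shows "(p, r) \<in> {(- 2 * x, - 2 * x), (- x, - 2 * x), (- 2 * x, - x)}"
proof -
  define e :: vec3 where "e = vector [1, 1, 0]"
  have e: "e \<noteq> 0" "e $ 3 = 0" by (simp_all add: e_def vec_eq_iff forall_3)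
  have eps: "0 = e \<bullet> dd e" by (simp add: e_def v3)
  have F: "p *\<^sub>R Dm = symE p 0 e" "x *\<^sub>R Dm = mixE x 0 0 e" "r *\<^sub>R Dm = symE r 0 e"
    by (simp_all add: symE_def mixE_def)
  have HB: "\<And>v. bop X Y Z (bop (symE p 0 e) (mixE x 0 0 e) (symE r 0 e) v) = v"
      "\<And>v. bop (symE p 0 e) (mixE x 0 0 e) (symE r 0 e) (bop X Y Z v) = v"
    using E unfolding ein_def F by auto
  define Dl where "Dl = p * r - x * x"
  define iD where "iD = 1 / Dl"
  have nz: "Dl \<noteq> 0" using diagonal_nondegenerate(1)[OF HB(1) e eps] by (simp add: Dl_def)
  interpret dg: diagonal_scalars 0 p 0 r 0 x 0 0 "x * x" 0 p r x Dl Dl iD iD 0 "r * iD" 0 "p * iD" 0 "- (x * iD)" 0 0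
    by unfold_locales (use nz in \<open>simp_all add: Dl_def iD_def\<close>)
  have XYZ: "X = symH (r * iD) 0 e" "Y = mixH (- (x * iD)) 0 0 e" "Z = symH (p * iD) 0 e"
    by (rule diagonal_inverse[OF HB eps dg.relations(1,2) dg.relations_mixed(1) dg.relations(3,4)
          dg.relations_mixed(2) dg.relations(5,6) dg.relations_mixed(3) dg.relations(7) dg.relations_mixed(4)])+
  have R: "ric11 (symE p 0 e) (mixE x 0 0 e) X Y Z (vector [0, 0, 1]) (vector [0, 0, 1]) = - 2 * lam * p"
    "ric11 (symE r 0 e) (mixE x 0 0 e) Z Y X (vector [0, 0, 1]) (vector [0, 0, 1]) = - 2 * lam * r"
    "ric12 (symE p 0 e) (mixE x 0 0 e) (symE r 0 e) X Y Z (vector [0, 0, 1]) (vector [0, 0, 1]) = - 2 * lam * x"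
    using ein_ric[OF E, of "vector [0, 0, 1]" "vector [0, 0, 1]"]
      ein_ric(1)[OF ein_swap[OF E], of "vector [0, 0, 1]" "vector [0, 0, 1]"]
      blk_values(1)[of p 0 1 1] blk_values(1)[of r 0 1 1] blk_values(3)[of x 0 0 1 1]
    unfolding XYZ F transpose_mix e_def by simp_all
  have E1: "pl11 0 p 0 x 0 0 (r * iD) 0 (p * iD) 0 (- (x * iD)) 0 0 = 2 * lam * p"
    using R(1) blocks_ric_plane(1)[of p 0 1 1 x 0 0 "r * iD" 0 "- (x * iD)" 0 0 "p * iD" 0]
    unfolding XYZ e_def by simp
  have E3: "pl11 0 r 0 x (- 0) 0 (p * iD) 0 (r * iD) 0 (- (x * iD)) (- 0) 0 = 2 * lam * r"
    using R(2) blocks_ric_plane(1)[of r 0 1 1 x 0 0 "p * iD" 0 "- (x * iD)" 0 0 "r * iD" 0]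
    unfolding XYZ e_def by simp
  have E5: "pl12 0 p r x 0 0 (r * iD) 0 (p * iD) 0 (- (x * iD)) 0 0 = 2 * lam * x"
    using R(3) blocks_ric_plane(2)[of p 0 1 1 x 0 0 r 0 "r * iD" 0 "- (x * iD)" 0 0 "p * iD" 0]
    unfolding XYZ e_def by simp
  have p12: "p * r * (p + r + 2 * x) + x * Dl = 2 * lam * Dl * Dl"
    by (rule dg.eq12_plane[OF E5]) (use x in \<open>simp_all add: th12_def\<close>)
  have "Dl * (2 * Dl * Dl - p * r * Dl + p * (x * x) * (p + r + 2 * x) - 2 * lam * p * Dl * Dl) = 0"
    "Dl * (2 * Dl * Dl - r * p * Dl + r * (x * x) * (r + p + 2 * x) - 2 * lam * r * Dl * Dl) = 0"
    using dg.eq11_plane[OF E1] diagonal_scalars.eq11_plane[OF dg.swapped E3] nz by (auto simp: algebra_simps)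
  then have p11: "2 * Dl * Dl - p * r * Dl + p * (x * x) * (p + r + 2 * x) = 2 * lam * p * Dl * Dl"
    "2 * Dl * Dl - r * p * Dl + r * (x * x) * (r + p + 2 * x) = 2 * lam * r * Dl * Dl"
    using nz by simp_all
  have "Dl * ((p + x) * (p + 2 * x)) = 0" using p11(1) p12 Dl_def by algebra
  moreover have "Dl * ((r + x) * (r + 2 * x)) = 0" using p11(2) p12 Dl_def by algebra
  ultimately have "p = - x \<or> p = - 2 * x" "r = - x \<or> r = - 2 * x" using nz by auto
  then show ?thesis using nz Dl_def by auto
qed

section \<open>Left-invariant nearly pseudo-Kaehler structures\<close>

definition opJ :: "mat3 \<Rightarrow> mat3 \<Rightarrow> mat3 \<Rightarrow> mat3 \<Rightarrow> vec3 \<times> vec3 \<Rightarrow> vec3 \<times> vec3" where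
  "opJ A B C E v = (A *v fst v + B *v snd v, C *v fst v + E *v snd v)"

lemma linear_blocks:
  fixes f :: "vec3 \<times> vec3 \<Rightarrow> vec3 \<times> vec3"
  assumes f: "linear f"
  obtains A B C E where "f = opJ A B C E"
proof -
  have l: "linear (\<lambda>x. fst (f (x, 0)))" "linear (\<lambda>u. fst (f (0, u)))" "linear (\<lambda>x. snd (f (x, 0)))" "linear (\<lambda>u. snd (f (0, u)))"
    using linear_add[OF f, of "(_, 0)" "(_, 0)"] linear_scale[OF f, of _ "(_, 0)"]
      linear_add[OF f, of "(0, _)" "(0, _)"] linear_scale[OF f, of _ "(0, _)"]
    by (auto intro!: linearI simp: scaleR_Pair)
  have mw: "matrix g *v x = g x" if "linear g" for g :: "vec3 \<Rightarrow> vec3" and x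
    using matrix_vector_mul(2)[OF that] by (rule fun_cong)
  have "f = opJ (matrix (\<lambda>x. fst (f (x, 0)))) (matrix (\<lambda>u. fst (f (0, u))))
      (matrix (\<lambda>x. snd (f (x, 0)))) (matrix (\<lambda>u. snd (f (0, u))))"
  proof
    fix v
    have "f v = f (fst v, 0) + f (0, snd v)"
      using linear_add[OF f, of "(fst v, 0)" "(0, snd v)"] by simp
    also have "\<dots> = opJ (matrix (\<lambda>x. fst (f (x, 0)))) (matrix (\<lambda>u. fst (f (0, u))))
      (matrix (\<lambda>x. snd (f (x, 0)))) (matrix (\<lambda>u. snd (f (0, u)))) v"
      unfolding opJ_def mw[OF l(1)] mw[OF l(2)] mw[OF l(3)] mw[OF l(4)] by (simp add: prod_eq_iff)
    finally show "f v = opJ (matrix (\<lambda>x. fst (f (x, 0)))) (matrix (\<lambda>u. fst (f (0, u))))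
      (matrix (\<lambda>x. snd (f (x, 0)))) (matrix (\<lambda>u. snd (f (0, u)))) v" .
  qed
  then show ?thesis using that by blast
qed

text \<open>The Kaehler form of the pair \<open>B\<close>, \<open>J\<close>.\<close>

definition om :: "(vec3 \<times> vec3 \<Rightarrow> vec3 \<times> vec3) \<Rightarrow> (vec3 \<times> vec3 \<Rightarrow> vec3 \<times> vec3) \<Rightarrow> vec3 \<times> vec3 \<Rightarrow> vec3 \<times> vec3 \<Rightarrow> real" where
  "om B J v w = B v \<bullet> J w"

text \<open>Minus the exterior derivative of \<open>om\<close>, regarded as a left-invariant
  2-form.\<close>

definition rho :: "(vec3 \<times> vec3 \<Rightarrow> vec3 \<times> vec3) \<Rightarrow> (vec3 \<times> vec3 \<Rightarrow> vec3 \<times> vec3) \<Rightarrow> vec3 \<times> vec3 \<Rightarrow> vec3 \<times> vec3 \<Rightarrow> vec3 \<times> vec3 \<Rightarrow> real" where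
  "rho B J x y z = om B J (brV x y) z + om B J (brV y z) x + om B J (brV z x) y"

text \<open>The tensor \<open>b (X, (\<nabla>\<^sub>Y J) Z)\<close> is totally skew, hence equal to a third of the (negative) differential of \<open>om\<close>;
  it determines the Nijenhuis tensor.\<close>

lemma nearly_kaehler_tensors:
  fixes B J :: "vec3 \<times> vec3 \<Rightarrow> vec3 \<times> vec3" and G
  assumes B: "linear B" and J: "linear J" and G: "bilinear G"
    and sym: "\<And>v w. B v \<bullet> w = v \<bullet> B w" and J2: "\<And>v. J (J v) = - v" and orth: "\<And>v w. B (J v) \<bullet> J w = B v \<bullet> w"
    and tor: "\<And>x y. G x y - G y x = brV x y" and met: "\<And>x y z. B (G x y) \<bullet> z + B y \<bullet> G x z = 0"
    and nk: "\<And>x. G x (J x) = J (G x x)"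
  shows "om B J v w = - om B J w v" "om B J (J v) w = - om B J v (J w)"
    "rho B J (J x) y z = rho B J x (J y) z" "rho B J x (J y) z = rho B J x y (J z)"
    "3 * om B J z (brV (J x) (J y) - brV x y - J (brV (J x) y) - J (brV x (J y))) = 4 * rho B J x y z"
proof -
  define T where "T x y = G x (J y) - J (G x y)" for x y
  note Gl = bilinear_ladd[OF G] bilinear_radd[OF G] bilinear_lsub[OF G] bilinear_rsub[OF G] bilinear_lneg[OF G] bilinear_rneg[OF G]
  note Jl = linear_add[OF J] linear_diff[OF J] linear_neg[OF J]
  note Bl = linear_add[OF B] linear_diff[OF B] linear_neg[OF B]
  have sk: "B (J v) \<bullet> w = - (B v \<bullet> J w)" for v w
    using orth[of v "J w"] by (simp add: J2)
  have sym': "B v \<bullet> w = B w \<bullet> v" for v w using sym inner_commute by metis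
  have omsk: "om B J v w = - om B J w v" for v w
    unfolding om_def using sk[of w v] sym'[of v "J w"] by simp
  show "om B J v w = - om B J w v" by (rule omsk)
  show "om B J (J v) w = - om B J v (J w)" by (simp add: om_def sk)
  \<comment> \<open>Polarisation of \<open>nk\<close>.\<close>
  have Tsk: "T x y = - T y x" for x y
  proof -
    have "G (x + y) (J (x + y)) = J (G (x + y) (x + y))" by (rule nk)
    then have "G x (J y) + G y (J x) = J (G x y) + J (G y x)"
      using nk[of x] nk[of y] by (simp add: Gl Jl algebra_simps)
    then show ?thesis unfolding T_def by (simp add: algebra_simps)
  qed
  have TJ2: "T x (J y) = - J (T x y)" for x y
    by (simp add: T_def J2 Jl Gl)
  have TJ1: "T (J x) y = - J (T x y)" for x y
    using Tsk[of "J x" y] TJ2[of y x] Tsk[of y x] by (simp add: Jl)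
  have omG: "om B J (G x y) z + om B J y (G x z) = - (B y \<bullet> T x z)" for x y z
    using met[of x y "J z"] by (simp add: om_def T_def inner_diff_right)
  have T23: "B x \<bullet> T y z = - (B x \<bullet> T z y)" for x y z
    using Tsk[of y z] by simp
  have T13: "B x \<bullet> T y z = - (B z \<bullet> T y x)" for x y z
    using omG[of y x z] omG[of y z x] omsk[of "G y x" z] omsk[of x "G y z"] by simp
  have rho: "rho B J x y z = 3 * (B x \<bullet> T y z)" for x y z
  proof -
    have brG: "om B J (brV a b) c = om B J (G a b) c - om B J (G b a) c" for a b c
      unfolding tor[symmetric] by (simp add: om_def Bl inner_diff_left)
    show ?thesis
      unfolding rho_def brG
      using omG[of x y z] omG[of y z x] omG[of z x y] omsk[of y "G x z"] omsk[of z "G y x"] omsk[of x "G z y"]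
        T23[of x y z] T23[of y z x] T23[of z x y] T13[of x y z] T13[of y z x] T13[of z x y] by linarith
  qed
  show "rho B J x (J y) z = rho B J x y (J z)" by (simp add: rho TJ1 TJ2)
  show "rho B J (J x) y z = rho B J x (J y) z" by (simp add: rho TJ1 sk)
  \<comment> \<open>The Nijenhuis tensor: with brackets written by \<open>tor\<close> it is a sum of
    four terms in \<open>T\<close>, which the type rules \<open>TJ1\<close> and \<open>Tsk\<close>
    make equal.\<close>
  have N: "brV (J x) (J y) - brV x y - J (brV (J x) y) - J (brV x (J y)) = - 4 *\<^sub>R J (T x y)"
  proof -
    have "brV (J x) (J y) - brV x y - J (brV (J x) y) - J (brV x (J y)) =
        T (J x) y - T (J y) x + J (T y x) - J (T x y)"
      unfolding tor[symmetric] T_def by (simp add: Jl J2 Gl algebra_simps)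
    also have "\<dots> = - 4 *\<^sub>R J (T x y)"
    proof -
      have "- w - w - w - w = - (4 *\<^sub>R w)" for w :: "vec3 \<times> vec3"
        by (simp add: prod_eq_iff vec_eq_iff)
      then show ?thesis
        using TJ1[of x y] TJ1[of y x] Tsk[of y x] by (simp add: Jl)
    qed
    finally show ?thesis .
  qed
  have "om B J z (- 4 *\<^sub>R J (T x y)) = 4 * (B z \<bullet> T x y)"
    by (simp add: om_def linear_scale[OF J] Jl J2)
  moreover have "B z \<bullet> T x y = B x \<bullet> T y z"
    using T13[of z x y] T23[of y x z] T13[of y z x] T23[of x z y] by linarith
  ultimately show "3 * om B J z (brV (J x) (J y) - brV x y - J (brV (J x) y) - J (brV x (J y))) = 4 * rho B J x y z"
    unfolding N rho by simp
qed

text \<open>The derivative of \<open>cross_cof\<close> at the identity matrix.\<close>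

lemma cross_linear_sum: "(A *v x) \<times> y + x \<times> (A *v y) = trace A *\<^sub>R (x \<times> y) - transpose A *v (x \<times> y)"
  by (simp add: v3 trace_def algebra_simps)

lemma cross_cof: "(A *v x) \<times> (A *v y) = cofm A *v (x \<times> y)"
  by (simp add: v3 cofm_def algebra_simps)

lemma cofm_transpose_mult: "cofm A ** transpose A = det A *\<^sub>R mat 1" "transpose A ** cofm A = det A *\<^sub>R mat 1"
  by (simp_all add: v3 cofm_def det_3 mat_def algebra_simps)

lemma cyclic_scalar:
  assumes "\<And>x y z. (y \<times> z) \<bullet> (R *v x) = (z \<times> x) \<bullet> (R *v y)"
  shows "\<exists>q. R = q *\<^sub>R mat 1"
proof -
  have z: "(x \<times> z) \<bullet> (R *v x) = 0" for x z
    using assms[of x z x] cross_skew[of z x] by simp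
  have "R = (R $ 1 $ 1) *\<^sub>R mat 1"
    using z[of "axis 1 1" "axis 2 1"] z[of "axis 1 1" "axis 3 1"] z[of "axis 2 1" "axis 1 1"]
      z[of "axis 2 1" "axis 3 1"] z[of "axis 3 1" "axis 1 1"] z[of "axis 3 1" "axis 2 1"]
      assms[of "axis 2 1" "axis 3 1" "axis 1 1"] assms[of "axis 3 1" "axis 1 1" "axis 2 1"]
    by (simp add: v3 mat_def)
  then show ?thesis ..
qed

text \<open>The hypothesis makes \<open>X\<close> self-adjoint for every skew form y \<bullet> (z
  \<times> x), which in dimension three only scalars are.\<close>

lemma cross_commuting_scalar:
  assumes "\<And>z x. z \<times> (X *v x) = transpose X *v (z \<times> x)"
  shows "\<exists>q. X = q *\<^sub>R mat 1"
proof -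
  have "X = (X $ 1 $ 1) *\<^sub>R mat 1"
    using assms[of "axis 1 1" "axis 1 1"] assms[of "axis 2 1" "axis 2 1"] assms[of "axis 3 1" "axis 3 1"]
      assms[of "axis 1 1" "axis 2 1"] assms[of "axis 1 1" "axis 3 1"] assms[of "axis 2 1" "axis 3 1"]
    by (simp add: v3 mat_def)
  then show ?thesis ..
qed

lemma adj3: "(A *v x) \<bullet> y = x \<bullet> (transpose A *v y)" for A :: mat3
  by (simp add: v3 algebra_simps)

lemma cross3_diff_left: "(a - b) \<times> c = a \<times> c - b \<times> c"
  and cross3_diff_right: "c \<times> (a - b) = c \<times> a - c \<times> b"
  by (simp_all add: v3 algebra_simps)

lemma dot_cross_adj: "(z \<times> w) \<bullet> y = w \<bullet> (y \<times> z)"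
  by (simp add: v3 algebra_simps)

lemma matrix_eq_inner: "(\<And>x y. x \<bullet> (A *v y) = x \<bullet> (B *v y)) \<Longrightarrow> A = (B :: mat3)"
  using vector_eq_ldot by (simp only: matrix_eq) blast

lemma skew_vector:
  assumes "\<And>x y. x \<bullet> (W *v y) = - (y \<bullet> (W *v x))"
  shows "\<exists>a. \<forall>x y. x \<bullet> (W *v y) = a \<bullet> (x \<times> y)"
proof -
  have "W $ i $ j = - W $ j $ i" for i j
    using assms[of "axis i 1" "axis j 1"] by (simp add: inner_axis' matrix_vector_mult_basis column_def)
  from this[of 1 1] this[of 2 2] this[of 3 3] this[of 1 2] this[of 1 3] this[of 2 3]
  have "x \<bullet> (W *v y) = vector [W $ 2 $ 3, W $ 3 $ 1, W $ 1 $ 2] \<bullet> (x \<times> y)" for x y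
    by (simp add: v3 algebra_simps)
  then show ?thesis by blast
qed

text \<open>a \<bullet> (x \<times> y) is a linear function of the bracket, that is an exact 2-form,
  hence closed. Therefore only the mixed block of \<open>om\<close> enters
  \<open>rho\<close>.\<close>

lemma jacobi_dot: "a \<bullet> (br3 x y \<times> z) + a \<bullet> (br3 y z \<times> x) + a \<bullet> (br3 z x \<times> y) = 0"
  by (simp add: v3 algebra_simps)

text \<open>The type conditions on \<open>rho\<close> determine \<open>J\<close> through the mixed
  block \<open>M\<close> of the Kaehler form; the vectors \<open>a\<close> and \<open>b\<close> of
  its diagonal blocks turn out to be 0. Then J J = -1 and the Nijenhuis identity give Y = D M D M^T
  a quadratic equation with linear coefficient trace Y / 2, so \<open>Y\<close> is scalar and
  \<open>M\<close> is conformal for \<open>Dm\<close>.\<close>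

lemma nearly_kaehler_form:
  fixes P K S X Y Z :: mat3 and J G
  assumes sy: "transpose P = P" "transpose S = S"
    and HB: "\<And>v. bop X Y Z (bop P K S v) = v" "\<And>v. bop P K S (bop X Y Z v) = v"
    and J: "linear J" and G: "bilinear G" and J2: "\<And>v. J (J v) = - v"
    and orth: "\<And>v w. bop P K S (J v) \<bullet> J w = bop P K S v \<bullet> w"
    and tor: "\<And>x y. G x y - G y x = brV x y"
    and met: "\<And>x y z. bop P K S (G x y) \<bullet> z + bop P K S y \<bullet> G x z = 0"
    and nk: "\<And>x. G x (J x) = J (G x x)"
  shows "\<exists>p T. p \<noteq> 0 \<and> det T = 1 \<and> T ** Dm ** transpose T = Dm \<and>
    P = p *\<^sub>R Dm \<and> S = p *\<^sub>R Dm \<and> K = - (p / 2) *\<^sub>R T"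
proof -
  let ?B = "bop P K S"
  note tens = nearly_kaehler_tensors[where B = ?B and J = J and G = G, OF linear_bop J G bop_sym[OF sy] J2 orth tor met nk]
  obtain A B C E where JJ: "J = opJ A B C E" using linear_blocks[OF J] .
  have J0: "J (x, u) = (A *v x + B *v u, C *v x + E *v u)" for x u by (simp add: JJ opJ_def)
  define M where "M = P ** B + K ** E"
  have skew: "om ?B J v w = - om ?B J w v" for v w by (rule tens(1))
  have M: "om ?B J (x, 0) (0, u) = x \<bullet> (M *v u)" for x u
    by (simp add: om_def J0 bop_def M_def adj3 sy matrix_vector_mult_add_rdistrib matrix_vector_mul_assoc[symmetric]
        inner_add_right)
  obtain a where a: "om ?B J (x, 0) (y, 0) = a \<bullet> (x \<times> y)" for x y
  proof -
    have e: "om ?B J (x, 0) (y, 0) = x \<bullet> ((P ** A + K ** C) *v y)" for x y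
      by (simp add: om_def J0 bop_def adj3 sy matrix_vector_mult_add_rdistrib matrix_vector_mul_assoc[symmetric]
          inner_add_right)
    have "\<exists>a. \<forall>x y. x \<bullet> ((P ** A + K ** C) *v y) = a \<bullet> (x \<times> y)"
      by (rule skew_vector) (simp only: e[symmetric], rule skew)
    then show ?thesis using that e by auto
  qed
  obtain b where b: "om ?B J (0, u) (0, v) = b \<bullet> (u \<times> v)" for u v
  proof -
    have e: "om ?B J (0, u) (0, v) = u \<bullet> ((transpose K ** B + S ** E) *v v)" for u v
      by (simp add: om_def J0 bop_def adj3 sy matrix_vector_mult_add_rdistrib matrix_vector_mul_assoc[symmetric]
          inner_add_right)
    have "\<exists>a. \<forall>x y. x \<bullet> ((transpose K ** B + S ** E) *v y) = a \<bullet> (x \<times> y)"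
      by (rule skew_vector) (simp only: e[symmetric], rule skew)
    then show ?thesis using that e by auto
  qed
  have OM: "om ?B J (x, u) (y, v) = a \<bullet> (x \<times> y) + x \<bullet> (M *v v) - y \<bullet> (M *v u) + b \<bullet> (u \<times> v)" for x u y v
  proof -
    have "(x, u) = (x, 0) + (0, u)" "(y, v) = (y, 0) + (0, v)" by simp_all
    then have "om ?B J (x, u) (y, v) = om ?B J (x, 0) (y, 0) + om ?B J (x, 0) (0, v)
        + om ?B J (0, u) (y, 0) + om ?B J (0, u) (0, v)"
      unfolding om_def using linear_add[OF linear_bop[of P K S]] linear_add[OF J]
      by (metis (no_types, lifting) inner_add_left inner_add_right add.assoc)
    then show ?thesis using skew[of "(0, u)" "(y, 0)"] by (simp add: a b M)
  qed
  have RHO: "rho ?B J (x, u) (y, v) (z, w) = (br3 x y \<bullet> (M *v w) + br3 y z \<bullet> (M *v u) + br3 z x \<bullet> (M *v v))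
      - (z \<bullet> (M *v br3 u v) + x \<bullet> (M *v br3 v w) + y \<bullet> (M *v br3 w u))" for x u y v z w
    unfolding rho_def brV_def fst_conv snd_conv OM
    using jacobi_dot[of a x y z] jacobi_dot[of b u v w] by linarith
  have b0: "br3 0 x = 0" "br3 x 0 = 0" "A' *v 0 = 0" for x and A' :: mat3 by (simp_all add: v3)
  have "?B v = 0 \<Longrightarrow> v = 0" for v using HB(1)[of v] linear_0[OF linear_bop] by simp
  moreover have JJv: "om ?B J v (J w) = - (?B v \<bullet> w)" for v w by (simp add: om_def J2)
  ultimately have nondeg: "v = 0" if "\<And>w. om ?B J v w = 0" for v
    using that by (metis inner_eq_zero_iff neg_equal_0_iff_equal)
  have br_anti: "br3 y x = - br3 x y" for x y by (simp add: v3)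
  note T3 = tens(3) and T4 = tens(4)
  \<comment> \<open>With three arguments from the first factor \<open>rho\<close> only sees
    \<open>M ** C\<close>, and the type condition becomes cyclic invariance.\<close>
  obtain q where q: "M ** C = q *\<^sub>R Dm"
  proof -
    have "(y \<times> z) \<bullet> ((Dm ** (M ** C)) *v x) = (z \<times> x) \<bullet> ((Dm ** (M ** C)) *v y)" for x y z
      using T3[of "(x, 0)" "(y, 0)" "(z, 0)"]
      by (simp add: J0 RHO b0 matrix_vector_mul_assoc[symmetric] Dm_mult dd_inner[symmetric] br3_def[symmetric])
    then obtain q where "Dm ** (M ** C) = q *\<^sub>R mat 1" using cyclic_scalar by blast
    then have "Dm ** (Dm ** (M ** C)) = q *\<^sub>R Dm" by (simp add: mult_scaleR_matrix)
    then have "M ** C = q *\<^sub>R Dm" by simp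
    then show ?thesis by (rule that)
  qed
  obtain q' where q': "transpose M ** B = q' *\<^sub>R Dm"
  proof -
    have m: "(y \<times> z) \<bullet> ((Dm ** (transpose M ** B)) *v x) = (B *v x) \<bullet> (M *v br3 y z)" for x y z
      using adj3[of M "dd (y \<times> z)" "B *v x"] dd_inner[of "y \<times> z"]
      by (simp add: matrix_vector_mul_assoc[symmetric] Dm_mult br3_def inner_commute[of "B *v x"])
    have "(y \<times> z) \<bullet> ((Dm ** (transpose M ** B)) *v x) = (z \<times> x) \<bullet> ((Dm ** (transpose M ** B)) *v y)" for x y z
      using T3[of "(0, x)" "(0, y)" "(0, z)"] unfolding m by (simp add: J0 RHO b0)
    then obtain q where "Dm ** (transpose M ** B) = q *\<^sub>R mat 1" using cyclic_scalar by blast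
    then have "Dm ** (Dm ** (transpose M ** B)) = q *\<^sub>R Dm" by (simp add: mult_scaleR_matrix)
    then have "transpose M ** B = q *\<^sub>R Dm" by simp
    then show ?thesis by (rule that)
  qed
  \<comment> \<open>Here \<open>J\<close> is moved from the first argument of \<open>rho\<close> to
    the third.\<close>
  have f1: "br3 (A *v x) y \<bullet> (M *v u) - y \<bullet> (M *v br3 u (C *v x)) = br3 x y \<bullet> (M *v (E *v u))" for x y u
    using T3[of "(x, 0)" "(y, 0)" "(0, u)"] T4[of "(x, 0)" "(y, 0)" "(0, u)"]
    by (simp add: J0 RHO b0)
  have f2: "br3 x (B *v u) \<bullet> (M *v v) - x \<bullet> (M *v br3 (E *v u) v) = - ((A *v x) \<bullet> (M *v br3 u v))" for x u v
    using T3[of "(0, u)" "(0, v)" "(x, 0)"] T4[of "(0, u)" "(0, v)" "(x, 0)"]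
    by (simp add: J0 RHO b0)
  \<comment> \<open>\<open>J\<close> is skew for \<open>om\<close>. The terms with \<open>C\<close>
    cancel because \<open>M ** C\<close> is symmetric, and the rest says that \<open>a\<close> is an
    eigenvector of \<open>A\<close>.\<close>
  have aA: "A *v a = trace A *\<^sub>R a"
  proof -
    have "a \<bullet> ((A *v x) \<times> y + x \<times> (A *v y)) = 0" for x y
    proof -
      have "om ?B J (J (x, 0)) (y, 0) = - om ?B J (x, 0) (J (y, 0))" by (rule tens(2))
      moreover have "y \<bullet> (M *v (C *v x)) = x \<bullet> (M *v (C *v y))"
        unfolding matrix_vector_mul_assoc q by (simp add: v3)
      ultimately show ?thesis by (simp add: J0 OM b0 cross_zero_left cross_zero_right inner_add_right)
    qed
    then have "(trace A *\<^sub>R a - A *v a) \<bullet> (x \<times> y) = 0" for x y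
      unfolding cross_linear_sum by (simp add: inner_diff_left inner_diff_right adj3)
    from this[of "axis 2 1" "axis 3 1"] this[of "axis 3 1" "axis 1 1"] this[of "axis 1 1" "axis 2 1"]
    show ?thesis by (simp add: cross3_def inner_vec_def sum_3 vec_eq_iff forall_3)
  qed
  have bE: "E *v b = trace E *\<^sub>R b"
  proof -
    have "b \<bullet> ((E *v x) \<times> y + x \<times> (E *v y)) = 0" for x y
    proof -
      have "om ?B J (J (0, x)) (0, y) = - om ?B J (0, x) (J (0, y))" by (rule tens(2))
      moreover have "(B *v x) \<bullet> (M *v y) = (B *v y) \<bullet> (M *v x)"
      proof -
        have "(B *v x) \<bullet> (M *v y) = ((transpose M ** B) *v x) \<bullet> y" for x y
          by (simp add: adj3 matrix_vector_mul_assoc[symmetric])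
        then show ?thesis unfolding q' by (simp add: v3)
      qed
      ultimately show ?thesis by (simp add: J0 OM b0 cross_zero_left cross_zero_right inner_add_right)
    qed
    then have "(trace E *\<^sub>R b - E *v b) \<bullet> (x \<times> y) = 0" for x y
      unfolding cross_linear_sum by (simp add: inner_diff_left inner_diff_right adj3)
    from this[of "axis 2 1" "axis 3 1"] this[of "axis 3 1" "axis 1 1"] this[of "axis 1 1" "axis 2 1"]
    show ?thesis by (simp add: cross3_def inner_vec_def sum_3 vec_eq_iff forall_3)
  qed
  have J2A: "A ** A + B ** C = - mat 1"
  proof -
    have "A *v (A *v x) + B *v (C *v x) = - x" for x
      using J2[of "(x, 0)"] by (simp add: J0 b0)
    then show ?thesis
      by (simp add: matrix_eq matrix_vector_mult_add_rdistrib matrix_vector_mul_assoc[symmetric])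
        (simp add: v3 mat_def)
  qed
  define d where "d = det M"
  \<comment> \<open>If \<open>M\<close> were singular then \<open>q' = 0\<close>, and J J = -1
    applied to \<open>a\<close> gives ((trace A)^2 + 1) M^T a = 0. So M^T a = 0 and
    \<open>a = 0\<close>, after which a kernel vector of M^T lies in the kernel of the nondegenerate
    form \<open>om\<close>.\<close>
  have d0: "d \<noteq> 0"
  proof
    assume d: "d = 0"
    have dD: "det Dm = 1" by (simp add: Dm_def det_3)
    have "q' = 0"
    proof -
      have "det (transpose M ** B) = 0" using d by (simp add: det_mul d_def)
      then show ?thesis unfolding q' by (simp add: Dm_def det_3)
    qed
    then have "transpose M *v (B *v v) = 0" for v
      using q' by (simp add: matrix_vector_mul_assoc)
    moreover have "A *v (A *v a) + B *v (C *v a) = - a"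
      using J2[of "(a, 0)"] by (simp add: J0 b0)
    then have "transpose M *v (A *v (A *v a) + B *v (C *v a)) = transpose M *v (- a)" by simp
    ultimately have "((trace A)\<^sup>2 + 1) *\<^sub>R (transpose M *v a) = 0"
      by (simp add: matrix_vector_right_distrib aA matrix_vector_mult_scaleR power2_eq_square scaleR_add_left
          linear_neg[OF matrix_vector_mul_linear])
    moreover have "(trace A)\<^sup>2 + 1 \<noteq> 0" using zero_le_power2[of "trace A"] by linarith
    ultimately have "transpose M *v a = 0" by simp
    then have ker: "om ?B J (a, 0) w = 0" for w
    proof -
      have "a \<bullet> (M *v snd w) = 0"
        using \<open>transpose M *v a = 0\<close> adj3[of "transpose M" a "snd w"] by simp
      then show ?thesis by (cases w) (simp add: OM b0 cross_zero_left dot_cross_self)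
    qed
    have "a = 0" using nondeg[OF ker] by (simp add: prod_eq_iff)
    obtain m where m: "m \<noteq> 0" "transpose M *v m = 0"
      using det_0_kernel[of "transpose M"] d by (auto simp: d_def)
    have "om ?B J (m, 0) w = 0" for w
    proof -
      have "m \<bullet> (M *v snd w) = 0"
        using m adj3[of "transpose M" m "snd w"] by simp
      then show ?thesis using \<open>a = 0\<close> by (cases w) (simp add: OM b0 cross_zero_left dot_cross_self)
    qed
    from nondeg[OF this] show False using m by (simp add: prod_eq_iff)
  qed
  obtain Mi where Mi: "M ** Mi = mat 1" "Mi ** M = mat 1"
    using d0 invertible_det_nz[of M] unfolding invertible_def d_def by auto
  have MiT: "transpose Mi ** transpose M = mat 1" "transpose M ** transpose Mi = mat 1"
    using Mi by (metis matrix_transpose_mul transpose_mat)+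
  have dMi: "d * det Mi = 1" using Mi(1) det_mul[of M Mi] by (simp add: d_def)
  have mv: "M *v (Mi *v v) = v" "Mi *v (M *v v) = v" "transpose Mi *v (transpose M *v v) = v"
    "transpose M *v (transpose Mi *v v) = v" for v
    using Mi MiT by (simp_all add: matrix_vector_mul_assoc)
  have cofMi: "cofm Mi *v v = (1 / d) *\<^sub>R (transpose M *v v)"
    "cofm (transpose Mi) *v v = (1 / d) *\<^sub>R (M *v v)" for v
  proof -
    have "det Mi = 1 / d" using dMi d0 by (simp add: field_simps)
    then have "(cofm Mi ** transpose Mi) *v (transpose M *v v) = (1 / d) *\<^sub>R (transpose M *v v)"
      "(cofm (transpose Mi) ** transpose (transpose Mi)) *v (M *v v) = (1 / d) *\<^sub>R (M *v v)"
      unfolding cofm_transpose_mult by (simp_all add: scaleR_matrix_vector_assoc[symmetric])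
    then show "cofm Mi *v v = (1 / d) *\<^sub>R (transpose M *v v)"
      "cofm (transpose Mi) *v v = (1 / d) *\<^sub>R (M *v v)"
      by (simp_all add: matrix_vector_mul_assoc[symmetric] mv)
  qed
  define ka where "ka = q / d"
  have qka: "q = ka * d" using d0 by (simp add: ka_def)
  \<comment> \<open>\<open>Y\<close> and \<open>Y2\<close> are \<open>Dm ** M\<close> composed with
    its \<open>Dm\<close>-adjoint, in either order.\<close>
  define Y where "Y = Dm ** M ** Dm ** transpose M"
  define Y2 where "Y2 = Dm ** transpose M ** Dm ** M"
  have tD: "transpose Dm = Dm" by (simp add: v3)
  have YT: "transpose Y = M ** Dm ** transpose M ** Dm"
    by (simp add: Y_def matrix_transpose_mul tD matrix_mul_assoc)
  have Yv: "Y *v v = dd (M *v dd (transpose M *v v))" "transpose Y *v v = M *v dd (transpose M *v dd v)"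
    "Y2 *v v = dd (transpose M *v dd (M *v v))" for v
    unfolding YT unfolding Y_def Y2_def by (simp_all add: matrix_vector_mul_assoc[symmetric] Dm_mult)
  have ddc: "dd x \<times> dd y = dd (x \<times> y)" for x y by (simp add: v3)
  have dds: "dd (c *\<^sub>R x) = c *\<^sub>R dd x" "dd (- x) = - dd x" "dd (x - y) = dd x - dd y" for c x y
    using linear_dd by (simp_all add: linear_scale linear_neg linear_diff)
  have Cx: "C *v x = q *\<^sub>R (Mi *v dd x)" for x
  proof -
    have "M *v (C *v x) = q *\<^sub>R dd x"
      using q by (simp add: matrix_vector_mul_assoc scaleR_matrix_vector_assoc[symmetric] Dm_mult)
    then show ?thesis by (metis mv(2) matrix_vector_mult_scaleR)
  qed
  have Bu: "B *v u = q' *\<^sub>R (transpose Mi *v dd u)" for u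
  proof -
    have "transpose M *v (B *v u) = q' *\<^sub>R dd u"
      using q' by (simp add: matrix_vector_mul_assoc scaleR_matrix_vector_assoc[symmetric] Dm_mult)
    then show ?thesis by (metis mv(3) matrix_vector_mult_scaleR)
  qed
  have cross0: "w = 0" if "\<And>x. w \<times> x = 0" for w
    using that[of "axis 1 1"] that[of "axis 2 1"] by (simp add: cross3_def vec_eq_iff forall_3)
  have inner0: "v = w" if "\<And>y. y \<bullet> v = y \<bullet> w" for v w :: vec3
    using that vector_eq_ldot by blast
  define E2 where "E2 z = dd (M *v (E *v (Mi *v dd z)))" for z
  \<comment> \<open>This is \<open>f1\<close> with \<open>C\<close> eliminated. The right side,
    paired with \<open>y\<close>, is skew in \<open>x\<close> and \<open>y\<close>; that is what
    isolates \<open>A + ka *\<^sub>R Y\<close> next.\<close>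
  have star: "z \<times> (A *v x) - ka *\<^sub>R (transpose Y *v (z \<times> x)) = E2 z \<times> x" for z x
  proof (rule inner0)
    fix y
    have "br3 (Mi *v dd z) (C *v x) = ka *\<^sub>R dd (transpose M *v dd (z \<times> x))"
      unfolding br3_def Cx cross_mult_right cross_cof cofMi ddc by (simp add: dds ka_def)
    then have "y \<bullet> (z \<times> (A *v x)) - y \<bullet> (ka *\<^sub>R (transpose Y *v (z \<times> x))) = (x \<times> y) \<bullet> E2 z"
      using f1[of x y "Mi *v dd z"]
      by (simp add: mv br3_def dd_inner E2_def Yv matrix_vector_mult_scaleR dot_cross_adj[of "A *v x"])
    then show "y \<bullet> (z \<times> (A *v x) - ka *\<^sub>R (transpose Y *v (z \<times> x))) = y \<bullet> (E2 z \<times> x)"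
      by (simp add: inner_diff_right dot_cross_adj)
  qed
  obtain t0 where t0: "A + ka *\<^sub>R Y = t0 *\<^sub>R mat 1"
  proof -
    have "z \<times> ((A + ka *\<^sub>R Y) *v x) = transpose (A + ka *\<^sub>R Y) *v (z \<times> x)" for z x
    proof (rule inner0)
      fix y
      have tr: "y \<bullet> (transpose F *v w) = (F *v y) \<bullet> w" for F :: mat3 and w by (simp add: adj3)
      have sk: "p \<bullet> (z \<times> r) = - (r \<bullet> (z \<times> p))" for p r by (simp add: v3 algebra_simps)
      have "y \<bullet> (E2 z \<times> x) + x \<bullet> (E2 z \<times> y) = 0" by (simp add: v3 algebra_simps)
      then have "y \<bullet> (z \<times> (A *v x)) - ka * ((Y *v y) \<bullet> (z \<times> x)) + (x \<bullet> (z \<times> (A *v y)) - ka * ((Y *v x) \<bullet> (z \<times> y))) = 0"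
        unfolding star[symmetric] by (simp add: inner_diff_right adj3)
      then have "y \<bullet> (z \<times> (A *v x)) + ka * (y \<bullet> (z \<times> (Y *v x))) = (A *v y) \<bullet> (z \<times> x) + ka * ((Y *v y) \<bullet> (z \<times> x))"
        using sk[of x "A *v y"] sk[of "Y *v x" y] by simp
      then show "y \<bullet> (z \<times> ((A + ka *\<^sub>R Y) *v x)) = y \<bullet> (transpose (A + ka *\<^sub>R Y) *v (z \<times> x))"
        unfolding tr by (simp add: matrix_vector_mult_add_rdistrib scaleR_matrix_vector_assoc[symmetric]
            cross_add_right cross_mult_right inner_add_left inner_add_right)
    qed
    then show ?thesis using cross_commuting_scalar that by blast
  qed
  have Ax: "A *v x = t0 *\<^sub>R x - ka *\<^sub>R (Y *v x)" for x
  proof -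
    have "(A + ka *\<^sub>R Y) *v x = t0 *\<^sub>R x" unfolding t0 by (simp add: scaleR_matrix_vector_assoc[symmetric])
    then show ?thesis by (simp add: matrix_vector_mult_add_rdistrib scaleR_matrix_vector_assoc[symmetric] algebra_simps)
  qed
  have E2z: "E2 z = (t0 - ka * trace Y) *\<^sub>R z + ka *\<^sub>R (Y *v z)" for z
  proof -
    have "(E2 z - ((t0 - ka * trace Y) *\<^sub>R z + ka *\<^sub>R (Y *v z))) \<times> x = 0" for x
    proof -
      have h: "(Y *v z) \<times> x + z \<times> (Y *v x) + transpose Y *v (z \<times> x) = trace Y *\<^sub>R (z \<times> x)"
        using cross_linear_sum[of Y z x] by simp
      have "ka *\<^sub>R ((Y *v z) \<times> x) + ka *\<^sub>R (z \<times> (Y *v x)) + ka *\<^sub>R (transpose Y *v (z \<times> x)) = (ka * trace Y) *\<^sub>R (z \<times> x)"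
        using arg_cong[OF h, of "\<lambda>v. ka *\<^sub>R v"] by (simp only: scaleR_add_right scaleR_scaleR)
      then show ?thesis
        unfolding cross3_diff_left star[symmetric] Ax
        by (simp add: cross_add_left cross3_diff_left cross_mult_left cross_mult_right cross3_diff_right algebra_simps)
    qed
    then show ?thesis using cross0 by fastforce
  qed
  have MEu: "M *v (E *v u) = (t0 - ka * trace Y) *\<^sub>R (M *v u) + ka *\<^sub>R (M *v (Y2 *v u))" for u
  proof -
    have "dd (E2 (dd (M *v u))) = M *v (E *v u)" by (simp add: E2_def mv)
    then show ?thesis
      using E2z[of "dd (M *v u)"] by (simp add: Yv dd_add dds)
  qed
  have Eu: "E *v u = (t0 - ka * trace Y) *\<^sub>R u + ka *\<^sub>R (Y2 *v u)" for u
    using arg_cong[OF MEu[of u], of "\<lambda>v. Mi *v v"]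
    by (simp add: mv matrix_vector_right_distrib matrix_vector_mult_scaleR)
  have trY2: "trace Y2 = trace Y"
    by (simp add: Y_def Y2_def v3 trace_def algebra_simps)
  have EA: "A = t0 *\<^sub>R mat 1 - ka *\<^sub>R Y" "E = (t0 - ka * trace Y) *\<^sub>R mat 1 + ka *\<^sub>R Y2"
    using Ax Eu by (simp_all add: matrix_eq matrix_vector_mult_add_rdistrib matrix_vector_mult_diff_rdistrib
        scaleR_matrix_vector_assoc[symmetric])
  define t where "t = trace Y / 2"
  have trA: "trace A = 3 * t0 - 2 * ka * t" and trE: "trace E = 3 * t0 - 4 * ka * t"
  proof -
    have l: "trace (c *\<^sub>R mat 1 + c' *\<^sub>R F) = 3 * c + c' * trace F" "trace (c *\<^sub>R mat 1 - c' *\<^sub>R F) = 3 * c - c' * trace F"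
      for c c' and F :: mat3
      by (simp_all add: trace_def sum_3 mat_def algebra_simps)
    have "trace A = 3 * t0 - ka * trace Y" "trace E = 3 * (t0 - ka * trace Y) + ka * trace Y"
      unfolding EA by (simp_all only: l trY2)
    then show "trace A = 3 * t0 - 2 * ka * t" "trace E = 3 * t0 - 4 * ka * t"
      by (simp_all add: t_def algebra_simps)
  qed
  \<comment> \<open>\<open>J\<close> is skew for the metric, so its trace vanishes; this fixes the
    remaining scalar \<open>t0\<close>.\<close>
  have "tr J = 0"
  proof -
    have "tr J = tr (\<lambda>v. - J v)"
    proof (rule tr_adjoint[OF J linear_compose_neg[OF J] linear_bop linear_bop HB bop_sym[OF sy]])
      show "?B (J x) \<bullet> y = ?B x \<bullet> - J y" for x y
        using orth[of x "J y"] by (simp add: J2)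
    qed
    then show ?thesis using tr_scale[of "-1" J] by simp
  qed
  moreover have "tr J = trace A + trace E"
    unfolding tr_pair tr_vec3 by (simp add: J0 b0 v3 trace_def)
  ultimately have t0t: "t0 = ka * t" using trA trE by simp
  have ka0: "ka \<noteq> 0"
  proof
    assume "ka = 0"
    then have "J (axis 1 1, 0) = 0" using t0t qka by (simp add: J0 Ax Cx b0 prod_eq_iff)
    have "J (J (axis 1 1, 0)) = 0" using \<open>J (axis 1 1, 0) = 0\<close> linear_0[OF J] by simp
    then have "(axis 1 1 :: vec3, 0 :: vec3) = 0" unfolding J2 by (simp only: neg_equal_0_iff_equal)
    then show False by (simp add: prod_eq_iff)
  qed
  have Yinj: "v = 0" if "Y *v v = 0" for v
  proof -
    have "M *v dd (transpose M *v v) = 0" using that unfolding Yv by (metis dd_dd linear_0 linear_dd)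
    then have "dd (transpose M *v v) = 0" by (metis mv(2) b0(3))
    then have "transpose M *v v = 0" by (metis dd_dd linear_0 linear_dd)
    then show ?thesis by (metis mv(3) b0(3))
  qed
  have Y2inj: "v = 0" if "Y2 *v v = 0" for v
  proof -
    have "transpose M *v dd (M *v v) = 0" using that unfolding Yv by (metis dd_dd linear_0 linear_dd)
    then have "dd (M *v v) = 0" by (metis mv(3) b0(3))
    then have "M *v v = 0" by (metis dd_dd linear_0 linear_dd)
    then show ?thesis by (metis mv(2) b0(3))
  qed
  \<comment> \<open>The eigenvalue of \<open>A\<close> on \<open>a\<close> is
    \<open>trace A\<close>, which is now \<open>ka * t\<close>; expressing \<open>A\<close> by
    \<open>Y\<close> leaves only this term.\<close>
  have "ka *\<^sub>R (Y *v a) = 0" using aA unfolding trA Ax t0t by (simp add: algebra_simps)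
  then have a0: "a = 0" using ka0 Yinj by simp
  have "ka *\<^sub>R (Y2 *v b) = 0" using bE unfolding trE Eu t0t t_def by (simp add: algebra_simps)
  then have b0': "b = 0" using ka0 Y2inj by simp
  have OM': "om ?B J (x, u) (y, v) = x \<bullet> (M *v v) - y \<bullet> (M *v u)" for x u y v
    unfolding OM a0 b0' by simp
  have BJ: "?B v \<bullet> w = - om ?B J v (J w)" for v w using JJv[of v w] by simp
  have P: "P = - q *\<^sub>R Dm"
  proof (rule matrix_eq_inner)
    fix x y
    have "M *v (C *v y) = q *\<^sub>R dd y" unfolding Cx by (simp add: matrix_vector_mult_scaleR mv)
    then have "(P *v x) \<bullet> y = - q * (x \<bullet> dd y)"
      using BJ[of "(x, 0)" "(y, 0)"] by (simp add: J0 b0 OM' bop_def)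
    then show "x \<bullet> (P *v y) = x \<bullet> ((- q *\<^sub>R Dm) *v y)"
      unfolding scaleR_matrix_vector_assoc[symmetric] Dm_mult by (simp add: adj3 sy)
  qed
  have S: "S = q' *\<^sub>R Dm"
  proof (rule matrix_eq_inner)
    fix x y
    have "(B *v y) \<bullet> (M *v x) = q' * (dd y \<bullet> x)"
      unfolding Bu by (simp add: adj3 mv)
    then have "(S *v x) \<bullet> y = q' * (x \<bullet> dd y)"
      using BJ[of "(0, x)" "(0, y)"] by (simp add: J0 b0 OM' bop_def inner_commute)
    then show "x \<bullet> (S *v y) = x \<bullet> ((q' *\<^sub>R Dm) *v y)"
      unfolding scaleR_matrix_vector_assoc[symmetric] Dm_mult by (simp add: adj3 sy)
  qed
  have K: "K *v u = - (M *v (E *v u))" for u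
  proof (rule inner0)
    fix y
    show "y \<bullet> (K *v u) = y \<bullet> - (M *v (E *v u))"
      using BJ[of "(y, 0)" "(0, u)"] adj3[of "transpose K" y u] by (simp add: J0 b0 OM' bop_def)
  qed
  \<comment> \<open>\<open>f2\<close> is the counterpart of \<open>f1\<close> for the second factor;
    the terms with \<open>u \<times> (Y2 *v v)\<close> relate the scales of the two diagonal
    blocks.\<close>
  have q'q: "q' = - q"
  proof -
    have *: "(q' / d) *\<^sub>R (u \<times> (Y2 *v v)) = - ka *\<^sub>R (u \<times> (Y2 *v v))" for u v
    proof -
      have eq: "(q' / d) *\<^sub>R dd (u \<times> (Y2 *v v)) - dd ((E *v u) \<times> v) = - ka *\<^sub>R (t *\<^sub>R dd (u \<times> v) - Y2 *v dd (u \<times> v))"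
      proof (rule inner0)
        fix xi
        have 1: "dd ((transpose Mi *v xi) \<times> (B *v u)) \<bullet> (M *v v) = (q' / d) * (xi \<bullet> dd (u \<times> (Y2 *v v)))"
        proof -
          have "dd ((transpose Mi *v xi) \<times> (B *v u)) \<bullet> (M *v v) = (q' / d) * ((M *v (xi \<times> dd u)) \<bullet> dd (M *v v))"
            unfolding Bu cross_mult_right cross_cof cofMi by (simp add: dds dd_inner)
          also have "(M *v (xi \<times> dd u)) \<bullet> dd (M *v v) = (xi \<times> dd u) \<bullet> dd (Y2 *v v)"
            by (simp add: adj3 Yv)
          also have "\<dots> = xi \<bullet> dd (u \<times> (Y2 *v v))"
            by (simp add: ddc[symmetric]) (simp add: v3 algebra_simps)
          finally show ?thesis .
        qed
        have 2: "(transpose Mi *v xi) \<bullet> (M *v w) = xi \<bullet> w" for w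
          by (simp add: adj3 mv)
        have 3: "(A *v (transpose Mi *v xi)) \<bullet> (M *v w) = ka * (t * (xi \<bullet> w) - xi \<bullet> (Y2 *v w))" for w
        proof -
          have "(Y *v (transpose Mi *v xi)) \<bullet> (M *v w) = xi \<bullet> (Y2 *v w)"
            by (simp add: Yv mv dd_inner adj3)
          then show ?thesis unfolding Ax t0t by (simp add: inner_diff_left 2 algebra_simps)
        qed
        show "xi \<bullet> ((q' / d) *\<^sub>R dd (u \<times> (Y2 *v v)) - dd ((E *v u) \<times> v)) =
            xi \<bullet> (- ka *\<^sub>R (t *\<^sub>R dd (u \<times> v) - Y2 *v dd (u \<times> v)))"
          using f2[of "transpose Mi *v xi" u v]
          by (simp add: br3_def 1 2 3 inner_diff_right)
      qed
      have "dd (Y2 *v dd w) = transpose Y2 *v w" for w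
        by (simp add: Yv Y2_def matrix_transpose_mul tD matrix_mul_assoc) (simp add: matrix_vector_mul_assoc[symmetric] Dm_mult)
      then have "(q' / d) *\<^sub>R (u \<times> (Y2 *v v)) - (E *v u) \<times> v = - ka *\<^sub>R (t *\<^sub>R (u \<times> v) - transpose Y2 *v (u \<times> v))"
        using arg_cong[OF eq, of dd] by (simp add: dds)
      moreover have "transpose Y2 *v (u \<times> v) = t *\<^sub>R (u \<times> v) + t *\<^sub>R (u \<times> v) - (Y2 *v u) \<times> v - u \<times> (Y2 *v v)"
      proof -
        have "transpose Y2 *v (u \<times> v) = trace Y *\<^sub>R (u \<times> v) - (Y2 *v u) \<times> v - u \<times> (Y2 *v v)"
          using cross_linear_sum[of Y2 u v] unfolding trY2 by (simp add: algebra_simps)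
        moreover have "trace Y *\<^sub>R w = t *\<^sub>R w + t *\<^sub>R w" for w :: vec3
          by (simp add: t_def scaleR_left_distrib[symmetric])
        ultimately show ?thesis by simp
      qed
      moreover have "E *v u = ka *\<^sub>R (Y2 *v u) - ka *\<^sub>R (t *\<^sub>R u)"
        unfolding Eu t0t by (simp add: t_def algebra_simps)
      ultimately show ?thesis
        by (simp add: cross3_diff_left cross_mult_left algebra_simps) (simp add: eq_neg_iff_add_eq_0 add.commute)
    qed
    have inj: "inj ((*v) Y2)"
      using Y2inj by (simp add: linear_injective_0)
    then obtain v where v: "Y2 *v v = axis 1 1"
      using linear_injective_imp_surjective[of "(*v) Y2"] by (metis matrix_vector_mul_linear surjD)
    have "(q' / d) *\<^sub>R (axis 2 1 \<times> axis 1 1) = - ka *\<^sub>R (axis 2 1 \<times> (axis 1 1 :: vec3))"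
      using *[of "axis 2 1" v] unfolding v .
    then have "q' / d = - ka" by (simp add: v3)
    then show ?thesis using d0 qka by (simp add: field_simps)
  qed
  define W where "W = transpose Mi ** Dm ** Mi ** Dm"
  have Wv: "W *v v = transpose Mi *v dd (Mi *v dd v)" for v
    by (simp add: W_def matrix_vector_mul_assoc[symmetric] Dm_mult)
  have tY: "trace Y = 2 * t" by (simp add: t_def)
  have Ax': "A *v x = ka *\<^sub>R (t *\<^sub>R x - Y *v x)" for x
    unfolding Ax t0t by (simp add: algebra_simps)
  have Eu': "E *v u = ka *\<^sub>R (Y2 *v u - t *\<^sub>R u)" for u
    unfolding Eu t0t tY by (simp add: algebra_simps)
  \<comment> \<open>The upper left block of J J = -1; it removes the inverse of \<open>M\<close>
    from the Nijenhuis identity below.\<close>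
  have qW: "(q * q) *\<^sub>R (W *v v) = v + (ka * ka) *\<^sub>R (t *\<^sub>R (t *\<^sub>R v - Y *v v) - Y *v (t *\<^sub>R v - Y *v v))" for v
  proof -
    have "A *v (A *v v) + B *v (C *v v) = - v"
      using J2[of "(v, 0)"] by (simp add: J0 b0)
    moreover have "B *v (C *v v) = - (q * q) *\<^sub>R (W *v v)"
      unfolding Bu Cx Wv q'q by (simp add: dds matrix_vector_mult_scaleR)
    moreover have "A *v (A *v v) = (ka * ka) *\<^sub>R (t *\<^sub>R (t *\<^sub>R v - Y *v v) - Y *v (t *\<^sub>R v - Y *v v))"
    proof -
      have "A *v (A *v v) = A *v (ka *\<^sub>R (t *\<^sub>R v - Y *v v))" by (simp only: Ax')
      also have "\<dots> = ka *\<^sub>R (A *v (t *\<^sub>R v - Y *v v))" by (simp only: matrix_vector_mult_scaleR)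
      also have "\<dots> = ka *\<^sub>R (ka *\<^sub>R (t *\<^sub>R (t *\<^sub>R v - Y *v v) - Y *v (t *\<^sub>R v - Y *v v)))"
        by (simp only: Ax')
      finally show ?thesis by (simp only: scaleR_scaleR)
    qed
    moreover have "v + a = b" if "a + c = - v" "c = - b" for a b c :: vec3
      using that by (metis add.commute add_diff_cancel_left' diff_minus_eq_add minus_add_cancel uminus_add_conv_diff)
    ultimately show ?thesis by (metis (no_types, lifting) scaleR_minus_left)
  qed
  \<comment> \<open>The Nijenhuis identity on (x, 0), (0, u) and (y, 0), with \<open>u\<close>
    chosen so that M u = dd z, rewritten in terms of \<open>Y\<close>.\<close>
  have nij: "(3 * (ka * ka)) *\<^sub>R (transpose Y *v (x \<times> (Y *v z - t *\<^sub>R z))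
      - (transpose Y *v (transpose Y *v (x \<times> z)) - t *\<^sub>R (transpose Y *v (x \<times> z)))
      + x \<times> (t *\<^sub>R (t *\<^sub>R z - Y *v z) - Y *v (t *\<^sub>R z - Y *v z))) = x \<times> z" for x z
  proof (rule inner0)
    fix y
    define u where "u = Mi *v dd z"
    have Mu: "M *v u = dd z" by (simp add: u_def mv)
    have MC: "M *v br3 (C *v x) (Mi *v w) = ka *\<^sub>R (M *v dd (transpose M *v (dd x \<times> w)))" for w
      unfolding br3_def Cx cross_mult_left cross_cof cofMi
      by (simp add: dds ka_def matrix_vector_mult_scaleR)
    have Eu2: "E *v u = Mi *v dd (ka *\<^sub>R (Y *v z - t *\<^sub>R z))"
      unfolding Eu' by (simp add: Yv u_def mv dds matrix_vector_mult_scaleR matrix_vector_mult_diff_distrib)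
    have t1: "M *v br3 (C *v x) (E *v u) = (ka * ka) *\<^sub>R (transpose Y *v (x \<times> (Y *v z - t *\<^sub>R z)))"
      unfolding Eu2 MC ddc by (simp add: Yv cross_mult_right dds matrix_vector_mult_scaleR)
    have t2': "M *v br3 (C *v x) u = ka *\<^sub>R (transpose Y *v (x \<times> z))"
      unfolding u_def MC ddc by (simp add: Yv)
    have MY2: "M *v (Y2 *v w) = transpose Y *v (M *v w)" for w by (simp add: Yv)
    have t2: "M *v (E *v br3 (C *v x) u) = (ka * ka) *\<^sub>R (transpose Y *v (transpose Y *v (x \<times> z)) - t *\<^sub>R (transpose Y *v (x \<times> z)))"
      unfolding Eu' matrix_vector_mult_scaleR matrix_vector_mult_diff_distrib MY2 t2'
      by (simp add: scaleR_diff_right)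
    have t3: "M *v (C *v br3 x (B *v u)) = - (q * q) *\<^sub>R (x \<times> (W *v z))"
      unfolding Cx br3_def Bu q'q Wv u_def by (simp add: matrix_vector_mult_scaleR mv cross_mult_right)
    have "3 * om ?B J (y, 0) (brV (J (x, 0)) (J (0, u)) - brV (x, 0) (0, u) - J (brV (J (x, 0)) (0, u)) - J (brV (x, 0) (J (0, u))))
        = 4 * rho ?B J (x, 0) (0, u) (y, 0)" by (rule tens(5))
    then have "3 * (y \<bullet> (M *v br3 (C *v x) (E *v u) - M *v (E *v br3 (C *v x) u) - M *v (C *v br3 x (B *v u))))
        = 4 * (br3 y x \<bullet> (M *v u))"
      by (simp add: J0 brV_def b0 OM' RHO matrix_vector_mult_diff_distrib matrix_vector_right_distrib algebra_simps)
    also have "br3 y x \<bullet> (M *v u) = y \<bullet> (x \<times> z)"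
      unfolding Mu br3_def by (simp add: dd_inner) (simp add: v3 algebra_simps)
    finally have "3 * (y \<bullet> ((ka * ka) *\<^sub>R (transpose Y *v (x \<times> (Y *v z - t *\<^sub>R z)))
        - (ka * ka) *\<^sub>R (transpose Y *v (transpose Y *v (x \<times> z)) - t *\<^sub>R (transpose Y *v (x \<times> z)))
        + x \<times> ((q * q) *\<^sub>R (W *v z)))) = 4 * (y \<bullet> (x \<times> z))"
      unfolding t1 t2 t3 by (simp add: cross_mult_right)
    then show "y \<bullet> ((3 * (ka * ka)) *\<^sub>R (transpose Y *v (x \<times> (Y *v z - t *\<^sub>R z))
      - (transpose Y *v (transpose Y *v (x \<times> z)) - t *\<^sub>R (transpose Y *v (x \<times> z)))
      + x \<times> (t *\<^sub>R (t *\<^sub>R z - Y *v z) - Y *v (t *\<^sub>R z - Y *v z)))) = y \<bullet> (x \<times> z)"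
      unfolding qW cross_add_right cross_mult_right
      by (simp add: inner_add_right inner_diff_right algebra_simps)
  qed
  obtain mu where mu: "Y ** Y - t *\<^sub>R Y = mu *\<^sub>R mat 1"
  proof -
    have "x \<times> ((Y ** Y - t *\<^sub>R Y) *v z) = transpose (Y ** Y - t *\<^sub>R Y) *v (x \<times> z)" for x z
    proof (rule inner0)
      fix y
      define f where "f v w = v \<bullet> (x \<times> w)" for v w
      have fs: "f v w = - f w v" for v w by (simp add: f_def v3 algebra_simps)
      have fl: "f (v - v') w = f v w - f v' w" "f v (w - w') = f v w - f v w'"
        "f (c *\<^sub>R v) w = c * f v w" "f v (c *\<^sub>R w) = c * f v w" for v v' w w' c
        by (simp_all add: f_def inner_diff_left cross3_diff_right inner_diff_right cross_mult_right)
      have Yt: "v \<bullet> (transpose Y *v w) = (Y *v v) \<bullet> w" for v w by (simp add: adj3)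
      have g: "3 * (ka * ka) * (f (Y *v v) (Y *v w) - t * f (Y *v v) w - (f (Y *v (Y *v v)) w - t * f (Y *v v) w)
          + (t * (t * f v w - f v (Y *v w)) - (t * f v (Y *v w) - f v (Y *v (Y *v w))))) = f v w" for v w
      proof -
        have "v \<bullet> ((3 * (ka * ka)) *\<^sub>R (transpose Y *v (x \<times> (Y *v w - t *\<^sub>R w))
          - (transpose Y *v (transpose Y *v (x \<times> w)) - t *\<^sub>R (transpose Y *v (x \<times> w)))
          + x \<times> (t *\<^sub>R (t *\<^sub>R w - Y *v w) - Y *v (t *\<^sub>R w - Y *v w)))) = f v w"
          unfolding nij f_def ..
        then show ?thesis
          by (simp add: inner_add_right inner_diff_right Yt f_def[symmetric] fl
              matrix_vector_mult_diff_distrib matrix_vector_mult_scaleR)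
      qed
      have "3 * (ka * ka) * (f (Y *v v) (Y *v w) - f (Y *v (Y *v v)) w + t * t * f v w - 2 * t * f v (Y *v w) + f v (Y *v (Y *v w))) = f v w" for v w
        using g[of v w] by (simp add: algebra_simps)
      \<comment> \<open>\<open>f\<close> is skew, so adding the relations for (y, z) and (z, y)
        cancels most terms and leaves self-adjointness of Y Y - t Y.\<close>
      from this[of y z] this[of z y]
      have "3 * (ka * ka) * (2 * (f y (Y *v (Y *v z)) - t * f y (Y *v z)) - 2 * (f (Y *v (Y *v y)) z - t * f (Y *v y) z)) = 0"
        using fs[of "Y *v y" "Y *v z"] fs[of "Y *v (Y *v y)" z] fs[of y z] fs[of y "Y *v z"] fs[of y "Y *v (Y *v z)"]
          fs[of "Y *v y" z] by algebra
      then have "f y (Y *v (Y *v z)) - t * f y (Y *v z) = f (Y *v (Y *v y)) z - t * f (Y *v y) z"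
        using ka0 by simp
      then show "y \<bullet> (x \<times> ((Y ** Y - t *\<^sub>R Y) *v z)) = y \<bullet> (transpose (Y ** Y - t *\<^sub>R Y) *v (x \<times> z))"
        unfolding adj3[of "Y ** Y - t *\<^sub>R Y", symmetric] f_def[symmetric]
        by (simp add: f_def[symmetric] matrix_vector_mult_diff_rdistrib matrix_vector_mul_assoc[symmetric]
            scaleR_matrix_vector_assoc[symmetric] fl)
    qed
    then show ?thesis using cross_commuting_scalar that by blast
  qed
  have "Y ** Y = (trace Y / 2) *\<^sub>R Y + mu *\<^sub>R mat 1"
    using mu by (simp add: t_def algebra_simps)
  moreover have dY: "det Y = d * d"
    by (simp add: Y_def det_mul d_def) (simp add: Dm_def det_3)
  ultimately obtain s where s: "Y = s *\<^sub>R mat 1"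
    using quadratic_scalar d0 by (metis mult_eq_0_iff)
  have ts: "t = 3 * s / 2" by (simp add: t_def s trace_def sum_3 mat_def)
  have d2: "d * d = s * s * s" using dY unfolding s by (simp add: det_3 mat_def)
  then have s0: "s \<noteq> 0" using d0 by auto
  have MDM: "M ** Dm ** transpose M = s *\<^sub>R Dm"
  proof -
    have "Dm ** (M ** Dm ** transpose M) = s *\<^sub>R mat 1" using s by (simp add: Y_def matrix_mul_assoc)
    then have "Dm ** (Dm ** (M ** Dm ** transpose M)) = s *\<^sub>R Dm" by (simp add: mult_scaleR_matrix)
    then show ?thesis by simp
  qed
  \<comment> \<open>Since d^2 = s^3, the factor s / d makes \<open>T\<close> an isometry of
    \<open>Dm\<close> and of determinant 1 at once.\<close>
  define T where "T = (s / d) *\<^sub>R M"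
  have "T ** Dm ** transpose T = ((s / d) * (s / d)) *\<^sub>R (M ** Dm ** transpose M)"
    by (simp add: T_def mult_scaleR_matrix transpose_scalar)
  also have "\<dots> = Dm"
  proof -
    have "(s / d) * (s / d) * s = 1" using d2 d0 s0 by (simp add: field_simps)
    then have "((s / d) * (s / d)) *\<^sub>R (s *\<^sub>R Dm) = Dm" by (simp only: scaleR_scaleR scaleR_one)
    then show ?thesis unfolding MDM .
  qed
  finally have T1: "T ** Dm ** transpose T = Dm" .
  have "det (c *\<^sub>R A) = c * c * c * det A" for c and A :: mat3
    by (simp add: det_3 algebra_simps)
  then have "det T = (s / d) * (s / d) * (s / d) * d" by (simp only: T_def d_def)
  also have "\<dots> = (s * s * s) / (d * d)" using d0 by (simp add: field_simps)
  finally have T2: "det T = 1" using d2 d0 s0 by simp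
  have "K = - (- q / 2) *\<^sub>R T"
  proof -
    have "K *v u = (q / 2) *\<^sub>R (T *v u)" for u
    proof -
      have tYs: "transpose Y *v w = s *\<^sub>R w" for w unfolding s by (simp add: v3 mat_def)
      have ME: "M *v (E *v u) = - (ka * s / 2) *\<^sub>R (M *v u)"
      proof -
        have "M *v (Y2 *v u) = transpose Y *v (M *v u)" by (simp add: Yv)
        then have "M *v (Y2 *v u) = s *\<^sub>R (M *v u)" using tYs by simp
        then have "M *v (E *v u) = ka *\<^sub>R (s *\<^sub>R (M *v u) - t *\<^sub>R (M *v u))"
          unfolding Eu' by (simp only: matrix_vector_mult_scaleR matrix_vector_mult_diff_distrib)
        also have "\<dots> = (ka * (s - t)) *\<^sub>R (M *v u)"
          by (simp only: scaleR_diff_left[symmetric] scaleR_scaleR)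
        also have "ka * (s - t) = - (ka * s / 2)" by (simp add: ts field_simps)
        finally show ?thesis .
      qed
      show ?thesis
        unfolding K T_def using ME d0 by (simp add: scaleR_matrix_vector_assoc[symmetric] qka)
    qed
    then show ?thesis by (simp add: matrix_eq scaleR_matrix_vector_assoc[symmetric])
  qed
  then show ?thesis
    using P S T1 T2 q'q qka ka0 d0 by (intro exI[of _ "- q"] exI[of _ T]) simp
qed

section \<open>Adapted frames\<close>

definition sl2 :: "vec3 \<Rightarrow> mat2" where
  "sl2 x = mat2_of (x $ 3 / 2) ((x $ 2 - x $ 1) / 2) ((x $ 1 + x $ 2) / 2) (- x $ 3 / 2)"

definition slc :: "mat2 \<Rightarrow> vec3" where
  "slc A = vector [A $ 2 $ 1 - A $ 1 $ 2, A $ 2 $ 1 + A $ 1 $ 2, A $ 1 $ 1 - A $ 2 $ 2]"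

text \<open>Conjugation by an element of GL(2), the inverse being written with the adjugate.
  Negative determinants are needed to reach both components of SO(Dm).\<close>

definition cj :: "mat2 \<Rightarrow> mat2 \<Rightarrow> mat2" where
  "cj m A = (1 / det m) *\<^sub>R (m ** A ** adj2 m)"

lemma matrix_distribs:
  fixes A B C :: "real^'n^'n"
  shows "A ** (B + C) = A ** B + A ** C" "(A + B) ** C = A ** C + B ** C"
    "A ** (c *\<^sub>R B) = c *\<^sub>R (A ** B)" "(c *\<^sub>R A) ** B = c *\<^sub>R (A ** B)"
  by (simp_all add: vec_eq_iff matrix_matrix_mult_def algebra_simps sum.distrib sum_distrib_left)

lemma linear_sl2: "linear sl2"
  by (rule linearI) (simp_all add: sl2_def mat2_of_def vec_eq_iff forall_2 vector_2 field_simps)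

lemma linear_slc: "linear slc"
  by (rule linearI) (simp_all add: slc_def vec_eq_iff forall_3 field_simps)

lemma linear_cj: "linear (cj m)"
  by (rule linearI) (simp_all add: cj_def matrix_distribs scaleR_right_distrib)

lemma slc_sl2 [simp]: "slc (sl2 x) = x"
  by (simp add: slc_def sl2_def vec_eq_iff forall_3 field_simps)

lemma sl2_slc: "trace A = 0 \<Longrightarrow> sl2 (slc A) = A"
  by (simp add: slc_def sl2_def mat2_simps field_simps)

lemma trace_sl2 [simp]: "trace (sl2 x) = 0"
  by (simp add: sl2_def mat2_simps)

text \<open>The product of split quaternions: the symmetric part is scalar, the skew part half the
  bracket. It lets an isometry of \<open>Dm\<close> extend to an algebra map.\<close>

lemma sl2_mult: "sl2 x ** sl2 y = (1 / 2) *\<^sub>R sl2 (br3 x y) - ((x \<bullet> dd y) / 4) *\<^sub>R mat 1"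
  by (simp add: sl2_def mat2_simps v3 field_simps)

lemma dd_dot_commute: "x \<bullet> dd y = y \<bullet> dd x"
  by (metis dd_inner inner_commute)

lemma br3_anti: "br3 x y = - br3 y x"
  by (simp add: v3 algebra_simps)

lemma sl2_bracket: "sl2 x ** sl2 y - sl2 y ** sl2 x = sl2 (br3 x y)"
  unfolding sl2_mult br3_anti[of y x] dd_dot_commute[of y x] linear_neg[OF linear_sl2]
  by (simp add: scaleR_left_distrib[symmetric])

lemma trace_sl2_mult: "trace (sl2 x ** sl2 y) = - (x \<bullet> dd y) / 2"
  by (simp add: sl2_def mat2_simps v3 field_simps)

lemma cj_mult: "det m \<noteq> 0 \<Longrightarrow> cj m (A ** B) = cj m A ** cj m B"
proof -
  assume m: "det m \<noteq> 0"
  have "(m ** A ** adj2 m) ** (m ** B ** adj2 m) = m ** A ** (adj2 m ** m) ** B ** adj2 m"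
    by (simp add: matrix_mul_assoc)
  also have "\<dots> = det m *\<^sub>R (m ** (A ** B) ** adj2 m)"
    by (simp add: mat2_mult_adj2 matrix_distribs matrix_mul_assoc)
  finally show ?thesis using m by (simp add: cj_def matrix_distribs)
qed

lemma cj_cj: "cj m (cj n A) = cj (m ** n) A"
  by (simp add: cj_def matrix_distribs adj2_mult det_mul matrix_mul_assoc)

lemma cj_scaled: "c \<noteq> 0 \<Longrightarrow> cj (c *\<^sub>R mat 1) A = A"
  by (simp add: cj_def mat2_simps power2_eq_square)

lemma cj_cancel [simp]:
  assumes "det m \<noteq> 0"
  shows "cj (adj2 m) (cj m A) = A" "cj m (cj (adj2 m) A) = A"
  using assms by (simp_all add: cj_cj mat2_mult_adj2 cj_scaled)

lemma trace_cj [simp]: "det m \<noteq> 0 \<Longrightarrow> trace (cj m A) = trace A"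
proof -
  assume m: "det m \<noteq> 0"
  have "trace (m ** A ** adj2 m) = trace (adj2 m ** (m ** A))"
    using trace_mul_sym by blast
  also have "\<dots> = det m * trace A"
    by (simp add: matrix_mul_assoc mat2_mult_adj2 matrix_distribs trace_def sum_distrib_left)
  finally show ?thesis using m by (simp add: cj_def trace_def sum_divide_distrib[symmetric])
qed

lemma det_cj [simp]: "det m \<noteq> 0 \<Longrightarrow> det (cj m A) = det A"
proof -
  assume m: "det m \<noteq> 0"
  have "det (c *\<^sub>R B) = c * c * det B" for c and B :: mat2 by (simp add: det_2 algebra_simps)
  then show ?thesis using m by (simp add: cj_def det_mul)
qed

lemma adj2_cj: "adj2 (cj m A) = cj m (adj2 A)"
  using linear_cmul[OF linear_adj2] by (simp add: cj_def adj2_mult matrix_mul_assoc)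

lemma cj_mat1 [simp]: "det m \<noteq> 0 \<Longrightarrow> cj m (mat 1) = mat 1"
  by (simp add: cj_def mat2_mult_adj2)

lemma cj_eqI: "det m \<noteq> 0 \<Longrightarrow> B ** m = m ** A \<Longrightarrow> B = cj m A"
proof -
  assume m: "det m \<noteq> 0" and e: "B ** m = m ** A"
  have "(B ** m) ** adj2 m = det m *\<^sub>R B"
    by (simp add: matrix_mul_assoc[symmetric] mat2_mult_adj2 matrix_distribs)
  then show ?thesis unfolding cj_def e[symmetric] using m by simp
qed

text \<open>The unital endomorphism \<open>\<Phi>\<close> of the algebra of \<open>2\<times>2\<close> matrices induced by \<open>T\<close> is inner:
  the columns of the conjugating matrix are \<open>\<Phi> e\<^sub>1\<^sub>1 w\<close> and \<open>\<Phi> e\<^sub>2\<^sub>1 w\<close>.\<close>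

lemma special_orthogonal_is_conj:
  assumes T: "T ** Dm ** transpose T = Dm" and d: "det T = 1"
  obtains m where "det m \<noteq> 0" "\<And>x. sl2 (T *v x) = cj m (sl2 x)"
proof -
  have tT: "transpose T ** Dm ** T = Dm"
  proof -
    have "(Dm ** T ** Dm) ** transpose T = mat 1"
      using T by (metis (no_types, lifting) Dm_Dm(1) matrix_mul_assoc)
    then have "transpose T ** (Dm ** T ** Dm) = mat 1" using matrix_left_right_inverse by blast
    then have "transpose T ** (Dm ** T ** Dm) ** Dm = Dm" by simp
    then show ?thesis by (simp add: matrix_mul_assoc[symmetric])
  qed
  have in_T: "(T *v x) \<bullet> dd (T *v y) = x \<bullet> dd y" for x y
  proof -
    have "(T *v x) \<bullet> dd (T *v y) = x \<bullet> ((transpose T ** Dm ** T) *v y)"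
      by (simp add: adj3 matrix_vector_mul_assoc[symmetric] Dm_mult)
    then show ?thesis by (simp add: tT Dm_mult)
  qed
  \<comment> \<open>\<open>det T = 1\<close> identifies \<open>cofm T\<close> with the inverse
    transpose, so the isometry \<open>T\<close> preserves the bracket.\<close>
  have br_T: "br3 (T *v x) (T *v y) = T *v br3 x y" for x y
  proof -
    have "T ** Dm = T ** Dm ** (transpose T ** cofm T)" using cofm_transpose_mult(2)[of T] d by simp
    also have "\<dots> = Dm ** cofm T" by (simp add: matrix_mul_assoc T)
    finally show ?thesis by (metis br3_def cross_cof matrix_vector_mul_assoc Dm_mult)
  qed
  define \<Phi> where "\<Phi> A = (trace A / 2) *\<^sub>R mat 1 + sl2 (T *v slc A)" for A
  have dec: "A = (trace A / 2) *\<^sub>R mat 1 + sl2 (slc A)" for A :: mat2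
    by (simp add: slc_def sl2_def mat2_simps field_simps)
  have \<Phi>s: "\<Phi> (a *\<^sub>R mat 1 + sl2 x) = a *\<^sub>R mat 1 + sl2 (T *v x)" for a x
  proof -
    have "slc (a *\<^sub>R mat 1 + sl2 x) = x"
      by (simp add: slc_def sl2_def mat_def vec_eq_iff forall_3 field_simps)
    moreover have "trace (a *\<^sub>R mat 1 + sl2 x) = 2 * a"
      by (simp add: sl2_def mat2_simps)
    ultimately show ?thesis by (simp add: \<Phi>_def)
  qed
  have mult: "(a *\<^sub>R mat 1 + sl2 x) ** (c *\<^sub>R mat 1 + sl2 y) =
      (a * c - (x \<bullet> dd y) / 4) *\<^sub>R mat 1 + sl2 (a *\<^sub>R y + c *\<^sub>R x + (1 / 2) *\<^sub>R br3 x y)" for a c x y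
    by (simp add: matrix_distribs sl2_mult linear_add[OF linear_sl2] linear_cmul[OF linear_sl2] algebra_simps)
  have \<Phi>m: "\<Phi> (A ** B) = \<Phi> A ** \<Phi> B" for A B
    using dec[of A] dec[of B] \<Phi>s mult in_T br_T
    by (metis (no_types, lifting) matrix_vector_right_distrib matrix_vector_mult_scaleR)
  have \<Phi>l: "linear \<Phi>"
  proof (rule linearI)
    show "\<Phi> (A + B) = \<Phi> A + \<Phi> B" for A B
      by (simp add: \<Phi>_def linear_add[OF linear_slc] linear_add[OF linear_sl2] matrix_vector_right_distrib
          trace_add add_divide_distrib scaleR_left_distrib)
    show "\<Phi> (c *\<^sub>R A) = c *\<^sub>R \<Phi> A" for c A
      by (simp add: \<Phi>_def linear_cmul[OF linear_slc] linear_cmul[OF linear_sl2] matrix_vector_mult_scaleR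
          trace_def sum_2 algebra_simps add_divide_distrib)
  qed
  let ?e = "\<lambda>i::2. (\<chi> k l. if k = i \<and> l = 1 then 1 else 0) :: mat2"
  have "trace (\<Phi> (?e 1)) = 1"
    by (simp add: \<Phi>_def trace_add) (simp add: trace_def sum_2 mat_def)
  then have "\<Phi> (?e 1) \<noteq> 0" by (auto simp: trace_def)
  then obtain w where w: "\<Phi> (?e 1) *v w \<noteq> 0"
    by (metis matrix_eq matrix_vector_mult_0)
  define m :: mat2 where "m = (\<chi> k i. (\<Phi> (?e i) *v w) $ k)"
  have mv: "m *v a = a $ 1 *\<^sub>R (\<Phi> (?e 1) *v w) + a $ 2 *\<^sub>R (\<Phi> (?e 2) *v w)" for a
    by (simp add: m_def vec_eq_iff matrix_vector_mult_def sum_2 algebra_simps)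
  have mv': "m *v a = \<Phi> (a $ 1 *\<^sub>R ?e 1 + a $ 2 *\<^sub>R ?e 2) *v w" for a
    by (simp add: mv linear_add[OF \<Phi>l] linear_cmul[OF \<Phi>l] matrix_vector_mult_add_rdistrib scaleR_matrix_vector_assoc)
  have eq: "\<Phi> A *v (m *v a) = m *v (A *v a)" for A a
  proof -
    have "A ** (a $ 1 *\<^sub>R ?e 1 + a $ 2 *\<^sub>R ?e 2) = (A *v a) $ 1 *\<^sub>R ?e 1 + (A *v a) $ 2 *\<^sub>R ?e 2"
      by (simp add: vec_eq_iff forall_2 sum_2 matrix_matrix_mult_def matrix_vector_mult_def)
    then show ?thesis
      by (simp only: mv'[of a] mv'[of "A *v a"] matrix_vector_mul_assoc[of "\<Phi> A"] \<Phi>m[symmetric])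
  qed
  \<comment> \<open>Some \<open>A\<close> sends a nonzero kernel vector to the first basis vector,
    whose image under \<open>m\<close> is nonzero by the choice of \<open>w\<close>.\<close>
  have inj: "a = 0" if "m *v a = 0" for a
  proof (rule ccontr)
    assume "a \<noteq> 0"
    then have n: "a \<bullet> a \<noteq> 0" by simp
    define A :: mat2 where "A = (\<chi> k l. if k = 1 then a $ l / (a \<bullet> a) else 0)"
    have "A *v a = axis 1 1"
      using n by (simp add: A_def vec_eq_iff forall_2 matrix_vector_mult_def sum_2 axis_def inner_vec_def add_divide_distrib[symmetric])
    then have "m *v axis 1 1 = 0" using eq[of A a] that by simp
    then show False using w by (simp add: mv)
  qed
  then have "invertible m"
    unfolding invertible_left_inverse matrix_left_invertible_ker by blast
  then have m0: "det m \<noteq> 0" by (simp add: invertible_det_nz)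
  have "sl2 (T *v x) = cj m (sl2 x)" for x
  proof (rule cj_eqI[OF m0])
    have "\<Phi> (sl2 x) = sl2 (T *v x)" using \<Phi>s[of 0 x] by simp
    then show "sl2 (T *v x) ** m = m ** sl2 x"
      using eq[of "sl2 x"] by (simp add: matrix_eq matrix_vector_mul_assoc[symmetric])
  qed
  then show ?thesis using that m0 by blast
qed

text \<open>In the basis w, A w for a vector \<open>w\<close> that is not an eigenvector,
  \<open>A\<close> becomes the companion matrix of t^2 + det A, and its coordinates in E_i / 2 are
  the stated ones. The zero third coordinate is what the invariance lemmas ask for.\<close>

lemma companion_form:
  fixes A :: mat2
  assumes tr0: "trace A = 0" and A: "A \<noteq> 0"
  obtains m where "det m \<noteq> 0" "A = cj m (sl2 (vector [1 + det A, 1 - det A, 0]))"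
proof -
  have t: "A $ 2 $ 2 = - A $ 1 $ 1" using tr0 by (simp add: trace_def sum_2)
  obtain w where w: "w $ 1 * (A *v w) $ 2 - w $ 2 * (A *v w) $ 1 \<noteq> 0"
  proof -
    consider "A $ 2 $ 1 \<noteq> 0" | "A $ 1 $ 2 \<noteq> 0" | "A $ 2 $ 1 = 0" "A $ 1 $ 2 = 0" "A $ 1 $ 1 \<noteq> 0"
      using A t by (auto simp: vec_eq_iff forall_2)
    then show ?thesis
    proof cases
      case 1
      then show ?thesis using that[of "vector [1, 0]"] by (simp add: matrix_vector_mult_def sum_2)
    next
      case 2
      then show ?thesis using that[of "vector [0, 1]"] by (simp add: matrix_vector_mult_def sum_2)
    next
      case 3
      then show ?thesis using that[of "vector [1, 1]"] by (simp add: matrix_vector_mult_def sum_2 t)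
    qed
  qed
  define m where "m = mat2_of (w $ 1) ((A *v w) $ 1) (w $ 2) ((A *v w) $ 2)"
  have m0: "det m \<noteq> 0" using w by (simp add: m_def det_2 algebra_simps)
  have "A ** m = m ** sl2 (vector [1 + det A, 1 - det A, 0])"
    by (simp add: m_def sl2_def vec_eq_iff forall_2 sum_2 matrix_matrix_mult_def matrix_vector_mult_def det_2 t algebra_simps)
  then show ?thesis using that m0 cj_eqI by blast
qed

section \<open>Frames and the block form of metrics\<close>

definition fr :: "mat2 \<Rightarrow> mat2 \<Rightarrow> vec3 \<times> vec3 \<Rightarrow> mat2_pair" where
  "fr m1 m2 v = (cj m1 (sl2 (fst v)), cj m2 (sl2 (snd v)))"

definition fc :: "mat2 \<Rightarrow> mat2 \<Rightarrow> mat2_pair \<Rightarrow> vec3 \<times> vec3" where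
  "fc m1 m2 u = (slc (cj (adj2 m1) (fst u)), slc (cj (adj2 m2) (snd u)))"

lemma linear_fr: "linear (fr m1 m2)"
  by (rule linearI) (simp_all add: fr_def linear_add[OF linear_sl2] linear_cmul[OF linear_sl2]
      linear_add[OF linear_cj] linear_cmul[OF linear_cj])

lemma linear_fc: "linear (fc m1 m2)"
  by (rule linearI) (simp_all add: fc_def linear_add[OF linear_slc] linear_cmul[OF linear_slc]
      linear_add[OF linear_cj] linear_cmul[OF linear_cj])

lemma symmetric_blocks:
  assumes L: "linear L" and sym: "\<And>v w. L v \<bullet> w = v \<bullet> L w"
  obtains P K S where "transpose P = P" "transpose S = S" "L = bop P K S"
proof -
  obtain A B C E where L: "L = opJ A B C E" using linear_blocks[OF L] .
  have "x \<bullet> (transpose A *v y) = x \<bullet> (A *v y)" "x \<bullet> (transpose C *v u) = x \<bullet> (B *v u)"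
    "u \<bullet> (transpose E *v v) = u \<bullet> (E *v v)" for x y u v
    using sym[of "(x, 0)" "(y, 0)"] sym[of "(x, 0)" "(0, u)"] sym[of "(0, u)" "(0, v)"]
    by (simp_all add: L opJ_def adj3)
  then have "transpose A = A" "transpose C = B" "transpose E = E"
    using matrix_eq_inner by blast+
  moreover from this(2) have "C = transpose B" by (metis transpose_transpose)
  ultimately show ?thesis using that[of A E B] by (simp add: L opJ_def bop_def fun_eq_iff)
qed

lemma metric_blocks:
  assumes f: "bilinear f" and sym: "\<And>v w. f v w = f w v"
    and nd: "\<And>v. (\<And>w. f v w = 0) \<Longrightarrow> v = 0"
  obtains P K S X Y Z where "transpose P = P" "transpose S = S" "transpose X = X" "transpose Z = Z"
    "\<And>v. bop X Y Z (bop P K S v) = v" "\<And>v. bop P K S (bop X Y Z v) = v"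
    "\<And>v w. f v w = bop P K S v \<bullet> w"
proof -
  define L where "L v = (\<Sum>i\<in>Basis. f v i *\<^sub>R i)" for v :: "vec3 \<times> vec3"
  have l: "linear (\<lambda>w. f v w)" "linear (\<lambda>v. f v w)" for v w
    using f unfolding bilinear_def by blast+
  have fL: "f v w = L v \<bullet> w" for v w
  proof -
    have "f v w = f v (\<Sum>i\<in>Basis. (w \<bullet> i) *\<^sub>R i)" by (simp add: euclidean_representation)
    also have "\<dots> = (\<Sum>i\<in>Basis. (w \<bullet> i) * f v i)"
      by (simp add: linear_sum[OF l(1)] linear_cmul[OF l(1)])
    finally show ?thesis by (simp add: L_def inner_sum_left) (simp add: inner_commute mult.commute)
  qed
  have L: "linear L"
    by (rule linearI) (simp_all add: L_def linear_add[OF l(2)] linear_cmul[OF l(2)] algebra_simps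
        sum.distrib scaleR_sum_right)
  have Ls: "L v \<bullet> w = v \<bullet> L w" for v w
    using sym[of v w] by (simp add: fL inner_commute)
  obtain P K S where P: "transpose P = P" "transpose S = S" "L = bop P K S"
    using symmetric_blocks[OF L Ls] by blast
  have "inj L"
    using nd by (auto simp: linear_injective_0[OF L] fL)
  then obtain H where H: "linear H" "\<And>v. H (L v) = v" "\<And>v. L (H v) = v"
    using linear_injective_isomorphism[OF L] by blast
  have "H v \<bullet> w = v \<bullet> H w" for v w
    using Ls[of "H v" "H w"] by (simp add: H)
  then obtain X Y Z where X: "transpose X = X" "transpose Z = Z" "H = bop X Y Z"
    using symmetric_blocks[OF H(1)] by blast
  show ?thesis using that[OF P(1,2) X(1,2)] H(2,3) fL unfolding P(3) X(3) by blast
qed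

locale frame =
  fixes m1 m2 :: mat2
  assumes det_m: "det m1 \<noteq> 0" "det m2 \<noteq> 0"
begin

lemma fr_sl [simp]: "fr m1 m2 v \<in> sl_pair"
  by (simp add: fr_def sl_pair_def det_m)

lemma fc_fr [simp]: "fc m1 m2 (fr m1 m2 v) = v"
  by (simp add: fr_def fc_def det_m)

lemma fr_fc [simp]: "u \<in> sl_pair \<Longrightarrow> fr m1 m2 (fc m1 m2 u) = u"
  by (cases u) (simp add: fr_def fc_def det_m sl_pair_def sl2_slc)

lemma fr_brV: "fr m1 m2 (brV v w) = brk (fr m1 m2 v) (fr m1 m2 w)"
  by (simp add: fr_def brV_def brk_def gmult_eq sl2_bracket[symmetric] linear_diff[OF linear_cj] cj_mult det_m)

text \<open>\<open>trace_on\<close> uses an unspecified basis; expanding in it and in the standard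
  basis and exchanging the sums identifies the two traces.\<close>

lemma trace_on_frame:
  assumes h: "linear h" and f: "\<And>v. f (fr m1 m2 v) = fr m1 m2 (h v)"
  shows "trace_on sl_pair f = tr h"
proof -
  let ?\<Psi> = "fr m1 m2"
  define B where "B = (SOME B. independent B \<and> span B = sl_pair)"
  have "\<exists>B. independent B \<and> span B = sl_pair"
    using basis_exists[of sl_pair] span_mono span_eq_iff subspace_sl_pair by (metis span_subspace)
  then have B: "independent B" "span B = sl_pair"
    unfolding B_def by (metis (mono_tags, lifting) someI_ex)+
  have fin: "finite B" using B(1) by (rule finiteI_independent)
  have Bsl: "b \<in> sl_pair" if "b \<in> B" for b using B(2) span_base that by blast
  have rep: "?\<Psi> v = (\<Sum>b\<in>B. representation B (?\<Psi> v) b *\<^sub>R b)" for v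
    using sum_representation_eq[OF B(1), of "?\<Psi> v" B] B(2) fin by simp
  have rep_lin: "linear (\<lambda>v. representation B (?\<Psi> v) b)" for b
    by (rule linearI) (simp_all add: linear_add[OF linear_fr] linear_cmul[OF linear_fr]
        representation_add[OF B(1)] representation_scale[OF B(1)] B(2))
  have v: "v = (\<Sum>b\<in>B. representation B (?\<Psi> v) b *\<^sub>R fc m1 m2 b)" for v
  proof -
    have "fc m1 m2 (?\<Psi> v) = (\<Sum>b\<in>B. representation B (?\<Psi> v) b *\<^sub>R fc m1 m2 b)"
      by (subst rep) (simp add: linear_sum[OF linear_fc] linear_cmul[OF linear_fc])
    then show ?thesis by simp
  qed
  have "tr h = (\<Sum>i\<in>Basis. \<Sum>b\<in>B. (h (fc m1 m2 b) \<bullet> i) * representation B (?\<Psi> i) b)"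
    unfolding tr_def
  proof (rule sum.cong[OF refl])
    fix i :: "vec3 \<times> vec3"
    have "h i = (\<Sum>b\<in>B. representation B (?\<Psi> i) b *\<^sub>R h (fc m1 m2 b))"
      by (subst v) (simp add: linear_sum[OF h] linear_cmul[OF h])
    then show "h i \<bullet> i = (\<Sum>b\<in>B. (h (fc m1 m2 b) \<bullet> i) * representation B (?\<Psi> i) b)"
      by (simp add: inner_sum_left mult.commute)
  qed
  also have "\<dots> = (\<Sum>b\<in>B. \<Sum>i\<in>Basis. (h (fc m1 m2 b) \<bullet> i) * representation B (?\<Psi> i) b)"
    by (rule sum.swap)
  also have "\<dots> = (\<Sum>b\<in>B. representation B (f b) b)"
  proof (rule sum.cong[OF refl])
    fix b assume "b \<in> B"
    then have "f b = ?\<Psi> (h (fc m1 m2 b))" using f[of "fc m1 m2 b"] Bsl by simp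
    also have "representation B \<dots> b = representation B (?\<Psi> (\<Sum>i\<in>Basis. (h (fc m1 m2 b) \<bullet> i) *\<^sub>R i)) b"
      by (simp add: euclidean_representation)
    also have "\<dots> = (\<Sum>i\<in>Basis. (h (fc m1 m2 b) \<bullet> i) * representation B (?\<Psi> i) b)"
      by (simp only: linear_sum[OF rep_lin] linear_cmul[OF rep_lin] real_scaleR_def)
    finally show "(\<Sum>i\<in>Basis. (h (fc m1 m2 b) \<bullet> i) * representation B (?\<Psi> i) b) = representation B (f b) b"
      by simp
  qed
  finally show ?thesis by (simp add: trace_on_def B_def Let_def)
qed

lemma metric_form_blocks:
  assumes b: "is_metric_form b"
  obtains P K S X Y Z where "transpose P = P" "transpose S = S" "transpose X = X" "transpose Z = Z"
    "\<And>v. bop X Y Z (bop P K S v) = v" "\<And>v. bop P K S (bop X Y Z v) = v"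
    "\<And>v w. b (fr m1 m2 v) (fr m1 m2 w) = bop P K S v \<bullet> w"
proof (rule metric_blocks[of "\<lambda>v w. b (fr m1 m2 v) (fr m1 m2 w)"])
  have D: "b x y = b y x" "b (x + y) z = b x z + b y z" "b (c *\<^sub>R x) y = c * b x y"
    if "x \<in> sl_pair" "y \<in> sl_pair" "z \<in> sl_pair" for x y z c
    using is_metric_formD[OF b that] by auto
  show sym: "b (fr m1 m2 v) (fr m1 m2 w) = b (fr m1 m2 w) (fr m1 m2 v)" for v w
    using D(1) fr_sl by blast
  have l: "linear (\<lambda>v. b (fr m1 m2 v) (fr m1 m2 w))" for w
    by (rule linearI) (simp_all add: linear_add[OF linear_fr] linear_cmul[OF linear_fr] D(2) D(3)[OF _ _ fr_sl[of 0]])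
  have "linear (\<lambda>v. b (fr m1 m2 w) (fr m1 m2 v))" for w
    using l[of w] by (simp only: sym[of _ w])
  then show "bilinear (\<lambda>v w. b (fr m1 m2 v) (fr m1 m2 w))"
    using l unfolding bilinear_def by blast
  show "v = 0" if "\<And>w. b (fr m1 m2 v) (fr m1 m2 w) = 0" for v
  proof -
    have "b (fr m1 m2 v) u = 0" if "u \<in> sl_pair" for u
      using \<open>\<And>w. b (fr m1 m2 v) (fr m1 m2 w) = 0\<close>[of "fc m1 m2 u"] that by simp
    then have "fr m1 m2 v = 0" using b unfolding is_metric_form_def by (metis fr_sl)
    then show ?thesis by (metis fc_fr linear_0[OF linear_fc])
  qed
qed (use that in blast)

end

locale framed_lc = left_invariant_lc + frame
begin

definition frG :: "vec3 \<times> vec3 \<Rightarrow> vec3 \<times> vec3 \<Rightarrow> vec3 \<times> vec3" where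
  "frG v w = fc m1 m2 (Gam (fr m1 m2 v) (fr m1 m2 w))"

lemma fr_frG: "fr m1 m2 (frG v w) = Gam (fr m1 m2 v) (fr m1 m2 w)"
  by (simp add: frG_def Gam_sl)

lemma bilinear_frG: "bilinear frG"
  unfolding bilinear_def
  by (intro conjI allI linearI; simp only: frG_def linear_add[OF linear_fr] linear_cmul[OF linear_fr]
      Gam_linear[OF fr_sl fr_sl fr_sl] linear_add[OF linear_fc] linear_cmul[OF linear_fc])

lemma frG_torsion: "frG v w - frG w v = brV v w"
proof -
  have "Gam (fr m1 m2 v) (fr m1 m2 w) - Gam (fr m1 m2 w) (fr m1 m2 v) = fr m1 m2 (brV v w)"
    using lc_form by (simp add: is_lc_form_def fr_brV)
  then show ?thesis unfolding frG_def by (metis fc_fr linear_diff[OF linear_fc])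
qed

lemma frG_metric:
  assumes bl: "\<And>v w. g gone (fr m1 m2 v) (fr m1 m2 w) = bop P K S v \<bullet> w" and sy: "transpose P = P" "transpose S = S"
  shows "bop P K S (frG x y) \<bullet> z + bop P K S y \<bullet> frG x z = 0"
proof -
  have "g gone (Gam (fr m1 m2 x) (fr m1 m2 y)) (fr m1 m2 z) + g gone (fr m1 m2 y) (Gam (fr m1 m2 x) (fr m1 m2 z)) = 0"
    using lc_form by (simp add: is_lc_form_def)
  then show ?thesis by (simp only: fr_frG[symmetric] bl)
qed

lemma einstein_frame:
  assumes bl: "\<And>v w. g gone (fr m1 m2 v) (fr m1 m2 w) = bop P K S v \<bullet> w"
    and sy: "transpose P = P" "transpose S = S" "transpose X = X" "transpose Z = Z"
    and HB: "\<And>v. bop X Y Z (bop P K S v) = v" "\<And>v. bop P K S (bop X Y Z v) = v"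
    and ei: "\<And>y z. y \<in> sl_pair \<Longrightarrow> z \<in> sl_pair \<Longrightarrow> trace_on sl_pair (\<lambda>u. Rie u y z) = lam * g gone y z"
  shows "ein lam P K S X Y Z"
proof -
  have G: "linear (\<lambda>x. frG x y)" "linear (\<lambda>y. frG x y)" for x y
    using bilinear_frG unfolding bilinear_def by blast+
  have br: "linear (\<lambda>x. brV x y)" for y using bilinear_brV unfolding bilinear_def by blast
  have "ric_blocks P K S X Y Z y z = lam * (bop P K S y \<bullet> z)" for y z
  proof -
    have "ric_blocks P K S X Y Z y z = tr (\<lambda>x. frG x (frG y z) - frG y (frG x z) - frG (brV x y) z)"
      using ricci_blocks[OF sy HB bilinear_frG frG_torsion frG_metric[OF bl sy(1,2)]] by simp
    also have "\<dots> = trace_on sl_pair (\<lambda>u. Rie u (fr m1 m2 y) (fr m1 m2 z))"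
    proof (rule trace_on_frame[symmetric])
      show "linear (\<lambda>x. frG x (frG y z) - frG y (frG x z) - frG (brV x y) z)"
        by (intro linear_compose_sub G linear_compose[OF G(1) G(2), unfolded o_def]
            linear_compose[OF br G(1), unfolded o_def])
      show "Rie (fr m1 m2 x) (fr m1 m2 y) (fr m1 m2 z)
          = fr m1 m2 (frG x (frG y z) - frG y (frG x z) - frG (brV x y) z)" for x
        by (simp add: Rie_def linear_diff[OF linear_fr] fr_frG fr_brV)
    qed
    also have "\<dots> = lam * (bop P K S y \<bullet> z)" using ei by (simp add: bl)
    finally show ?thesis .
  qed
  then show ?thesis using sy HB by (simp add: ein_def)
qed

end

text \<open>Precomposition with \<open>sl_proj\<close> extends the form to the ambient space, where
  product rules are available.\<close>

lemma bounded_bilinear_form: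
  assumes "is_metric_form b"
  shows "bounded_bilinear (\<lambda>u v. b (sl_proj u) (sl_proj v))"
proof -
  have D: "b (sl_proj x) (sl_proj y) = b (sl_proj y) (sl_proj x)"
    "b (sl_proj x + sl_proj y) (sl_proj z) = b (sl_proj x) (sl_proj z) + b (sl_proj y) (sl_proj z)"
    "b (c *\<^sub>R sl_proj x) (sl_proj y) = c * b (sl_proj x) (sl_proj y)" for x y z c
    using is_metric_formD[OF assms sl_proj_in sl_proj_in sl_proj_in] by blast+
  have l: "linear (\<lambda>u. b (sl_proj u) (sl_proj v))" for v
    by (rule linearI) (simp_all add: linear_add[OF linear_sl_proj] linear_cmul[OF linear_sl_proj] D(2,3))
  have "linear (\<lambda>v. b (sl_proj u) (sl_proj v))" for u
    using l[of u] by (simp only: D(1)[of _ u])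
  then have "bilinear (\<lambda>u v. b (sl_proj u) (sl_proj v))"
    using l unfolding bilinear_def by blast
  then show ?thesis by (simp add: bilinear_conv_bounded_bilinear)
qed

text \<open>Left and right invariance make the form invariant under Ad of the inverse of
  \<open>\<gamma> t\<close>; differentiating at 0 gives the skewness of ad A.\<close>

lemma biinvariant_skew:
  assumes b: "is_metric_form (g gone)" and li: "left_invariant g"
    and sg: "one_parameter_subgroup A \<gamma>" and ri: "\<And>t. right_invariant_under g (\<gamma> t)"
  shows "A \<in> sl_pair"
    and "u \<in> sl_pair \<Longrightarrow> v \<in> sl_pair \<Longrightarrow> g gone (brk A u) v + g gone u (brk A v) = 0"
proof -
  have SL: "\<gamma> t \<in> SL2xSL2" and hom: "\<gamma> (s + t) = \<gamma> s \<odot> \<gamma> t"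
    and d: "(\<gamma> has_vector_derivative A) (at 0)" for s t
    using sg by (auto simp: one_parameter_subgroup_def)
  have g0: "\<gamma> 0 = gone"
    using hom[of 0 0] gadj_cancel(1)[OF SL[of 0], of "\<gamma> 0"] SL[of 0] by simp
  show A: "A \<in> sl_pair"
    unfolding tangent_space_gone[symmetric] tangent_space_def using SL d g0 by blast
  have adA: "gadj A = - A" using A by (cases A) (simp add: gadj_def sl_pair_def adj2_traceless)
  assume u: "u \<in> sl_pair" and v: "v \<in> sl_pair"
  define f where "f w t = gadj (\<gamma> t) \<odot> (w \<odot> \<gamma> t)" for w t
  have f_sl: "f w t \<in> sl_pair" if "w \<in> sl_pair" for w t
  proof -
    have "trace (adj2 a ** (x ** a)) = trace x" if "det a = 1" for a x :: mat2
      using trace_mul_sym[of "adj2 a" "x ** a"] that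
      by (simp add: matrix_mul_assoc[symmetric] mat2_mult_adj2)
    then show ?thesis using that SL[of t] by (simp add: f_def sl_pair_def gmult_eq gadj_def SL_iff)
  qed
  have f_inv: "g gone (f u t) (f v t) = g gone u v" for t
  proof -
    have "g (\<gamma> t) (\<gamma> t \<odot> f u t) (\<gamma> t \<odot> f v t) = g gone (f u t) (f v t)"
      using li SL[of t] f_sl[OF u, of t] f_sl[OF v, of t] tangent_space_gone
      unfolding left_invariant_def by (metis gone_SL gone_gmult(2))
    moreover have "g (\<gamma> t) (u \<odot> \<gamma> t) (v \<odot> \<gamma> t) = g gone u v"
      using ri[of t] u v tangent_space_gone unfolding right_invariant_under_def by (metis gone_SL gone_gmult(1))
    ultimately show ?thesis by (simp add: f_def SL)
  qed
  have f_d: "(f w has_vector_derivative - brk A w) (at 0)" for w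
  proof -
    have "((\<lambda>t. gadj (\<gamma> t) \<odot> (w \<odot> \<gamma> t)) has_vector_derivative
        gadj (\<gamma> 0) \<odot> (w \<odot> A) + gadj A \<odot> (w \<odot> \<gamma> 0)) (at 0)"
      by (intro bounded_bilinear.has_vector_derivative[OF bounded_bilinear_gmult]
          bounded_linear.has_vector_derivative[OF bounded_linear_gadj]
          bounded_linear.has_vector_derivative[OF bounded_linear_gmult_right] d)
    then show ?thesis unfolding f_def by (simp add: g0 adA brk_def gmult_minus_left)
  qed
  have f0: "f w 0 = w" for w by (simp add: f_def g0)
  have "((\<lambda>t. g gone (sl_proj (f u t)) (sl_proj (f v t))) has_vector_derivative
      g gone (sl_proj (f u 0)) (sl_proj (- brk A v)) + g gone (sl_proj (- brk A u)) (sl_proj (f v 0))) (at 0)"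
    by (intro bounded_bilinear.has_vector_derivative[OF bounded_bilinear_form[OF b]] f_d)
  moreover have "((\<lambda>t. g gone (sl_proj (f u t)) (sl_proj (f v t))) has_vector_derivative 0) (at 0)"
    using f_sl[OF u] f_sl[OF v] f_inv by simp
  ultimately have "g gone u (- brk A v) + g gone (- brk A u) v = 0"
    using u v by (simp add: f0 vector_derivative_unique_at)
  moreover have "g gone (- 1 *\<^sub>R brk A u) v = - 1 * g gone (brk A u) v"
    "g gone u (- 1 *\<^sub>R brk A v) = - 1 * g gone u (brk A v)"
    using bounded_bilinear.scaleR_left[OF bounded_bilinear_form[OF b], of "-1" "brk A u" v]
      bounded_bilinear.scaleR_right[OF bounded_bilinear_form[OF b], of u "-1" "brk A v"] u v
    by simp_all
  ultimately show "g gone (brk A u) v + g gone u (brk A v) = 0" by simp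
qed

section \<open>Homotheties\<close>

lemma field_left [simp]: "p \<in> SL2xSL2 \<Longrightarrow> left_invariant_field b p (p \<odot> u) (p \<odot> v) = b u v"
  by (simp add: left_invariant_field_def ginv_eq_gadj)

lemma smooth_fun_Pair:
  assumes "smooth_fun M f" "smooth_fun M g"
  shows "smooth_fun M (\<lambda>x. (f x, g x))"
proof -
  have "smooth_fun M (\<lambda>x. (f x, 0) + (0, g x))"
    by (intro smooth_fun_add smooth_fun_linear[OF _ assms(1)] smooth_fun_linear[OF _ assms(2)]
        bounded_linear_Pair bounded_linear_ident bounded_linear_zero)
  then show ?thesis by simp
qed

text \<open>\<open>L p\<close> is the differential of \<open>\<phi>\<close> at \<open>p\<close> read
  in left trivialisations. It may depend on \<open>p\<close>, as it does for the twisted maps below,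
  as long as each one is an isometry up to \<open>c\<close>.\<close>

lemma homotheticI:
  assumes gb: "\<And>p u v. p \<in> SL2xSL2 \<Longrightarrow> u \<in> sl_pair \<Longrightarrow> v \<in> sl_pair \<Longrightarrow> g p (p \<odot> u) (p \<odot> v) = b u v"
    and \<phi>: "\<And>p. p \<in> SL2xSL2 \<Longrightarrow> \<phi> p \<in> SL2xSL2" and \<psi>: "\<And>p. p \<in> SL2xSL2 \<Longrightarrow> \<psi> p \<in> SL2xSL2"
    and inv: "\<And>p. p \<in> SL2xSL2 \<Longrightarrow> \<psi> (\<phi> p) = p" "\<And>p. p \<in> SL2xSL2 \<Longrightarrow> \<phi> (\<psi> p) = p"
    and sm: "smooth_fun SL2xSL2 \<phi>" "smooth_fun SL2xSL2 \<psi>"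
    and d: "\<And>p. p \<in> SL2xSL2 \<Longrightarrow> (\<phi> has_derivative \<phi>' p) (at p within SL2xSL2)"
    and L: "\<And>p u. p \<in> SL2xSL2 \<Longrightarrow> u \<in> sl_pair \<Longrightarrow> \<phi>' p (p \<odot> u) = \<phi> p \<odot> L p u"
    and iso: "\<And>p u v. p \<in> SL2xSL2 \<Longrightarrow> u \<in> sl_pair \<Longrightarrow> v \<in> sl_pair \<Longrightarrow> b' (L p u) (L p v) = c * b u v"
    and c: "c \<noteq> 0"
  shows "homothetic SL2xSL2 g (left_invariant_field b')"
proof -
  have bij: "bij_betw \<phi> SL2xSL2 SL2xSL2"
    using \<phi> \<psi> inv by (intro bij_betw_byWitness[where f' = \<psi>]) auto
  have "inv_into SL2xSL2 \<phi> p = \<psi> p" if "p \<in> SL2xSL2" for p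
    using bij \<psi>[OF that] inv(2)[OF that] by (metis bij_betw_inv_into_left)
  then have "smooth_fun SL2xSL2 (inv_into SL2xSL2 \<phi>)"
    using smooth_fun_cong[OF sm(2)] by metis
  then have "diffeo SL2xSL2 \<phi>" using bij sm by (simp add: diffeo_def)
  moreover have "left_invariant_field b' (\<phi> p) (differential SL2xSL2 \<phi> p u) (differential SL2xSL2 \<phi> p v) = c * g p u v"
    if p: "p \<in> SL2xSL2" and u: "u \<in> tangent_space SL2xSL2 p" and v: "v \<in> tangent_space SL2xSL2 p" for p u v
  proof -
    obtain u' v' where uv: "u = p \<odot> u'" "v = p \<odot> v'" "u' \<in> sl_pair" "v' \<in> sl_pair"
      using u v unfolding tangent_space_SL[OF p] by blast
    have du: "differential SL2xSL2 \<phi> p u = \<phi> p \<odot> L p u'" "differential SL2xSL2 \<phi> p v = \<phi> p \<odot> L p v'"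
      using differential_eq[OF d[OF p] u] differential_eq[OF d[OF p] v] L[OF p] uv by simp_all
    have "g p u v = b u' v'" using gb[OF p uv(3,4)] by (simp only: uv(1,2))
    moreover have "left_invariant_field b' (\<phi> p) (differential SL2xSL2 \<phi> p u) (differential SL2xSL2 \<phi> p v) = b' (L p u') (L p v')"
      by (simp only: du field_left[OF \<phi>[OF p]])
    ultimately show ?thesis by (simp only: iso[OF p uv(3,4)])
  qed
  ultimately show ?thesis unfolding homothetic_def using c by blast
qed

lemma matrix_diff_distribs:
  fixes A B C :: "real^'n^'n"
  shows "A ** (B - C) = A ** B - A ** C" "(A - B) ** C = A ** C - B ** C"
    "A ** (- B) = - (A ** B)" "(- A) ** B = - (A ** B)"
  by (simp_all add: vec_eq_iff matrix_matrix_mult_def algebra_simps sum_subtractf sum_negf)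

definition gcj :: "mat2 \<Rightarrow> mat2 \<Rightarrow> mat2_pair \<Rightarrow> mat2_pair" where
  "gcj k l p = (cj k (fst p), cj l (snd p))"

lemma bounded_linear_cj: "bounded_linear (cj k)"
  using linear_cj linear_conv_bounded_linear by blast

lemma bounded_linear_gcj: "bounded_linear (gcj k l)"
proof -
  have "linear (gcj k l)"
    by (rule linearI) (simp_all add: gcj_def linear_add[OF linear_cj] linear_cmul[OF linear_cj])
  then show ?thesis using linear_conv_bounded_linear by blast
qed

text \<open>A conjugation is linear, hence its own derivative, and multiplicative, so its
  left-trivialised differential is the same at every point.\<close>

lemma homothetic_gcj:
  assumes gb: "\<And>p u v. p \<in> SL2xSL2 \<Longrightarrow> u \<in> sl_pair \<Longrightarrow> v \<in> sl_pair \<Longrightarrow> g p (p \<odot> u) (p \<odot> v) = b u v"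
    and k: "det k \<noteq> 0" "det l \<noteq> 0"
    and iso: "\<And>u v. u \<in> sl_pair \<Longrightarrow> v \<in> sl_pair \<Longrightarrow> b' (gcj k l u) (gcj k l v) = c * b u v"
    and c: "c \<noteq> 0"
  shows "homothetic SL2xSL2 g (left_invariant_field b')"
proof (rule homotheticI[where g = g and b = b, OF gb])
  show "smooth_fun SL2xSL2 (gcj k l)" "smooth_fun SL2xSL2 (gcj (adj2 k) (adj2 l))"
    by (intro smooth_fun_linear[OF bounded_linear_gcj] smooth_fun_id)+
  show "(gcj k l has_derivative gcj k l) (at p within SL2xSL2)" for p
    by (rule bounded_linear_imp_has_derivative[OF bounded_linear_gcj])
  show "gcj k l (p \<odot> u) = gcj k l p \<odot> gcj k l u" for p u
    by (simp add: gcj_def gmult_eq cj_mult k)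
  show "b' (gcj k l u) (gcj k l v) = c * b u v" if "u \<in> sl_pair" "v \<in> sl_pair" for u v
    by (rule iso[OF that])
  show "gcj k l p \<in> SL2xSL2" "gcj (adj2 k) (adj2 l) p \<in> SL2xSL2" if "p \<in> SL2xSL2" for p
    using that k by (simp_all add: gcj_def SL_iff)
  show "gcj (adj2 k) (adj2 l) (gcj k l p) = p" "gcj k l (gcj (adj2 k) (adj2 l) p) = p" for p
    using k by (simp_all add: gcj_def)
  show "c \<noteq> 0" by (rule c)
qed

lemma killing_fr:
  assumes "det m1 \<noteq> 0" "det m2 \<noteq> 0"
  shows "killing_form (fr m1 m2 v) (fr m1 m2 w) = -2 * (fst v \<bullet> dd (fst w) + snd v \<bullet> dd (snd w))"
  using assms by (simp add: killing_form_def fr_def cj_mult[symmetric] trace_sl2_mult)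

lemma gcj_fr: "gcj k l (fr m1 m2 v) = fr (k ** m1) (l ** m2) v"
  by (simp add: gcj_def fr_def cj_cj)

context frame
begin

lemma fr_induct: "u \<in> sl_pair \<Longrightarrow> (\<And>v. P (fr m1 m2 v)) \<Longrightarrow> P u"
  by (metis fr_fc)

text \<open>The identity map serves; the constant comes from \<open>killing_form\<close> being -2
  times the \<open>dd\<close> form in any frame.\<close>

lemma homothetic_killing:
  assumes gb: "\<And>p u v. p \<in> SL2xSL2 \<Longrightarrow> u \<in> sl_pair \<Longrightarrow> v \<in> sl_pair \<Longrightarrow> g p (p \<odot> u) (p \<odot> v) = b u v"
    and b: "\<And>v w. b (fr m1 m2 v) (fr m1 m2 w) = c * (fst v \<bullet> dd (fst w) + snd v \<bullet> dd (snd w))"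
    and c: "c \<noteq> 0"
  shows "homothetic SL2xSL2 g killing_metric"
  unfolding killing_metric_def
proof (rule homothetic_gcj[where g = g and b = b, OF gb, where k = "mat 1" and l = "mat 1" and c = "-2 / c"])
  fix u v assume u: "u \<in> sl_pair" and v: "v \<in> sl_pair"
  show "killing_form (gcj (mat 1) (mat 1) u) (gcj (mat 1) (mat 1) v) = -2 / c * b u v"
    by (rule fr_induct[OF u], rule fr_induct[OF v]) (use c in \<open>simp add: gcj_fr killing_fr det_m b\<close>)
qed (use c in auto)

text \<open>\<open>k\<close> and \<open>l\<close> undo the frame, then (a, b) goes to (a b^-1, b).
  The left-trivialised differential is (Ad b (u - v), v), and the Killing form is
  Ad-invariant.\<close>

lemma homothetic_killing_twisted_left:
  assumes gb: "\<And>p u v. p \<in> SL2xSL2 \<Longrightarrow> u \<in> sl_pair \<Longrightarrow> v \<in> sl_pair \<Longrightarrow> g p (p \<odot> u) (p \<odot> v) = b u v"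
    and b: "\<And>v w. b (fr m1 m2 v) (fr m1 m2 w) =
      c * ((fst v - snd v) \<bullet> dd (fst w - snd w) + snd v \<bullet> dd (snd w))"
    and c: "c \<noteq> 0"
  shows "homothetic SL2xSL2 g killing_metric"
proof -
  define k l where "k = cj (adj2 m1)" and "l = cj (adj2 m2)"
  have kl: "bounded_linear (\<lambda>p::mat2_pair. k (fst p))" "bounded_linear (\<lambda>p::mat2_pair. l (snd p))"
    "bounded_linear (\<lambda>p::mat2_pair. adj2 (l (snd p)))"
    unfolding k_def l_def linear_conv_bounded_linear[symmetric]
    by (auto intro!: linearI simp: linear_add[OF linear_cj] linear_cmul[OF linear_cj] linear_add[OF linear_adj2] linear_cmul[OF linear_adj2])
  have bb: "bounded_bilinear ((**) :: mat2 \<Rightarrow> mat2 \<Rightarrow> mat2)"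
    unfolding bilinear_conv_bounded_bilinear[symmetric] bilinear_def
    by (auto intro!: linearI simp: matrix_distribs)
  have det_kl: "det (k a) = det a" "det (l a) = det a" and mult_kl: "k (a ** a') = k a ** k a'" "l (a ** a') = l a ** l a'" for a a'
    using det_m by (simp_all add: k_def l_def cj_mult)
  define \<phi> where "\<phi> p = (k (fst p) ** adj2 (l (snd p)), l (snd p))" for p :: mat2_pair
  define \<phi>' where "\<phi>' p w = (k (fst p) ** adj2 (l (snd w)) + k (fst w) ** adj2 (l (snd p)), l (snd w))" for p w :: mat2_pair
  define \<psi> where "\<psi> q = (cj m1 (fst q ** snd q), cj m2 (snd q))" for q :: mat2_pair
  define L where "L p u = (cj (l (snd p)) (k (fst u) - l (snd u)), l (snd u))" for p u :: mat2_pair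
  have ad: "a ** adj2 a = mat 1" "adj2 a ** a = mat 1" if "det a = 1" for a
    using that by (simp_all add: mat2_mult_adj2)
  show ?thesis
    unfolding killing_metric_def
  proof (rule homotheticI[where g = g and b = b, OF gb, where \<phi> = \<phi> and \<psi> = \<psi> and \<phi>' = \<phi>' and L = L and c = "-2 / c"])
    fix p assume p: "p \<in> SL2xSL2"
    then have p1: "det (fst p) = 1" "det (snd p) = 1" by (auto simp: SL_iff)
    show "\<phi> p \<in> SL2xSL2" "\<psi> p \<in> SL2xSL2"
      using p1 det_m by (simp_all add: SL_iff \<phi>_def \<psi>_def det_mul det_kl)
    show "\<psi> (\<phi> p) = p"
      using p1 det_m by (simp add: \<phi>_def \<psi>_def matrix_mul_assoc[symmetric] ad det_kl) (simp add: k_def l_def)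
    show "\<phi> (\<psi> p) = p"
      using p1 det_m by (simp add: \<phi>_def \<psi>_def k_def l_def matrix_mul_assoc[symmetric] ad)
    show "(\<phi> has_derivative \<phi>' p) (at p within SL2xSL2)"
      unfolding \<phi>_def \<phi>'_def
      by (intro has_derivative_Pair bounded_bilinear.FDERIV[OF bb] bounded_linear_imp_has_derivative kl)
    fix u assume u: "u \<in> sl_pair"
    then have "adj2 (l (snd u)) = - l (snd u)"
      by (simp add: adj2_traceless sl_pair_def l_def det_m)
    then have "k (fst p) ** adj2 (l (snd p ** snd u)) + k (fst p ** fst u) ** adj2 (l (snd p))
        = k (fst p) ** (k (fst u) - l (snd u)) ** adj2 (l (snd p))"
      by (simp add: mult_kl adj2_mult matrix_distribs matrix_mul_assoc matrix_diff_distribs)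
    also have "\<dots> = (k (fst p) ** adj2 (l (snd p))) ** cj (l (snd p)) (k (fst u) - l (snd u))"
      by (simp add: cj_def det_kl p1 matrix_mul_assoc) (simp add: matrix_mul_assoc[symmetric] ad det_kl p1)
    finally show "\<phi>' p (p \<odot> u) = \<phi> p \<odot> L p u"
      by (simp add: \<phi>'_def \<phi>_def L_def gmult_eq mult_kl)
    fix v assume v: "v \<in> sl_pair"
    obtain x y where xy: "u = fr m1 m2 x" "v = fr m1 m2 y" using u v by (metis fr_fc)
    have Lx: "L p (fr m1 m2 x) = (cj (l (snd p)) (sl2 (fst x - snd x)), sl2 (snd x))" for x
      by (simp add: L_def k_def l_def fr_def det_m linear_diff[OF linear_sl2])
    have "det (l (snd p)) \<noteq> 0" by (simp add: det_kl p1)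
    then show "killing_form (L p u) (L p v) = -2 / c * b u v"
      unfolding xy Lx b using c by (simp add: killing_form_def cj_mult[symmetric] trace_sl2_mult)
  next
    show "smooth_fun SL2xSL2 \<phi>" "smooth_fun SL2xSL2 \<psi>"
      unfolding \<phi>_def \<psi>_def
      by (intro smooth_fun_Pair smooth_fun_bilinear[OF bb] smooth_fun_linear[OF bounded_linear_cj]
          smooth_fun_linear[OF kl(1)] smooth_fun_linear[OF kl(2)] smooth_fun_linear[OF kl(3)]
          smooth_fun_linear[OF bounded_linear_fst] smooth_fun_linear[OF bounded_linear_snd] smooth_fun_id)+
  qed (use c in auto)
qed

text \<open>The mirror image of the previous construction, with (a, b) sent to (a, b a^-1).\<close>

lemma homothetic_killing_twisted_right:
  assumes gb: "\<And>p u v. p \<in> SL2xSL2 \<Longrightarrow> u \<in> sl_pair \<Longrightarrow> v \<in> sl_pair \<Longrightarrow> g p (p \<odot> u) (p \<odot> v) = b u v"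
    and b: "\<And>v w. b (fr m1 m2 v) (fr m1 m2 w) =
      c * ((snd v - fst v) \<bullet> dd (snd w - fst w) + fst v \<bullet> dd (fst w))"
    and c: "c \<noteq> 0"
  shows "homothetic SL2xSL2 g killing_metric"
proof -
  define k l where "k = cj (adj2 m1)" and "l = cj (adj2 m2)"
  have kl: "bounded_linear (\<lambda>p::mat2_pair. k (fst p))" "bounded_linear (\<lambda>p::mat2_pair. l (snd p))"
    "bounded_linear (\<lambda>p::mat2_pair. adj2 (k (fst p)))"
    unfolding k_def l_def linear_conv_bounded_linear[symmetric]
    by (auto intro!: linearI simp: linear_add[OF linear_cj] linear_cmul[OF linear_cj] linear_add[OF linear_adj2] linear_cmul[OF linear_adj2])
  have bb: "bounded_bilinear ((**) :: mat2 \<Rightarrow> mat2 \<Rightarrow> mat2)"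
    unfolding bilinear_conv_bounded_bilinear[symmetric] bilinear_def
    by (auto intro!: linearI simp: matrix_distribs)
  have det_kl: "det (k a) = det a" "det (l a) = det a" and mult_kl: "k (a ** a') = k a ** k a'" "l (a ** a') = l a ** l a'" for a a'
    using det_m by (simp_all add: k_def l_def cj_mult)
  define \<phi> where "\<phi> p = (k (fst p), l (snd p) ** adj2 (k (fst p)))" for p :: mat2_pair
  define \<phi>' where "\<phi>' p w = (k (fst w), l (snd p) ** adj2 (k (fst w)) + l (snd w) ** adj2 (k (fst p)))" for p w :: mat2_pair
  define \<psi> where "\<psi> q = (cj m1 (fst q), cj m2 (snd q ** fst q))" for q :: mat2_pair
  define L where "L p u = (k (fst u), cj (k (fst p)) (l (snd u) - k (fst u)))" for p u :: mat2_pair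
  have ad: "a ** adj2 a = mat 1" "adj2 a ** a = mat 1" if "det a = 1" for a
    using that by (simp_all add: mat2_mult_adj2)
  show ?thesis
    unfolding killing_metric_def
  proof (rule homotheticI[where g = g and b = b, OF gb, where \<phi> = \<phi> and \<psi> = \<psi> and \<phi>' = \<phi>' and L = L and c = "-2 / c"])
    fix p assume p: "p \<in> SL2xSL2"
    then have p1: "det (fst p) = 1" "det (snd p) = 1" by (auto simp: SL_iff)
    show "\<phi> p \<in> SL2xSL2" "\<psi> p \<in> SL2xSL2"
      using p1 det_m by (simp_all add: SL_iff \<phi>_def \<psi>_def det_mul det_kl)
    show "\<psi> (\<phi> p) = p"
      using p1 det_m by (simp add: \<phi>_def \<psi>_def matrix_mul_assoc[symmetric] ad det_kl) (simp add: k_def l_def)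
    show "\<phi> (\<psi> p) = p"
      using p1 det_m by (simp add: \<phi>_def \<psi>_def k_def l_def matrix_mul_assoc[symmetric] ad)
    show "(\<phi> has_derivative \<phi>' p) (at p within SL2xSL2)"
      unfolding \<phi>_def \<phi>'_def
      by (intro has_derivative_Pair bounded_bilinear.FDERIV[OF bb] bounded_linear_imp_has_derivative kl)
    fix u assume u: "u \<in> sl_pair"
    then have "adj2 (k (fst u)) = - k (fst u)"
      by (simp add: adj2_traceless sl_pair_def k_def det_m)
    then have "l (snd p) ** adj2 (k (fst p ** fst u)) + l (snd p ** snd u) ** adj2 (k (fst p))
        = l (snd p) ** (l (snd u) - k (fst u)) ** adj2 (k (fst p))"
      by (simp add: mult_kl adj2_mult matrix_distribs matrix_mul_assoc matrix_diff_distribs)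
    also have "\<dots> = (l (snd p) ** adj2 (k (fst p))) ** cj (k (fst p)) (l (snd u) - k (fst u))"
      by (simp add: cj_def det_kl p1 matrix_mul_assoc) (simp add: matrix_mul_assoc[symmetric] ad det_kl p1)
    finally show "\<phi>' p (p \<odot> u) = \<phi> p \<odot> L p u"
      by (simp add: \<phi>'_def \<phi>_def L_def gmult_eq mult_kl)
    fix v assume v: "v \<in> sl_pair"
    obtain x y where xy: "u = fr m1 m2 x" "v = fr m1 m2 y" using u v by (metis fr_fc)
    have Lx: "L p (fr m1 m2 x) = (sl2 (fst x), cj (k (fst p)) (sl2 (snd x - fst x)))" for x
      by (simp add: L_def k_def l_def fr_def det_m linear_diff[OF linear_sl2])
    have "det (k (fst p)) \<noteq> 0" by (simp add: det_kl p1)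
    then show "killing_form (L p u) (L p v) = -2 / c * b u v"
      unfolding xy Lx b using c by (simp add: killing_form_def cj_mult[symmetric] trace_sl2_mult)
  next
    show "smooth_fun SL2xSL2 \<phi>" "smooth_fun SL2xSL2 \<psi>"
      unfolding \<phi>_def \<psi>_def
      by (intro smooth_fun_Pair smooth_fun_bilinear[OF bb] smooth_fun_linear[OF bounded_linear_cj]
          smooth_fun_linear[OF kl(1)] smooth_fun_linear[OF kl(2)] smooth_fun_linear[OF kl(3)]
          smooth_fun_linear[OF bounded_linear_fst] smooth_fun_linear[OF bounded_linear_snd] smooth_fun_id)+
  qed (use c in auto)
qed

end

section \<open>The two model metrics\<close>

lemma exhaust_6: "i = 1 \<or> i = 2 \<or> i = 3 \<or> i = 4 \<or> i = 5 \<or> i = 6" for i :: 6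
proof (induct i)
  case (of_int z)
  then have "0 \<le> z" and "z < 6" by simp_all
  then have "z = 0 \<or> z = 1 \<or> z = 2 \<or> z = 3 \<or> z = 4 \<or> z = 5" by arith
  then show ?case by auto
qed

lemma UNIV_6: "UNIV = {1, 2, 3, 4, 5, 6 :: 6}"
  using exhaust_6 by auto

lemma sum_6: "sum f (UNIV :: 6 set) = f 1 + f 2 + f 3 + f 4 + f 5 + f 6"
  unfolding UNIV_6 by (simp add: add.assoc)

lemma vector_6 [simp]:
  "(vector [a, b, c, d, e, f] :: ('a::zero)^6) $ 1 = a"
  "(vector [a, b, c, d, e, f] :: ('a::zero)^6) $ 2 = b"
  "(vector [a, b, c, d, e, f] :: ('a::zero)^6) $ 3 = c"
  "(vector [a, b, c, d, e, f] :: ('a::zero)^6) $ 4 = d"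
  "(vector [a, b, c, d, e, f] :: ('a::zero)^6) $ 5 = e"
  "(vector [a, b, c, d, e, f] :: ('a::zero)^6) $ 6 = f"
  by (simp_all add: vector_def)

definition half_coords :: "vec3 \<times> vec3 \<Rightarrow> real^6" where
  "half_coords v = vector [fst v $ 1 / 2, fst v $ 2 / 2, fst v $ 3 / 2, snd v $ 1 / 2, snd v $ 2 / 2, snd v $ 3 / 2]"

lemma F_combination:
  "(\<Sum>i\<in>UNIV. c $ i *\<^sub>R F $ i) = (sl2 (vector [2 * c $ 1, 2 * c $ 2, 2 * c $ 3]), sl2 (vector [2 * c $ 4, 2 * c $ 5, 2 * c $ 6]))"
  by (simp add: sum_6 F_def E1_def E2_def E3_def sl2_def mat2_of_def vec_eq_iff forall_2)

lemma F_combination_zero: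
  assumes "(\<Sum>i\<in>UNIV. c i *\<^sub>R F $ i) = 0"
  shows "c i = 0"
proof -
  have "(\<Sum>i\<in>UNIV. (\<chi> i. c i) $ i *\<^sub>R F $ i) = 0" using assms by simp
  then have "sl2 (vector [2 * c 1, 2 * c 2, 2 * c 3]) = 0" "sl2 (vector [2 * c 4, 2 * c 5, 2 * c 6]) = 0"
    unfolding F_combination by (simp_all add: zero_prod_def)
  then have "(vector [2 * c 1, 2 * c 2, 2 * c 3] :: vec3) = 0" "(vector [2 * c 4, 2 * c 5, 2 * c 6] :: vec3) = 0"
    by (metis slc_sl2 linear_0[OF linear_slc])+
  then show ?thesis using exhaust_6[of i] by (auto simp: vec_eq_iff forall_3)
qed

lemma inj_F: "inj (($) F)"
proof (rule injI, rule ccontr)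
  fix i j assume e: "F $ i = F $ j" and n: "i \<noteq> j"
  have "(\<Sum>k\<in>UNIV. (if k = i then 1 else if k = j then -1 else 0) *\<^sub>R F $ k) =
      (\<Sum>k\<in>UNIV. (if k = i then F $ i else 0) - (if k = j then F $ j else 0))"
    using n by (intro sum.cong) auto
  also have "\<dots> = 0" using e by (simp add: sum_subtractf)
  finally show False using F_combination_zero[of _ i] by fastforce
qed

lemma independent_F: "independent (range (($) F))"
proof (rule independent_if_scalars_zero)
  fix f x assume "(\<Sum>x\<in>range (($) F). f x *\<^sub>R x) = 0" and x: "x \<in> range (($) F)"
  then have "(\<Sum>i\<in>UNIV. f (F $ i) *\<^sub>R F $ i) = 0" by (simp add: sum.reindex[OF inj_F])
  from F_combination_zero[OF this] show "f x = 0" using x by auto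
qed simp

lemma representation_F: "representation (range (($) F)) (sl2 x, sl2 u) (F $ i) = half_coords (x, u) $ i"
proof -
  let ?c = "half_coords (x, u)"
  have e: "(sl2 x, sl2 u) = (\<Sum>i\<in>UNIV. ?c $ i *\<^sub>R F $ i)"
    unfolding F_combination by (simp add: half_coords_def) (intro conjI arg_cong[of _ _ sl2]; simp add: vec_eq_iff forall_3)
  have s: "F $ j \<in> span (range (($) F))" for j by (simp add: span_base)
  have "representation (range (($) F)) (\<Sum>j\<in>UNIV. ?c $ j *\<^sub>R F $ j) (F $ i)
      = (\<Sum>j\<in>UNIV. ?c $ j * (if F $ i = F $ j then 1 else 0))"
    using independent_F s
    by (simp add: representation_sum representation_scale representation_basis span_scale)
  also have "\<dots> = ?c $ i" by (simp add: inj_eq[OF inj_F] if_distrib[of "(*) _"] cong: if_cong)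
  finally show ?thesis by (simp only: e)
qed

definition nk_form :: "mat2_pair \<Rightarrow> mat2_pair \<Rightarrow> real" where
  "nk_form = gram_form ((1 / sqrt 3) *\<^sub>R vector
     [vector [-2, 0, 0,   1, 0, 0],
      vector [ 0, 2, 0,   0, 1, 0],
      vector [ 0, 0, 2,   0, 0, 1],
      vector [ 1, 0, 0,  -2, 0, 0],
      vector [ 0, 1, 0,   0, 2, 0],
      vector [ 0, 0, 1,   0, 0, 2]])"

lemma nk_metric_eq: "nk_metric = left_invariant_field nk_form"
  by (simp add: nk_metric_def nk_form_def)

lemma nk_form_sl2:
  "nk_form (sl2 x, sl2 u) (sl2 y, sl2 v) =
    (1 / (4 * sqrt 3)) * (-2 * (x \<bullet> dd y) - 2 * (u \<bullet> dd v) + x \<bullet> v + u \<bullet> y)"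
  unfolding nk_form_def gram_form_def representation_F
  by (simp add: sum_6 half_coords_def v3 field_simps)

lemma det_E1 [simp]: "det E1 = 1"
  by (simp add: det_2 E1_def)

text \<open>Conjugation by \<open>E1\<close> realises \<open>dd\<close>. In the frame (1, E1) the
  identity block of the model metric therefore becomes a multiple of \<open>Dm\<close>, the shape
  reached by the classification.\<close>

lemma cj_E1: "cj E1 (sl2 x) = sl2 (dd x)"
  by (simp add: cj_def E1_def sl2_def mat2_simps dd_def field_simps)

lemma nk_form_fr:
  "nk_form (fr (mat 1) E1 v) (fr (mat 1) E1 w) = (1 / (4 * sqrt 3)) *
    (-2 * (fst v \<bullet> dd (fst w)) - 2 * (snd v \<bullet> dd (snd w)) + fst v \<bullet> dd (snd w) + snd v \<bullet> dd (fst w))"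
proof -
  have "cj (mat 1) A = A" for A by (rule cj_eqI[symmetric]) auto
  then show ?thesis by (simp add: fr_def cj_E1 nk_form_sl2 dd_inner)
qed

interpretation E1: frame "mat 1" E1 by unfold_locales auto

lemma fr_forall: "(\<forall>u\<in>sl_pair. P u) \<longleftrightarrow> (\<forall>v. P (fr (mat 1) E1 v))"
  using E1.fr_sl E1.fr_induct by blast

lemma sum_dd_zero: "(\<And>y. x \<bullet> dd y = 0) \<Longrightarrow> x = 0"
  by (metis dd_dd inner_eq_zero_iff)

lemma is_metric_form_fr:
  assumes f: "\<And>v w. b (fr (mat 1) E1 v) (fr (mat 1) E1 w) = c * (p * (fst v \<bullet> dd (fst w)) + p * (snd v \<bullet> dd (snd w))
       + q * (fst v \<bullet> dd (snd w)) + q * (snd v \<bullet> dd (fst w)))"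
    and c: "c \<noteq> 0" "p * p \<noteq> q * q"
  shows "is_metric_form b"
  unfolding is_metric_form_def fr_forall
proof (intro conjI allI impI)
  let ?f = "fr (mat 1) E1"
  note lin = linear_add[OF linear_fr, symmetric] linear_cmul[OF linear_fr, symmetric]
  show "b (?f v) (?f w) = b (?f w) (?f v)" for v w
    by (simp add: f dd_dot_commute[of "fst v"] dd_dot_commute[of "snd v"])
  show "b (?f v + ?f v') (?f w) = b (?f v) (?f w) + b (?f v') (?f w)" for v v' w
    unfolding lin f by (simp add: inner_add_left algebra_simps)
  show "b (k *\<^sub>R ?f v) (?f w) = k * b (?f v) (?f w)" for k v w
    unfolding lin f by (simp add: algebra_simps)
  show "?f v = 0" if z: "\<forall>w. b (?f v) (?f w) = 0" for v
  proof -
    have "p *\<^sub>R fst v + q *\<^sub>R snd v = 0"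
      by (rule sum_dd_zero) (use z[rule_format, of "(_, 0)"] c(1) in \<open>simp add: f inner_add_left linear_0[OF linear_dd]\<close>)
    moreover have "q *\<^sub>R fst v + p *\<^sub>R snd v = 0"
      by (rule sum_dd_zero) (use z[rule_format, of "(0, _)"] c(1) in \<open>simp add: f inner_add_left linear_0[OF linear_dd] add.commute\<close>)
    ultimately have e: "p * fst v $ i + q * snd v $ i = 0" "q * fst v $ i + p * snd v $ i = 0" for i
      by (simp_all add: vec_eq_iff)
    have "(p * p - q * q) * fst v $ i = 0 \<and> (p * p - q * q) * snd v $ i = 0" for i
      using e[of i] by algebra
    then have "v = 0" using c(2) by (simp add: prod_eq_iff vec_eq_iff)
    then show ?thesis by (simp add: linear_0[OF linear_fr])
  qed
qed

lemma left_invariant_field_left_invariant: "left_invariant (left_invariant_field b)"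
  unfolding left_invariant_def
proof (intro ballI)
  fix a p u v assume a: "a \<in> SL2xSL2" and p: "p \<in> SL2xSL2" and "u \<in> tangent_space SL2xSL2 p" "v \<in> tangent_space SL2xSL2 p"
  then obtain u' v' where "u = p \<odot> u'" "v = p \<odot> v'" unfolding tangent_space_SL[OF p] by blast
  then show "left_invariant_field b (a \<odot> p) (a \<odot> u) (a \<odot> v) = left_invariant_field b p u v"
    using a p by (simp add: gmult_assoc[symmetric] gmult_SL)
qed

lemma pseudo_riemannian_field:
  assumes b: "is_metric_form b"
  shows "pseudo_riemannian SL2xSL2 (left_invariant_field b)"
  unfolding pseudo_riemannian_def
proof (intro conjI ballI allI impI)
  note D = is_metric_formD[OF b]
  fix p assume p: "p \<in> SL2xSL2"
  note T = tangent_space_SL[OF p]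
  fix u assume u: "u \<in> tangent_space SL2xSL2 p"
  then obtain u' where u': "u = p \<odot> u'" "u' \<in> sl_pair" unfolding T by blast
  {
    fix v assume "v \<in> tangent_space SL2xSL2 p"
    then obtain v' where v': "v = p \<odot> v'" "v' \<in> sl_pair" unfolding T by blast
    show "left_invariant_field b p u v = left_invariant_field b p v u"
      using D(1)[OF u'(2) v'(2) v'(2)] by (simp add: u' v' p)
    show "left_invariant_field b p (c *\<^sub>R u) v = c * left_invariant_field b p u v" for c
      using D(3)[OF u'(2) v'(2) v'(2)] by (simp add: u' v' p gmult_scaleR_right[symmetric])
    fix w assume "w \<in> tangent_space SL2xSL2 p"
    then obtain w' where w': "w = p \<odot> w'" "w' \<in> sl_pair" unfolding T by blast
    show "left_invariant_field b p (u + v) w = left_invariant_field b p u w + left_invariant_field b p v w"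
      using D(2)[OF u'(2) v'(2) w'(2)] by (simp add: u' v' w' p gmult_add_right[symmetric])
  }
  assume z: "\<forall>v\<in>tangent_space SL2xSL2 p. left_invariant_field b p u v = 0"
  have "b u' v' = 0" if "v' \<in> sl_pair" for v'
    using z that unfolding T by (auto simp: u' p)
  then have "u' = 0" using b u'(2) unfolding is_metric_form_def by blast
  then show "u = 0" by (simp add: u' gmult_zero)
next
  fix X Y assume X: "vector_field SL2xSL2 X" and Y: "vector_field SL2xSL2 Y"
  have "smooth_fun SL2xSL2 (\<lambda>p. b (sl_proj (gadj p \<odot> X p)) (sl_proj (gadj p \<odot> Y p)))"
    by (intro smooth_fun_bilinear[OF bounded_bilinear_form[OF b]] vector_field_coeff X Y)
  then show "smooth_fun SL2xSL2 (\<lambda>p. left_invariant_field b p (X p) (Y p))"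
    by (rule smooth_fun_cong) (simp add: left_invariant_field_def ginv_eq_gadj vector_field_coeff[OF X] vector_field_coeff[OF Y])
qed

text \<open>Upper bound: reading the two first coordinates is injective on a negative definite
  subspace, because the form is nonnegative where they vanish. Lower bound: the span of the two
  first axes.\<close>

lemma metric_index_field:
  assumes pos: "\<And>v. fst v $ 1 = 0 \<Longrightarrow> snd v $ 1 = 0 \<Longrightarrow> 0 \<le> b (fr (mat 1) E1 v) (fr (mat 1) E1 v)"
    and neg: "\<And>a c. (a, c) \<noteq> 0 \<Longrightarrow> b (fr (mat 1) E1 (axis 1 a, axis 1 c)) (fr (mat 1) E1 (axis 1 a, axis 1 c)) < 0"
    and p: "p \<in> SL2xSL2"
  shows "metric_index SL2xSL2 (left_invariant_field b) p = 2"
  unfolding metric_index_def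
proof (rule Max_eqI)
  let ?g = "left_invariant_field b p" and ?f = "fr (mat 1) E1"
  let ?D = "{dim W |W. subspace W \<and> W \<subseteq> tangent_space SL2xSL2 p \<and> (\<forall>w\<in>W. w \<noteq> 0 \<longrightarrow> ?g w w < 0)}"
  show le: "d \<le> 2" if d: "d \<in> ?D" for d
  proof -
    obtain W where W: "d = dim W" "subspace W" "W \<subseteq> tangent_space SL2xSL2 p" "\<And>w. w \<in> W \<Longrightarrow> w \<noteq> 0 \<Longrightarrow> ?g w w < 0"
      using d by blast
    define h where "h w = (let v = fc (mat 1) E1 (gadj p \<odot> w) in (fst v $ 1, snd v $ 1))" for w
    have h: "linear h"
      by (rule linearI) (simp_all add: h_def Let_def gmult_add_right gmult_scaleR_right linear_add[OF linear_fc] linear_cmul[OF linear_fc])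
    have "w = 0" if w: "w \<in> W" "h w = 0" for w
    proof (rule ccontr)
      assume n: "w \<noteq> 0"
      obtain u where u: "w = p \<odot> u" "u \<in> sl_pair" using W(3) w(1) unfolding tangent_space_SL[OF p] by blast
      define v where "v = fc (mat 1) E1 u"
      have v: "?f v = u" using u by (simp add: v_def)
      have "fst v $ 1 = 0" "snd v $ 1 = 0" using w(2) p by (simp_all add: h_def u v_def Let_def zero_prod_def)
      then have "0 \<le> b u u" using pos[of v] v by simp
      then show False using W(4)[OF w(1) n] p by (simp add: u)
    qed
    then have "inj_on h W" using linear_inj_on_iff_eq_0[OF h] W(2) by blast
    then have "dim (h ` W) = dim W" using dim_image_eq[OF h, of W] span_eq_iff[THEN iffD2, OF W(2)] by (simp only:)
    then show ?thesis using dim_subset_UNIV[of "h ` W"] by (simp add: W(1))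
  qed
  then show "finite ?D" by (meson finite_nat_set_iff_bounded_le)
  define k where "k a = p \<odot> ?f (axis 1 (fst a), axis 1 (snd a))" for a :: "real \<times> real"
  have ax: "axis 1 (a + c) = axis 1 a + (axis 1 c :: vec3)" "axis 1 (r * a) = r *\<^sub>R (axis 1 a :: vec3)" for a c r :: real
    by (simp_all add: axis_def vec_eq_iff)
  have k: "linear k"
    by (rule linearI) (simp_all add: k_def gmult_add_right[symmetric] gmult_scaleR_right[symmetric] ax
        linear_add[OF linear_fr, symmetric] linear_cmul[OF linear_fr, symmetric])
  have kn: "?g (k a) (k a) < 0" if "a \<noteq> 0" for a
    using neg[of "fst a" "snd a"] that by (simp add: k_def p)
  have "a = 0" if "k a = 0" for a
  proof (rule ccontr)
    assume "a \<noteq> 0"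
    then have "?g 0 0 < 0" using kn[of a] that by simp
    moreover have "?g 0 0 = b 0 0" using field_left[OF p, of b 0 0] by (simp add: gmult_zero)
    moreover have "0 \<le> b 0 0" using pos[of 0] by (simp add: linear_0[OF linear_fr])
    ultimately show False by simp
  qed
  then have "inj k" using linear_injective_0[OF k] by blast
  then have r1: "2 = dim (range k)" using dim_image_eq[OF k, of UNIV] by simp
  have r2: "subspace (range k)" using k by (simp add: linear_subspace_image)
  have r3: "range k \<subseteq> tangent_space SL2xSL2 p" unfolding k_def using gmult_tangent[OF p] E1.fr_sl by blast
  have r4: "?g w w < 0" if wk: "w \<in> range k" "w \<noteq> 0" for w
  proof -
    obtain a where a: "w = k a" using wk(1) by blast
    then have "a \<noteq> 0" using wk(2) linear_0[OF k] by metis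
    then show ?thesis unfolding a by (rule kn)
  qed
  show "2 \<in> ?D"
    by (intro CollectI exI[of _ "range k"] conjI ballI impI r1 r2 r3 r4)
qed

lemma models_index:
  assumes c: "c > 0"
  shows "pseudo_riemannian SL2xSL2 (\<lambda>p u v. c * nk_metric p u v)"
    "pseudo_riemannian SL2xSL2 (\<lambda>p u v. c * killing_metric p u v)"
    "p \<in> SL2xSL2 \<Longrightarrow> metric_index SL2xSL2 (\<lambda>p u v. c * nk_metric p u v) p = 2"
    "p \<in> SL2xSL2 \<Longrightarrow> metric_index SL2xSL2 (\<lambda>p u v. c * killing_metric p u v) p = 2"
proof -
  have e: "(\<lambda>p u v. c * nk_metric p u v) = left_invariant_field (\<lambda>u v. c * nk_form u v)"
    "(\<lambda>p u v. c * killing_metric p u v) = left_invariant_field (\<lambda>u v. c * killing_form u v)"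
    by (simp_all add: fun_eq_iff nk_metric_eq killing_metric_def left_invariant_field_def)
  have kf: "killing_form (fr (mat 1) E1 v) (fr (mat 1) E1 w) = -2 * (fst v \<bullet> dd (fst w) + snd v \<bullet> dd (snd w))" for v w
    by (simp add: killing_fr)
  show "pseudo_riemannian SL2xSL2 (\<lambda>p u v. c * nk_metric p u v)"
    unfolding e
    by (rule pseudo_riemannian_field, rule is_metric_form_fr[where p = "-2" and q = 1 and c = "c / (4 * sqrt 3)"])
      (use c in \<open>simp_all add: nk_form_fr\<close>)
  show "pseudo_riemannian SL2xSL2 (\<lambda>p u v. c * killing_metric p u v)"
    unfolding e
    by (rule pseudo_riemannian_field, rule is_metric_form_fr[where p = "-2" and q = 0 and c = c])
      (use c in \<open>simp_all add: kf algebra_simps\<close>)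
  \<comment> \<open>A sum of squares, which controls the mixed term of the model metric on every
    coordinate pair.\<close>
  have sq: "2 * (a * a) + 2 * (d * d) - 2 * (a * d) = (a - d) * (a - d) + (a * a + d * d)" for a d :: real
    by (simp add: algebra_simps)
  {
    assume p: "p \<in> SL2xSL2"
    show "metric_index SL2xSL2 (\<lambda>p u v. c * nk_metric p u v) p = 2"
      unfolding e
    proof (rule metric_index_field[OF _ _ p])
      fix v :: "vec3 \<times> vec3" assume z: "fst v $ 1 = 0" "snd v $ 1 = 0"
      show "0 \<le> c * nk_form (fr (mat 1) E1 v) (fr (mat 1) E1 v)"
      proof -
        have "0 \<le> 2 * (a * a) + 2 * (d * d) - 2 * (a * d)" for a d :: real
          unfolding sq by (intro add_nonneg_nonneg zero_le_square)
        from add_nonneg_nonneg[OF this[of "fst v $ 2" "snd v $ 2"] this[of "fst v $ 3" "snd v $ 3"]]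
        moreover have "nk_form (fr (mat 1) E1 v) (fr (mat 1) E1 v) = (1 / (4 * sqrt 3)) *
            (2 * (fst v $ 2 * fst v $ 2) + 2 * (snd v $ 2 * snd v $ 2) - 2 * (fst v $ 2 * snd v $ 2) +
            (2 * (fst v $ 3 * fst v $ 3) + 2 * (snd v $ 3 * snd v $ 3) - 2 * (fst v $ 3 * snd v $ 3)))"
          using z by (simp add: nk_form_fr v3 field_simps)
        ultimately show ?thesis using c by simp
      qed
    next
      fix a d :: real assume "(a, d) \<noteq> 0"
      then have "0 < a * a + d * d" by (auto simp: zero_prod_def sum_squares_gt_zero_iff)
      then have "0 < 2 * (a * a) + 2 * (d * d) - 2 * (a * d)"
        unfolding sq by (rule add_nonneg_pos[OF zero_le_square])
      then show "c * nk_form (fr (mat 1) E1 (axis 1 a, axis 1 d)) (fr (mat 1) E1 (axis 1 a, axis 1 d)) < 0"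
        using c by (simp add: nk_form_fr v3 mult_less_0_iff divide_less_0_iff axis_def)
    qed
    show "metric_index SL2xSL2 (\<lambda>p u v. c * killing_metric p u v) p = 2"
      unfolding e
    proof (rule metric_index_field[OF _ _ p])
      fix v :: "vec3 \<times> vec3" assume "fst v $ 1 = 0" "snd v $ 1 = 0"
      then show "0 \<le> c * killing_form (fr (mat 1) E1 v) (fr (mat 1) E1 v)"
        using c by (simp add: kf v3 zero_le_mult_iff)
    next
      fix a d :: real assume "(a, d) \<noteq> 0"
      then have "0 < a * a + d * d" by (auto simp: zero_prod_def sum_squares_gt_zero_iff)
      then show "c * killing_form (fr (mat 1) E1 (axis 1 a, axis 1 d)) (fr (mat 1) E1 (axis 1 a, axis 1 d)) < 0"
        using c by (simp add: kf v3 mult_less_0_iff axis_def)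
    qed
  }
qed

section \<open>Einstein metrics\<close>

lemma transpose_Dm: "transpose Dm = Dm"
  by (simp add: v3)

lemma transpose_0 [simp]: "transpose 0 = (0 :: real^'n^'m)"
  by (simp add: vec_eq_iff transpose_def)

lemma bracket_cube: "br3 e (br3 e (br3 e x)) = (- (e \<bullet> dd e)) *\<^sub>R br3 e x"
  by (simp add: v3 algebra_simps)

text \<open>The metric pairs the \<open>ad\<close>-eigenspaces of the two factors; for different eigenvalues
  only the kernels can be paired nontrivially.\<close>

lemma invariance_splits:
  assumes sy: "transpose P = P" "transpose S = S"
    and inv: "\<And>v w. bop P K S (brV (e, f) v) \<bullet> w + bop P K S v \<bullet> brV (e, f) w = 0"
    and ne: "e \<bullet> dd e \<noteq> f \<bullet> dd f"
  shows "bop P K S (brV (e, 0) v) \<bullet> w + bop P K S v \<bullet> brV (e, 0) w = 0"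
proof -
  have K: "br3 e x \<bullet> (K *v u) + x \<bullet> (K *v br3 f u) = 0" for x u
    using inv[of "(x, 0)" "(0, u)"] by (simp add: bop_def brV_def br3_def linear_0[OF linear_dd] adj3)
  have Pi: "(P *v br3 e x) \<bullet> y + (P *v x) \<bullet> br3 e y = 0" for x y
    using inv[of "(x, 0)" "(y, 0)"] by (simp add: bop_def brV_def br3_def linear_0[OF linear_dd])
  have eK: "br3 e x \<bullet> (K *v u) = 0" for x u
  proof -
    \<comment> \<open>By \<open>bracket_cube\<close>, moving three brackets across \<open>K\<close>
      produces the factor of \<open>e\<close> on one side and that of \<open>f\<close> on the
      other.\<close>
    have "br3 e (br3 e (br3 e x)) \<bullet> (K *v u) = - (x \<bullet> (K *v br3 f (br3 f (br3 f u))))"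
      using K[of "br3 e (br3 e x)" u] K[of "br3 e x" "br3 f u"] K[of x "br3 f (br3 f u)"] by linarith
    then have "(- (e \<bullet> dd e)) * (br3 e x \<bullet> (K *v u)) = (f \<bullet> dd f) * (x \<bullet> (K *v br3 f u))"
      by (simp only: bracket_cube matrix_vector_mult_scaleR inner_scaleR_left inner_scaleR_right)
    moreover have "x \<bullet> (K *v br3 f u) = - (br3 e x \<bullet> (K *v u))" using K[of x u] by linarith
    ultimately have "(e \<bullet> dd e - f \<bullet> dd f) * (br3 e x \<bullet> (K *v u)) = 0" by (simp add: algebra_simps)
    then show ?thesis using ne by simp
  qed
  have "(transpose K *v br3 e x) \<bullet> u = 0" for x u by (simp add: adj3 eK)
  then show ?thesis
    using Pi[of "fst v" "fst w"] eK[of "fst w" "snd v"]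
    by (simp add: bop_def brV_def br3_def linear_0[OF linear_dd] inner_add_left inner_add_right inner_prod_def inner_commute)
qed

text \<open>\<open>Dm ** transpose T\<close> is again in SO(Dm), hence a conjugation. Multiplied
  onto the second frame it turns a mixed block proportional to \<open>T\<close> into one
  proportional to \<open>Dm\<close>.\<close>

lemma orthogonal_second_frame:
  assumes m2: "det m2 \<noteq> 0" and T: "T ** Dm ** transpose T = Dm" "det T = 1"
  obtains n2 where "det n2 \<noteq> 0"
    "\<And>m1 v. fr m1 n2 v = fr m1 m2 (fst v, Dm ** transpose T *v snd v)"
proof -
  let ?U = "Dm ** transpose T"
  have "T ** (Dm ** transpose T ** Dm) = mat 1" using T(1) by (simp add: matrix_mul_assoc)
  then have "(Dm ** transpose T ** Dm) ** T = mat 1" using matrix_left_right_inverse by blast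
  then have "Dm ** ((Dm ** transpose T ** Dm) ** T) ** Dm = Dm ** Dm" by (simp add: matrix_mul_assoc)
  then have 1: "transpose T ** Dm ** T ** Dm = mat 1" by (simp add: matrix_mul_assoc[symmetric])
  have "?U ** Dm ** transpose ?U = Dm ** (transpose T ** Dm ** T ** Dm)"
    by (simp add: matrix_transpose_mul matrix_mul_assoc transpose_Dm)
  then have "?U ** Dm ** transpose ?U = Dm" unfolding 1 by simp
  moreover have "det ?U = 1" using T(2) by (simp add: det_mul det_transpose) (simp add: Dm_def det_3)
  ultimately obtain m where m: "det m \<noteq> 0" "\<And>x. sl2 (?U *v x) = cj m (sl2 x)"
    using special_orthogonal_is_conj by blast
  show ?thesis
    by (rule that[of "m2 ** m"]) (use m m2 in \<open>simp_all add: det_mul fr_def m(2) cj_cj\<close>)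
qed

lemma bop_second_frame:
  "bop P K S (x, U *v u) \<bullet> (y, U *v w) = bop P (K ** U) (transpose U ** S ** U) (x, u) \<bullet> (y, w)"
  by (simp add: bop_def inner_add_left adj3 matrix_vector_mul_assoc[symmetric] matrix_transpose_mul inner_commute
      matrix_vector_right_distrib)

lemma orthogonal_blocks:
  assumes T: "T ** Dm ** transpose T = Dm" "det T = 1"
  shows "T ** (Dm ** transpose T) = Dm" "transpose (Dm ** transpose T) ** Dm ** (Dm ** transpose T) = Dm"
  using T(1) by (simp_all add: matrix_mul_assoc matrix_transpose_mul transpose_Dm) (simp add: matrix_mul_assoc[symmetric])

lemma (in framed_lc) scalar_blocks_form:
  assumes bl: "\<And>v w. g gone (fr m1 m2 v) (fr m1 m2 w) = bop (p *\<^sub>R Dm) (x *\<^sub>R Dm) (r *\<^sub>R Dm) v \<bullet> w"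
  shows "g gone (fr m1 m2 v) (fr m1 m2 w) = p * (fst v \<bullet> dd (fst w)) + x * (snd v \<bullet> dd (fst w)) + x * (fst v \<bullet> dd (snd w))
      + r * (snd v \<bullet> dd (snd w))"
  unfolding bl by (simp add: bop_def inner_prod_def inner_add_left transpose_scalar transpose_Dm
        scaleR_matrix_vector_assoc[symmetric] Dm_mult dd_inner)

lemma (in framed_lc) scalar_blocks_nk:
  assumes bl: "\<And>v w. g gone (fr m1 m2 v) (fr m1 m2 w) = bop (p *\<^sub>R Dm) (x *\<^sub>R Dm) (p *\<^sub>R Dm) v \<bullet> w"
    and x: "x \<noteq> 0" and p: "p = -2 * x"
  shows "homothetic SL2xSL2 g nk_metric"
proof -
  note b = scalar_blocks_form[OF bl]
  have "homothetic SL2xSL2 g (left_invariant_field nk_form)"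
  \<comment> \<open>The automorphism carries the frame (m1, m2) to (1, E1); the constant matches the
    factor of \<open>nk_form_fr\<close> with the mixed coefficient \<open>x\<close>.\<close>
  proof (rule homothetic_gcj[where g = g and b = "g gone", OF metric_left, where k = "adj2 m1" and l = "E1 ** adj2 m2" and c = "1 / (4 * sqrt 3 * x)"])
    fix u v assume "u \<in> sl_pair" "v \<in> sl_pair"
    then obtain y z where "u = fr m1 m2 y" "v = fr m1 m2 z" by (metis fr_fc)
    moreover have "gcj (adj2 m1) (E1 ** adj2 m2) (fr m1 m2 y) = fr (mat 1) E1 y" for y
      by (simp add: gcj_def fr_def cj_cj[symmetric] det_m cj_eqI[of "mat 1", symmetric])
    ultimately show "nk_form (gcj (adj2 m1) (E1 ** adj2 m2) u) (gcj (adj2 m1) (E1 ** adj2 m2) v) = 1 / (4 * sqrt 3 * x) * g gone u v"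
      using x by (simp add: nk_form_fr b p field_simps)
  qed (use det_m x in \<open>simp_all add: det_mul\<close>)
  then show ?thesis by (simp add: nk_metric_eq)
qed

lemma (in framed_lc) scalar_blocks_homothetic:
  assumes bl: "\<And>v w. g gone (fr m1 m2 v) (fr m1 m2 w) = bop (p *\<^sub>R Dm) (x *\<^sub>R Dm) (r *\<^sub>R Dm) v \<bullet> w"
    and x: "x \<noteq> 0" and pr: "(p, r) \<in> {(-2 * x, -2 * x), (- x, -2 * x), (-2 * x, - x)}"
  shows "homothetic SL2xSL2 g killing_metric \<or> homothetic SL2xSL2 g nk_metric"
proof -
  note b = scalar_blocks_form[OF bl]
  consider "p = -2 * x" "r = -2 * x" | "p = - x" "r = -2 * x" | "p = -2 * x" "r = - x" using pr by auto
  then show ?thesis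
  proof cases
    case 1
    then show ?thesis using scalar_blocks_nk[of p x] bl x by simp
  next
    case 2
    \<comment> \<open>The form -x ((v - w)^2 + w^2), squares taken with \<open>dd\<close>, has
      exactly the coefficients of this case.\<close>
    have "homothetic SL2xSL2 g killing_metric"
      by (rule homothetic_killing_twisted_left[where g = g and b = "g gone", OF metric_left, where c = "- x"])
        (use x in \<open>simp_all add: b 2 linear_diff[OF linear_dd] inner_diff_left inner_diff_right algebra_simps\<close>)
    then show ?thesis ..
  next
    case 3
    have "homothetic SL2xSL2 g killing_metric"
      by (rule homothetic_killing_twisted_right[where g = g and b = "g gone", OF metric_left, where c = "- x"])
        (use x in \<open>simp_all add: b 3 linear_diff[OF linear_dd] inner_diff_left inner_diff_right algebra_simps\<close>)
    then show ?thesis ..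
  qed
qed

lemma (in framed_lc) decoupled_homothetic:
  assumes bl: "\<And>v w. g gone (fr m1 m2 v) (fr m1 m2 w) = bop (p *\<^sub>R Dm) 0 (p *\<^sub>R Dm) v \<bullet> w" and p: "p \<noteq> 0"
  shows "homothetic SL2xSL2 g killing_metric"
proof (rule homothetic_killing[where g = g and b = "g gone" and c = p, OF metric_left])
  show "g gone (fr m1 m2 v) (fr m1 m2 w) = p * (fst v \<bullet> dd (fst w) + snd v \<bullet> dd (snd w))" for v w
    unfolding bl by (simp add: bop_def inner_prod_def inner_add_left transpose_scalar transpose_Dm
        scaleR_matrix_vector_assoc[symmetric] Dm_mult dd_inner algebra_simps)
qed (use p in auto)

text \<open>Determinants give d^2 = m^3 for d = det K, so the factor m / d makes \<open>K\<close> an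
  isometry of determinant 1.\<close>

lemma scaled_orthogonal:
  assumes K: "K ** Dm ** transpose K = m *\<^sub>R Dm" and m: "m \<noteq> 0"
  obtains q T where "q \<noteq> 0" "K = q *\<^sub>R T" "T ** Dm ** transpose T = Dm" "det T = 1"
proof -
  have sc: "det (c *\<^sub>R A) = c * c * c * det A" for c and A :: mat3
    by (simp add: det_3 algebra_simps)
  have dD: "det Dm = 1" by (simp add: Dm_def det_3)
  define d where "d = det K"
  have "det (K ** Dm ** transpose K) = m * m * m" unfolding K sc dD by simp
  then have d2: "d * d = m * m * m" by (simp add: det_mul det_transpose dD d_def)
  then have d0: "d \<noteq> 0" using m by auto
  define T where "T = (m / d) *\<^sub>R K"
  have "T ** Dm ** transpose T = ((m / d) * (m / d)) *\<^sub>R (K ** Dm ** transpose K)"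
    by (simp add: T_def mult_scaleR_matrix transpose_scalar)
  moreover have "(m / d) * (m / d) * m = 1" using d2 d0 m by (simp add: field_simps)
  ultimately have "T ** Dm ** transpose T = Dm" unfolding K by (simp only: scaleR_scaleR scaleR_one)
  moreover have "det T = (m * m * m) / (d * d)" unfolding T_def sc d_def[symmetric] using d0 by (simp add: field_simps)
  then have "det T = 1" using d2 m by simp
  ultimately show ?thesis using that[of "d / m" T] d0 m by (simp add: T_def)
qed

section \<open>The classification of the Einstein metrics\<close>

locale einstein_lc = left_invariant_lc +
  fixes lam :: real
  assumes ei: "\<And>y z. y \<in> sl_pair \<Longrightarrow> z \<in> sl_pair \<Longrightarrow> trace_on sl_pair (\<lambda>u. Rie u y z) = lam * g gone y z"
begin

text \<open>Once \<open>T\<close> is absorbed into the second frame, the Einstein equation is set up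
  afresh there, and \<open>einstein_tensor_form\<close> leaves three metrics.\<close>

lemma einstein_orthogonal_homothetic:
  assumes "frame m1 m2" and e: "ein lam (p *\<^sub>R Dm) K (r *\<^sub>R Dm) X Y Z"
    and bl: "\<And>v w. g gone (fr m1 m2 v) (fr m1 m2 w) = bop (p *\<^sub>R Dm) K (r *\<^sub>R Dm) v \<bullet> w"
    and K: "K ** Dm ** transpose K = m *\<^sub>R Dm" and m: "m \<noteq> 0"
  shows "homothetic SL2xSL2 g killing_metric \<or> homothetic SL2xSL2 g nk_metric"
proof -
  interpret frame m1 m2 by fact
  obtain q T where q: "q \<noteq> 0" "K = q *\<^sub>R T" and T: "T ** Dm ** transpose T = Dm" "det T = 1"
    using scaled_orthogonal[OF K m] .
  obtain n2 where n2: "det n2 \<noteq> 0" "\<And>m1 v. fr m1 n2 v = fr m1 m2 (fst v, Dm ** transpose T *v snd v)"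
    using orthogonal_second_frame[OF det_m(2) T] by blast
  interpret N: framed_lc g nabla m1 n2 by unfold_locales (use det_m n2 in auto)
  have bl': "g gone (fr m1 n2 v) (fr m1 n2 w) = bop (p *\<^sub>R Dm) (q *\<^sub>R Dm) (r *\<^sub>R Dm) v \<bullet> w" for v w
    unfolding n2(2) bl bop_second_frame q(2)
    using orthogonal_blocks[OF T] by (simp add: mult_scaleR_matrix)
  obtain P K' S X Y Z where b: "transpose P = P" "transpose S = S" "transpose X = X" "transpose Z = Z"
    "\<And>v. bop X Y Z (bop P K' S v) = v" "\<And>v. bop P K' S (bop X Y Z v) = v"
    "\<And>v w. g gone (fr m1 n2 v) (fr m1 n2 w) = bop P K' S v \<bullet> w"
    using N.metric_form_blocks[OF metric_form] by metis
  have "bop P K' S v = bop (p *\<^sub>R Dm) (q *\<^sub>R Dm) (r *\<^sub>R Dm) v" for v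
    using b(7) bl' by (metis vector_eq_rdot)
  then have bo: "bop P K' S = bop (p *\<^sub>R Dm) (q *\<^sub>R Dm) (r *\<^sub>R Dm)" by blast
  have "ein lam (p *\<^sub>R Dm) (q *\<^sub>R Dm) (r *\<^sub>R Dm) X Y Z"
    by (rule N.einstein_frame[OF bl' _ _ b(3,4) b(5,6)[unfolded bo] ei]) (simp_all add: transpose_scalar transpose_Dm)
  from einstein_tensor_form[OF this q(1)] show ?thesis
    by (rule N.scalar_blocks_homothetic[OF bl' q(1)])
qed

theorem einstein_homothetic:
  assumes A: "A \<in> sl_pair" "A \<noteq> 0"
    and skew: "\<And>u v. u \<in> sl_pair \<Longrightarrow> v \<in> sl_pair \<Longrightarrow> g gone (brk A u) v + g gone u (brk A v) = 0"
  shows "homothetic SL2xSL2 g killing_metric \<or> homothetic SL2xSL2 g nk_metric"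
proof -
  \<comment> \<open>\<open>en (det B)\<close> is the companion vector of \<open>B\<close>; its
    \<open>dd\<close> norm 4 det B decides between the cases.\<close>
  define en where "en d = (vector [1 + d, 1 - d, 0] :: vec3)" for d :: real
  have en: "en d \<noteq> 0" "en d $ 3 = 0" "en d \<bullet> dd (en d) = 4 * d" for d
    by (auto simp: en_def v3 algebra_simps)
  have comp: "\<exists>m e. det m \<noteq> 0 \<and> B = cj m (sl2 e) \<and> (B \<noteq> 0 \<longrightarrow> e = en (det B)) \<and> (B = 0 \<longrightarrow> e = 0)" if t0: "trace B = 0" for B :: mat2
  proof (cases "B = 0")
    case True
    then show ?thesis by (intro exI[of _ "mat 1"] exI[of _ 0]) (simp add: linear_0[OF linear_sl2] linear_0[OF linear_cj])
  next
    case False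
    then show ?thesis using companion_form[OF t0 False] unfolding en_def by metis
  qed
  have "trace (fst A) = 0" "trace (snd A) = 0" using A(1) by (simp_all add: sl_pair_def)
  then obtain m1 e m2 f where m: "det m1 \<noteq> 0" "det m2 \<noteq> 0" and Ae: "A = fr m1 m2 (e, f)"
    and ef: "fst A \<noteq> 0 \<longrightarrow> e = en (det (fst A))" "fst A = 0 \<longrightarrow> e = 0" "snd A \<noteq> 0 \<longrightarrow> f = en (det (snd A))" "snd A = 0 \<longrightarrow> f = 0"
    using comp[of "fst A"] comp[of "snd A"] unfolding fr_def by (metis fst_conv snd_conv prod.collapse)
  interpret framed_lc g nabla m1 m2 by unfold_locales (use m in auto)
  obtain P K S X Y Z where b: "transpose P = P" "transpose S = S" "transpose X = X" "transpose Z = Z"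
    "\<And>v. bop X Y Z (bop P K S v) = v" "\<And>v. bop P K S (bop X Y Z v) = v"
    and bl: "\<And>v w. g gone (fr m1 m2 v) (fr m1 m2 w) = bop P K S v \<bullet> w"
    using metric_form_blocks[OF metric_form] by metis
  have E: "ein lam P K S X Y Z" by (rule einstein_frame[OF bl b ei])
  have inv: "bop P K S (brV (e, f) v) \<bullet> w + bop P K S v \<bullet> brV (e, f) w = 0" for v w
    using skew[of "fr m1 m2 v" "fr m1 m2 w"] by (simp add: Ae fr_brV[symmetric] bl)
  have first: ?thesis if e0: "e \<noteq> 0" "e $ 3 = 0"
    and i: "\<And>v w. bop P K S (brV (e, 0) v) \<bullet> w + bop P K S v \<bullet> brV (e, 0) w = 0"
  proof -
    obtain p where "p \<noteq> 0" "P = p *\<^sub>R Dm" "K = 0" "S = p *\<^sub>R Dm"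
      using einstein_invariant_first_factor[OF E e0 i] by blast
    then show ?thesis using decoupled_homothetic[of p] bl by simp
  qed
  have second: ?thesis if e0: "e = 0" and f0: "f \<noteq> 0" "f $ 3 = 0"
  proof -
    have sw: "brV (f, 0) (prod.swap v) = prod.swap (brV (0, f) v)" "prod.swap v \<bullet> w = v \<bullet> prod.swap w" for v w :: "vec3 \<times> vec3"
      by (simp_all add: brV_def inner_prod_def prod.swap_def add.commute)
    have "bop S (transpose K) P (brV (f, 0) v) \<bullet> w + bop S (transpose K) P v \<bullet> brV (f, 0) w = 0" for v w
      using inv[of "prod.swap v" "prod.swap w"] sw(1)[of "prod.swap v"] sw(1)[of "prod.swap w"]
      by (simp add: e0 bop_swap[of S K P] sw(2))
    then obtain p where "p \<noteq> 0" "S = p *\<^sub>R Dm" "transpose K = 0" "P = p *\<^sub>R Dm"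
      using einstein_invariant_first_factor[OF ein_swap[OF E] f0] by blast
    moreover from this(3) have "K = 0" by (metis transpose_transpose transpose_0)
    ultimately show ?thesis using decoupled_homothetic[of p] bl by simp
  qed
  consider "e \<noteq> 0" "f = 0" | "e = 0" "f \<noteq> 0" | "e \<noteq> 0" "f \<noteq> 0" "e = en (det (fst A))" "f = en (det (snd A))"
  proof -
    have "fst A \<noteq> 0 \<or> snd A \<noteq> 0" using A(2) by (simp add: prod_eq_iff)
    moreover have "e \<noteq> 0 \<longleftrightarrow> fst A \<noteq> 0" using ef(1,2) en(1) by auto
    moreover have "f \<noteq> 0 \<longleftrightarrow> snd A \<noteq> 0" using ef(3,4) en(1) by auto
    ultimately show ?thesis using ef that by blast
  qed
  then show ?thesis
  proof cases
    case 1
    then have "e $ 3 = 0" using ef(1,2) en(2) by auto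
    then show ?thesis by (rule first[OF 1(1)]) (use inv 1(2) in simp)
  next
    case 2
    then have "f $ 3 = 0" using ef(3,4) en(2) by auto
    then show ?thesis by (rule second[OF 2])
  next
    case 3
    show ?thesis
    proof (cases "e \<bullet> dd e = f \<bullet> dd f")
      case False
      have "e $ 3 = 0" using 3(3) en(2) by simp
      then show ?thesis by (rule first[OF 3(1) _ invariance_splits[OF b(1,2) inv False]])
    next
      case True
      \<comment> \<open>Equal norms mean equal determinants, hence the same companion vector in both
        factors: the generator is diagonal in this frame.\<close>
      then have "det (fst A) = det (snd A)" using en(3) 3(3,4) by simp
      then have fe: "f = e" using 3(3,4) by simp
      have "e $ 3 = 0" using 3(3) en(2) by simp
      from einstein_invariant_diagonal[OF E 3(1) this inv[unfolded fe]]
      consider p where "p \<noteq> 0" "P = p *\<^sub>R Dm" "K = 0" "S = p *\<^sub>R Dm"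
        | p r m where "m \<noteq> 0" "P = p *\<^sub>R Dm" "S = r *\<^sub>R Dm" "K ** Dm ** transpose K = m *\<^sub>R Dm"
        by blast
      then show ?thesis
      proof cases
        case 1
        then show ?thesis using decoupled_homothetic[of p] bl by simp
      next
        case 2
        then show ?thesis
          using einstein_orthogonal_homothetic[OF frame_axioms E[unfolded 2(2,3)] bl[unfolded 2(2,3)] 2(4,1)] by blast
      qed
    qed
  qed
qed

end

section \<open>Left-invariant connections\<close>

text \<open>In the left trivialisation: the flat derivative of the coefficient plus the product
  \<open>\<Gamma>\<close>. It supplies the connection whose existence
  \<open>nearly_pseudo_kaehler\<close> demands.\<close>

definition left_conn :: "(mat2_pair \<Rightarrow> mat2_pair \<Rightarrow> mat2_pair) \<Rightarrow> mat2_pair connection" where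
  "left_conn \<Gamma> X Y p = p \<odot> (differential SL2xSL2 (\<lambda>q. gadj q \<odot> Y q) p (X p) + \<Gamma> (gadj p \<odot> X p) (gadj p \<odot> Y p))"

lemma vector_field_derivative:
  assumes Y: "vector_field SL2xSL2 Y" and p: "p \<in> SL2xSL2"
  obtains D where "((\<lambda>q. gadj q \<odot> Y q) has_derivative D) (at p within SL2xSL2)" "linear D"
    "\<And>v. v \<in> tangent_space SL2xSL2 p \<Longrightarrow> D v \<in> sl_pair"
    "\<And>v. v \<in> tangent_space SL2xSL2 p \<Longrightarrow> differential SL2xSL2 (\<lambda>q. gadj q \<odot> Y q) p v = D v"
    "\<And>v. v \<in> tangent_space SL2xSL2 p \<Longrightarrow> differential SL2xSL2 Y p v = v \<odot> (gadj p \<odot> Y p) + p \<odot> D v"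
proof -
  obtain D where D: "((\<lambda>q. gadj q \<odot> Y q) has_derivative D) (at p within SL2xSL2)"
    using smooth_fun_has_derivative[OF vector_field_coeff(1)[OF Y] p] by blast
  have l: "linear D" using D has_derivative_bounded_linear bounded_linear.linear by blast
  have "((\<lambda>q. q \<odot> (gadj q \<odot> Y q)) has_derivative (\<lambda>v. p \<odot> D v + v \<odot> (gadj p \<odot> Y p))) (at p within SL2xSL2)"
    by (rule bounded_bilinear.FDERIV[OF bounded_bilinear_gmult has_derivative_ident D])
  then have Y': "(Y has_derivative (\<lambda>v. p \<odot> D v + v \<odot> (gadj p \<odot> Y p))) (at p within SL2xSL2)"
    by (rule has_derivative_within_cong[OF _ p]) simp
  show ?thesis
    by (rule that[OF D l])
      (use has_derivative_sl[OF D p] vector_field_coeff(2)[OF Y] differential_eq[OF D] differential_eq[OF Y']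
        in \<open>simp_all add: add.commute\<close>)
qed

lemma vector_field_tangent: "vector_field M X \<Longrightarrow> p \<in> M \<Longrightarrow> X p \<in> tangent_space M p"
  by (simp add: vector_field_def)

lemma affine_left_conn:
  assumes \<Gamma>: "bounded_bilinear \<Gamma>" and sl: "\<And>u v. u \<in> sl_pair \<Longrightarrow> v \<in> sl_pair \<Longrightarrow> \<Gamma> u v \<in> sl_pair"
  shows "affine_connection SL2xSL2 (left_conn \<Gamma>)"
  unfolding affine_connection_def
proof (intro conjI allI impI ballI)
  note add = bounded_bilinear.add_left[OF \<Gamma>] bounded_bilinear.add_right[OF \<Gamma>]
    bounded_bilinear.scaleR_left[OF \<Gamma>] bounded_bilinear.scaleR_right[OF \<Gamma>]
  fix X Y assume X: "vector_field SL2xSL2 X" and Y: "vector_field SL2xSL2 Y"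
  note tan = vector_field_tangent[OF X]
  show "vector_field SL2xSL2 (left_conn \<Gamma> X Y)"
  proof -
    have "vector_field SL2xSL2 (\<lambda>p. p \<odot> (differential SL2xSL2 (\<lambda>q. gadj q \<odot> Y q) p (X p) + \<Gamma> (gadj p \<odot> X p) (gadj p \<odot> Y p)))"
    proof (rule vector_field_left)
      show "smooth_fun SL2xSL2 (\<lambda>p. differential SL2xSL2 (\<lambda>q. gadj q \<odot> Y q) p (X p) + \<Gamma> (gadj p \<odot> X p) (gadj p \<odot> Y p))"
        by (intro smooth_fun_add smooth_fun_differential smooth_fun_bilinear[OF \<Gamma>] vector_field_coeff X Y)
      fix p assume p: "p \<in> SL2xSL2"
      obtain D where D: "\<And>v. v \<in> tangent_space SL2xSL2 p \<Longrightarrow> D v \<in> sl_pair"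
        "\<And>v. v \<in> tangent_space SL2xSL2 p \<Longrightarrow> differential SL2xSL2 (\<lambda>q. gadj q \<odot> Y q) p v = D v"
        by (rule vector_field_derivative[OF Y p]) blast
      show "differential SL2xSL2 (\<lambda>q. gadj q \<odot> Y q) p (X p) + \<Gamma> (gadj p \<odot> X p) (gadj p \<odot> Y p) \<in> sl_pair"
        using D tan[OF p] sl vector_field_coeff(2)[OF X p] vector_field_coeff(2)[OF Y p] by simp
    qed
    then show ?thesis by (simp add: left_conn_def[abs_def])
  qed
  {
    fix X' p assume X': "vector_field SL2xSL2 X'" and p: "p \<in> SL2xSL2"
    obtain D where D: "linear D" "\<And>v. v \<in> tangent_space SL2xSL2 p \<Longrightarrow> differential SL2xSL2 (\<lambda>q. gadj q \<odot> Y q) p v = D v"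
      by (rule vector_field_derivative[OF Y p]) blast
    show "left_conn \<Gamma> (\<lambda>q. X q + X' q) Y p = left_conn \<Gamma> X Y p + left_conn \<Gamma> X' Y p"
      using tan[OF p] vector_field_tangent[OF X' p]
      by (simp add: left_conn_def D(2) subspace_add[OF subspace_tangent[OF p]] linear_add[OF D(1)] gmult_add_right add algebra_simps)
  }
  {
    fix Y' p assume Y': "vector_field SL2xSL2 Y'" and p: "p \<in> SL2xSL2"
    obtain D where D: "((\<lambda>q. gadj q \<odot> Y q) has_derivative D) (at p within SL2xSL2)"
      by (rule vector_field_derivative[OF Y p]) blast
    obtain D' where D': "((\<lambda>q. gadj q \<odot> Y' q) has_derivative D') (at p within SL2xSL2)"
      by (rule vector_field_derivative[OF Y' p]) blast
    have s: "((\<lambda>q. gadj q \<odot> (Y q + Y' q)) has_derivative (\<lambda>v. D v + D' v)) (at p within SL2xSL2)"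
      unfolding gmult_add_right by (rule has_derivative_add[OF D D'])
    show "left_conn \<Gamma> X (\<lambda>q. Y q + Y' q) p = left_conn \<Gamma> X Y p + left_conn \<Gamma> X Y' p"
      unfolding left_conn_def differential_eq[OF D tan[OF p]] differential_eq[OF D' tan[OF p]]
          differential_eq[OF s tan[OF p]]
      by (simp only: gmult_add_right add add_ac)
  }
  fix f :: "mat2_pair \<Rightarrow> real" and p assume f: "smooth_fun SL2xSL2 f" and p: "p \<in> SL2xSL2"
  obtain D where D: "((\<lambda>q. gadj q \<odot> Y q) has_derivative D) (at p within SL2xSL2)" "linear D"
    by (rule vector_field_derivative[OF Y p]) blast
  obtain f' where f': "(f has_derivative f') (at p within SL2xSL2)"
    using smooth_fun_has_derivative[OF f p] by blast
  have tan': "f p *\<^sub>R X p \<in> tangent_space SL2xSL2 p" using tan[OF p] by (simp add: subspace_scale[OF subspace_tangent[OF p]])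
  show "left_conn \<Gamma> (\<lambda>q. f q *\<^sub>R X q) Y p = f p *\<^sub>R left_conn \<Gamma> X Y p"
    by (simp add: left_conn_def differential_eq[OF D(1) tan[OF p]] differential_eq[OF D(1) tan'] linear_cmul[OF D(2)]
        gmult_add_right gmult_scaleR_right add scaleR_right_distrib)
  have s: "((\<lambda>q. gadj q \<odot> (f q *\<^sub>R Y q)) has_derivative (\<lambda>v. f p *\<^sub>R D v + f' v *\<^sub>R (gadj p \<odot> Y p))) (at p within SL2xSL2)"
    unfolding gmult_scaleR_right by (rule has_derivative_scaleR[OF f' D(1)])
  show "left_conn \<Gamma> X (\<lambda>q. f q *\<^sub>R Y q) p = differential SL2xSL2 f p (X p) *\<^sub>R Y p + f p *\<^sub>R left_conn \<Gamma> X Y p"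
    unfolding left_conn_def differential_eq[OF D(1) tan[OF p]] differential_eq[OF s tan[OF p]] differential_eq[OF f' tan[OF p]]
    by (simp add: gmult_add_right gmult_scaleR_right add scaleR_right_distrib p)
qed

lemma levi_civita_left_conn:
  assumes b: "is_metric_form b" and \<Gamma>: "bounded_bilinear \<Gamma>" and lc: "is_lc_form b \<Gamma>"
  shows "levi_civita SL2xSL2 (left_invariant_field b) (left_conn \<Gamma>)"
  unfolding levi_civita_def
proof (intro conjI allI impI ballI)
  show "affine_connection SL2xSL2 (left_conn \<Gamma>)"
    by (rule affine_left_conn[OF \<Gamma>]) (use lc in \<open>simp add: is_lc_form_def\<close>)
  fix X Y p assume X: "vector_field SL2xSL2 X" and Y: "vector_field SL2xSL2 Y" and p: "p \<in> SL2xSL2"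
  note tX = vector_field_tangent[OF X p] and tY = vector_field_tangent[OF Y p]
  define x y where "x = gadj p \<odot> X p" and "y = gadj p \<odot> Y p"
  have xy: "X p = p \<odot> x" "Y p = p \<odot> y" "x \<in> sl_pair" "y \<in> sl_pair"
    using p vector_field_coeff(2)[OF X p] vector_field_coeff(2)[OF Y p] by (simp_all add: x_def y_def)
  obtain DX where DX: "\<And>v. v \<in> tangent_space SL2xSL2 p \<Longrightarrow> differential SL2xSL2 (\<lambda>q. gadj q \<odot> X q) p v = DX v"
    "\<And>v. v \<in> tangent_space SL2xSL2 p \<Longrightarrow> differential SL2xSL2 X p v = v \<odot> (gadj p \<odot> X p) + p \<odot> DX v"
    by (rule vector_field_derivative[OF X p]) blast
  obtain DY where DY: "((\<lambda>q. gadj q \<odot> Y q) has_derivative DY) (at p within SL2xSL2)"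
    "\<And>v. v \<in> tangent_space SL2xSL2 p \<Longrightarrow> DY v \<in> sl_pair"
    "\<And>v. v \<in> tangent_space SL2xSL2 p \<Longrightarrow> differential SL2xSL2 (\<lambda>q. gadj q \<odot> Y q) p v = DY v"
    "\<And>v. v \<in> tangent_space SL2xSL2 p \<Longrightarrow> differential SL2xSL2 Y p v = v \<odot> (gadj p \<odot> Y p) + p \<odot> DY v"
    by (rule vector_field_derivative[OF Y p]) blast
  have "\<Gamma> x y - \<Gamma> y x = brk x y" using lc xy by (simp add: is_lc_form_def)
  then have "p \<odot> (\<Gamma> x y - \<Gamma> y x) = p \<odot> x \<odot> y - p \<odot> y \<odot> x" by (simp add: brk_def gmult_diff_right gmult_assoc)
  then show "left_conn \<Gamma> X Y p - left_conn \<Gamma> Y X p = lie_bracket SL2xSL2 X Y p"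
    unfolding left_conn_def lie_bracket_def DX(1)[OF tY] DY(3)[OF tX] DX(2)[OF tY] DY(4)[OF tX]
      x_def[symmetric] y_def[symmetric]
    by (simp add: gmult_add_right gmult_diff_right xy(1,2) algebra_simps)
  fix Z assume Z: "vector_field SL2xSL2 Z"
  define z where "z = gadj p \<odot> Z p"
  have z: "Z p = p \<odot> z" "z \<in> sl_pair"
    using p vector_field_coeff(2)[OF Z p] by (simp_all add: z_def)
  obtain DZ where DZ: "((\<lambda>q. gadj q \<odot> Z q) has_derivative DZ) (at p within SL2xSL2)"
    "\<And>v. v \<in> tangent_space SL2xSL2 p \<Longrightarrow> DZ v \<in> sl_pair"
    "\<And>v. v \<in> tangent_space SL2xSL2 p \<Longrightarrow> differential SL2xSL2 (\<lambda>q. gadj q \<odot> Z q) p v = DZ v"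
    by (rule vector_field_derivative[OF Z p]) blast
  have "((\<lambda>q. b (sl_proj (gadj q \<odot> Y q)) (sl_proj (gadj q \<odot> Z q))) has_derivative
      (\<lambda>v. b (sl_proj y) (sl_proj (DZ v)) + b (sl_proj (DY v)) (sl_proj z))) (at p within SL2xSL2)"
    unfolding y_def z_def by (rule bounded_bilinear.FDERIV[OF bounded_bilinear_form[OF b] DY(1) DZ(1)])
  then have "((\<lambda>q. left_invariant_field b q (Y q) (Z q)) has_derivative
      (\<lambda>v. b (sl_proj y) (sl_proj (DZ v)) + b (sl_proj (DY v)) (sl_proj z))) (at p within SL2xSL2)"
    by (rule has_derivative_within_cong[OF _ p])
      (simp add: left_invariant_field_def ginv_eq_gadj vector_field_coeff(2)[OF Y] vector_field_coeff(2)[OF Z])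
  note d = differential_eq[OF this tX]
  have sl: "\<Gamma> x y \<in> sl_pair" "\<Gamma> x z \<in> sl_pair" and m: "b (\<Gamma> x y) z + b y (\<Gamma> x z) = 0"
    using lc xy z by (simp_all add: is_lc_form_def)
  show "differential SL2xSL2 (\<lambda>q. left_invariant_field b q (Y q) (Z q)) p (X p)
      = left_invariant_field b p (left_conn \<Gamma> X Y p) (Z p) + left_invariant_field b p (Y p) (left_conn \<Gamma> X Z p)"
    unfolding d left_conn_def DY(3)[OF tX] DZ(3)[OF tX] x_def[symmetric] y_def[symmetric] z_def[symmetric]
    using m is_metric_formD(2)[OF b DY(2)[OF tX] sl(1) z(2)] is_metric_formD(4)[OF b DZ(2)[OF tX] sl(2) xy(4)]
    by (simp add: xy(2,4) z p DY(2)[OF tX] DZ(2)[OF tX])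
qed

section \<open>The nearly Kaehler structure\<close>

text \<open>Half the bracket plus a symmetric part; 1/6 is the value that makes the product
  compatible with the form of \<open>nk_form_fr\<close>, whose coefficients are in the ratio -2 to
  1.\<close>

definition nkG :: "vec3 \<times> vec3 \<Rightarrow> vec3 \<times> vec3 \<Rightarrow> vec3 \<times> vec3" where
  "nkG v w = (let s = (1 / 6) *\<^sub>R (br3 (fst v) (snd w) + br3 (fst w) (snd v)) in
    ((1 / 2) *\<^sub>R br3 (fst v) (fst w) - s, (1 / 2) *\<^sub>R br3 (snd v) (snd w) + s))"

text \<open>J = (2 \<sigma> + 1) / sqrt 3 for the map \<sigma> (v, w) = (w - v, - v) of order three.
  It satisfies \<sigma>^2 + \<sigma> + 1 = 0, hence J J = -1.\<close>

definition nkJ :: "vec3 \<times> vec3 \<Rightarrow> vec3 \<times> vec3" where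
  "nkJ v = (1 / sqrt 3) *\<^sub>R (2 *\<^sub>R snd v - fst v, snd v - 2 *\<^sub>R fst v)"

lemma br3_linear:
  "br3 (x + y) z = br3 x z + br3 y z" "br3 z (x + y) = br3 z x + br3 z y"
  "br3 (c *\<^sub>R x) z = c *\<^sub>R br3 x z" "br3 z (c *\<^sub>R x) = c *\<^sub>R br3 z x"
  by (simp_all add: v3 algebra_simps)

lemma bilinear_nkG: "bilinear nkG"
  unfolding bilinear_def
  by (intro conjI allI linearI; simp add: nkG_def Let_def br3_linear algebra_simps)

lemma linear_nkJ: "linear nkJ"
  by (rule linearI) (simp_all add: nkJ_def algebra_simps)

lemma nkG_torsion: "nkG v w - nkG w v = brV v w"
  by (simp add: nkG_def brV_def Let_def v3 algebra_simps)

lemma nkJ_nkJ: "nkJ (nkJ v) = - v"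
  by (cases v) (simp add: nkJ_def algebra_simps vec_eq_iff)

lemma nkG_nkJ: "nkG v (nkJ v) = nkJ (nkG v v)"
proof -
  have "linear (nkG v)" using bilinear_nkG by (simp add: bilinear_def del: split_paired_All)
  then have "nkG v (nkJ v) = (1 / sqrt 3) *\<^sub>R nkG v (2 *\<^sub>R snd v - fst v, snd v - 2 *\<^sub>R fst v)"
    unfolding nkJ_def by (rule linear_cmul)
  also have "nkG v (2 *\<^sub>R snd v - fst v, snd v - 2 *\<^sub>R fst v) =
      (2 *\<^sub>R snd (nkG v v) - fst (nkG v v), snd (nkG v v) - 2 *\<^sub>R fst (nkG v v))"
    by (simp add: nkG_def Let_def v3 field_simps)
  finally show ?thesis by (simp only: nkJ_def)
qed

abbreviation "nfr \<equiv> fr (mat 1) E1"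
abbreviation "nfc \<equiv> fc (mat 1) E1"

text \<open>Without its factor 1 / sqrt 3 the map multiplies the quadratic form by 3.\<close>

lemma nk_form_J: "nk_form (nfr (nkJ v)) (nfr (nkJ w)) = nk_form (nfr v) (nfr w)"
proof -
  define q where "q V W = -2 * (fst V \<bullet> dd (fst W)) - 2 * (snd V \<bullet> dd (snd W)) + fst V \<bullet> dd (snd W) + snd V \<bullet> dd (fst W)"
    for V W :: "vec3 \<times> vec3"
  define j where "j v = (2 *\<^sub>R snd v - fst v, snd v - 2 *\<^sub>R fst v)" for v :: "vec3 \<times> vec3"
  have sc: "q (c *\<^sub>R V) (c *\<^sub>R W) = (c * c) * q V W" for c V W
    by (simp add: q_def linear_cmul[OF linear_dd] algebra_simps)
  have "q (j v) (j w) = 3 * q v w"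
    by (simp add: q_def j_def v3 algebra_simps)
  then have "q (nkJ v) (nkJ w) = q v w"
    unfolding nkJ_def j_def[symmetric] sc by simp
  then show ?thesis unfolding nk_form_fr q_def by (simp only:)
qed

lemma br3_dot_dd: "br3 a b \<bullet> dd c = (a \<times> b) \<bullet> c" "c \<bullet> dd (br3 a b) = (a \<times> b) \<bullet> c"
  by (simp_all add: v3 algebra_simps)

lemma triple_anti: "(a \<times> b) \<bullet> c = - ((a \<times> c) \<bullet> b)" "(b \<times> a) \<bullet> c = - ((a \<times> b) \<bullet> c)"
  for a b c :: vec3
  by (simp_all add: v3 algebra_simps)

text \<open>In blocks both summands are combinations of triple products, which cancel by their
  skew-symmetry.\<close>

lemma nkG_metric: "nk_form (nfr (nkG x y)) (nfr z) + nk_form (nfr y) (nfr (nkG x z)) = 0"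
proof -
  obtain a u where x: "x = (a, u)" by (cases x)
  obtain b v where y: "y = (b, v)" by (cases y)
  obtain c w where z: "z = (c, w)" by (cases z)
  define q where "q V W = -2 * (fst V \<bullet> dd (fst W)) - 2 * (snd V \<bullet> dd (snd W)) + fst V \<bullet> dd (snd W) + snd V \<bullet> dd (fst W)"
    for V W :: "vec3 \<times> vec3"
  have 1: "q (nkG (a, u) (b, v)) (c, w) = - ((a \<times> b) \<bullet> c) + ((a \<times> v) \<bullet> c) / 2 + ((b \<times> u) \<bullet> c) / 2
      - ((u \<times> v) \<bullet> w) - ((a \<times> v) \<bullet> w) / 2 - ((b \<times> u) \<bullet> w) / 2 + ((a \<times> b) \<bullet> w) / 2 + ((u \<times> v) \<bullet> c) / 2"
    for b v c w
    by (simp add: q_def nkG_def Let_def inner_add_left inner_diff_left br3_dot_dd field_simps)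
  have sym: "q V W = q W V" for V W
    by (simp add: q_def dd_dot_commute[of "fst V"] dd_dot_commute[of "snd V"])
  have "q (nkG (a, u) (b, v)) (c, w) + q (nkG (a, u) (c, w)) (b, v) = 0"
    unfolding 1
    using triple_anti(1)[of a c b] triple_anti(1)[of a w b] triple_anti(1)[of a w v] triple_anti(1)[of a c v]
      triple_anti(1)[of u w v] triple_anti(1)[of u w b] triple_anti(1)[of u b c] triple_anti(1)[of u v c]
      triple_anti(2)[of b u c] triple_anti(2)[of b u w] triple_anti(2)[of c u b] triple_anti(2)[of c u v]
      triple_anti(2)[of u b c] triple_anti(2)[of u b w] triple_anti(2)[of u c b] triple_anti(2)[of u c v]
    by linarith
  moreover have "nk_form (nfr V) (nfr W) = (1 / (4 * sqrt 3)) * q V W" for V W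
    by (simp add: nk_form_fr q_def)
  ultimately show ?thesis unfolding x y z sym[of "(b, v)"]
    by (metis distrib_left mult_zero_right sym)
qed

lemma is_metric_form_nk: "is_metric_form nk_form"
  by (rule is_metric_form_fr[where p = "-2" and q = 1 and c = "1 / (4 * sqrt 3)"]) (simp_all add: nk_form_fr)

text \<open>Product and complex structure live at the neutral element in the frame (1, E1) and are
  spread by left translation. As \<open>j\<close> is a constant linear map there, it commutes with
  the flat part of \<open>left_conn\<close>, and only the algebraic identity \<open>nkG_nkJ\<close>
  remains.\<close>

theorem nk_metric_nearly_kaehler:
  "left_invariant nk_metric \<and> (\<exists>J. left_invariant_J J \<and> nearly_pseudo_kaehler SL2xSL2 nk_metric J)"
proof
  show "left_invariant nk_metric" unfolding nk_metric_eq by (rule left_invariant_field_left_invariant)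
  define \<Gamma> where "\<Gamma> u v = nfr (nkG (nfc u) (nfc v))" for u v
  define j where "j u = nfr (nkJ (nfc u))" for u
  define J where "J p v = p \<odot> j (gadj p \<odot> v)" for p v
  have j_lin: "linear j"
    by (rule linearI) (simp_all add: j_def linear_add[OF linear_fc] linear_cmul[OF linear_fc] linear_add[OF linear_nkJ]
        linear_cmul[OF linear_nkJ] linear_add[OF linear_fr] linear_cmul[OF linear_fr])
  then have j_bl: "bounded_linear j" by (simp add: linear_conv_bounded_linear)
  have j_sl: "j u \<in> sl_pair" for u unfolding j_def by (rule E1.fr_sl)
  have j_j: "j (j u) = - u" if "u \<in> sl_pair" for u
    using that by (simp add: j_def nkJ_nkJ linear_neg[OF linear_fr])
  have j_nk: "nk_form (j u) (j v) = nk_form u v" if "u \<in> sl_pair" "v \<in> sl_pair" for u v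
    using that by (simp add: j_def nk_form_J)
  have "linear (\<lambda>v. nkG v w)" "linear (\<lambda>v. nkG w v)" for w using bilinear_nkG unfolding bilinear_def by blast+
  then have "bilinear \<Gamma>"
    unfolding bilinear_def \<Gamma>_def
    by (intro conjI allI; intro linear_compose[OF linear_fc, unfolded o_def] linear_compose[OF _ linear_fr, unfolded o_def])
  then have \<Gamma>: "bounded_bilinear \<Gamma>" by (simp add: bilinear_conv_bounded_bilinear)
  have "is_lc_form nk_form \<Gamma>"
    unfolding is_lc_form_def
  proof (intro ballI conjI)
    fix u v w assume u: "u \<in> sl_pair" and v: "v \<in> sl_pair"
    show "\<Gamma> u v \<in> sl_pair" unfolding \<Gamma>_def by (rule E1.fr_sl)
    have "\<Gamma> u v - \<Gamma> v u = nfr (brV (nfc u) (nfc v))"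
      by (simp add: \<Gamma>_def linear_diff[OF linear_fr, symmetric] nkG_torsion)
    then show "\<Gamma> u v - \<Gamma> v u = brk u v" using u v by (simp add: E1.fr_brV)
    assume "w \<in> sl_pair"
    then show "nk_form (\<Gamma> u v) w + nk_form v (\<Gamma> u w) = 0"
      using nkG_metric[of "nfc u" "nfc v" "nfc w"] v by (simp add: \<Gamma>_def)
  qed
  then have lc: "levi_civita SL2xSL2 nk_metric (left_conn \<Gamma>)"
    unfolding nk_metric_eq by (rule levi_civita_left_conn[OF is_metric_form_nk \<Gamma>])
  have \<Gamma>j: "\<Gamma> u (j u) = j (\<Gamma> u u)" for u
    by (simp add: \<Gamma>_def j_def nkG_nkJ)
  have J_inv: "left_invariant_J J"
    unfolding left_invariant_J_def
  proof (intro ballI)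
    fix a p u assume "a \<in> SL2xSL2" "p \<in> SL2xSL2" "u \<in> tangent_space SL2xSL2 p"
    then show "J (a \<odot> p) (a \<odot> u) = a \<odot> J p u"
      by (simp add: J_def gadj_mult gmult_assoc)
  qed
  have coeff: "gadj p \<odot> J p v = j (gadj p \<odot> v)" if "p \<in> SL2xSL2" for p v
    using that by (simp add: J_def)
  have ac: "almost_complex SL2xSL2 J"
    unfolding almost_complex_def
  proof (intro conjI ballI allI impI)
    fix p u assume p: "p \<in> SL2xSL2" and u: "u \<in> tangent_space SL2xSL2 p"
    show "J p u \<in> tangent_space SL2xSL2 p" unfolding J_def by (rule gmult_tangent[OF p j_sl])
    show "J p (J p u) = - u"
      using p gadj_tangent[OF p u] by (simp add: J_def j_j gmult_minus_right)
    show "J p (u + v) = J p u + J p v" for v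
      by (simp add: J_def gmult_add_right linear_add[OF j_lin])
    show "J p (c *\<^sub>R u) = c *\<^sub>R J p u" for c
      by (simp add: J_def gmult_scaleR_right linear_cmul[OF j_lin])
  next
    fix X assume X: "vector_field SL2xSL2 X"
    show "vector_field SL2xSL2 (\<lambda>p. J p (X p))"
      unfolding J_def
      by (rule vector_field_left[OF smooth_fun_linear[OF j_bl vector_field_coeff(1)[OF X]] j_sl])
  qed
  have orth: "nk_metric p (J p u) (J p v) = nk_metric p u v"
    if p: "p \<in> SL2xSL2" and "u \<in> tangent_space SL2xSL2 p" "v \<in> tangent_space SL2xSL2 p" for p u v
    using gadj_tangent[OF p] that by (simp add: nk_metric_eq left_invariant_field_def ginv_eq_gadj coeff j_nk)
  have nk: "left_conn \<Gamma> X (\<lambda>q. J q (X q)) p - J p (left_conn \<Gamma> X X p) = 0"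
    if X: "vector_field SL2xSL2 X" and p: "p \<in> SL2xSL2" for X p
  proof -
    note tX = vector_field_tangent[OF X p]
    obtain D where D: "((\<lambda>q. gadj q \<odot> X q) has_derivative D) (at p within SL2xSL2)"
      by (rule vector_field_derivative[OF X p]) blast
    have "((\<lambda>q. gadj q \<odot> J q (X q)) has_derivative (\<lambda>v. j (D v))) (at p within SL2xSL2)"
      by (rule has_derivative_within_cong[OF bounded_linear.has_derivative[OF j_bl D] p]) (simp add: coeff)
    then show ?thesis
      using p by (simp add: left_conn_def differential_eq[OF D tX] differential_eq[OF _ tX] coeff \<Gamma>j)
        (simp add: J_def linear_add[OF j_lin])
  qed
  have "nearly_pseudo_kaehler SL2xSL2 nk_metric J"
    unfolding nearly_pseudo_kaehler_def
    using pseudo_riemannian_field[OF is_metric_form_nk] ac orth lc nk by (auto simp: nk_metric_eq[symmetric])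
  then show "\<exists>J. left_invariant_J J \<and> nearly_pseudo_kaehler SL2xSL2 nk_metric J"
    using J_inv by blast
qed

text \<open>A left-invariant \<open>J\<close> maps left-invariant fields to left-invariant fields,
  so on them the nearly Kaehler condition is algebraic.\<close>

lemma (in left_invariant_lc) nearly_kaehler_at_gone:
  assumes ac: "almost_complex SL2xSL2 J" and lJ: "left_invariant_J J"
    and nk: "\<And>X p. vector_field SL2xSL2 X \<Longrightarrow> p \<in> SL2xSL2 \<Longrightarrow> nabla X (\<lambda>q. J q (X q)) p - J p (nabla X X p) = 0"
    and u: "u \<in> sl_pair"
  shows "Gam u (J gone u) = J gone (Gam u u)"
proof -
  have Ju: "J gone u \<in> sl_pair"
    using ac u unfolding almost_complex_def by (metis gone_SL tangent_space_gone)
  have "J q (q \<odot> u) = q \<odot> J gone u" if "q \<in> SL2xSL2" for q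
    using lJ that u unfolding left_invariant_J_def by (metis gone_SL gone_gmult(2) tangent_space_gone)
  moreover have "vector_field SL2xSL2 (\<lambda>q. J q (q \<odot> u))"
    using ac vector_field_lvec[OF u] unfolding almost_complex_def by blast
  ultimately have "nabla (lvec u) (\<lambda>q. J q (q \<odot> u)) gone = nabla (lvec u) (lvec (J gone u)) gone"
    by (intro nabla_cong vector_field_lvec u Ju gone_SL) auto
  then show ?thesis
    using nk[OF vector_field_lvec[OF u] gone_SL] unfolding Gam_def by simp
qed

text \<open>\<open>nearly_kaehler_form\<close> gives the mixed block -(p / 2) T. With
  \<open>T\<close> absorbed into the second frame the mixed coefficient is x = -p / 2, the relation
  p = -2 x of the model metric.\<close>

theorem nearly_kaehler_homothetic:
  assumes li: "left_invariant h" and lJ: "left_invariant_J J" and h: "nearly_pseudo_kaehler SL2xSL2 h J"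
  shows "homothetic SL2xSL2 h nk_metric"
proof -
  obtain nabla where pr: "pseudo_riemannian SL2xSL2 h" and ac: "almost_complex SL2xSL2 J"
    and orth: "\<And>p u v. p \<in> SL2xSL2 \<Longrightarrow> u \<in> tangent_space SL2xSL2 p \<Longrightarrow> v \<in> tangent_space SL2xSL2 p \<Longrightarrow>
      h p (J p u) (J p v) = h p u v"
    and lc: "levi_civita SL2xSL2 h nabla"
    and nk: "\<And>X p. vector_field SL2xSL2 X \<Longrightarrow> p \<in> SL2xSL2 \<Longrightarrow> nabla X (\<lambda>q. J q (X q)) p - J p (nabla X X p) = 0"
    using h unfolding nearly_pseudo_kaehler_def by blast
  interpret framed_lc h nabla "mat 1" "mat 1" by unfold_locales (use pr li lc in auto)
  let ?f = "fr (mat 1) (mat 1)" and ?c = "fc (mat 1) (mat 1)"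
  have ac0: "\<forall>u\<in>sl_pair. J gone u \<in> sl_pair \<and> J gone (J gone u) = - u \<and>
      (\<forall>v\<in>sl_pair. J gone (u + v) = J gone u + J gone v) \<and> (\<forall>c. J gone (c *\<^sub>R u) = c *\<^sub>R J gone u)"
    using ac gone_SL unfolding almost_complex_def tangent_space_gone[symmetric] by blast
  have J: "J gone u \<in> sl_pair" "J gone (J gone u) = - u" "J gone (c *\<^sub>R u) = c *\<^sub>R J gone u"
    "v \<in> sl_pair \<Longrightarrow> J gone (u + v) = J gone u + J gone v" if u: "u \<in> sl_pair" for u v c
    using ac0 u by blast+
  define j where "j v = ?c (J gone (?f v))" for v
  have fj: "?f (j v) = J gone (?f v)" for v by (simp add: j_def J)
  have j_lin: "linear j"
    by (rule linearI) (simp_all add: j_def linear_add[OF linear_fr] linear_cmul[OF linear_fr] J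
        linear_add[OF linear_fc] linear_cmul[OF linear_fc])
  have jj: "j (j v) = - v" for v
    unfolding j_def[of "j v"] fj by (simp add: J linear_neg[OF linear_fc])
  obtain P K S X Y Z where b: "transpose P = P" "transpose S = S" "transpose X = X" "transpose Z = Z"
    "\<And>v. bop X Y Z (bop P K S v) = v" "\<And>v. bop P K S (bop X Y Z v) = v"
    and bl: "\<And>v w. h gone (?f v) (?f w) = bop P K S v \<bullet> w"
    using metric_form_blocks[OF metric_form] by metis
  have jo: "bop P K S (j v) \<bullet> j w = bop P K S v \<bullet> w" for v w
    using orth[of gone "?f v" "?f w"] by (simp add: bl[symmetric] fj tangent_space_gone)
  have jn: "frG v (j v) = j (frG v v)" for v
    unfolding j_def[of "frG v v"] fr_frG
    unfolding frG_def fj using nearly_kaehler_at_gone[OF ac lJ nk, of "?f v"] by simp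
  have fm: "bop P K S (frG x y) \<bullet> z + bop P K S y \<bullet> frG x z = 0" for x y z
    by (rule frG_metric) (simp_all add: bl b(1,2))
  obtain p T where p: "p \<noteq> 0" and T: "T ** Dm ** transpose T = Dm" "det T = 1"
    and PKS: "P = p *\<^sub>R Dm" "S = p *\<^sub>R Dm" "K = - (p / 2) *\<^sub>R T"
    using nearly_kaehler_form[where P = P and K = K and S = S and X = X and Y = Y and Z = Z and J = j and G = frG,
        OF b(1,2,5,6) j_lin bilinear_frG jj jo frG_torsion fm jn] by blast
  obtain n2 where n2: "det n2 \<noteq> 0" "\<And>m1 v. fr m1 n2 v = fr m1 (mat 1) (fst v, Dm ** transpose T *v snd v)"
    using orthogonal_second_frame[OF det_m(2) T] by blast
  interpret N: framed_lc h nabla "mat 1" n2 by unfold_locales (use n2 in auto)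
  have KU: "K ** (Dm ** transpose T) = (- (p / 2)) *\<^sub>R Dm"
    unfolding PKS(3) by (simp only: mult_scaleR_matrix orthogonal_blocks[OF T])
  have SU: "transpose (Dm ** transpose T) ** S ** (Dm ** transpose T) = p *\<^sub>R Dm"
    unfolding PKS(2) by (simp only: mult_scaleR_matrix orthogonal_blocks[OF T])
  have "h gone (fr (mat 1) n2 v) (fr (mat 1) n2 w) = bop (p *\<^sub>R Dm) ((- (p / 2)) *\<^sub>R Dm) (p *\<^sub>R Dm) v \<bullet> w" for v w
    unfolding n2(2) bl bop_second_frame by (simp only: KU SU PKS(1) prod.collapse)
  then show ?thesis by (rule N.scalar_blocks_nk) (use p in auto)
qed

theorem einstein_biinvariant_homothetic:
  assumes pr: "pseudo_riemannian SL2xSL2 g" and li: "left_invariant g" and ei: "einstein SL2xSL2 g"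
    and bi: "biinvariant_under_subgroup g"
  shows "homothetic SL2xSL2 g killing_metric \<or> homothetic SL2xSL2 g nk_metric"
proof -
  obtain nabla lam where lc: "levi_civita SL2xSL2 g nabla"
    and ric: "\<And>Y Z p. vector_field SL2xSL2 Y \<Longrightarrow> vector_field SL2xSL2 Z \<Longrightarrow> p \<in> SL2xSL2 \<Longrightarrow>
      ricci SL2xSL2 nabla Y Z p = lam * g p (Y p) (Z p)"
    using ei unfolding einstein_def by blast
  obtain A \<gamma> where A: "A \<noteq> 0" "one_parameter_subgroup A \<gamma>" "\<And>t. right_invariant_under g (\<gamma> t)"
    using bi unfolding biinvariant_under_subgroup_def by blast
  interpret left_invariant_lc g nabla by unfold_locales (use pr li lc in auto)
  interpret einstein_lc g nabla lam
  proof unfold_locales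
    fix y z assume y: "y \<in> sl_pair" and z: "z \<in> sl_pair"
    show "trace_on sl_pair (\<lambda>u. Rie u y z) = lam * g gone y z"
      using ric[OF vector_field_lvec[OF y] vector_field_lvec[OF z] gone_SL] ricci_gone[OF y z] by simp
  qed
  show ?thesis
    using einstein_homothetic[OF _ A(1)] biinvariant_skew[OF metric_form li A(2,3)] by blast
qed

theorem theorem1p1:
  shows "(\<forall>g. pseudo_riemannian SL2xSL2 g \<and> left_invariant g \<and> einstein SL2xSL2 g \<and>
              biinvariant_under_subgroup g \<longrightarrow>
            homothetic SL2xSL2 g killing_metric \<or> homothetic SL2xSL2 g nk_metric) \<and>
         (left_invariant nk_metric \<and>
          (\<exists>J. left_invariant_J J \<and> nearly_pseudo_kaehler SL2xSL2 nk_metric J)) \<and>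
         (\<forall>h J. left_invariant h \<and> left_invariant_J J \<and> nearly_pseudo_kaehler SL2xSL2 h J \<longrightarrow>
            homothetic SL2xSL2 h nk_metric) \<and>
         (\<forall>c>0. pseudo_riemannian SL2xSL2 (\<lambda>p u v. c * nk_metric p u v) \<and>
            pseudo_riemannian SL2xSL2 (\<lambda>p u v. c * killing_metric p u v) \<and>
            (\<forall>p\<in>SL2xSL2. metric_index SL2xSL2 (\<lambda>p u v. c * nk_metric p u v) p = 2 \<and>
               metric_index SL2xSL2 (\<lambda>p u v. c * killing_metric p u v) p = 2))"
  using einstein_biinvariant_homothetic nk_metric_nearly_kaehler nearly_kaehler_homothetic models_index
  by blast

end
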